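(* Let $\{v_j\}_{j\in\mathbb{Z}}\in\ell^\infty$, let $T^+$ be the associated differential transform operator $$T^{+}f(x)=\sum_{j\in\mathbb{Z}}v_{j}\,(D_{j}f(x)-D_{j-1}f(x)),\qquad D_{j}f(x)=\frac{1}{2^{j}}\int_{x}^{x+2^{j}}f(t)\,dt,$$ let $k$ be a non-negative integer and let $b\in BMO$. If $0<p<\infty$, $\varepsilon>0$ and $w$ is a weight with $w\in C^+_{\max\{p,1\}+\varepsilon}$, then there is a constant $C>0$, independent of $f$ and $b$, such that for every $f\in L^\infty_c$ $$\|(T^{+})_{b}^{k}f\|_{L^{p}(w)}\le C\,\|b\|_{BMO}^{k}\,\|M_{L(\log L)^{1+k}(\log\log L)^{1+\varepsilon}}^{+}f\|_{L^{p}(w)}.$$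
   Context: A weight is a nonnegative locally integrable function $w$ on $\mathbb{R}$; $\|g\|_{L^p(w)}=\left(\int_{\mathbb{R}}|g|^p w\right)^{1/p}$ for $0<p<\infty$. $L^\infty_c$ denotes the bounded measurable functions on $\mathbb{R}$ with compact support. $M^{+}f(x)=\sup_{h>0}\frac1h\int_x^{x+h}|f(y)|\,dy$. $BMO$ is the usual space of functions of bounded mean oscillation on $\mathbb{R}$; for $k=0$, $\|b\|_{BMO}^0$ is read as $1$. For $1<r<\infty$, $w\in C_r^+$ means: there exist $\varepsilon_0>0$ and $C>0$ such that for all $a<b'<c$ with $c-b'<b'-a$ and every measurable $E\subset(a,b')$, $\int_E w\le C\left(\frac{|E|}{c-b'}\right)^{\varepsilon_0}\int_{\mathbb{R}}\left(M^+\chi_{(a,c)}\right)^r w$. For a Young function $A$ (convex, $A(0)=0$, $A(1)=1$, $A(t)\to\infty$), $\|f\|_{A,E}=\inf\{\lambda>0:\frac1{|E|}\int_EA(|f|/\lambda)\le1\}$ and $M_A^+f(x)=\sup_{h>0}\|f\|_{A,[x,x+h]}$. $M^+_{L(\log L)^{1+k}(\log\log L)^{1+\varepsilon}}$ denotes $M_A^+$ with $A(t)=t(1+\log^+t)^{1+k}(1+\log^+\log^+t)^{1+\varepsilon}$ (with $\log^+ s=\max\{\log s,0\}$ for $s>0$ and $\log^+0=0$), where $\varepsilon$ is the same as in the hypothesis on $w$. For a linear operator $T$ and a locally integrable $b$, $[b,T]f=b\,Tf-T(bf)$; the iterated commutators are $T_b^0=T$ and $T_b^kf=[b,T_b^{k-1}]f$.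 *)

theory Defs
  imports "HOL-Analysis.Analysis"
begin

text \<open>
  Quantities that may be infinite (maximal functions, norms, integrals of nonnegative functions)
  take values in \<^typ>\<open>ennreal\<close>; measurable means Lebesgue measurable throughout.
\<close>

text \<open>Only used for positive exponents.\<close>

definition ennreal_powr :: "ennreal \<Rightarrow> real \<Rightarrow> ennreal" where
  "ennreal_powr x p = (if x = \<infinity> then \<infinity> else ennreal (enn2real x powr p))"

definition locally_integrable :: "(real \<Rightarrow> real) \<Rightarrow> bool" where
  "locally_integrable f \<longleftrightarrow> (\<forall>K. compact K \<longrightarrow> f absolutely_integrable_on K)"

definition weight :: "(real \<Rightarrow> real) \<Rightarrow> bool" where
  "weight w \<longleftrightarrow> (\<forall>x. 0 \<le> w x) \<and> locally_integrable w"

text \<open>The argument \<open>g\<close> stands for the absolute value of the function whose norm is taken.\<close>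

definition weighted_Lp_norm :: "real \<Rightarrow> (real \<Rightarrow> real) \<Rightarrow> (real \<Rightarrow> ennreal) \<Rightarrow> ennreal" where
  "weighted_Lp_norm p w g =
     ennreal_powr (\<integral>\<^sup>+x. ennreal_powr (g x) p * ennreal (w x) \<partial>lebesgue) (1 / p)"

definition Linfty_c :: "(real \<Rightarrow> real) set" where
  "Linfty_c = {f. f \<in> borel_measurable lebesgue \<and> bounded (range f) \<and>
                  (\<exists>K. compact K \<and> (\<forall>x. x \<notin> K \<longrightarrow> f x = 0))}"

definition interval_mean :: "(real \<Rightarrow> real) \<Rightarrow> real \<Rightarrow> real \<Rightarrow> real" where
  "interval_mean f c d = (LINT t:{c..d}|lebesgue. f t) / (d - c)"

definition BMO_norm :: "(real \<Rightarrow> real) \<Rightarrow> ennreal" where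
  "BMO_norm b = (SUP (c, d) \<in> {(c, d). c < d}.
     (\<integral>\<^sup>+x\<in>{c..d}. ennreal \<bar>b x - interval_mean b c d\<bar> \<partial>lebesgue) / ennreal (d - c))"

definition BMO :: "(real \<Rightarrow> real) set" where
  "BMO = {b. locally_integrable b \<and> BMO_norm b < \<infinity>}"

definition maximal_plus :: "(real \<Rightarrow> real) \<Rightarrow> real \<Rightarrow> ennreal" where
  "maximal_plus f x =
     (SUP h\<in>{0<..}. (\<integral>\<^sup>+y\<in>{x..x+h}. ennreal \<bar>f y\<bar> \<partial>lebesgue) / ennreal h)"

definition C_plus :: "real \<Rightarrow> (real \<Rightarrow> real) set" where
  "C_plus r = {w. \<exists>\<epsilon>\<^sub>0>0. \<exists>C>0. \<forall>a b c. a < b \<longrightarrow> b < c \<longrightarrow> c - b < b - a \<longrightarrow>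
     (\<forall>E\<in>sets lebesgue. E \<subseteq> {a<..<b} \<longrightarrow>
        (\<integral>\<^sup>+x\<in>E. ennreal (w x) \<partial>lebesgue) \<le>
          ennreal (C * (measure lebesgue E / (c - b)) powr \<epsilon>\<^sub>0) *
          (\<integral>\<^sup>+x. ennreal_powr (maximal_plus (indicator {a<..<c}) x) r * ennreal (w x) \<partial>lebesgue))}"

definition luxemburg_norm :: "(real \<Rightarrow> real) \<Rightarrow> real set \<Rightarrow> (real \<Rightarrow> real) \<Rightarrow> ennreal" where
  "luxemburg_norm A E f = (INF s\<in>{s. 0 < s \<and>
     (\<integral>\<^sup>+y\<in>E. ennreal (A (\<bar>f y\<bar> / s)) \<partial>lebesgue) / emeasure lebesgue E \<le> 1}. ennreal s)"

definition orlicz_maximal_plus :: "(real \<Rightarrow> real) \<Rightarrow> (real \<Rightarrow> real) \<Rightarrow> real \<Rightarrow> ennreal" where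
  "orlicz_maximal_plus A f x = (SUP h\<in>{0<..}. luxemburg_norm A {x..x+h} f)"

definition log_plus :: "real \<Rightarrow> real" where
  "log_plus s = (if 0 < s then max (ln s) 0 else 0)"

definition LlogL_loglogL :: "nat \<Rightarrow> real \<Rightarrow> real \<Rightarrow> real" where
  "LlogL_loglogL k \<epsilon> t =
     t * (1 + log_plus t) ^ (1 + k) * (1 + log_plus (log_plus t)) powr (1 + \<epsilon>)"

definition forward_mean :: "int \<Rightarrow> (real \<Rightarrow> real) \<Rightarrow> real \<Rightarrow> real" where
  "forward_mean j f x = 1 / 2 powi j * (LINT t:{x..x + 2 powi j}|lebesgue. f t)"

text \<open>
  The two-sided series need not converge absolutely (averages over short intervals), so it is the
  limit of the partial sums over \<open>-m \<le> j \<le> n\<close> as \<open>m\<close> and \<open>n\<close> tend to infinity independently. The limit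
  exists for almost every \<open>x\<close>, for the functions considered here; on the exceptional null set
  \<^const>\<open>Lim\<close> returns an arbitrary value, which no norm below sees.
\<close>

definition differential_transform :: "(int \<Rightarrow> real) \<Rightarrow> (real \<Rightarrow> real) \<Rightarrow> real \<Rightarrow> real" where
  "differential_transform v f x =
     Lim (sequentially \<times>\<^sub>F sequentially)
       (\<lambda>(m, n). \<Sum>j = - int m..int n. v j * (forward_mean j f x - forward_mean (j - 1) f x))"

definition commutator ::
  "(real \<Rightarrow> real) \<Rightarrow> ((real \<Rightarrow> real) \<Rightarrow> real \<Rightarrow> real) \<Rightarrow> (real \<Rightarrow> real) \<Rightarrow> real \<Rightarrow> real" where
  "commutator b T f = (\<lambda>x. b x * T f x - T (\<lambda>y. b y * f y) x)"

definition iterated_commutator ::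
  "nat \<Rightarrow> (real \<Rightarrow> real) \<Rightarrow> ((real \<Rightarrow> real) \<Rightarrow> real \<Rightarrow> real) \<Rightarrow> (real \<Rightarrow> real) \<Rightarrow> real \<Rightarrow> real" where
  "iterated_commutator k b T = (commutator b ^^ k) T"

end

theory Submission
  imports Defs
begin

text \<open>
  The basic object is \<open>rset g\<close>, the set of points \<open>x\<close> from which some interval \<open>{x..y}\<close> carries more mass of \<open>g\<close>
  than its length. The rising sun lemma gives its measure and the mean of \<open>g\<close> over its components
  exactly, so that no covering argument is needed.

  The inequality is a good-lambda argument for whole families of level sets. Let \<open>Om s\<close> be the rising
  sun set of \<open>A (\<bar>f\<bar> / s)\<close>, where \<open>A\<close> is the Young function; it lies in the set where the Orlicz maximal
  function is at least \<open>s\<close>. For every order \<open>i \<le> k\<close> there are open sets \<open>U j\<close> that contain almost all points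
  where the commutator of order \<open>i\<close> exceeds \<open>2\<^sup>j\<close>, such that

  \<^item> to the right of a point outside \<open>U j\<close> the set \<open>U (j + N)\<close> has density at most \<open>4 / 2\<^sup>N\<close> (\<open>good_levels\<close>);
  \<^item> off the family of the previous order, at a shifted level, \<open>U (j + N)\<close> is thin in the left half of
    every component of \<open>U j\<close> (\<open>dominated_levels\<close>).

  The weight enters only through \<open>level_set_domination\<close>: for such families the sum of \<open>2\<^sup>j\<^sup>p w (U j)\<close> is at
  most a constant times the same sum for the comparison family. In its proof \<open>w (U)\<close> is replaced by
  \<open>compsum U\<close>, the sum over the components of the integral of the \<open>r\<close>-th power of the maximal function of
  the component. Density makes \<open>compsum (U (j + N))\<close> at most a small multiple of \<open>compsum (U j)\<close> plus a
  multiple of \<open>w (U j)\<close>, because sums of tails of disjoint intervals are exponentially integrable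
  (\<open>exp_tail\<close>); the condition on the weight bounds thin parts by a small multiple of \<open>compsum\<close>. The
  recursion is absorbed, which needs an a priori bound that holds when \<open>p\<close>-th powers of the tails are
  integrable, since \<open>p < r\<close>. If they are not, the right-hand side of the theorem is infinite or \<open>f\<close> vanishes
  (\<open>orlicz_infinite\<close>).

  That the families exist follows from \<open>oscillation_bound\<close>: right of a point \<open>\<xi>\<close> outside \<open>Om s\<close> and the lower
  order sets, a commutator is close to a constant. The part of \<open>f\<close> near \<open>\<xi>\<close> is handled by the weak type
  inequality \<open>weak_type_psum\<close>. For the far part, differences of averages at distance \<open>H\<close> only see an interval of
  length \<open>H\<close> at distance \<open>2\<^sup>n H\<close>, on which the power of \<open>b\<close> costs a factor \<open>n\<^sup>k\<close> at least; the Young inequality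
  \<open>young_ineq\<close> between \<open>A\<close> and the exponential given by John and Nirenberg yields the coefficients
  \<open>1 / (n (log n)\<^sup>1\<^sup>+\<^sup>e)\<close>, whose sum converges.

  The series defining the transform converges almost everywhere for functions in \<open>L\<^sup>2\<close> with bounded support: it is
  bounded on \<open>L\<^sup>2\<close> by almost orthogonality, the truncations obey Cotlar's inequality, and indicators of
  intervals are dense.
\<close>

text \<open>Lebesgue measure, its integrals, and the Young function occur in almost every statement; the short
  names keep the estimates readable.\<close>

abbreviation leb :: "real set => ennreal" where "leb == emeasure lborel"
abbreviation rleb :: "real set => real" where "rleb == measure lborel"
abbreviation lint :: "(real => ennreal) => ennreal" where "lint == nn_integral lborel"
abbreviation lint_on :: "real set => (real => ennreal) => ennreal" where "lint_on A f == set_nn_integral lborel A f"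
abbreviation Borel :: "('a::topological_space => 'b::topological_space) set" where "Borel == borel_measurable borel"
abbreviation ind :: "'a set => 'a => 'b::zero_neq_one" where "ind == indicator"
abbreviation LL :: "nat => real => real => real" where "LL == LlogL_loglogL"
abbreviation enn :: "real => ennreal" where "enn == ennreal"
lemmas sli_def = set_lebesgue_integral_def

section \<open>Rising sun sets\<close>

definition mass :: "(real => real) => real => real => real" where
 "mass g x y = (LINT t:{x..y}|lborel. g t)"

definition ibs :: "(real => real) => bool" where
 "ibs g \<longleftrightarrow> integrable lborel g & (EX R. ALL x. R < abs x --> g x = 0)"

definition rset :: "(real => real) => real set" where
 "rset g = {x. EX y>x. y - x < mass g x y}"

lemma set_integrable_Icc:
 assumes "integrable lborel g"
 shows "set_integrable lborel {x..y::real} (g :: real => real)" using assms unfolding set_integrable_def by (intro integrable_mult_indicator) auto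

lemma mass_nonneg: "(!!x. 0 <= g x) ==> 0 <= mass g x y" unfolding mass_def sli_def by (intro integral_nonneg_AE) auto

lemma mass_mono:
 assumes "integrable lborel g" "integrable lborel g'" "!!t. x <= t ==> t <= y ==> g t <= g' t"
 shows "mass g x y <= mass g' x y" unfolding mass_def using assms by (intro set_integral_mono set_integrable_Icc) auto

lemma mass_eq_integral: "integrable lborel g ==> mass g x y = integral {x..y} g" unfolding mass_def by (intro set_borel_integral_eq_integral set_integrable_Icc)

lemma integrable_imp_integrable_on_Icc: "integrable lborel (g :: real => real) ==> g integrable_on {x..y}" by (intro set_borel_integral_eq_integral(1) set_integrable_Icc)

lemma mass_split:
 assumes "integrable lborel g" "x <= y" "y <= z"
 shows "mass g x z = mass g x y + mass g y z" using assms Henstock_Kurzweil_Integration.integral_combine[OF assms(2,3) integrable_imp_integrable_on_Icc[OF assms(1)]]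
 by (simp add: mass_eq_integral)

lemma mass_subset:
 assumes "integrable lborel g" "!!t. 0 <= g t" "x' <= x" "y <= y'"
 shows "mass g x y <= mass g x' y'" unfolding mass_def sli_def using set_integrable_Icc[OF assms(1), of x y] set_integrable_Icc[OF assms(1), of x' y'] assms(2-4)
 by (intro integral_mono) (auto simp: set_integrable_def indicator_def)

lemma mass_continuous:
 assumes "integrable lborel g"
 shows "continuous_on {a..b} (%y. mass g a y)" using indefinite_integral_continuous_1[OF integrable_imp_integrable_on_Icc[OF assms], of a b] by (simp add: mass_eq_integral[OF assms])

lemma mass_same [simp]: "mass g x x = 0"
proof -
 have "AE t in lborel. ind {x..x} t *\<^sub>R g t = 0" using AE_lborel_singleton[of x] by eventually_elim (auto simp: indicator_def)
 then show ?thesis unfolding mass_def sli_def by (rule integral_eq_zero_AE)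
qed

lemma open_rset:
 assumes "integrable lborel g" and nn: "!!t. 0 <= g t"
 shows "open (rset g)"
proof (rule openI)
 fix x assume "x : rset g"
 then obtain y where y: "x < y" "y - x < mass g x y" by (auto simp: rset_def)
 define e where "e = mass g x y - (y - x)"
 have e: "0 < e" using y by (simp add: e_def)
 have "continuous (at x within {x..y}) (%z. mass g x z)" using mass_continuous[OF assms(1), of x y] y by (simp add: continuous_on_eq_continuous_within)
 then obtain d where d: "0 < d" "!!z. z : {x..y} ==> dist z x < d ==> dist (mass g x z) (mass g x x) < e / 2" unfolding continuous_within_eps_delta using e by (metis half_gt_zero)
 define r where "r = min (d / 2) (min (e / 4) ((y - x) / 2))"
 have r: "0 < r" "r < d" "r < e / 2" "r < y - x" using d e y by (auto simp: r_def min_def)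
 have "z : rset g" if "z : ball x r" for z
 proof -
  have z: "abs (z - x) < r" using that by (simp add: dist_real_def abs_minus_commute)
  have zy: "z < y" using z r by linarith
  have "mass g x y - e / 2 <= mass g z y"
  proof (cases "x <= z")
   case True
   have "mass g x z < e / 2" using d(2)[of z] True z zy r by (auto simp: dist_real_def)
   then show ?thesis using mass_split[OF assms(1) True, of y] zy by linarith
  next
   case False
   then show ?thesis using mass_subset[OF assms(1) nn, of z x y y] e by linarith
  qed
  then show ?thesis unfolding rset_def using zy z r(3) e_def by (intro CollectI exI[of _ y] conjI) linarith+
 qed
 then show "EX T. 0 < T & ball x T <= rset g" using r(1) by blast
qed

lemma component_Ioo:
 fixes U :: "real set"
 assumes "open U" "bounded U" "C : components U"
 obtains a c where "a < c" "C = {a<..<c}" "a ~: U" "c ~: U"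
proof -
 have C: "open C" "connected C" "C ~= {}" "C <= U" using assms by (auto simp: in_components_connected in_components_nonempty in_components_subset open_components)
 have bC: "bounded C" using C assms bounded_subset by blast
 define a c where "a = Inf C" and "c = Sup C"
 have bb: "bdd_below C" "bdd_above C" using bC bounded_imp_bdd_below bounded_imp_bdd_above by auto
 have int: "is_interval C" using C(2) is_interval_connected_1 by blast
 have na: "a ~: C"
 proof
  assume "a : C"
  then obtain e where "e > 0" "ball a e <= C" using C(1) openE by blast
  then have "a - e / 2 : C" by (auto simp: dist_real_def subset_iff)
  then show False using cInf_lower[OF _ bb(1)] \<open>e > 0\<close> a_def by force
 qed
 have nc: "c ~: C"
 proof
  assume "c : C"
  then obtain e where "e > 0" "ball c e <= C" using C(1) openE by blast
  then have "c + e / 2 : C" by (auto simp: dist_real_def subset_iff)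
  then show False using cSup_upper[OF _ bb(2)] \<open>e > 0\<close> c_def by force
 qed
 have "C = {a<..<c}"
 proof (intro set_eqI iffI)
  fix x assume x: "x : C"
  have "a <= x" "x <= c" using x bb by (auto simp: a_def c_def cInf_lower cSup_upper)
  then show "x : {a<..<c}" using x na nc by (auto simp: order.order_iff_strict)
 next
  fix x assume "x : {a<..<c}"
  then obtain y z where "y : C" "z : C" "y < x" "x < z" unfolding a_def c_def using cInf_lessD[OF C(3)] less_cSupD[OF C(3)] by (metis greaterThanLessThan_iff)
  then show "x : C" using int by (meson is_interval_1 less_imp_le)
 qed
 moreover have "a < c" using C(3) \<open>C = {a<..<c}\<close> by auto
 moreover have "a ~: U"
 proof
  assume "a : U"
  have "connected {a..<c}" by simp
  moreover have "{a..<c} <= U" using \<open>a : U\<close> \<open>C = {a<..<c}\<close> C(4) by (auto simp: le_less)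
  moreover have "C Int {a..<c} ~= {}" using C(3) \<open>C = {a<..<c}\<close> by fastforce
  ultimately have "{a..<c} <= C" using components_maximal[OF assms(3)] by blast
  then show False using na \<open>a < c\<close> by auto
 qed
 moreover have "c ~: U"
 proof
  assume "c : U"
  have "connected {a<..c}" by simp
  moreover have "{a<..c} <= U" using \<open>c : U\<close> \<open>C = {a<..<c}\<close> C(4) by (auto simp: le_less)
  moreover have "C Int {a<..c} ~= {}" using C(3) \<open>C = {a<..<c}\<close> by fastforce
  ultimately have "{a<..c} <= C" using components_maximal[OF assms(3)] by blast
  then show False using nc \<open>a < c\<close> by auto
 qed
 ultimately show ?thesis using that by blast
qed

lemma countable_components_open: "open U ==> countable (components (U :: real set))"
 using countable_disjoint_open_subsets[of "components U"] open_components[of U] pairwise_disjoint_components[of U] by (auto simp: disjnt_def pairwise_def)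

text \<open>The rising sun lemma. If the mass of \<open>{x..c}\<close> were too small, the last point that can be reached from
 \<open>x\<close> with enough mass would lie before \<open>c\<close>, hence in the set, and could be improved.\<close>

lemma rset_component_ge:
 assumes "integrable lborel g" and nn: "!!t. 0 <= g t"
  and sub: "{a<..<c} <= rset g" and c: "c ~: rset g" and x: "a < x" "x < c"
 shows "c - x <= mass g x c"
proof -
 let ?S = "{y : {x..c}. y - x <= mass g x y}"
 have "continuous_on {x..c} (%y. mass g x y - (y - x))" by (intro continuous_intros mass_continuous assms)
 from continuous_closed_preimage[OF this, of "{0..}"]
 have "closed ({x..c} Int (%y. mass g x y - (y - x)) -` {0..})" by simp
 moreover have "?S = {x..c} Int (%y. mass g x y - (y - x)) -` {0..}" by auto
 ultimately have cl: "closed ?S" by simp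
 have ne: "x : ?S" using x by simp
 have bdd: "bdd_above ?S" by (intro bdd_aboveI[of _ c]) auto
 define y where "y = Sup ?S"
 have y: "y : ?S" unfolding y_def using closed_contains_Sup[OF _ bdd cl] ne by blast
 show ?thesis
 proof (cases "y = c")
  case True then show ?thesis using y by simp
 next
  case False
  then have "y : rset g" using y sub x by auto
  then obtain z where z: "y < z" "z - y < mass g y z" by (auto simp: rset_def)
  have *: "z - x < mass g x z" using mass_split[OF assms(1), of x y z] y z by auto
  show ?thesis
  proof (cases "z <= c")
   case True
   then have "z : ?S" using * y z by auto
   then have "z <= y" unfolding y_def using bdd by (rule cSup_upper)
   then show ?thesis using z by simp
  next
   case False
   have "mass g c z <= z - c" using c False by (auto simp: rset_def not_less)
   then show ?thesis using * mass_split[OF assms(1), of x c z] x False by auto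
  qed
 qed
qed

lemma rset_component_ge':
 assumes "integrable lborel g" and nn: "!!t. 0 <= g t"
  and sub: "{a<..<c} <= rset g" and c: "c ~: rset g" and ac: "a < c"
 shows "c - a <= mass g a c"
proof (rule field_le_epsilon)
 fix e :: real assume "0 < e"
 define x where "x = min (a + e) ((a + c) / 2)"
 have x: "a < x" "x < c" "x <= a + e" using \<open>0 < e\<close> ac by (auto simp: x_def min_def field_simps)
 show "c - a <= mass g a c + e" using rset_component_ge[OF assms(1-4) x(1,2)] mass_subset[OF assms(1) nn, of a x c c] x by linarith
qed

lemma emeasure_density_Icc:
 assumes "integrable lborel g" "!!t. 0 <= g t" "(g :: real => real) : Borel"
 shows "emeasure (density lborel (%t. enn (g t))) {a..c} = enn (mass g a c)"
proof -
 have "emeasure (density lborel (%t. enn (g t))) {a..c} = (lint (%t. enn (ind {a..c} t * g t)))"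
  using assms by (subst emeasure_density) (auto intro!: nn_integral_cong simp: ennreal_mult'' indicator_def)
 also have "... = enn (LINT t|lborel. ind {a..c} t * g t)" using set_integrable_Icc[OF assms(1), of a c] assms(2) by (intro nn_integral_eq_integral) (auto simp: set_integrable_def)
 finally show ?thesis by (simp add: mass_def sli_def)
qed

lemma emeasure_density_Ioo:
 assumes "integrable lborel g" "!!t. 0 <= g t" "(g :: real => real) : Borel"
 shows "emeasure (density lborel (%t. enn (g t))) {a<..<c} = enn (mass g a c)"
proof -
 have "AE t in lborel. t ~= a & t ~= c" using AE_lborel_singleton[of a] AE_lborel_singleton[of c] by eventually_elim simp
 then have "AE t in lborel. enn (g t) * ind {a<..<c} t = enn (g t) * ind {a..c} t" by eventually_elim (auto simp: indicator_def)
 then have "emeasure (density lborel (%t. enn (g t))) {a<..<c} = emeasure (density lborel (%t. enn (g t))) {a..c}" using assms by (simp add: emeasure_density nn_integral_cong_AE)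
 then show ?thesis using emeasure_density_Icc[OF assms] by simp
qed

lemma bounded_rset:
 assumes "ibs g" "!!t. 0 <= g t"
 shows "bounded (rset g)"
proof -
 obtain R where R: "!!x. R < abs x ==> g x = 0" and ig: "integrable lborel g" using assms by (auto simp: ibs_def)
 have "abs x <= abs R + (LINT t|lborel. g t)" if x: "x : rset g" for x
 proof -
  obtain y where y: "x < y" "y - x < mass g x y" using x by (auto simp: rset_def)
  have tot: "mass g x y <= (LINT t|lborel. g t)" unfolding mass_def sli_def using set_integrable_Icc[OF ig, of x y] assms(2) ig
   by (intro integral_mono) (auto simp: set_integrable_def indicator_def)
  have "\<not> abs R < x"
  proof
   assume "abs R < x"
   then have "mass g x y = 0" unfolding mass_def sli_def by (intro integral_eq_zero_AE AE_I2) (auto simp: R indicator_def)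
   then show False using y by simp
  qed
  moreover have "\<not> y < - abs R"
  proof
   assume "y < - abs R"
   then have "mass g x y = 0" unfolding mass_def sli_def by (intro integral_eq_zero_AE AE_I2) (auto simp: R indicator_def)
   then show False using y by simp
  qed
  ultimately show ?thesis using tot y by linarith
 qed
 then show ?thesis by (intro boundedI[where B="abs R + (LINT t|lborel. g t)"]) auto
qed

lemma emeasure_components:
 fixes U :: "real set"
 assumes "open U" "sets M = sets borel"
 shows "emeasure M U = (nn_integral (count_space (components U)) (%C. emeasure M C))"
proof -
 have "emeasure M (\<Union>C\<in>components U. C) = (nn_integral (count_space (components U)) (%C. emeasure M C))"
 proof (rule emeasure_UN_countable)
  show "countable (components U)" using assms countable_components_open by blast
  show "C : sets M" if "C : components U" for C using open_components[OF assms(1) that] assms(2) by simp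
  show "disjoint_family_on (%C. C) (components U)" using pairwise_disjoint_components[of U] by (auto simp: disjoint_family_on_def pairwise_def)
 qed
 then show ?thesis by simp
qed

lemma rset_weak_type_set:
 assumes "ibs g" and nn: "!!t. 0 <= g t" and gm: "g : Borel"
 shows "leb (rset g) <= (lint_on (rset g) (%t. enn (g t)))"
proof -
 have ig: "integrable lborel g" using assms by (simp add: ibs_def)
 note op = open_rset[OF ig nn]
 let ?N = "density lborel (%t. enn (g t))"
 have "leb (rset g) = (\<integral>\<^sup>+C. leb C \<partial>count_space (components (rset g)))" by (intro emeasure_components op) simp
 also have "... <= (\<integral>\<^sup>+C. emeasure ?N C \<partial>count_space (components (rset g)))"
 proof (rule nn_integral_mono)
  fix C assume "C : space (count_space (components (rset g)))"
  then have C: "C : components (rset g)" by simp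
  obtain a c where ac: "a < c" "C = {a<..<c}" "a ~: rset g" "c ~: rset g" using component_Ioo[OF op bounded_rset[OF assms(1,2)] C] .
  have "{a<..<c} <= rset g" using C ac in_components_subset by blast
  then show "leb C <= emeasure ?N C" using rset_component_ge'[OF ig nn _ ac(4,1)] ac by (simp add: emeasure_density_Ioo[OF ig nn gm] ennreal_leI)
 qed
 also have "... = emeasure ?N (rset g)" by (intro emeasure_components[symmetric] op) simp
 also have "... = (lint_on (rset g) (%t. enn (g t)))" using gm op by (subst emeasure_density) auto
 finally show ?thesis .
qed

lemma rset_weak_type:
 assumes "ibs g" and nn: "!!t. 0 <= g t" and gm: "g : Borel"
 shows "leb (rset g) <= enn (LINT t|lborel. g t)"
proof -
 have ig: "integrable lborel g" using assms by (simp add: ibs_def)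
 have "(lint_on (rset g) (%t. enn (g t))) <= (lint (%t. enn (g t)))" by (intro nn_integral_mono) (auto simp: indicator_def)
 also have "... = enn (LINT t|lborel. g t)" using ig nn by (intro nn_integral_eq_integral) auto
 finally show ?thesis using rset_weak_type_set[OF assms] by simp
qed

lemma rset_eq_witness: "x : rset g \<longleftrightarrow> (EX h>0. h < mass g x (x + h))"
proof
 assume "x : rset g"
 then obtain y where "x < y" "y - x < mass g x y" unfolding rset_def by auto
 then show "EX h>0. h < mass g x (x + h)" by (intro exI[of _ "y - x"]) auto
next
 assume "EX h>0. h < mass g x (x + h)"
 then obtain h where "0 < h" "h < mass g x (x + h)" by auto
 then show "x : rset g" unfolding rset_def by (intro CollectI exI[of _ "x + h"]) auto
qed

lemma not_rset: "x ~: rset g ==> x <= y ==> mass g x y <= y - x" by (cases "x = y") (force simp: rset_def not_less)+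

lemma ibs_indicator:
 assumes "integrable lborel g"
 shows "ibs (%t. ind {x..y} t * g t)" unfolding ibs_def
proof (intro conjI exI[of _ "abs x + abs y"] allI impI)
 show "integrable lborel (%t. ind {x..y} t * g t)" using set_integrable_Icc[OF assms, of x y] by (simp add: set_integrable_def)
qed (auto simp: indicator_def)

lemma mass_restrict:
 assumes "u <= x" "y <= v"
 shows "mass (%t. ind {u..v} t * g t) x y = mass g x y" unfolding mass_def sli_def by (intro Bochner_Integration.integral_cong) (use assms in \<open>auto simp: indicator_def\<close>)

text \<open>Scale invariance: small density of \<open>g\<close> right of \<open>a\<close> at all lengths keeps the intervals that start before
 \<open>a + D\<close> from leaving \<open>{a<..<a + 2 D}\<close>.\<close>

lemma rset_thin:
 assumes ig: "integrable lborel g" and nn: "!!t. 0 <= g t" and gm: "g : Borel"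
  and thin: "!!D. 0 < D ==> mass g a (a + D) <= d * D" and d: "d <= 1 / 2" and D: "0 < D"
 shows "leb (rset g Int {a<..<a + D}) <= enn (2 * d * D)"
proof -
 let ?h = "%t. ind {a..a + 2 * D} t * g t"
 have sub: "rset g Int {a<..<a + D} <= rset ?h"
 proof
  fix x assume "x : rset g Int {a<..<a + D}"
  then obtain h where x: "a < x" "x < a + D" and h: "0 < h" "h < mass g x (x + h)" using rset_eq_witness[of x g] by auto
  have "h < mass g a (a + (x + h - a))" using h mass_subset[OF ig nn, of a x "x + h" "x + h"] x by simp
  also have "... <= d * (x + h - a)" using thin[of "x + h - a"] x h by simp
  also have "... <= 1 / 2 * (x + h - a)" using d x h by (intro mult_right_mono) auto
  finally have "x + h <= a + 2 * D" using x by simp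
  then show "x : rset ?h" unfolding rset_eq_witness using h x by (intro exI[of _ h]) (simp add: mass_restrict)
 qed
 have "leb (rset g Int {a<..<a + D}) <= leb (rset ?h)" using open_rset[of ?h] ibs_indicator[OF ig, of a "a + 2 * D"] nn by (intro emeasure_mono sub) (auto simp: ibs_def)
 also have "... <= enn (LINT t|lborel. ?h t)" by (intro rset_weak_type ibs_indicator ig) (use nn gm in auto)
 also have "(LINT t|lborel. ?h t) = mass g a (a + 2 * D)" by (simp add: mass_def sli_def)
 also have "... <= 2 * d * D" using thin[of "2 * D"] D by simp
 finally show ?thesis by (simp add: ennreal_leI)
qed

text \<open>A one-sided differentiation theorem. Were \<open>g > 1 + d\<close> on a set of positive measure off \<open>rset g\<close>, then inside
 a tight open cover the mass of \<open>g\<close> on that set would exceed the length of the cover.\<close>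

lemma rset_AE:
 assumes "ibs g" and nn: "!!t. 0 <= g t" and gm [measurable]: "g : Borel"
 shows "AE x in lborel. x ~: rset g --> g x <= 1"
proof -
 have ig: "integrable lborel g" using assms by (simp add: ibs_def)
 obtain R where R: "!!x. R < abs x ==> g x = 0" using assms by (auto simp: ibs_def)
 note op = open_rset[OF ig nn]
 have [measurable]: "rset g : sets borel" using op by simp
 let ?N = "density lborel (%t. enn (g t))"
 have null: "leb {x. x ~: rset g & 1 + d <= g x} = 0" if d: "0 < d" for d :: real
 proof (rule ccontr)
  let ?E = "{x. x ~: rset g & 1 + d <= g x}"
  assume pos: "leb ?E ~= 0"
  have [measurable]: "?E : sets borel" by measurable
  have Esub: "?E <= {-abs R..abs R}"
  proof
   fix x assume "x : ?E"
   then have "g x ~= 0" using d by auto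
   then have "\<not> R < abs x" using R by auto
   then show "x : {-abs R..abs R}" by auto
  qed
  have fin: "leb ?E < \<infinity>" using emeasure_mono[OF Esub, of lborel] by (auto simp: less_top[symmetric] top_unique)
  define m where "m = rleb ?E"
  have mE: "leb ?E = enn m" using fin by (simp add: m_def emeasure_eq_ennreal_measure)
  have m: "0 < m" using pos mE by (simp add: m_def zero_less_measure_iff less_le)
  obtain O' where O': "open O'" "?E <= O'" "leb (O' - ?E) < enn (d * m)" using outer_regular_lborel[of ?E "d * m"] d m by auto
  define V where "V = O' Int {-abs R - 1<..<abs R + 1}"
  have V: "open V" "bounded V" "?E <= V" "V <= O'" using O' Esub unfolding V_def by (auto intro: bounded_subset[OF bounded_closed_interval[of "-abs R - 1" "abs R + 1"]])
  let ?M = "density lborel (%t. ind ?E t * enn (g t))"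
  have "emeasure ?M V = (nn_integral (count_space (components V)) (%C. emeasure ?M C))" by (intro emeasure_components V) simp
  also have "... <= (nn_integral (count_space (components V)) (%C. leb C))"
  proof (rule nn_integral_mono)
   fix C assume "C : space (count_space (components V))"
   then have C: "C : components V" by simp
   obtain alf be where ab: "alf < be" "C = {alf<..<be}" using component_Ioo[OF V(1,2) C] by metis
   show "emeasure ?M C <= leb C"
   proof (cases "?E Int C = {}")
    case True
    then have z: "ind ?E t * enn (g t) * ind C t = 0" for t by (auto simp: indicator_def)
    have "emeasure ?M C = (lint (%t. ind ?E t * enn (g t) * ind C t))" using ab by (intro emeasure_density) auto
    then show ?thesis unfolding z by simp
   next
    case False
    define S where "S = {alf..be} Int - rset g"
    have clS: "closed S" unfolding S_def using op by (auto simp: closed_Compl)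
    obtain z where z: "z : ?E Int C" using False by blast
    have "z : S" using z ab by (simp add: S_def)
    then have Sne: "S ~= {}" by blast
    have Sb: "bdd_below S" unfolding S_def by (intro bdd_belowI[of _ alf]) auto
    define x where "x = Inf S"
    have x: "x : S" unfolding x_def using closed_contains_Inf[OF Sne Sb clS] .
    have "emeasure ?M C <= emeasure ?N {x..be}"
    proof -
     have "ind ?E t * enn (g t) * ind C t <= enn (g t) * ind {x..be} t" for t
     proof (cases "t : ?E Int C")
      case True
      then have "t : S" using ab by (auto simp: S_def)
      then have "x <= t" unfolding x_def using Sb by (rule cInf_lower)
      then show ?thesis using True ab by (auto simp: indicator_def)
     qed (auto simp: indicator_def)
     then show ?thesis using ab by (simp add: emeasure_density nn_integral_mono)
    qed
    also have "... = enn (mass g x be)" by (rule emeasure_density_Icc[OF ig nn gm])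
    also have "mass g x be <= be - x" using x not_rset[of x g be] by (auto simp: S_def)
    also have "be - x <= be - alf" using x by (auto simp: S_def)
    finally show ?thesis using ab by (simp add: ennreal_leI)
   qed
  qed
  also have "... = leb V" by (intro emeasure_components[symmetric] V) simp
  also have "... <= leb (?E Un (O' - ?E))" using V O' by (intro emeasure_mono) auto
  also have "... <= leb ?E + leb (O' - ?E)" using O' by (intro emeasure_subadditive) auto
  also have "... < leb ?E + enn (d * m)" using O'(3) fin by (simp add: ennreal_add_left_cancel_less)
  also have "... = enn ((1 + d) * m)" using mE d m by (simp add: ennreal_plus[symmetric] algebra_simps del: ennreal_plus)
  finally have up: "emeasure ?M V < enn ((1 + d) * m)" .
  have "enn ((1 + d) * m) = enn (1 + d) * leb ?E" using mE d m by (simp add: ennreal_mult)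
  also have "... = (lint (%t. enn (1 + d) * ind ?E t))" by (subst nn_integral_cmult_indicator) auto
  also have "... <= (lint (%t. ind ?E t * enn (g t) * ind V t))" using V(3) by (intro nn_integral_mono) (auto simp: indicator_def intro!: ennreal_leI)
  also have "... = emeasure ?M V" using V(1) by (subst emeasure_density) auto
  finally show False using up by simp
 qed
 have "AE x in lborel. ALL n. \<not> (x ~: rset g & 1 + 1 / real (Suc n) <= g x)" unfolding AE_all_countable
 proof
  fix n
  have "{x. x ~: rset g & 1 + 1 / real (Suc n) <= g x} : null_sets lborel" using null[of "1 / real (Suc n)"] by (auto simp: null_sets_def)
  then show "AE x in lborel. \<not> (x ~: rset g & 1 + 1 / real (Suc n) <= g x)" by (rule AE_I'[rule_format]) auto
 qed
 then show ?thesis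
 proof eventually_elim
  fix x assume *: "ALL n. \<not> (x ~: rset g & 1 + 1 / real (Suc n) <= g x)"
  show "x ~: rset g --> g x <= 1"
  proof (rule impI, rule ccontr)
   assume "x ~: rset g" "\<not> g x <= 1"
   then obtain n where "1 / real (Suc n) < g x - 1" using nat_approx_posE[of "g x - 1"] by (auto simp: inverse_eq_divide)
   then show False using * \<open>x ~: rset g\<close> by (auto dest!: spec[of _ n])
  qed
 qed
qed

section \<open>Tails of intervals and the weight condition\<close>

text \<open>This bounds the one-sided maximal function of the indicator of \<open>{a<..<c}\<close>.\<close>

definition tail :: "real => real => real => real" where
 "tail a c x = (if c <= x then 0 else min 1 ((c - a) / (c - x)))"

lemma tail_nonneg: "a <= c ==> 0 <= tail a c x" by (simp add: tail_def)

lemma tail_le_1: "tail a c x <= 1" by (simp add: tail_def)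

lemma tail_right: "c <= x ==> tail a c x = 0" by (simp add: tail_def)

lemma tail_inside: "a <= x ==> x < c ==> tail a c x = 1" by (simp add: tail_def field_simps)

lemma tail_left: "x <= a ==> a < c ==> tail a c x = (c - a) / (c - x)" by (simp add: tail_def field_simps)

lemma tail_measurable [measurable]: "(%x. tail a c x) : Borel" unfolding tail_def by measurable

lemma tail_extend:
 assumes "a' <= a" "a < c"
 shows "tail a' c x <= (c - a') / (c - a) * tail a c x"
proof (cases "c <= x")
 case True then show ?thesis by (simp add: tail_right)
next
 case False
 then have x: "x < c" by simp
 have q: "1 <= (c - a') / (c - a)" using assms by (simp add: field_simps)
 show ?thesis
 proof (cases "a <= x")
  case True
  then show ?thesis using x q tail_le_1[of a' c x] by (simp add: tail_inside)
 next
  case False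
  then have "(c - a') / (c - a) * tail a c x = (c - a') / (c - x)" using assms by (simp add: tail_left)
  then show ?thesis using x by (simp add: tail_def)
 qed
qed

lemma suminf_ennreal_le_const:
 fixes f :: "nat => ennreal"
 assumes "!!n. (SUM i<n. f i) <= K"
 shows "(\<Sum>i. f i) <= K" using assms by (intro suminf_le_const summableI)

text \<open>The points cut \<open>{a<..<c}\<close> into pieces whose lengths halve towards \<open>c\<close>, so that each piece is
 admissible in the weight condition together with its right neighbour.\<close>

definition pt :: "real => real => nat => real" where
 "pt a c n = c - (c - a) / 2 ^ n"

lemma pt_0 [simp]: "pt a c 0 = a" by (simp add: pt_def)

lemma pt_less: "a < c ==> pt a c n < c" by (simp add: pt_def)

lemma pt_mono: "a < c ==> pt a c n < pt a c (Suc n)" by (simp add: pt_def field_simps)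

lemma pt_ge: "a < c ==> a <= pt a c n"
proof -
 assume "a < c"
 then have "(c - a) / 2 ^ n <= (c - a) / 1" by (intro divide_left_mono) auto
 then show ?thesis by (simp add: pt_def)
qed

lemma pt_diff: "c - pt a c n = (c - a) / 2 ^ n" by (simp add: pt_def)

lemma pt_cover:
 assumes "a <= x" "x < c"
 shows "EX n. pt a c n <= x & x < pt a c (Suc n)"
proof -
 have "EX n. x < pt a c n"
 proof -
  obtain n where "(c - a) / (c - x) < 2 ^ n" using real_arch_pow[of 2 "(c - a) / (c - x)"] by auto
  then have "(c - a) / 2 ^ n < c - x" using assms by (simp add: field_simps)
  then show ?thesis by (auto simp: pt_def intro!: exI[of _ n])
 qed
 then obtain n where n: "x < pt a c n" "!!k. k < n ==> \<not> x < pt a c k" using exists_least_iff[of "%n. x < pt a c n"] by auto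
 have "n ~= 0" using n(1) assms by (cases n) auto
 then obtain k where "n = Suc k" by (cases n) auto
 then show ?thesis using n by (intro exI[of _ k]) (auto simp: not_less)
qed

lemma tail_pieces_sum:
 assumes ac: "a < c" and r: "1 <= r"
 shows "(\<Sum>n. enn (tail (pt a c n) (pt a c (n + 2)) x powr r)) <= enn (8 * tail a c x powr r)"
proof (cases "c <= x")
 case True
 have "tail (pt a c n) (pt a c (n + 2)) x = 0" for n using pt_less[OF ac, of "n + 2"] True by (intro tail_right) simp
 then show ?thesis by simp
next
 case False
 define L d u where "L = c - a" and "d = c - x" and "u = (%n. L / 2 ^ n / d)"
 have d: "0 < d" and L: "0 < L" using False ac by (auto simp: L_def d_def)
 have u0: "0 < u n" for n using d L by (simp add: u_def)
 have us: "u (Suc n) = u n / 2" for n by (simp add: u_def)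
 have un: "u n = u 0 / 2 ^ n" for n by (simp add: u_def)
 let ?t = "%n. tail (pt a c n) (pt a c (n + 2)) x"
 have pp: "pt a c n < pt a c (n + 2)" for n using pt_mono[OF ac, of n] pt_mono[OF ac, of "Suc n"] by simp
 have t0: "0 <= ?t n" for n by (intro tail_nonneg less_imp_le pp)
 have tu: "?t n <= (if u n < 4 then min 1 (u n) else 0)" for n
 proof (cases "pt a c (n + 2) <= x")
  case True then show ?thesis using u0[of n] by (simp add: tail_right)
 next
  case False
  then have "d > L / 2 ^ (n + 2)" by (simp add: d_def L_def pt_def)
  then have u4: "u n < 4" using d by (simp add: u_def field_simps)
  show ?thesis
  proof (cases "1 <= u n")
   case True then show ?thesis using u4 tail_le_1 by simp
  next
   case f: False
   then have dn: "L / 2 ^ n < d" using d by (simp add: u_def field_simps)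
   then have xn: "x < pt a c n" by (simp add: d_def L_def pt_def)
   have "?t n = (pt a c (n + 2) - pt a c n) / (pt a c (n + 2) - x)" using xn pp by (intro tail_left) auto
   also have "pt a c (n + 2) - pt a c n = 3 / 4 * (L / 2 ^ n)" by (simp add: pt_def L_def field_simps)
   also have "pt a c (n + 2) - x = d - L / 2 ^ n / 4" by (simp add: pt_def L_def d_def)
   also have "3 / 4 * (L / 2 ^ n) / (d - L / 2 ^ n / 4) <= 3 / 4 * (L / 2 ^ n) / (3 / 4 * d)" using dn L d by (intro divide_left_mono mult_pos_pos) auto
   also have "... = u n" by (simp add: u_def)
   finally show ?thesis using u4 f by simp
  qed
 qed
 show ?thesis
 proof (cases "u 0 <= 1")
  case True
  have tl: "tail a c x = u 0" using True d L False ac by (subst tail_left) (auto simp: u_def L_def d_def field_simps)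
  have "enn (?t n powr r) <= enn (u 0 powr r * (1 / 2) ^ n)" for n
  proof (rule ennreal_leI)
   have le: "?t n <= u n" using tu[of n] u0[of n] by (auto split: if_splits)
   have "?t n powr r <= u n powr r" using le t0 r by (intro powr_mono2) auto
   also have "u n powr r = u 0 powr r * ((1 / 2) ^ n) powr r"
   proof -
    have "u n = u 0 * (1 / 2) ^ n" by (subst un) (simp add: power_divide)
    then show ?thesis by (simp only: powr_mult)
   qed
   also have "... <= u 0 powr r * (1 / 2) ^ n"
   proof (rule mult_left_mono)
    have "((1 / 2) ^ n) powr r <= ((1 / 2 :: real) ^ n) powr 1" using r by (intro powr_mono') (auto simp: power_le_one)
    then show "((1 / 2) ^ n) powr r <= (1 / 2 :: real) ^ n" by simp
   qed simp
   finally show "?t n powr r <= u 0 powr r * (1 / 2) ^ n" .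
  qed
  then have "(\<Sum>n. enn (?t n powr r)) <= (\<Sum>n. enn (u 0 powr r * (1 / 2) ^ n))" by (rule suminf_le) (rule summableI)+
  also have "... = enn (u 0 powr r * 2)" by (rule suminf_ennreal_eq) (use sums_mult[OF geometric_sums[of "1/2::real"], of "u 0 powr r"] in simp_all)
  also have "... <= enn (8 * tail a c x powr r)" unfolding tl by (intro ennreal_leI) simp
  finally show ?thesis .
 next
  case False
  have tl: "tail a c x = 1" using False d L \<open>\<not> c <= x\<close> ac by (intro tail_inside) (auto simp: u_def L_def d_def field_simps)
  have b: "?t n powr r <= 2 * (min 4 (u n) - min 4 (u (Suc n)))" for n
  proof -
   have "?t n powr r <= ?t n powr 1" using t0 tail_le_1 r by (intro powr_mono') auto
   also have "... = ?t n" using t0 by simp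
   also have "... <= 2 * (min 4 (u n) - min 4 (u (Suc n)))" using tu[of n] us[of n] u0[of n] by (auto simp: min_def split: if_splits)
   finally show ?thesis .
  qed
  have "(SUM i<n. enn (?t i powr r)) <= enn 8" for n
  proof -
   have "(SUM i<n. ?t i powr r) <= (SUM i<n. 2 * (min 4 (u i) - min 4 (u (Suc i))))" by (intro sum_mono b)
   also have "... = 2 * (min 4 (u 0) - min 4 (u n))" by (simp only: sum_distrib_left[symmetric] sum_lessThan_telescope'[of "%i. min 4 (u i)"])
   also have "... <= 8" using u0[of n] by (simp add: min_def)
   finally have "enn (SUM i<n. ?t i powr r) <= enn 8" by (rule ennreal_leI)
   then show ?thesis by (subst sum_ennreal) simp_all
  qed
  then have "(\<Sum>i. enn (?t i powr r)) <= enn 8" by (rule suminf_ennreal_le_const)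
  then show ?thesis using tl by simp
 qed
qed

locale one_sided_weight =
 fixes M :: "real measure" and r e0 C0 :: real
 assumes setsM [measurable_cong, simp]: "sets M = sets borel"
  and r: "1 < r" and e0: "0 < e0" and C0: "0 <= C0"
  and Cplus: "!!a b c E. a < b ==> b < c ==> c - b < b - a ==> E : sets borel ==> E <= {a<..<b} ==>
   emeasure M E <= enn (C0 * (rleb E / (c - b)) powr e0) * (nn_integral M (%x. enn (tail a c x powr r)))"
begin

definition W :: "real => real => ennreal" where
 "W a c = (nn_integral M (%x. enn (tail a c x powr r)))"

lemma space_M [simp]: "space M = UNIV" using sets_eq_imp_space_eq[OF setsM] by simp

lemma Cplus':
 assumes "a < b" "b < c" "c - b < b - a" "E : sets borel" "E <= {a<..<b}"
  and "leb E <= enn (h * (c - b))" "0 <= h"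
 shows "emeasure M E <= enn (C0 * h powr e0) * W a c"
proof -
 have "rleb E <= h * (c - b)" using assms unfolding measure_def by (intro enn2real_leI) auto
 then have "(rleb E / (c - b)) powr e0 <= h powr e0" using assms e0 by (intro powr_mono2) (auto simp: field_simps)
 then show ?thesis using Cplus[OF assms(1-5)] C0 unfolding W_def by (elim order_trans) (auto intro!: mult_right_mono ennreal_leI mult_left_mono)
qed

lemma emeasure_point [simp]: "emeasure M {x} = 0" using Cplus'[of "x - 2" "x + 1" "x + 2" "{x}" 0] e0 by simp

lemma AE_neq: "AE x in M. x ~= y" by (intro AE_I[of _ _ "{y}"]) auto

lemma emeasure_le_W: "a < c ==> emeasure M {a<..<c} <= W a c"
proof -
 assume "a < c"
 have "emeasure M {a<..<c} = (nn_integral M (%x. ind {a<..<c} x))" by simp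
 also have "... <= W a c" unfolding W_def by (intro nn_integral_mono) (auto simp: indicator_def tail_inside)
 finally show ?thesis .
qed

lemma W_extend:
 assumes "a' <= a" "a < c"
 shows "W a' c <= enn (((c - a') / (c - a)) powr r) * W a c"
proof -
 have q: "0 <= (c - a') / (c - a)" using assms by simp
 have "W a' c <= (nn_integral M (%x. enn (((c - a') / (c - a)) powr r) * enn (tail a c x powr r)))" unfolding W_def
 proof (rule nn_integral_mono)
  fix x
  have "tail a' c x powr r <= ((c - a') / (c - a) * tail a c x) powr r" using tail_extend[OF assms] tail_nonneg[of a' c x] assms r by (intro powr_mono2) auto
  also have "... = ((c - a') / (c - a)) powr r * tail a c x powr r" by (rule powr_mult)
  finally show "enn (tail a' c x powr r) <= enn (((c - a') / (c - a)) powr r) * enn (tail a c x powr r)" by (simp add: ennreal_mult[symmetric] ennreal_leI)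
 qed
 also have "... = enn (((c - a') / (c - a)) powr r) * W a c" unfolding W_def by (intro nn_integral_cmult) measurable
 finally show ?thesis .
qed

lemma piece_small:
 assumes ac: "a < c" and E: "E : sets borel" "E <= {pt a c n<..<pt a c (Suc n)}"
  and small: "leb E <= enn (h * (c - a) / 2 ^ n)" and h: "0 <= h"
 shows "emeasure M E <= enn (C0 * (4 * h) powr e0) * W (pt a c n) (pt a c (n + 2))"
proof (rule Cplus')
 show "pt a c n < pt a c (Suc n)" "pt a c (Suc n) < pt a c (n + 2)" using pt_mono[OF ac, of n] pt_mono[OF ac, of "Suc n"] by simp_all
 show "pt a c (n + 2) - pt a c (Suc n) < pt a c (Suc n) - pt a c n" using ac by (simp add: pt_def field_simps)
 have "h * (c - a) / 2 ^ n = 4 * h * (pt a c (n + 2) - pt a c (Suc n))" by (simp add: pt_def field_simps)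
 then show "leb E <= enn (4 * h * (pt a c (n + 2) - pt a c (Suc n)))" using small by simp
qed (use E h in auto)

lemma W_pieces: "a < c ==> (\<Sum>n. W (pt a c n) (pt a c (n + 2))) <= 8 * W a c"
proof -
 assume ac: "a < c"
 have "(\<Sum>n. W (pt a c n) (pt a c (n + 2))) = (nn_integral M (%x. (\<Sum>n. enn (tail (pt a c n) (pt a c (n + 2)) x powr r))))"
  unfolding W_def by (intro nn_integral_suminf[symmetric]) measurable
 also have "... <= (nn_integral M (%x. 8 * enn (tail a c x powr r)))"
 proof (rule nn_integral_mono)
  fix x
  have "(\<Sum>n. enn (tail (pt a c n) (pt a c (n + 2)) x powr r)) <= enn (8 * tail a c x powr r)" by (rule tail_pieces_sum[OF ac less_imp_le[OF r]])
  also have "... = 8 * enn (tail a c x powr r)" by (subst ennreal_mult) auto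
  finally show "(\<Sum>n. enn (tail (pt a c n) (pt a c (n + 2)) x powr r)) <= 8 * enn (tail a c x powr r)" .
 qed
 also have "... = 8 * W a c" unfolding W_def by (intro nn_integral_cmult) measurable
 finally show ?thesis .
qed

lemma emeasure_pieces:
 assumes ac: "a < c" and E: "E : sets borel" "E <= {a<..<c}"
 shows "emeasure M E <= (\<Sum>n. emeasure M (E Int {pt a c n<..<pt a c (Suc n)}))"
proof -
 have "AE x in M. ALL n. x ~= pt a c n" unfolding AE_all_countable by (intro allI AE_neq)
 then have ae: "AE x in M. ind E x <= (\<Sum>n. ind (E Int {pt a c n<..<pt a c (Suc n)}) x :: ennreal)"
 proof eventually_elim
  fix x assume x: "ALL n. x ~= pt a c n"
  let ?f = "%n. ind (E Int {pt a c n<..<pt a c (Suc n)}) x :: ennreal"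
  show "ind E x <= (\<Sum>n. ?f n)"
  proof (cases "x : E")
   case True
   then obtain n where "pt a c n <= x" "x < pt a c (Suc n)" using pt_cover[of a x c] E(2) by force
   then have "?f n = 1" using True x by (auto simp: indicator_def less_le)
   moreover have "sum ?f {n} <= (\<Sum>n. ?f n)" by (intro sum_le_suminf) auto
   ultimately show ?thesis by (simp add: indicator_def)
  qed simp
 qed
 have "emeasure M E = (nn_integral M (%x. ind E x))" using E by simp
 also have "... <= (nn_integral M (%x. (\<Sum>n. ind (E Int {pt a c n<..<pt a c (Suc n)}) x)))" by (intro nn_integral_mono_AE ae)
 also have "... = (\<Sum>n. \<integral>\<^sup>+x. ind (E Int {pt a c n<..<pt a c (Suc n)}) x \<partial>M)" using E by (intro nn_integral_suminf) auto
 also have "... = (\<Sum>n. emeasure M (E Int {pt a c n<..<pt a c (Suc n)}))" using E by simp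
 finally show ?thesis .
qed

end

definition fam :: "real set set => bool" where
 "fam Q \<longleftrightarrow> countable Q & disjoint Q & (ALL C:Q. EX alf ga. alf < ga & C = {alf<..<ga})"

definition stail :: "real set => real => real" where
 "stail C x = tail (Inf C) (Sup C) x"

lemma stail_Ioo [simp]: "a < c ==> stail {a<..<c} x = tail a c x" by (simp add: stail_def)

lemma stail_measurable [measurable]: "stail C : Borel" unfolding stail_def[abs_def] by measurable

lemma famE:
 assumes "fam Q" "C : Q"
 obtains alf ga where "alf < ga" "C = {alf<..<ga}" using assms unfolding fam_def by blast

lemma fam_subset: "fam Q ==> Q' <= Q ==> fam Q'" unfolding fam_def by (meson countable_subset pairwise_subset subsetD)

lemma fam_sum_measure:
 assumes Q: "fam Q" and N: "sets N = sets borel" and B: "B : sets borel"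
 shows "(nn_integral (count_space Q) (%C. emeasure N (C Int B))) = emeasure N (\<Union>Q Int B)"
proof -
 have "emeasure N (\<Union>C\<in>Q. C Int B) = (nn_integral (count_space Q) (%C. emeasure N (C Int B)))"
 proof (rule emeasure_UN_countable)
  show "C Int B : sets N" if C: "C : Q" for C using famE[OF Q C] B N by (metis borel_open open_greaterThanLessThan sets.Int)
  show "countable Q" using Q by (simp add: fam_def)
  show "disjoint_family_on (%C. C Int B) Q" using Q by (auto simp: fam_def disjoint_family_on_def disjoint_def)
 qed
 moreover have "(\<Union>C\<in>Q. C Int B) = \<Union>Q Int B" by auto
 ultimately show ?thesis by simp
qed

lemma fam_Union_borel: "fam Q ==> \<Union>Q : sets borel" by (rule borel_open, rule open_Union) (metis famE open_greaterThanLessThan)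

lemma fam_components: "open U ==> bounded U ==> Q <= components U ==> fam Q"
proof -
 assume U: "open U" "bounded U" and Q: "Q <= components U"
 have "fam (components U)" unfolding fam_def
 proof (intro conjI ballI)
  show "disjoint (components U)" using pairwise_disjoint_components[of U] by (simp add: disjoint_def pairwise_def disjnt_def)
  show "EX alf ga. alf < ga & C = {alf<..<ga}" if "C : components U" for C using component_Ioo[OF U that] by metis
 qed (use U countable_components_open in auto)
 then show ?thesis using Q by (rule fam_subset)
qed

lemma powr_split1: "0 <= x ==> x powr r = x powr (r - 1) * (x :: real)" by (cases "x = 0") (simp_all add: powr_diff)

lemma outside_single:
 assumes Q: "fam Q" and sub: "\<Union>Q <= {a<..<c}" and ac: "a < c" and h: "0 <= h"
  and thin: "!!D. 0 < D ==> D <= c - a ==> leb (\<Union>Q Int {a<..<a + D}) <= enn (h * D)"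
  and x: "x < a" and C: "C : Q"
 shows "stail C x <= h * tail a c x"
proof -
 obtain alf ga where ag: "alf < ga" "C = {alf<..<ga}" using famE[OF Q C] .
 have b: "a <= alf" "ga <= c"
 proof -
  have "{alf<..<ga} <= {a<..<c}" using sub C ag by auto
  then show "a <= alf" "ga <= c" using ag by (auto simp: greaterThanLessThan_subseteq_greaterThanLessThan)
 qed
 have "enn (ga - alf) = leb C" using ag by simp
 also have "... <= leb (\<Union>Q Int {a<..<a + (ga - a)})" using C ag b fam_Union_borel[OF Q] by (intro emeasure_mono) auto
 also have "... <= enn (h * (ga - a))" using ag b by (intro thin) auto
 finally have l: "ga - alf <= h * (ga - a)" using h ag b by (simp add: ennreal_le_iff)
 have "stail C x = (ga - alf) / (ga - x)" using ag b x by (simp add: tail_left)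
 also have "... <= h * (ga - a) / (ga - x)" using l ag b x by (intro divide_right_mono) auto
 also have "... = h * ((ga - a) / (ga - x))" by simp
 also have "... <= h * ((c - a) / (c - x))"
 proof (rule mult_left_mono[OF _ h])
  have "(ga - a) * (c - x) <= (c - a) * (ga - x)"
  proof -
   have "0 <= (c - ga) * (a - x)" using b x by simp
   then show ?thesis by (simp add: algebra_simps)
  qed
  then show "(ga - a) / (ga - x) <= (c - a) / (c - x)" using ag b x by (simp add: divide_simps)
 qed
 also have "... = h * tail a c x" using x ac by (simp add: tail_left)
 finally show ?thesis .
qed

text \<open>Intervals at distance about \<open>L / 2\<^sup>k\<close> are counted by their total length, which the density assumption
 bounds; the weights \<open>2\<^sup>k / L\<close> then leave one term for each dyadic distance.\<close>

lemma outside_sum: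
 assumes Q: "fam Q" and sub: "\<Union>Q <= {a<..<c}" and ac: "a < c" and h: "0 <= h"
  and thin: "!!D. 0 < D ==> D <= c - a ==> leb (\<Union>Q Int {a<..<a + D}) <= enn (h * D)"
  and x: "x < a" "(c - a) / 2 ^ n <= a - x"
 shows "(nn_integral (count_space Q) (%C. enn (stail C x))) <= enn (2 * h * (n + 1))"
proof -
 define L where "L = c - a"
 have L: "0 < L" using ac by (simp add: L_def)
 have "(nn_integral (count_space Q) (%C. enn (stail C x))) <=
   (nn_integral (count_space Q) (%C. (SUM k<=n. enn (2 ^ (k + 1) / L) * leb (C Int {a<..<a + L / 2 ^ k}))))"
 proof (rule nn_integral_mono)
  fix C assume "C : space (count_space Q)"
  then have C: "C : Q" by simp
  obtain alf ga where ag: "alf < ga" "C = {alf<..<ga}" using famE[OF Q C] .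
  have b: "a <= alf" "ga <= c"
  proof -
   have "{alf<..<ga} <= {a<..<c}" using sub C ag by auto
   then show "a <= alf" "ga <= c" using ag by (auto simp: greaterThanLessThan_subseteq_greaterThanLessThan)
  qed
  have st: "stail C x = (ga - alf) / (ga - x)" using ag b x by (simp add: tail_left)
  obtain k where k: "k <= n" "ga - a <= L / 2 ^ k" "k < n ==> L / 2 ^ (k + 1) < ga - a"
  proof -
   let ?P = "%k. k = n | L / 2 ^ (k + 1) < ga - a"
   define k where "k = (LEAST k. ?P k)"
   have Pk: "?P k" unfolding k_def by (rule LeastI[of ?P n]) simp
   have le: "k <= n" unfolding k_def by (rule Least_le) simp
   have "ga - a <= L / 2 ^ k"
   proof (cases k)
    case 0 then show ?thesis using b by (simp add: L_def)
   next
    case (Suc j)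
    then have "\<not> ?P j" unfolding k_def using not_less_Least[of j ?P] by auto
    then show ?thesis using Suc by simp
   qed
   then show ?thesis using that le Pk by blast
  qed
  have dx: "L / 2 ^ (k + 1) <= ga - x"
  proof (cases "k < n")
   case True then show ?thesis using k x by linarith
  next
   case False
   then have "k = n" using k by simp
   moreover have "L / 2 ^ (n + 1) <= L / 2 ^ n" using L by (simp add: field_simps)
   ultimately show ?thesis using x b ag by (simp add: L_def)
  qed
  have "enn (stail C x) <= enn (2 ^ (k + 1) / L * (ga - alf))"
  proof (rule ennreal_leI)
   have "(ga - alf) / (ga - x) <= (ga - alf) / (L / 2 ^ (k + 1))" using dx L ag b x by (intro divide_left_mono mult_pos_pos) auto
   then show "stail C x <= 2 ^ (k + 1) / L * (ga - alf)" using st by (simp add: mult.commute)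
  qed
  also have "... = enn (2 ^ (k + 1) / L) * leb (C Int {a<..<a + L / 2 ^ k})"
  proof -
   have "C Int {a<..<a + L / 2 ^ k} = C" using ag b k by auto
   then show ?thesis using ag L by (simp add: ennreal_mult[symmetric])
  qed
  also have "... <= (SUM k<=n. enn (2 ^ (k + 1) / L) * leb (C Int {a<..<a + L / 2 ^ k}))" using k by (intro member_le_sum) auto
  finally show "enn (stail C x) <= (SUM k<=n. enn (2 ^ (k + 1) / L) * leb (C Int {a<..<a + L / 2 ^ k}))" .
 qed
 also have "... = (SUM k<=n. enn (2 ^ (k + 1) / L) * leb (\<Union>Q Int {a<..<a + L / 2 ^ k}))"
  using fam_sum_measure[OF Q, of lborel] by (subst nn_integral_sum) (auto simp: nn_integral_cmult intro!: sum.cong)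
 also have "... <= (SUM k<=n. enn (2 * h))"
 proof (rule sum_mono)
  fix k
  have "L / 2 ^ k <= L / 1" using L by (intro divide_left_mono) auto
  then have "leb (\<Union>Q Int {a<..<a + L / 2 ^ k}) <= enn (h * (L / 2 ^ k))" using L by (intro thin) (auto simp: L_def)
  then have "enn (2 ^ (k + 1) / L) * leb (\<Union>Q Int {a<..<a + L / 2 ^ k}) <= enn (2 ^ (k + 1) / L) * enn (h * (L / 2 ^ k))" by (rule mult_left_mono) simp
  also have "... = enn (2 * h)" using L h by (simp add: ennreal_mult[symmetric] field_simps)
  finally show "enn (2 ^ (k + 1) / L) * leb (\<Union>Q Int {a<..<a + L / 2 ^ k}) <= enn (2 * h)" .
 qed
 also have "... = enn (2 * h * (n + 1))" using h by (simp add: ennreal_of_nat_eq_real_of_nat ennreal_mult[symmetric] algebra_simps)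
 finally show ?thesis .
qed

lemma outside_sum_far:
 assumes Q: "fam Q" and sub: "\<Union>Q <= {a<..<c}" and ac: "a < c" and h: "0 <= h"
  and thin: "leb (\<Union>Q) <= enn (h * (c - a))"
  and x: "x <= 2 * a - c"
 shows "(nn_integral (count_space Q) (%C. enn (stail C x))) <= enn (2 * h * tail a c x)"
proof -
 have "(nn_integral (count_space Q) (%C. enn (stail C x))) <= (nn_integral (count_space Q) (%C. enn (2 / (c - x)) * leb (C Int UNIV)))"
 proof (rule nn_integral_mono)
  fix C assume "C : space (count_space Q)"
  then have C: "C : Q" by simp
  obtain alf ga where ag: "alf < ga" "C = {alf<..<ga}" using famE[OF Q C] .
  have b: "a <= alf" "ga <= c"
  proof -
   have "{alf<..<ga} <= {a<..<c}" using sub C ag by auto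
   then show "a <= alf" "ga <= c" using ag by (auto simp: greaterThanLessThan_subseteq_greaterThanLessThan)
  qed
  have "stail C x = (ga - alf) / (ga - x)" using ag b x ac by (simp add: tail_left)
  also have "... <= (ga - alf) / ((c - x) / 2)" using ag b x ac by (intro divide_left_mono mult_pos_pos) auto
  also have "... = 2 / (c - x) * (ga - alf)" by simp
  finally have "enn (stail C x) <= enn (2 / (c - x) * (ga - alf))" by (rule ennreal_leI)
  also have "... = enn (2 / (c - x)) * enn (ga - alf)" using ag x ac by (intro ennreal_mult) auto
  finally show "enn (stail C x) <= enn (2 / (c - x)) * leb (C Int UNIV)" using ag by simp
 qed
 also have "... = enn (2 / (c - x)) * leb (\<Union>Q)" using fam_sum_measure[OF Q, of lborel UNIV] by (simp add: nn_integral_cmult)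
 also have "... <= enn (2 / (c - x)) * enn (h * (c - a))" by (intro mult_left_mono thin) simp
 also have "... = enn (2 * h * tail a c x)" using x ac h by (simp add: ennreal_mult[symmetric] tail_left)
 finally show ?thesis .
qed

context one_sided_weight
begin

definition Psi :: "real set set => real => ennreal" where
 "Psi Q x = (nn_integral (count_space Q) (%C. enn (stail C x powr r)))"

definition WC :: "real set => ennreal" where
 "WC C = W (Inf C) (Sup C)"

lemma Psi_integral:
 assumes "fam Q" "sets N = sets borel" "B : sets borel"
 shows "(\<integral>\<^sup>+x\<in>B. Psi Q x \<partial>N) = (nn_integral (count_space Q) (%C. (\<integral>\<^sup>+x\<in>B. enn (stail C x powr r) \<partial>N)))"
proof -
 have [measurable_cong]: "sets N = sets borel" by fact
 have [measurable]: "B : sets borel" by fact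
 have "(\<integral>\<^sup>+x\<in>B. Psi Q x \<partial>N) = (nn_integral N (%x. (nn_integral (count_space Q) (%C. enn (stail C x powr r) * ind B x))))"
  unfolding Psi_def by (simp add: nn_integral_multc)
 also have "... = (nn_integral (count_space Q) (%C. (\<integral>\<^sup>+x\<in>B. enn (stail C x powr r) \<partial>N)))"
  using assms(1) by (intro nn_integral_count_space_nn_integral) (auto simp: fam_def)
 finally show ?thesis .
qed

lemma sum_WC: "fam Q ==> (nn_integral (count_space Q) (%C. WC C)) = (nn_integral M (%x. Psi Q x))" using Psi_integral[of Q M UNIV] by (simp add: WC_def W_def stail_def)

lemma Psi_measurable: 
 assumes "fam Q" shows "Psi Q : Borel"
proof -
 interpret sigma_finite_measure "count_space Q" using assms by (intro sigma_finite_measure_count_space_countable) (simp add: fam_def)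
 have "(%(C, x). enn (stail C x powr r)) : borel_measurable (count_space Q \<Otimes>\<^sub>M borel)" using assms by (intro measurable_pair_measure_countable1) (auto simp: fam_def)
 from measurable_pair_swap[OF this]
 have "(%(x, C). enn (stail C x powr r)) : borel_measurable (borel \<Otimes>\<^sub>M count_space Q)" by simp
 from borel_measurable_nn_integral[OF this] show ?thesis unfolding Psi_def[abs_def] by simp
qed

end

section \<open>Exponential integrability of sums of tails\<close>

lemma measure_Icc_Ioo:
 fixes E :: "real set"
 assumes "E : sets borel"
 shows "rleb (E Int {x<..<y}) = rleb (E Int {x..y})"
proof -
 have "leb (E Int {x<..<y}) = leb (E Int {x..y})"
 proof (rule emeasure_eq_AE)
  show "AE z in lborel. z : E Int {x<..<y} \<longleftrightarrow> z : E Int {x..y}" using AE_lborel_singleton[of x] AE_lborel_singleton[of y] by eventually_elim (auto simp: less_le)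
 qed (use assms in auto)
 then show ?thesis by (simp add: measure_def)
qed

lemma finite_emeasure_Int_Icc: "leb (E Int {x..y::real}) < \<infinity>"
proof (cases "E Int {x..y} : sets lborel")
 case True
 have "leb (E Int {x..y}) <= leb {x..y}" by (intro emeasure_mono) auto
 also have "... < \<infinity>" by (simp add: emeasure_lborel_Icc_eq)
 finally show ?thesis .
qed (simp add: emeasure_notin_sets)

lemma mass_indicator:
 assumes "E : sets borel"
 shows "mass (%t. k * ind E t) x y = k * rleb (E Int {x..y})"
proof -
 have "mass (%t. k * ind E t) x y = (LINT t|lborel. k * ind (E Int {x..y}) t)" unfolding mass_def sli_def by (intro Bochner_Integration.integral_cong) (auto simp: indicator_def)
 also have "... = k * rleb (E Int {x..y})" by simp
 finally show ?thesis .
qed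

lemma ibs_scaled_indicator:
 assumes "E : sets borel" "E <= {u..v}"
 shows "ibs (%t. k * ind E t)" unfolding ibs_def
proof (intro conjI exI[of _ "abs u + abs v"] allI impI)
 have "E = E Int {u..v}" using assms by auto
 then have "leb E < \<infinity>" using finite_emeasure_Int_Icc[of E u v] by simp
 then show "integrable lborel (%t. k * ind E t)" using assms by (auto intro!: integrable_mult_right)
 fix t :: real assume "abs u + abs v < abs t"
 then have "t ~: {u..v}" by auto
 then show "k * ind E t = 0" using assms(2) by (auto simp: indicator_def)
qed

lemma measurable_uminus_image: "E : sets borel ==> uminus -` E : sets (borel :: real measure)" using measurable_sets[of uminus borel borel E] by simp

lemma emeasure_uminus_vimage:
 assumes "E : sets borel"
 shows "leb (uminus -` E) = leb (E :: real set)"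
proof -
 have "leb E = emeasure (distr lborel borel uminus) E" by (simp add: lborel_distr_uminus)
 also have "... = leb (uminus -` E)" using assms by (subst emeasure_distr) auto
 finally show ?thesis by simp
qed

text \<open>The rising sun lemma for the reflected set.\<close>

lemma left_maximal_set:
 fixes E :: "real set"
 assumes E: "E : sets borel" "E <= {u..v}" and k: "1 <= k"
 obtains L where "L : sets borel" "leb L <= enn k * leb E"
  "!!y h. y ~: L ==> 0 < h ==> rleb (E Int {y - h<..<y}) <= h / k"
proof -
 let ?E = "uminus -` E"
 let ?g = "%t. k * ind ?E t"
 have mE: "?E : sets borel" using E(1) by (rule measurable_uminus_image)
 have sE: "?E <= {-v..-u}" using E(2) by auto
 have ib: "ibs ?g" by (rule ibs_scaled_indicator[OF mE sE])
 have nn: "0 <= ?g t" for t using k by simp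
 have gm: "?g : Borel" using mE by simp
 have op: "open (rset ?g)" using ib nn by (intro open_rset) (auto simp: ibs_def)
 show ?thesis
 proof (rule that[of "uminus -` rset ?g"])
  show "uminus -` rset ?g : sets borel" using op by (intro measurable_uminus_image) auto
  have "leb (uminus -` rset ?g) = leb (rset ?g)" using op by (intro emeasure_uminus_vimage) auto
  also have "... <= enn (LINT t|lborel. ?g t)" by (rule rset_weak_type[OF ib nn gm])
  also have "(LINT t|lborel. ?g t) = k * rleb ?E" by simp
  also have "enn (k * rleb ?E) = enn k * leb ?E"
  proof -
   have "?E = ?E Int {-v..-u}" using sE by auto
   then have "leb ?E < \<infinity>" using finite_emeasure_Int_Icc[of ?E "-v" "-u"] by simp
   then show ?thesis using k by (simp add: ennreal_mult emeasure_eq_ennreal_measure)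
  qed
  also have "leb ?E = leb E" by (rule emeasure_uminus_vimage[OF E(1)])
  finally show "leb (uminus -` rset ?g) <= enn k * leb E" .
  fix y h :: real assume y: "y ~: uminus -` rset ?g" and h: "0 < h"
  then have "mass ?g (-y) (-y + h) <= h" using not_rset[of "-y" ?g "-y + h"] by simp
  then have "k * rleb (?E Int {-y..-y + h}) <= h" by (simp add: mass_indicator[OF mE])
  moreover have "?E Int {-y..-y + h} = uminus -` (E Int {y - h..y})" by auto
  moreover have "leb (uminus -` (E Int {y - h..y})) = leb (E Int {y - h..y})" using E by (intro emeasure_uminus_vimage) auto
  ultimately have "k * rleb (E Int {y - h..y}) <= h" by (simp add: measure_def)
  then show "rleb (E Int {y - h<..<y}) <= h / k" using k by (simp add: measure_Icc_Ioo[OF E(1)] field_simps)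
 qed
qed

context one_sided_weight
begin

definition K' :: real where "K' = 2 / (1 - 2 powr (1 - r))"

lemma K'_gt: "2 < K'" and q_less: "2 powr (1 - r) < 1"
proof -
 have "2 powr (1 - r) < 2 powr 0" using r by (subst powr_less_cancel_iff) auto
 then show q: "2 powr (1 - r) < 1" by simp
 have "0 < 2 powr (1 - r)" by simp
 then show "2 < K'" unfolding K'_def using q by (simp add: field_simps)
qed

lemma tail_integral_density:
 assumes E: "E : sets borel" and ag: "alf < ga" and y: "alf < y" "y < ga" and D: "0 <= D"
  and dens: "!!h. 0 < h ==> rleb (E Int {y - h<..<y}) <= D * h"
 shows "(lint_on (E Int {..<alf}) (%x. enn (tail alf ga x powr r))) <= enn (K' * D * (ga - alf))"
proof -
 define l where "l = ga - alf"
 have l: "0 < l" using ag by (simp add: l_def)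
 let ?q = "2 powr (1 - r)"
 let ?f = "%i x. enn ((1 / 2 ^ i) powr r) * ind (E Int {y - 2 ^ (i + 1) * l<..<y}) x"
 have "(lint_on (E Int {..<alf}) (%x. enn (tail alf ga x powr r))) <= (lint (%x. (\<Sum>i. ?f i x)))"
 proof (rule nn_integral_mono)
  fix x
  show "enn (tail alf ga x powr r) * ind (E Int {..<alf}) x <= (\<Sum>i. ?f i x)"
  proof (cases "x : E Int {..<alf}")
   case True
   then have x: "x : E" "x < alf" by auto
   obtain n where "(ga - x) / l < 2 ^ n" using real_arch_pow[of 2 "(ga - x) / l"] by auto
   then have n: "ga - x < 2 ^ n * l" using l by (simp add: field_simps)
   define m where "m = (LEAST n. ga - x < 2 ^ n * l)"
   have m: "ga - x < 2 ^ m * l" unfolding m_def by (rule LeastI[of _ n]) (rule n)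
   have "m ~= 0"
   proof
    assume "m = 0" then have "ga - x < l" using m by simp
    then show False using x by (simp add: l_def)
   qed
   then obtain i where i: "m = Suc i" by (cases m) auto
   have "\<not> ga - x < 2 ^ i * l" using not_less_Least[of i "%n. ga - x < 2 ^ n * l"] i by (simp add: m_def)
   then have lo: "2 ^ i * l <= ga - x" by simp
   have "tail alf ga x = l / (ga - x)" using x ag by (simp add: tail_left l_def)
   also have "... <= l / (2 ^ i * l)" using lo l x ag by (intro divide_left_mono mult_pos_pos) auto
   also have "... = 1 / 2 ^ i" using l by simp
   finally have "tail alf ga x powr r <= (1 / 2 ^ i) powr r" using r tail_nonneg[of alf ga x] ag by (intro powr_mono2) auto
   moreover have "x : {y - 2 ^ (i + 1) * l<..<y}" using m i x y by auto
   ultimately have "enn (tail alf ga x powr r) * ind (E Int {..<alf}) x <= ?f i x" using x by (simp add: ennreal_leI)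
   moreover have "sum (%j. ?f j x) {i} <= (\<Sum>j. ?f j x)" by (rule sum_le_suminf[OF summableI]) simp_all
   then have "?f i x <= (\<Sum>j. ?f j x)" by (simp only: sum.insert sum.empty finite.intros empty_iff not_False_eq_True add_0_right)
   ultimately show ?thesis by (rule order_trans)
  qed simp
 qed
 also have "... = (\<Sum>i. \<integral>\<^sup>+x. ?f i x \<partial>lborel)" using E by (intro nn_integral_suminf) auto
 also have "... <= (\<Sum>i. enn (2 * D * l * ?q ^ i))"
 proof (rule suminf_le[OF _ summableI summableI])
  fix i
  let ?S = "E Int {y - 2 ^ (i + 1) * l<..<y}"
  have fin: "leb ?S < \<infinity>"
  proof -
   have "leb ?S <= leb (E Int {y - 2 ^ (i + 1) * l..y})" using E by (intro emeasure_mono) auto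
   then show ?thesis using finite_emeasure_Int_Icc[of E "y - 2 ^ (i + 1) * l" y] by simp
  qed
  have "(lint (%x. ?f i x)) = enn ((1 / 2 ^ i) powr r) * enn (rleb ?S)" using E fin by (subst nn_integral_cmult_indicator) (auto simp: emeasure_eq_ennreal_measure)
  also have "... <= enn ((1 / 2 ^ i) powr r) * enn (D * (2 ^ (i + 1) * l))" using dens[of "2 ^ (i + 1) * l"] l by (intro mult_left_mono ennreal_leI) auto
  also have "... = enn (2 * D * l * ((1 / 2 ^ i) powr r * 2 ^ i))" using D l by (simp add: ennreal_mult[symmetric] algebra_simps)
  also have "(1 / 2 ^ i) powr r * 2 ^ i = ?q ^ i"
  proof -
   have "(1 / 2 ^ i :: real) = 2 powr (- real i)" by (simp add: powr_minus_divide powr_realpow)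
   then have "(1 / 2 ^ i) powr r * 2 ^ i = 2 powr (- real i * r) * 2 powr real i" by (simp add: powr_powr powr_realpow)
   also have "... = 2 powr ((1 - r) * real i)" by (simp add: powr_add[symmetric] algebra_simps)
   also have "... = ?q ^ i" by (simp add: powr_powr[symmetric] powr_realpow)
   finally show ?thesis .
  qed
  finally show "(lint (%x. ?f i x)) <= enn (2 * D * l * ?q ^ i)" .
 qed
 also have "... = enn (2 * D * l * (1 / (1 - ?q)))"
 proof (rule suminf_ennreal_eq)
  show "(%i. 2 * D * l * ?q ^ i) sums (2 * D * l * (1 / (1 - ?q)))" using q_less by (intro sums_mult geometric_sums) simp
 qed (use D l in auto)
 also have "2 * D * l * (1 / (1 - ?q)) = K' * D * (ga - alf)" by (simp add: K'_def l_def)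
 finally show ?thesis .
qed

definition K1 :: real where "K1 = 2 + 4 * K'"

text \<open>Exponential integrability by duality. A set \<open>E\<close> on which \<open>Psi\<close> is large is tested against \<open>Psi\<close>; moving
 the tails from the intervals onto \<open>E\<close> replaces the indicator of \<open>E\<close> by its left maximal function, whose integral over
 \<open>{u<..<v}\<close> is at most \<open>2 k\<close> times the measure of \<open>E\<close> up to an error \<open>(v - u) / 2\<^sup>k\<close>.\<close>

lemma exp_tail:
 assumes Q: "fam Q" and uv: "u < v" and hi: "!!C. C : Q ==> Sup C <= v"
  and E: "E : sets borel" "E <= {u<..<v}"
  and large: "!!x. x : E ==> ennreal (K1 * (real k + 1)) <= Psi Q x"
 shows "leb E <= enn ((v - u) / 2 ^ k)"
proof -
 define m where "m = rleb E"
 have E': "E <= {u..v}" using E by auto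
 have finE: "leb E < \<infinity>"
 proof -
  have "E = E Int {u..v}" using E' by auto
  then show ?thesis using finite_emeasure_Int_Icc[of E u v] by simp
 qed
 have mE: "leb E = enn m" using finE by (simp add: m_def emeasure_eq_ennreal_measure)
 have m0: "0 <= m" by (simp add: m_def)
 have "ALL i. EX L. L : sets borel & leb L <= enn (2 ^ i) * leb E &
  (ALL y h. y ~: L --> 0 < h --> rleb (E Int {y - h<..<y}) <= h / 2 ^ i)"
 proof
  fix i :: nat
  obtain L where "L : sets borel" "leb L <= enn (2 ^ i) * leb E"
   "!!y h. y ~: L ==> 0 < h ==> rleb (E Int {y - h<..<y}) <= h / 2 ^ i" using left_maximal_set[OF E(1) E', of "2 ^ i"] by auto
  then show "EX L. L : sets borel & leb L <= enn (2 ^ i) * leb E &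
   (ALL y h. y ~: L --> 0 < h --> rleb (E Int {y - h<..<y}) <= h / 2 ^ i)" by blast
 qed
 then obtain L where L [measurable]: "!!i. L i : sets borel"
  and Lm: "!!i. leb (L i) <= enn (2 ^ i) * leb E"
  and Ld: "!!i y h. y ~: L i ==> 0 < h ==> rleb (E Int {y - h<..<y}) <= h / 2 ^ i" by metis
 have triv: "rleb (E Int {y - h<..<y}) <= h / 2 ^ 0" if "0 < h" for y h
 proof -
  have "leb (E Int {y - h<..<y}) <= leb {y - h<..<y}" by (intro emeasure_mono) auto
  then show ?thesis unfolding measure_def using that by (intro enn2real_leI) simp_all
 qed
 define ph :: "real => real" where "ph y = (SUM i<k. (1 / 2 ^ i) * ind (L (Suc i)) y) + 1 / 2 ^ k" for y :: real
 have phi0: "0 <= ph y" for y unfolding ph_def by (intro add_nonneg_nonneg sum_nonneg) auto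
 have [measurable]: "ph : Borel" unfolding ph_def[abs_def] by measurable
 have phi: "rleb (E Int {y - h<..<y}) <= ph y * h" if h: "0 < h" for y h
 proof -
  have "EX i. rleb (E Int {y - h<..<y}) <= h / 2 ^ i & 1 / 2 ^ i <= ph y"
  proof (cases "ALL i<k. y ~: L (Suc i)")
   case True
   have "rleb (E Int {y - h<..<y}) <= h / 2 ^ k"
   proof (cases k)
    case 0 then show ?thesis using triv[OF h] by simp
   next
    case (Suc j)
    then have "y ~: L k" using True by auto
    then show ?thesis using Ld h by blast
   qed
   moreover have "1 / 2 ^ k <= ph y" unfolding ph_def by (simp add: sum_nonneg)
   ultimately show ?thesis by blast
  next
   case False
   define i where "i = (LEAST i. i < k & y : L (Suc i))"
   have i: "i < k" "y : L (Suc i)" unfolding i_def using False by (metis (mono_tags, lifting) LeastI)+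
   have "rleb (E Int {y - h<..<y}) <= h / 2 ^ i"
   proof (cases i)
    case 0 then show ?thesis using triv[OF h] by simp
   next
    case (Suc j)
    then have "\<not> (j < k & y : L (Suc j))" using not_less_Least[of j "%i. i < k & y : L (Suc i)"] unfolding i_def by simp
    then have "y ~: L i" using Suc i by simp
    then show ?thesis using Ld h by blast
   qed
   moreover have "(1 / 2 ^ i) * ind (L (Suc i)) y <= (SUM i<k. (1 / 2 ^ i) * ind (L (Suc i)) y :: real)" using i by (intro member_le_sum) auto
   then have "1 / 2 ^ i <= ph y" using i unfolding ph_def by (simp add: add_increasing2)
   ultimately show ?thesis by blast
  qed
  then obtain i where "rleb (E Int {y - h<..<y}) <= h / 2 ^ i" "1 / 2 ^ i <= ph y" by blast
  moreover have "h / 2 ^ i <= ph y * h" using \<open>1 / 2 ^ i <= ph y\<close> h mult_right_mono[of "1 / 2 ^ i" "ph y" h] by simp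
  ultimately show ?thesis by linarith
 qed
 let ?N = "density lborel (%y. enn (ph y))"
 have each: "(lint_on E (%x. enn (stail C x powr r))) <= leb (C Int E) +
   enn K' * emeasure ?N (C Int {u<..<v})" if C: "C : Q" for C
 proof -
  obtain alf ga where ag: "alf < ga" "C = {alf<..<ga}" using famE[OF Q C] .
  have gv: "ga <= v" using hi[OF C] ag by simp
  define G where "G = (lint_on (E Int {..<alf}) (%x. enn (tail alf ga x powr r)))"
  have "(lint_on E (%x. enn (stail C x powr r))) <=
    (lint (%x. ind (C Int E) x + enn (tail alf ga x powr r) * ind (E Int {..<alf}) x))"
  proof (rule nn_integral_mono_AE)
   show "AE x in lborel. enn (stail C x powr r) * ind E x <=
    ind (C Int E) x + enn (tail alf ga x powr r) * ind (E Int {..<alf}) x" using AE_lborel_singleton[of alf]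
   proof eventually_elim
    fix x assume "x ~= alf"
    then consider "x < alf" | "alf < x" "x < ga" | "ga <= x" by linarith
    then show "enn (stail C x powr r) * ind E x <=
    ind (C Int E) x + enn (tail alf ga x powr r) * ind (E Int {..<alf}) x" using ag by cases (auto simp: indicator_def tail_inside tail_right)
   qed
  qed
  also have "... = leb (C Int E) + G" unfolding G_def using E ag by (subst nn_integral_add) auto
  also have "G <= enn K' * emeasure ?N (C Int {u<..<v})"
  proof (cases "alf <= u")
   case True
   then have "E Int {..<alf} = {}" using E by auto
   then show ?thesis by (simp add: G_def)
  next
   case False
   then have CC: "C Int {u<..<v} = C" using ag gv by auto
   have "enn (ga - alf) * G = (lint_on C (%y. G))" using ag by (simp add: nn_integral_cmult_indicator mult.commute)
   also have "... <= (lint (%y. enn (K' * (ga - alf)) * (enn (ph y) * ind C y)))"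
   proof (rule nn_integral_mono)
    fix y
    show "G * ind C y <= enn (K' * (ga - alf)) * (enn (ph y) * ind C y)"
    proof (cases "y : C")
     case True
     have "G <= enn (K' * ph y * (ga - alf))" unfolding G_def using True ag phi phi0 by (intro tail_integral_density[OF E(1) ag(1), of y]) auto
     then show ?thesis using True K'_gt ag phi0 by (simp add: ennreal_mult[symmetric] mult_ac)
    qed simp
   qed
   also have "... = enn (ga - alf) * (enn K' * emeasure ?N C)"
   proof -
    have "(lint (%y. enn (K' * (ga - alf)) * (enn (ph y) * ind C y))) =
     enn (K' * (ga - alf)) * (lint (%y. enn (ph y) * ind C y))" using ag by (intro nn_integral_cmult) auto
    also have "(lint (%y. enn (ph y) * ind C y)) = emeasure ?N C" using ag by (subst emeasure_density) auto
    finally have "(lint (%y. enn (K' * (ga - alf)) * (enn (ph y) * ind C y))) =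
     enn (K' * (ga - alf)) * emeasure ?N C" .
    moreover have "enn (K' * (ga - alf)) = enn (ga - alf) * enn K'" using ag K'_gt by (subst ennreal_mult[symmetric]) (auto simp: mult.commute)
    ultimately show ?thesis by (simp only: mult.assoc)
   qed
   finally show ?thesis unfolding CC using ag by (subst (asm) ennreal_mult_le_mult_iff) (auto simp: ennreal_eq_0_iff)
  qed
  finally show ?thesis by (simp add: add_left_mono)
 qed
 have "enn (K1 * (real k + 1) * m) = (lint (%x. enn (K1 * (real k + 1)) * ind E x))" using E m0 mE K'_gt by (simp add: nn_integral_cmult_indicator ennreal_mult K1_def)
 also have "... <= (lint_on E (%x. Psi Q x))" using large by (intro nn_integral_mono) (auto simp: indicator_def)
 also have "... = (nn_integral (count_space Q) (%C. (lint_on E (%x. enn (stail C x powr r)))))" by (intro Psi_integral Q E) simp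
 also have "... <= (\<integral>\<^sup>+C. leb (C Int E) +
   enn K' * emeasure ?N (C Int {u<..<v}) \<partial>count_space Q)" by (intro nn_integral_mono each) simp
 also have "... = leb (\<Union>Q Int E) + enn K' * emeasure ?N (\<Union>Q Int {u<..<v})"
  using fam_sum_measure[OF Q, of lborel E] fam_sum_measure[OF Q, of "density lborel (%y. enn (ph y))" "{u<..<v}"] E by (simp add: nn_integral_add nn_integral_cmult)
 also have "... <= leb E + enn K' * emeasure ?N {u<..<v}" using E by (intro add_mono mult_left_mono emeasure_mono) auto
 also have "emeasure ?N {u<..<v} <= enn (2 * real k * m + (v - u) / 2 ^ k)"
 proof -
  have "emeasure ?N {u<..<v} = (lint_on {u<..<v} (%y. enn (ph y)))" by (subst emeasure_density) auto
  also have "... <= (lint (%y. (SUM i<k. enn (1 / 2 ^ i) * ind (L (Suc i)) y) + enn (1 / 2 ^ k) * ind {u<..<v} y))"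
  proof (rule nn_integral_mono)
   fix y
   have "enn (ph y) = (SUM i<k. enn (1 / 2 ^ i) * ind (L (Suc i)) y) + enn (1 / 2 ^ k)"
   proof -
    have "enn (ph y) = enn (SUM i<k. (1 / 2 ^ i) * ind (L (Suc i)) y) + enn (1 / 2 ^ k)" unfolding ph_def by (intro ennreal_plus sum_nonneg) auto
    also have "enn (SUM i<k. (1 / 2 ^ i) * ind (L (Suc i)) y) = (SUM i<k. enn ((1 / 2 ^ i) * ind (L (Suc i)) y))" by (intro sum_ennreal[symmetric]) auto
    also have "... = (SUM i<k. enn (1 / 2 ^ i) * ind (L (Suc i)) y)" by (intro sum.cong refl) (auto simp: indicator_def)
    finally show ?thesis .
   qed
   then show "enn (ph y) * ind {u<..<v} y <= (SUM i<k. enn (1 / 2 ^ i) * ind (L (Suc i)) y) + enn (1 / 2 ^ k) * ind {u<..<v} y" by (auto simp: indicator_def)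
  qed
  also have "... = (SUM i<k. enn (1 / 2 ^ i) * leb (L (Suc i))) + enn (1 / 2 ^ k) * enn (v - u)"
  proof -
   define g where "g i y = enn (1 / 2 ^ i) * ind (L (Suc i)) y" for i and y :: real
   have [measurable]: "g i : Borel" for i unfolding g_def[abs_def] by measurable
   have gi: "(lint (%y. g i y)) = enn (1 / 2 ^ i) * leb (L (Suc i))" for i unfolding g_def by (intro nn_integral_cmult_indicator) simp
   have "(lint (%y. (SUM i<k. g i y) + enn (1 / 2 ^ k) * ind {u<..<v} y)) =
    (SUM i<k. \<integral>\<^sup>+y. g i y \<partial>lborel) + (lint (%y. enn (1 / 2 ^ k) * ind {u<..<v} y))" by (subst nn_integral_add) (auto simp: nn_integral_sum)
   also have "(lint (%y. enn (1 / 2 ^ k) * ind {u<..<v} y)) = enn (1 / 2 ^ k) * enn (v - u)" using uv by (subst nn_integral_cmult_indicator) auto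
   finally show ?thesis unfolding gi unfolding g_def .
  qed
  also have "... <= (SUM i<k. enn (2 * m)) + enn ((v - u) / 2 ^ k)"
  proof (rule add_mono)
   show "(SUM i<k. enn (1 / 2 ^ i) * leb (L (Suc i))) <= (SUM i<k. enn (2 * m))"
   proof (rule sum_mono)
    fix i
    have "enn (1 / 2 ^ i) * leb (L (Suc i)) <= enn (1 / 2 ^ i) * (enn (2 ^ Suc i) * enn m)" using Lm[of "Suc i"] mE by (intro mult_left_mono) auto
    also have "... = enn (2 * m)" using m0 by (simp add: ennreal_mult[symmetric] del: ennreal_mult)
    finally show "enn (1 / 2 ^ i) * leb (L (Suc i)) <= enn (2 * m)" .
   qed
   show "enn (1 / 2 ^ k) * enn (v - u) <= enn ((v - u) / 2 ^ k)" using uv by (simp add: ennreal_mult[symmetric])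
  qed
  also have "... = enn (2 * real k * m + (v - u) / 2 ^ k)" using m0 uv by (simp add: ennreal_of_nat_eq_real_of_nat ennreal_mult[symmetric] ennreal_plus[symmetric] mult_ac del: ennreal_plus)
  finally show ?thesis .
 qed
 finally have "enn (K1 * (real k + 1) * m) <= enn m + enn K' * enn (2 * real k * m + (v - u) / 2 ^ k)" using mE by (simp add: mult_left_mono add_left_mono)
 also have "... = enn (m + K' * (2 * real k * m + (v - u) / 2 ^ k))" using m0 K'_gt uv by (simp add: ennreal_mult[symmetric] ennreal_plus[symmetric] del: ennreal_plus)
 finally have le: "K1 * (real k + 1) * m <= m + K' * (2 * real k * m + (v - u) / 2 ^ k)" using m0 K'_gt uv by (subst (asm) ennreal_le_iff) auto
 have "K' * m <= K' * ((v - u) / 2 ^ k)"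
 proof -
  have a: "0 <= real k * m" "0 <= K' * m" "0 <= K' * (real k * m)" using m0 K'_gt by auto
  have "K1 * (real k + 1) * m = 2 * (real k * m) + 2 * m + 4 * (K' * (real k * m)) + 4 * (K' * m)" unfolding K1_def by (simp add: algebra_simps)
  moreover have "m + K' * (2 * real k * m + (v - u) / 2 ^ k) = m + 2 * (K' * (real k * m)) + K' * ((v - u) / 2 ^ k)" by (simp add: algebra_simps)
  ultimately show ?thesis using le a m0 by linarith
 qed
 then have "m <= (v - u) / 2 ^ k" using K'_gt by (intro mult_left_le_imp_le[of K' m]) auto
 then show ?thesis using mE by (simp add: ennreal_leI)
qed

end

lemma ennreal_le_layers:
 assumes K: "0 < K" "0 <= s"
 shows "P <= enn s + (\<Sum>i. enn K * (if enn (s + K * real i) <= P then 1 else 0))"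
proof -
 let ?f = "%i. enn K * (if enn (s + K * real i) <= P then 1 else 0)"
 have m: "min P (enn (s + K * real N)) <= enn s + (SUM i<N. ?f i)" for N
 proof (induction N)
  case 0 show ?case by simp
 next
  case (Suc N)
  show ?case
  proof (cases "enn (s + K * real N) <= P")
   case True
   have "enn (s + K * real (Suc N)) = enn (s + K * real N) + enn K" using K by (simp add: ennreal_plus[symmetric] algebra_simps del: ennreal_plus)
   also have "enn (s + K * real N) <= enn s + (SUM i<N. ?f i)" using Suc True by (simp add: min_absorb2)
   finally show ?thesis using True by (simp add: min.coboundedI2 add.assoc)
  next
   case False
   then have "min P (enn (s + K * real N)) = P" by (metis min_absorb1 linear)
   then have "min P (enn (s + K * real (Suc N))) <= min P (enn (s + K * real N))" by (simp only: min.cobounded1)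
   also note Suc
   also have "enn s + (SUM i<N. ?f i) <= enn s + (SUM i<Suc N. ?f i)" by (intro add_left_mono sum_mono2) auto
   finally show ?thesis .
  qed
 qed
 have m': "min P (enn (s + K * real N)) <= enn s + (\<Sum>i. ?f i)" for N
 proof -
  have "(SUM i<N. ?f i) <= (\<Sum>i. ?f i)" by (rule sum_le_suminf[OF summableI]) auto
  then show ?thesis by (rule order_trans[OF m add_left_mono])
 qed
 have bound: "enn (s + K * real N) <= enn s + (\<Sum>i. ?f i)" if "P = \<infinity>" for N using m'[of N] that by simp
 show ?thesis
 proof (cases P)
  case (real p)
  then have Pp: "P = enn p" by simp
  obtain N where "p < real N * K" using K reals_Archimedean3 by blast
  then have "P <= enn (s + K * real N)" unfolding Pp using K by (intro ennreal_leI) (simp add: mult.commute)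
  then show ?thesis using m'[of N] by (simp add: min_absorb1)
 next
  case top
  have "enn s + (\<Sum>i. ?f i) = \<infinity>"
  proof (rule ccontr)
   assume "enn s + (\<Sum>i. ?f i) ~= \<infinity>"
   then obtain z where z: "enn s + (\<Sum>i. ?f i) = enn z" "0 <= z" by (cases "enn s + (\<Sum>i. ?f i)") (auto simp del: ennreal_plus)
   obtain N where N: "z < real N * K" using K reals_Archimedean3 by blast
   have "enn (s + K * real N) <= enn z" using bound[of N] top z by simp
   then have "s + K * real N <= z" using z by (simp add: ennreal_le_iff)
   then show False using N K by (simp add: mult.commute)
  qed
  then show ?thesis by simp
 qed
qed

lemma fam_indicator_sum:
 assumes Q: "fam Q"
 shows "(nn_integral (count_space Q) (%C. ind C x)) <= 1"
proof (cases "EX C:Q. x : C")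
 case True
 then obtain C0 where C0: "C0 : Q" "x : C0" by blast
 have "(nn_integral (count_space Q) (%C. ind C x)) = (nn_integral (count_space Q) (%C. ind {C0} C))"
 proof (rule nn_integral_cong)
  fix C assume "C : space (count_space Q)"
  then have "C : Q" by simp
  then have "x : C \<longleftrightarrow> C = C0" using C0 Q unfolding fam_def disjoint_def by blast
  then show "ind C x = (ind {C0} C :: ennreal)" by (auto simp: indicator_def)
 qed
 also have "... = 1" using C0 by simp
 finally show ?thesis by simp
next
 case False
 then have "(nn_integral (count_space Q) (%C. ind C x)) = (nn_integral (count_space Q) (%C. 0))" by (intro nn_integral_cong) (auto simp: indicator_def)
 then show ?thesis by simp
qed

context one_sided_weight
begin

lemma AE_pieces:
 assumes ac: "a < c"
 shows "AE x in M. ind {a<..<c} x <= (\<Sum>n. ind {pt a c n<..<pt a c (Suc n)} x :: ennreal)"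
proof -
 have "AE x in M. ALL n. x ~= pt a c n" unfolding AE_all_countable by (intro allI AE_neq)
 then show ?thesis
 proof eventually_elim
  fix x assume x: "ALL n. x ~= pt a c n"
  let ?f = "%n. ind {pt a c n<..<pt a c (Suc n)} x :: ennreal"
  show "ind {a<..<c} x <= (\<Sum>n. ?f n)"
  proof (cases "x : {a<..<c}")
   case True
   then obtain n where "pt a c n <= x" "x < pt a c (Suc n)" using pt_cover[of a x c] by force
   then have "?f n = 1" using x by (auto simp: indicator_def less_le)
   moreover have "sum ?f {n} <= (\<Sum>n. ?f n)" by (intro sum_le_suminf) auto
   ultimately show ?thesis using True by (simp add: indicator_def)
  qed simp
 qed
qed

lemma pieces_disjoint_sum:
 assumes ac: "a < c"
 shows "(\<Sum>n. emeasure M {pt a c n<..<pt a c (Suc n)}) <= emeasure M {a<..<c}"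
proof -
 have mono: "pt a c i <= pt a c j" if "i <= j" for i j by (rule lift_Suc_mono_le[of "pt a c", OF less_imp_le[OF pt_mono[OF ac]] that])
 have "disjoint_family (%n. {pt a c n<..<pt a c (Suc n)})" unfolding disjoint_family_on_def
 proof (intro ballI impI)
  fix i j :: nat assume "i ~= j"
  then consider "Suc i <= j" | "Suc j <= i" by linarith
  then show "{pt a c i<..<pt a c (Suc i)} Int {pt a c j<..<pt a c (Suc j)} = {}" by cases (use mono[of "Suc i" j] mono[of "Suc j" i] in auto)
 qed
 then have "(\<Sum>n. emeasure M {pt a c n<..<pt a c (Suc n)}) = emeasure M (\<Union>n. {pt a c n<..<pt a c (Suc n)})" by (intro suminf_emeasure) auto
 also have "... <= emeasure M {a<..<c}"
 proof (intro emeasure_mono)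
  show "(\<Union>n. {pt a c n<..<pt a c (Suc n)}) <= {a<..<c}" using pt_ge[OF ac] pt_less[OF ac] by (force intro: le_less_trans less_trans)
 qed simp
 finally show ?thesis .
qed

text \<open>Intervals that reach beyond the next piece contribute a bounded amount only, being disjoint and
 comparable in length to their distance.\<close>

lemma near_far:
 assumes ac: "a < c" and Q: "fam Q" and sub: "\<Union>Q <= {a<..<c}"
  and x: "x : {pt a c n<..<pt a c (Suc n)}"
 shows "Psi Q x <= Psi {C : Q. Sup C <= pt a c (n + 2)} x + 5"
proof -
 let ?Q = "{C : Q. Sup C <= pt a c (n + 2)}"
 let ?K = "4 * 2 ^ n / (c - a)"
 have xc: "x < c" using x pt_less[OF ac, of "Suc n"] by auto
 have K: "0 <= ?K" using ac by simp
 have "Psi Q x <= (nn_integral (count_space Q) (%C. enn (stail C x powr r) * ind ?Q C + (ind C x + enn ?K * leb (C Int {x<..<c}))))" unfolding Psi_def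
 proof (rule nn_integral_mono)
  fix C assume "C : space (count_space Q)"
  then have C: "C : Q" by simp
  obtain alf ga where ag: "alf < ga" "C = {alf<..<ga}" using famE[OF Q C] .
  have b: "a <= alf" "ga <= c"
  proof -
   have "{alf<..<ga} <= {a<..<c}" using sub C ag by auto
   then show "a <= alf" "ga <= c" using ag by (auto simp: greaterThanLessThan_subseteq_greaterThanLessThan)
  qed
  have p1: "stail C x powr r <= stail C x"
  proof -
   have t0: "0 <= stail C x" using ag by (simp add: tail_nonneg)
   have "stail C x powr r <= stail C x powr 1" using r t0 ag by (intro powr_mono') (auto simp: tail_le_1)
   then show ?thesis using t0 by simp
  qed
  show "enn (stail C x powr r) <= enn (stail C x powr r) * ind ?Q C + (ind C x + enn ?K * leb (C Int {x<..<c}))"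
  proof (cases "C : ?Q")
   case True then show ?thesis by simp
  next
   case False
   then have g: "pt a c (n + 2) < ga" using C ag by simp
   have gx: "(c - a) / (4 * 2 ^ n) <= ga - x"
   proof -
    have "pt a c (n + 2) - pt a c (Suc n) = (c - a) / (4 * 2 ^ n)" by (simp add: pt_def field_simps)
    then show ?thesis using g x by auto
   qed
   have dpos: "0 < (c - a) / (4 * 2 ^ n)" using ac by simp
   have "enn (stail C x powr r) <= ind C x + enn ?K * leb (C Int {x<..<c})"
   proof (cases "x : C")
    case True
    have "enn (stail C x powr r) <= enn 1" using p1 tail_le_1[of alf ga x] ag by (intro ennreal_leI) simp
    then show ?thesis using True by (simp add: add_increasing2)
   next
    case False
    then have xa: "x <= alf" using ag gx dpos by auto
    have "stail C x = (ga - alf) / (ga - x)" using xa ag by (simp add: tail_left)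
    also have "... <= (ga - alf) / ((c - a) / (4 * 2 ^ n))" using gx ag dpos by (intro divide_left_mono mult_pos_pos) auto
    also have "... = ?K * (ga - alf)" by simp
    finally have "enn (stail C x powr r) <= enn (?K * (ga - alf))" using p1 by (intro ennreal_leI) simp
    also have "... = enn ?K * enn (ga - alf)" using K ag by (intro ennreal_mult) auto
    also have "enn (ga - alf) = leb (C Int {x<..<c})"
    proof -
     have "C Int {x<..<c} = C" using ag xa b by auto
     then show ?thesis using ag by simp
    qed
    finally show ?thesis by (simp add: add_increasing)
   qed
   then show ?thesis by (simp add: add_increasing)
  qed
 qed
 also have "... = (nn_integral (count_space Q) (%C. enn (stail C x powr r) * ind ?Q C)) +
   ((nn_integral (count_space Q) (%C. ind C x)) + enn ?K * (nn_integral (count_space Q) (%C. leb (C Int {x<..<c}))))" by (simp add: nn_integral_add nn_integral_cmult)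
 also have "(nn_integral (count_space Q) (%C. enn (stail C x powr r) * ind ?Q C)) = Psi ?Q x" unfolding Psi_def
  by (subst (1 2) nn_integral_count_space_indicator) (auto intro!: nn_integral_cong simp: indicator_def)
 also have "(nn_integral (count_space Q) (%C. leb (C Int {x<..<c}))) = leb (\<Union>Q Int {x<..<c})" by (intro fam_sum_measure Q) auto
 also have "(nn_integral (count_space Q) (%C. ind C x)) + enn ?K * leb (\<Union>Q Int {x<..<c}) <= 1 + enn 4"
 proof (intro add_mono fam_indicator_sum Q)
  have "enn ?K * leb (\<Union>Q Int {x<..<c}) <= enn ?K * leb {x<..<c}" by (intro mult_left_mono emeasure_mono) auto
  also have "... = enn ?K * enn (c - x)" using xc by simp
  also have "... = enn (?K * (c - x))" using xc K by (intro ennreal_mult[symmetric]) auto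
  also have "... <= enn 4"
  proof (rule ennreal_leI)
   have "c - x <= (c - a) / 2 ^ n" using x pt_diff[of c a n] by auto
   then have "?K * (c - x) <= ?K * ((c - a) / 2 ^ n)" using K by (rule mult_left_mono)
   also have "... = 4" using ac by simp
   finally show "?K * (c - x) <= 4" .
  qed
  finally show "enn ?K * leb (\<Union>Q Int {x<..<c}) <= enn 4" .
 qed
 finally show ?thesis by (simp add: add_left_mono)
qed

definition q where "q = (1 / 2) powr e0"

lemma half_pow_powr: "(1 / 2 ^ n) powr e0 = q ^ n"
proof (induction n)
 case (Suc n)
 have "(1 / 2 ^ Suc n :: real) = 1 / 2 * (1 / 2 ^ n)" by simp
 then have "(1 / 2 ^ Suc n :: real) powr e0 = (1 / 2) powr e0 * (1 / 2 ^ n) powr e0" by (simp only: powr_mult)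
 then show ?case using Suc by (simp add: q_def)
qed simp

lemma q: "0 < q" "q < 1"
proof -
 show "0 < q" by (simp add: q_def)
 have "(1 / 2 :: real) powr e0 < 1 powr e0" using e0 by (intro powr_less_mono2) auto
 then show "q < 1" by (simp add: q_def)
qed

definition K2 where "K2 = 8 * K1 * C0 * 4 powr e0 / (1 - q)"

lemma K1_pos: "0 < K1" using K'_gt by (simp add: K1_def)

lemma K2_nonneg: "0 <= K2" using K1_pos C0 q by (simp add: K2_def)

text \<open>On every piece the level sets of \<open>Psi\<close> are exponentially thin, and the weight condition turns this into
 a geometric series with ratio \<open>q\<close>.\<close>

lemma inside_sum:
 assumes ac: "a < c" and Q: "fam Q" and sub: "\<Union>Q <= {a<..<c}"
 shows "(\<integral>\<^sup>+x\<in>{a<..<c}. Psi Q x \<partial>M) <=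
  enn (K1 * (real k + 1) + 5) * emeasure M {a<..<c} + enn (K2 * q ^ k) * W a c"
proof -
 let ?J = "%n. {pt a c n<..<pt a c (Suc n)}"
 let ?Q = "%n. {C : Q. Sup C <= pt a c (n + 2)}"
 have fQ: "fam (?Q n)" for n by (rule fam_subset[OF Q]) auto
 note [measurable] = Psi_measurable[OF fQ] Psi_measurable[OF Q]
 define E where "E n i = {x : ?J n. enn (K1 * (real (k + i) + 1)) <= Psi (?Q n) x}" for n i
 have [measurable]: "E n i : sets borel" for n i
 proof -
  have "E n i = ?J n Int (Psi (?Q n) -` {enn (K1 * (real (k + i) + 1))..} Int space borel)" by (auto simp: E_def)
  moreover have "... : sets borel" by (rule sets.Int[OF _ measurable_sets[OF Psi_measurable[OF fQ[of n]]]]) simp_all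
  ultimately show ?thesis by (simp only:)
 qed
 have small: "emeasure M (E n i) <= enn (C0 * 4 powr e0 * q ^ (k + i)) * W (pt a c n) (pt a c (n + 2))" for n i
 proof -
  have le: "pt a c n < pt a c (n + 2)" using pt_mono[OF ac, of n] pt_mono[OF ac, of "Suc n"] by simp
  have "leb (E n i) <= enn ((pt a c (n + 2) - pt a c n) / 2 ^ (k + i))"
  proof (rule exp_tail[OF fQ[of n] le])
   show "E n i <= {pt a c n<..<pt a c (n + 2)}" using pt_mono[OF ac, of "Suc n"] by (auto simp: E_def)
   show "E n i : sets borel" by measurable
   show "Sup C <= pt a c (n + 2)" if "C : ?Q n" for C using that by simp
   show "enn (K1 * (real (k + i) + 1)) <= Psi (?Q n) x" if "x : E n i" for x using that by (simp only: E_def mem_Collect_eq)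
  qed
  also have "... <= enn (1 / 2 ^ (k + i) * (c - a) / 2 ^ n)"
  proof (rule ennreal_leI)
   have "pt a c (n + 2) - pt a c n <= (c - a) / 2 ^ n" using pt_less[OF ac, of "n + 2"] pt_diff[of c a n] by linarith
   then have "(pt a c (n + 2) - pt a c n) / 2 ^ (k + i) <= (c - a) / 2 ^ n / 2 ^ (k + i)" by (rule divide_right_mono) simp
   then show "(pt a c (n + 2) - pt a c n) / 2 ^ (k + i) <= 1 / 2 ^ (k + i) * (c - a) / 2 ^ n" by (simp add: mult_ac)
  qed
  finally have es: "leb (E n i) <= enn (1 / 2 ^ (k + i) * (c - a) / 2 ^ n)" .
  have Eb: "E n i : sets borel" by measurable
  have "E n i <= ?J n" by (auto simp: E_def)
  then have "emeasure M (E n i) <= enn (C0 * (4 * (1 / 2 ^ (k + i))) powr e0) * W (pt a c n) (pt a c (n + 2))" by (rule piece_small[OF ac Eb _ es]) simp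
  also have "(4 * (1 / 2 ^ (k + i))) powr e0 = 4 powr e0 * q ^ (k + i)"
  proof -
   show ?thesis by (simp only: powr_mult half_pow_powr)
  qed
  finally show ?thesis by (simp add: mult.assoc)
 qed
 have piece: "(\<integral>\<^sup>+x\<in>?J n. Psi Q x \<partial>M) <= enn (K1 * (real k + 1) + 5) * emeasure M (?J n) +
   enn (K2 * q ^ k / 8) * W (pt a c n) (pt a c (n + 2))" for n
 proof -
  have "(\<integral>\<^sup>+x\<in>?J n. Psi Q x \<partial>M) <= (nn_integral M (%x. enn (K1 * (real k + 1) + 5) * ind (?J n) x + (\<Sum>i. enn K1 * ind (E n i) x)))"
  proof (rule nn_integral_mono)
   fix x
   show "Psi Q x * ind (?J n) x <= enn (K1 * (real k + 1) + 5) * ind (?J n) x + (\<Sum>i. enn K1 * ind (E n i) x)"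
   proof (cases "x : ?J n")
    case True
    have "Psi Q x <= Psi (?Q n) x + 5" by (rule near_far[OF ac Q sub True])
    also have "Psi (?Q n) x <= enn (K1 * (real k + 1)) +
      (\<Sum>i. enn K1 * (if enn (K1 * (real k + 1) + K1 * real i) <= Psi (?Q n) x then 1 else 0))" using K1_pos by (intro ennreal_le_layers) auto
    also have "(%i. enn K1 * (if enn (K1 * (real k + 1) + K1 * real i) <= Psi (?Q n) x then 1 else 0)) = (%i. enn K1 * ind (E n i) x)"
     using True by (intro ext) (auto simp: E_def indicator_def algebra_simps)
    finally have "Psi Q x <= enn (K1 * (real k + 1)) + (\<Sum>i. enn K1 * ind (E n i) x) + 5" by (simp add: add_right_mono)
    then show ?thesis using True K1_pos by (simp add: ennreal_plus add_ac)
   qed simp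
  qed
  also have "... = enn (K1 * (real k + 1) + 5) * emeasure M (?J n) + (\<Sum>i. enn K1 * emeasure M (E n i))"
  proof -
   have "(nn_integral M (%x. (\<Sum>i. enn K1 * ind (E n i) x))) = (\<Sum>i. \<integral>\<^sup>+x. enn K1 * ind (E n i) x \<partial>M)" by (rule nn_integral_suminf) measurable
   also have "... = (\<Sum>i. enn K1 * emeasure M (E n i))" by (intro suminf_cong nn_integral_cmult_indicator) simp
   finally show ?thesis by (subst nn_integral_add) (auto simp: nn_integral_cmult_indicator)
  qed
  also have "(\<Sum>i. enn K1 * emeasure M (E n i)) <= (\<Sum>i. enn (K1 * C0 * 4 powr e0 * q ^ k * q ^ i) * W (pt a c n) (pt a c (n + 2)))"
  proof (rule suminf_le[OF _ summableI summableI])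
   fix i
   have "enn K1 * emeasure M (E n i) <= enn K1 * (enn (C0 * 4 powr e0 * q ^ (k + i)) * W (pt a c n) (pt a c (n + 2)))" by (intro mult_left_mono small) simp
   also have "... = enn (K1 * (C0 * 4 powr e0 * q ^ (k + i))) * W (pt a c n) (pt a c (n + 2))" using K1_pos C0 q by (simp add: ennreal_mult mult.assoc)
   finally show "enn K1 * emeasure M (E n i) <= enn (K1 * C0 * 4 powr e0 * q ^ k * q ^ i) * W (pt a c n) (pt a c (n + 2))" by (simp add: power_add mult_ac)
  qed
  also have "... = (\<Sum>i. enn (K1 * C0 * 4 powr e0 * q ^ k * q ^ i)) * W (pt a c n) (pt a c (n + 2))" by (rule ennreal_suminf_multc)
  also have "(\<Sum>i. enn (K1 * C0 * 4 powr e0 * q ^ k * q ^ i)) = enn (K1 * C0 * 4 powr e0 * q ^ k * (1 / (1 - q)))"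
   using K1_pos C0 q by (intro suminf_ennreal_eq sums_mult geometric_sums) auto
  also have "K1 * C0 * 4 powr e0 * q ^ k * (1 / (1 - q)) = K2 * q ^ k / 8" using q by (simp add: K2_def divide_simps)
  finally show ?thesis by (simp add: add_left_mono)
 qed
 have "(\<integral>\<^sup>+x\<in>{a<..<c}. Psi Q x \<partial>M) <= (nn_integral M (%x. (\<Sum>n. Psi Q x * ind (?J n) x)))"
  using AE_pieces[OF ac] by (intro nn_integral_mono_AE) (auto elim!: eventually_mono intro!: mult_left_mono)
 also have "... = (\<Sum>n. \<integral>\<^sup>+x\<in>?J n. Psi Q x \<partial>M)" by (intro nn_integral_suminf) measurable
 also have "... <= (\<Sum>n. enn (K1 * (real k + 1) + 5) * emeasure M (?J n) +
   enn (K2 * q ^ k / 8) * W (pt a c n) (pt a c (n + 2)))" by (rule suminf_le[OF piece summableI summableI])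
 also have "... = enn (K1 * (real k + 1) + 5) * (\<Sum>n. emeasure M (?J n)) + enn (K2 * q ^ k / 8) * (\<Sum>n. W (pt a c n) (pt a c (n + 2)))"
  by (subst suminf_add[symmetric]) (auto intro: summableI)
 also have "... <= enn (K1 * (real k + 1) + 5) * emeasure M {a<..<c} + enn (K2 * q ^ k / 8) * (8 * W a c)" by (intro add_mono mult_left_mono pieces_disjoint_sum W_pieces ac) auto
 also have "enn (K2 * q ^ k / 8) * (8 * W a c) = enn (K2 * q ^ k) * W a c"
 proof -
  have "enn (K2 * q ^ k / 8) * 8 = enn (K2 * q ^ k / 8) * enn 8" by simp
  also have "... = enn (K2 * q ^ k)" using K2_nonneg q by (subst ennreal_mult[symmetric]) auto
  finally show ?thesis by (simp add: mult.assoc[symmetric])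
 qed
 finally show ?thesis .
qed

definition K3 where "K3 = 2 + 4 * C0 * 3 powr r / (1 - q)"

lemma K3_ge: "2 <= K3" using C0 q by (simp add: K3_def)

lemma outside_integral:
 assumes Q: "fam Q" and sub: "\<Union>Q <= {a<..<c}" and ac: "a < c" and h: "0 <= h"
  and thin: "!!D. 0 < D ==> D <= c - a ==> leb (\<Union>Q Int {a<..<a + D}) <= enn (h * D)"
 shows "(\<integral>\<^sup>+x\<in>{..<a}. Psi Q x \<partial>M) <= enn (K3 * h powr r) * W a c"
proof -
 define L where "L = c - a"
 have L: "0 < L" using ac by (simp add: L_def)
 let ?S = "%x. \<integral>\<^sup>+C. enn (stail C x) \<partial>count_space Q"
 let ?I = "%n. {a - L / 2 ^ n<..<a}"
 have tot: "leb (\<Union>Q) <= enn (h * (c - a))"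
 proof -
  have "\<Union>Q Int {a<..<a + (c - a)} = \<Union>Q" using sub by auto
  then show ?thesis using thin[of "c - a"] ac by simp
 qed
 have Psi_S: "Psi Q x <= enn ((h * tail a c x) powr (r - 1)) * ?S x" if x: "x < a" for x
 proof -
  have "Psi Q x <= (nn_integral (count_space Q) (%C. enn ((h * tail a c x) powr (r - 1)) * enn (stail C x)))" unfolding Psi_def
  proof (rule nn_integral_mono)
   fix C assume "C : space (count_space Q)"
   then have C: "C : Q" by simp
   have t0: "0 <= stail C x" using famE[OF Q C] by (metis less_imp_le stail_Ioo tail_nonneg)
   have "stail C x powr r = stail C x powr (r - 1) * stail C x" by (rule powr_split1[OF t0])
   also have "... <= (h * tail a c x) powr (r - 1) * stail C x" using outside_single[OF Q sub ac h thin x C] t0 r by (intro mult_right_mono powr_mono2) auto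
   finally show "enn (stail C x powr r) <= enn ((h * tail a c x) powr (r - 1)) * enn (stail C x)" using t0 by (simp add: ennreal_mult[symmetric] ennreal_leI)
  qed
  then show ?thesis by (simp add: nn_integral_cmult)
 qed
 have pw: "Psi Q x <= enn (2 * h powr r) * enn (tail a c x powr r) + enn (4 * h powr r) * (\<Sum>n. ind (?I n) x)"
  if x: "x < a" for x
 proof (cases "x <= 2 * a - c")
  case True
  let ?t = "h * tail a c x"
  have t: "0 <= ?t" using h ac by (simp add: tail_nonneg)
  have "Psi Q x <= enn (?t powr (r - 1)) * enn (2 * h * tail a c x)" using Psi_S[OF x] outside_sum_far[OF Q sub ac h tot True] by (meson mult_left_mono order_trans zero_le)
  also have "... = enn (2 * (?t powr (r - 1) * ?t))" using t by (simp add: ennreal_mult[symmetric] mult_ac)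
  also have "... = enn (2 * ?t powr r)" by (simp only: powr_split1[OF t, symmetric])
  also have "... = enn (2 * h powr r) * enn (tail a c x powr r)" by (simp add: ennreal_mult[symmetric] powr_mult)
  finally show ?thesis by (simp add: add_increasing2)
 next
  case False
  then have xL: "a - x < L" by (simp add: L_def)
  obtain m where "L / (a - x) < 2 ^ m" using real_arch_pow[of 2 "L / (a - x)"] by auto
  then have m: "L / 2 ^ m <= a - x" using x by (simp add: field_simps)
  define n where "n = (LEAST m. L / 2 ^ m <= a - x)"
  have n: "L / 2 ^ n <= a - x" unfolding n_def by (rule LeastI[of _ m]) (rule m)
  have nl: "a - x < L / 2 ^ k" if "k < n" for k using not_less_Least[of k "%m. L / 2 ^ m <= a - x"] that by (simp add: n_def)
  have "n ~= 0" using n xL by (cases n) auto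
  have t1: "h * tail a c x <= h" "0 <= h * tail a c x" using h tail_le_1[of a c x] tail_nonneg[of a c x] ac mult_left_mono[of "tail a c x" 1 h] by auto
  have "Psi Q x <= enn ((h * tail a c x) powr (r - 1)) * enn (2 * h * (n + 1))"
  proof (rule order_trans[OF Psi_S[OF x]], rule mult_left_mono)
   show "?S x <= enn (2 * h * (n + 1))" using outside_sum[OF Q sub ac h thin x, of n] n by (simp add: L_def)
  qed simp
  also have "... <= enn (h powr (r - 1)) * enn (2 * h * (n + 1))" using t1 r by (intro mult_right_mono ennreal_leI powr_mono2) auto
  also have "... <= enn (h powr (r - 1)) * enn (4 * h * n)"
   proof (intro mult_left_mono ennreal_leI)
   have "2 * h * (1 + real n) <= 2 * h * (2 * real n)" using \<open>n ~= 0\<close> h by (intro mult_left_mono) auto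
   then show "2 * h * real (n + 1) <= 4 * h * real n" by (simp add: algebra_simps)
  qed simp
  also have "... = enn (4 * (h powr (r - 1) * h)) * enn (real n)" using h by (simp add: ennreal_mult[symmetric] mult_ac)
  also have "... = enn (4 * h powr r) * enn (real n)" by (simp only: powr_split1[OF h, symmetric])
  also have "enn (real n) = (SUM k<n. ind (?I k) x)"
  proof -
   have "ind (?I k) x = (1 :: ennreal)" if "k < n" for k using nl[OF that] x by (simp add: indicator_def algebra_simps)
   then show ?thesis by (simp add: ennreal_of_nat_eq_real_of_nat)
  qed
  also have "... <= (\<Sum>k. ind (?I k) x)" by (intro sum_le_suminf) auto
  finally have "Psi Q x <= enn (4 * h powr r) * (\<Sum>k. ind (?I k) x)" by (simp add: mult_left_mono)
  then show ?thesis by (simp add: add_increasing)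
 qed
 have sh: "emeasure M (?I n) <= enn (C0 * 3 powr r * q ^ n) * W a c" for n
 proof -
  have qn: "(1 / 2 ^ n :: real) powr e0 = q ^ n" by (rule half_pow_powr)
  have "emeasure M (?I n) <= enn (C0 * (1 / 2 ^ n) powr e0) * W (a - 2 * L) c"
  proof (rule Cplus')
   have "L / 2 ^ n <= L / 1" using L by (intro divide_left_mono) auto
   then show "?I n <= {a - 2 * L<..<a}" using L by auto
  qed (use L in \<open>auto simp: L_def\<close>)
  also have "... <= enn (C0 * (1 / 2 ^ n) powr e0) * (enn (3 powr r) * W a c)"
  proof (rule mult_left_mono)
   have "(c - (a - 2 * L)) / (c - a) = 3" using ac by (simp add: L_def field_simps)
   then show "W (a - 2 * L) c <= enn (3 powr r) * W a c" using W_extend[of "a - 2 * L" a c] L ac by simp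
  qed simp
  also have "... = (enn (C0 * q ^ n) * enn (3 powr r)) * W a c" by (simp only: qn mult.assoc)
  also have "enn (C0 * q ^ n) * enn (3 powr r) = enn (C0 * 3 powr r * q ^ n)" using C0 q by (subst ennreal_mult[symmetric]) (auto simp: mult_ac)
  finally show ?thesis .
 qed
 have "(\<integral>\<^sup>+x\<in>{..<a}. Psi Q x \<partial>M) <= (nn_integral M (%x. enn (2 * h powr r) * enn (tail a c x powr r) + enn (4 * h powr r) * (\<Sum>n. ind (?I n) x)))"
  using pw by (intro nn_integral_mono) (auto simp: indicator_def)
 also have "... = enn (2 * h powr r) * W a c + enn (4 * h powr r) * (\<Sum>n. emeasure M (?I n))" unfolding W_def by (simp add: nn_integral_add nn_integral_cmult nn_integral_suminf)
 also have "(\<Sum>n. emeasure M (?I n)) <= (\<Sum>n. enn (C0 * 3 powr r * q ^ n) * W a c)" by (rule suminf_le[OF sh summableI summableI])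
 also have "... = (\<Sum>n. enn (C0 * 3 powr r * q ^ n)) * W a c" by (rule ennreal_suminf_multc)
 also have "(\<Sum>n. enn (C0 * 3 powr r * q ^ n)) = enn (C0 * 3 powr r * (1 / (1 - q)))" using C0 q by (intro suminf_ennreal_eq sums_mult geometric_sums) auto
 also have "enn (2 * h powr r) * W a c + enn (4 * h powr r) * (enn (C0 * 3 powr r * (1 / (1 - q))) * W a c)
   = enn (K3 * h powr r) * W a c"
 proof -
  have "enn (4 * h powr r) * enn (C0 * 3 powr r * (1 / (1 - q))) = enn (4 * h powr r * (C0 * 3 powr r * (1 / (1 - q))))" using C0 q by (intro ennreal_mult[symmetric]) auto
  moreover have "enn (2 * h powr r) + enn (4 * h powr r * (C0 * 3 powr r * (1 / (1 - q)))) = enn (K3 * h powr r)"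
   using C0 q by (subst ennreal_plus[symmetric]) (auto simp: K3_def algebra_simps)
  ultimately show ?thesis by (simp add: mult.assoc[symmetric] distrib_right[symmetric])
 qed
 finally show ?thesis by (simp add: mult_left_mono add_left_mono)
qed

lemma sum_WC_le:
 assumes Q: "fam Q" and sub: "\<Union>Q <= {a<..<c}" and ac: "a < c" and h: "0 <= h"
  and thin: "!!D. 0 < D ==> D <= c - a ==> leb (\<Union>Q Int {a<..<a + D}) <= enn (h * D)"
 shows "(nn_integral (count_space Q) (%C. WC C)) <=
  enn (K3 * h powr r + K2 * q ^ k) * W a c + enn (K1 * (real k + 1) + 5) * emeasure M {a<..<c}"
proof -
 have zero: "Psi Q x = 0" if "c <= x" for x
 proof -
  have "stail C x = 0" if C: "C : Q" for C
  proof -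
   obtain alf ga where ag: "alf < ga" "C = {alf<..<ga}" using famE[OF Q C] .
   have "{alf<..<ga} <= {a<..<c}" using sub C ag by auto
   then have "ga <= c" using ag by (auto simp: greaterThanLessThan_subseteq_greaterThanLessThan)
   then show ?thesis using ag \<open>c <= x\<close> by (simp add: tail_right)
  qed
  then have "Psi Q x = (nn_integral (count_space Q) (%C. 0))" unfolding Psi_def by (intro nn_integral_cong) simp
  then show ?thesis by simp
 qed
 note [measurable] = Psi_measurable[OF Q]
 have "(nn_integral (count_space Q) (%C. WC C)) = (nn_integral M (%x. Psi Q x))" by (rule sum_WC[OF Q])
 also have "... <= (nn_integral M (%x. Psi Q x * ind {..<a} x + Psi Q x * ind {a<..<c} x))"
  using AE_neq[of a] by (intro nn_integral_mono_AE, eventually_elim) (auto simp: indicator_def zero not_less)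
 also have "... = (\<integral>\<^sup>+x\<in>{..<a}. Psi Q x \<partial>M) + (\<integral>\<^sup>+x\<in>{a<..<c}. Psi Q x \<partial>M)" by (intro nn_integral_add) measurable
 also have "... <= enn (K3 * h powr r) * W a c + (enn (K1 * (real k + 1) + 5) * emeasure M {a<..<c} + enn (K2 * q ^ k) * W a c)" by (intro add_mono outside_integral inside_sum assms)
 also have "... = enn (K3 * h powr r + K2 * q ^ k) * W a c + enn (K1 * (real k + 1) + 5) * emeasure M {a<..<c}"
  using K3_ge K2_nonneg q by (subst ennreal_plus) (auto simp: distrib_right add_ac)
 finally show ?thesis .
qed

end

section \<open>Comparison of families of level sets\<close>

abbreviation isum :: "(int => ennreal) => ennreal" where
 "isum F \<equiv> (nn_integral (count_space UNIV) (%j. F j))"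

lemma isum_shift: "isum (%j. F (j + i)) = isum F" by (rule nn_integral_bij_count_space[of "%j. j + i"]) (rule bij_betwI[of _ _ _ "%j. j - i"], auto)

lemma isum_geometric_finite:
 assumes t: "0 < t" and B: "B < \<infinity>"
 shows "isum (%j. B * enn (2 powr (t * of_int j)) * ind {..0} j) < \<infinity>"
proof -
 let ?q = "2 powr (- t)"
 have q: "0 <= ?q" "?q < 1" using t powr_less_mono[of "-t" 0 2] by auto
 have bij: "bij_betw (%n. - int n) UNIV {..0}" by (rule bij_betwI[of _ _ _ "%j. nat (- j)"]) auto
 have "isum (%j. B * enn (2 powr (t * of_int j)) * ind {..0} j)
   = (\<integral>\<^sup>+j. B * enn (2 powr (t * of_int j)) \<partial>count_space {..0::int})" by (subst (2) nn_integral_count_space_indicator) auto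
 also have "... = (nn_integral (count_space (UNIV :: nat set)) (%n. B * enn (2 powr (t * of_int (- int n)))))" by (rule nn_integral_bij_count_space[OF bij, symmetric])
 also have "... = (\<Sum>n. B * enn (?q ^ n))"
 proof -
  have "2 powr (t * of_int (- int n)) = ?q ^ n" for n
  proof -
   have "?q ^ n = ?q powr real n" by (simp add: powr_realpow)
   then show ?thesis by (simp add: powr_powr)
  qed
  then show ?thesis by (simp add: nn_integral_count_space_nat)
 qed
 also have "... = B * (\<Sum>n. enn (?q ^ n))" by simp
 also have "(\<Sum>n. enn (?q ^ n)) = enn (1 / (1 - ?q))" using q by (intro suminf_ennreal_eq geometric_sums) auto
 also have "B * enn (1 / (1 - ?q)) < \<infinity>" using B by (simp add: ennreal_mult_less_top)
 finally show ?thesis .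
qed

text \<open>Summation over \<open>j\<close> absorbs the first two terms if the sum is finite. The growth bound makes a sum damped at
 \<open>- \<infinity>\<close> finite, and the damping is removed afterwards.\<close>

lemma absorb_recursion:
 fixes F R :: "int => ennreal" and N :: nat
 assumes N: "0 < N"
  and rec: "!!j. F j <= enn (1/8) * F (j - int N) + enn (1/8) * F (j - 2 * int N) + R j"
  and growth: "!!t. 0 < t ==> EX B<\<infinity>. ALL j<=0. F j <= B * enn (2 powr (- t * of_int j))"
  and fin: "!!j. F j < \<infinity>"
 shows "isum F <= 2 * isum R"
proof -
 define t where "t = 1 / (2 * real N)"
 have t: "0 < t" using N by (simp add: t_def)
 have key: "isum (%j. F j * ind {j1..J} j) <= 2 * isum R" for j1 J :: int
 proof -
  define rho where "rho j = min 1 (2 powr (t * of_int (j - j1)))" for j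
  have rho0: "0 <= rho j" for j by (simp add: rho_def)
  have rho_step: "rho j <= 2 * rho (j - i)" if "0 <= i" "i <= 2 * int N" for i j
  proof -
   have ti: "t * of_int i <= 1" 
   proof -
    have "of_int i <= 2 * real N" using that by linarith
    then show ?thesis using N by (simp add: t_def field_simps)
   qed
   have "2 powr (t * of_int (j - j1)) = 2 powr (t * of_int i) * 2 powr (t * of_int (j - i - j1))" by (simp add: powr_add[symmetric] algebra_simps)
   also have "... <= 2 powr 1 * 2 powr (t * of_int (j - i - j1))" using ti by (intro mult_right_mono powr_mono) auto
   finally have "2 powr (t * of_int (j - j1)) <= 2 * 2 powr (t * of_int (j - i - j1))" by simp
   then show ?thesis unfolding rho_def by (auto simp: min_def)
  qed
  define G where "G j = enn (rho j) * F j * ind {..J} j" for j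
  have Gstep: "G j <= enn (1/4) * G (j - int N) + enn (1/4) * G (j - 2 * int N) + R j" for j
  proof (cases "j <= J")
   case True
   have s: "enn (rho j) * (enn (1/8) * F (j - i)) <= enn (1/4) * G (j - i)" if "0 <= i" "i <= 2 * int N" for i
   proof -
    have "enn (rho j) <= enn (2 * rho (j - i))" by (intro ennreal_leI rho_step that)
    then have "enn (rho j) * (enn (1/8) * F (j - i)) <= enn (2 * rho (j - i)) * (enn (1/8) * F (j - i))" by (rule mult_right_mono) simp
    also have "... = enn (2 * rho (j - i) * (1/8)) * F (j - i)" using rho0 by (subst ennreal_mult[of _ "1/8"]) (auto simp: mult.assoc)
    also have "2 * rho (j - i) * (1/8) = 1/4 * rho (j - i)" by simp
    also have "enn (1/4 * rho (j - i)) * F (j - i) = enn (1/4) * (enn (rho (j - i)) * F (j - i))" using rho0 by (subst ennreal_mult) (auto simp: mult.assoc)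
    also have "... = enn (1/4) * G (j - i)" using True that by (simp add: G_def)
    finally show ?thesis .
   qed
   have "G j = enn (rho j) * F j" using True by (simp add: G_def)
   also have "... <= enn (rho j) * (enn (1/8) * F (j - int N) + enn (1/8) * F (j - 2 * int N) + R j)" by (intro mult_left_mono rec) simp
   also have "... = enn (rho j) * (enn (1/8) * F (j - int N)) + enn (rho j) * (enn (1/8) * F (j - 2 * int N)) + enn (rho j) * R j" by (simp add: distrib_left)
   also have "... <= enn (1/4) * G (j - int N) + enn (1/4) * G (j - 2 * int N) + 1 * R j" by (intro add_mono s mult_right_mono) (auto simp: rho_def ennreal_le_1)
   finally show ?thesis by simp
  qed (simp add: G_def)
  have Gfin: "isum G < \<infinity>"
  proof -
   obtain B where B: "B < \<infinity>" "!!j. j <= 0 ==> F j <= B * enn (2 powr (- (t/2) * of_int j))" using growth[of "t/2"] t by auto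
   let ?B = "B * enn (2 powr (- t * of_int j1))"
   have Bf: "?B < \<infinity>" using B(1) by (simp add: ennreal_mult_less_top)
   have "G j <= ?B * enn (2 powr (t/2 * of_int j)) * ind {..0} j + F j * ind {1..J} j" for j
   proof (cases "j <= 0")
    case True
    have "G j <= enn (rho j) * F j" by (simp add: G_def indicator_def)
    also have "... <= enn (2 powr (t * of_int (j - j1))) * (B * enn (2 powr (- (t/2) * of_int j)))" using B(2)[OF True] by (intro mult_mono ennreal_leI) (auto simp: rho_def)
    also have "... = B * (enn (2 powr (t * of_int (j - j1))) * enn (2 powr (- (t/2) * of_int j)))" by (simp only: mult_ac)
    also have "enn (2 powr (t * of_int (j - j1))) * enn (2 powr (- (t/2) * of_int j))
      = enn (2 powr (- t * of_int j1)) * enn (2 powr (t/2 * of_int j))" by (simp add: ennreal_mult[symmetric] powr_add[symmetric] algebra_simps)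
    finally show ?thesis using True by (simp add: mult.assoc)
   next
    case False
    then have "G j <= F j * ind {1..J} j" using rho0[of j] mult_right_mono[of "enn (rho j)" 1 "F j"] by (auto simp: G_def rho_def indicator_def ennreal_le_1)
    then show ?thesis by (simp add: add_increasing)
   qed
   then have "isum G <= isum (%j. ?B * enn (2 powr (t/2 * of_int j)) * ind {..0} j + F j * ind {1..J} j)" by (intro nn_integral_mono) auto
   also have "... = isum (%j. ?B * enn (2 powr (t/2 * of_int j)) * ind {..0} j) + isum (%j. F j * ind {1..J} j)" by (intro nn_integral_add) auto
   also have "isum (%j. F j * ind {1..J} j) = (SUM j:{1..J}. F j)"
   proof -
    have "isum (%j. F j * ind {1..J} j) = (\<integral>\<^sup>+j. F j \<partial>count_space {1..J})" by (subst (2) nn_integral_count_space_indicator) auto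
    then show ?thesis by (simp add: nn_integral_count_space_finite)
   qed
   also have "isum (%j. ?B * enn (2 powr (t/2 * of_int j)) * ind {..0} j) + (SUM j:{1..J}. F j) < \<infinity>"
    using isum_geometric_finite[OF _ Bf, of "t/2"] t fin by (auto simp: ennreal_add_less_top ennreal_sum_less_top)
   finally show ?thesis .
  qed
  have "isum G <= isum (%j. enn (1/4) * G (j - int N) + enn (1/4) * G (j - 2 * int N) + R j)" by (intro nn_integral_mono Gstep)
  also have "... = enn (1/4) * isum (%j. G (j - int N)) + enn (1/4) * isum (%j. G (j - 2 * int N)) + isum R" by (simp add: nn_integral_add nn_integral_cmult)
  also have "isum (%j. G (j - int N)) = isum G" using isum_shift[of G "- int N"] by simp
  also have "isum (%j. G (j - 2 * int N)) = isum G" using isum_shift[of G "- 2 * int N"] by simp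
  finally have le: "isum G <= enn (1/4) * isum G + enn (1/4) * isum G + isum R" .
  have "isum G <= 2 * isum R"
  proof (cases "isum R")
   case (real x)
   obtain y where y: "isum G = enn y" "0 <= y" using Gfin by (cases "isum G") auto
   have x: "isum R = enn x" "0 <= x" using real by auto
   have "enn (1/4) * enn y + enn (1/4) * enn y + enn x = enn (1/4 * y + 1/4 * y + x)" using x y by (simp add: ennreal_mult[symmetric] ennreal_plus[symmetric] del: ennreal_plus)
   then have "enn y <= enn (1/4 * y + 1/4 * y + x)" using le unfolding x y by (simp only:)
   then have "y <= 1/4 * y + 1/4 * y + x" by (rule ennreal_le_iff[THEN iffD1, rotated]) (use x y in simp)
   then have "y <= 2 * x" by simp
   then have "enn y <= enn (2 * x)" by (rule ennreal_leI)
   then show ?thesis using real y by (simp add: ennreal_mult)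
  next
   case top then show ?thesis by (simp add: ennreal_mult_top)
  qed
  moreover have "isum (%j. F j * ind {j1..J} j) <= isum G" by (intro nn_integral_mono) (use t in \<open>auto simp: G_def rho_def indicator_def ge_one_powr_ge_zero min_absorb1\<close>)
  ultimately show ?thesis by simp
 qed
 have "isum F = isum (%j. SUP n. F j * ind {- int n..int n} j)"
 proof (intro nn_integral_cong antisym)
  fix j :: int
  have e: "F j = F j * ind {- int (nat (abs j))..int (nat (abs j))} j" by (auto simp: indicator_def)
  have "F j * ind {- int (nat (abs j))..int (nat (abs j))} j <= (SUP n. F j * ind {- int n..int n} j)" by (rule SUP_upper) simp
  with e show "F j <= (SUP n. F j * ind {- int n..int n} j)" by (rule ord_eq_le_trans)
  show "(SUP n. F j * ind {- int n..int n} j) <= F j" by (intro SUP_least) (auto simp: indicator_def)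
 qed
 also have "... = (SUP n. isum (%j. F j * ind {- int n..int n} j))" by (intro nn_integral_monotone_convergence_SUP) (auto simp: incseq_def le_fun_def indicator_def)
 also have "... <= 2 * isum R" by (intro SUP_least key)
 finally show ?thesis .
qed

context one_sided_weight
begin

text \<open>Larger than \<open>emeasure M U\<close>, but comparable under passing to thin subsets, unlike the measure itself.\<close>

definition compsum :: "real set => ennreal" where
 "compsum U = (nn_integral (count_space (components U)) (%C. WC C))"

lemma component_bounds:
 assumes "open U" "bounded U" "C : components U"
 obtains a c where "a < c" "C = {a<..<c}" "a ~: U" "c ~: U" "C <= U" "WC C = W a c"
 using component_Ioo[OF assms] in_components_subset[OF assms(3)] by (metis WC_def cInf_greaterThanLessThan cSup_greaterThanLessThan)

lemma emeasure_le_compsum: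
 assumes U: "open U" "bounded U"
 shows "emeasure M U <= compsum U"
proof -
 have "emeasure M U = (nn_integral (count_space (components U)) (%C. emeasure M C))" by (intro emeasure_components U) simp
 also have "... <= compsum U" unfolding compsum_def by (intro nn_integral_mono) (use component_bounds[OF U] emeasure_le_W in \<open>metis space_count_space\<close>)
 finally show ?thesis .
qed

text \<open>Each component of \<open>V\<close> lies in one component of \<open>U\<close>, and the density of \<open>V\<close> right of the left end point
 of that component allows to sum the tails there.\<close>

lemma compsum_step:
 assumes U: "open U" "bounded U" and V: "open V" "V <= U" and h: "0 <= h"
  and thin: "!!a D. a ~: U ==> 0 < D ==> leb (V Int {a<..<a + D}) <= enn (h * D)"
 shows "compsum V <= enn (K3 * h powr r + K2 * q ^ k) * compsum U + enn (K1 * (real k + 1) + 5) * emeasure M U"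
proof -
 have bV: "bounded V" using U V bounded_subset by blast
 let ?A = "enn (K3 * h powr r + K2 * q ^ k)" and ?T = "enn (K1 * (real k + 1) + 5)"
 have "compsum V <= (nn_integral (count_space (components V)) (%C. (nn_integral (count_space (components U)) (%P. WC C * (if C <= P then 1 else 0)))))" unfolding compsum_def
 proof (rule nn_integral_mono)
  fix C assume "C : space (count_space (components V))"
  then have C: "C : components V" by simp
  have "C <= U" "connected C" "C ~= {}" using C V in_components_subset in_components_connected in_components_nonempty by blast+
  then obtain P where P: "P : components U" "C <= P" using exists_component_superset[of C U] by blast
  have "WC C * (if C <= P then 1 else 0) <= (nn_integral (count_space (components U)) (%P. WC C * (if C <= P then 1 else 0)))" using P by (intro nn_integral_ge_point)
  then show "WC C <= (nn_integral (count_space (components U)) (%P. WC C * (if C <= P then 1 else 0)))" using P by simp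
 qed
 also have "... = (nn_integral (count_space (components U)) (%P. (nn_integral (count_space (components V)) (%C. WC C * (if C <= P then 1 else 0)))))"
  by (intro nn_integral_count_space_nn_integral countable_components_open U) auto
 also have "... <= (nn_integral (count_space (components U)) (%P. ?A * WC P + ?T * emeasure M P))"
 proof (rule nn_integral_mono)
  fix P assume "P : space (count_space (components U))"
  then have P: "P : components U" by simp
  obtain a c where ac: "a < c" "P = {a<..<c}" "a ~: U" "c ~: U" "P <= U" "WC P = W a c" using component_bounds[OF U P] .
  let ?Q = "{C : components V. C <= P}"
  have fQ: "fam ?Q" by (rule fam_components[OF V(1) bV]) auto
  have "(nn_integral (count_space (components V)) (%C. WC C * (if C <= P then 1 else 0))) = (nn_integral (count_space ?Q) (%C. WC C))"
   by (subst (1 2) nn_integral_count_space_indicator) (auto intro!: nn_integral_cong simp: indicator_def)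
  also have "... <= ?A * W a c + ?T * emeasure M {a<..<c}"
  proof (rule sum_WC_le[OF fQ _ ac(1) h])
   show "\<Union> ?Q <= {a<..<c}" using ac by auto
   fix D :: real assume D: "0 < D"
   have QV: "\<Union> ?Q <= V" using in_components_subset by blast
   have "leb (\<Union> ?Q Int {a<..<a + D}) <= leb (V Int {a<..<a + D})" using V QV by (intro emeasure_mono) auto
   also have "... <= enn (h * D)" by (rule thin[OF ac(3) D])
   finally show "leb (\<Union> ?Q Int {a<..<a + D}) <= enn (h * D)" .
  qed
  finally show "(nn_integral (count_space (components V)) (%C. WC C * (if C <= P then 1 else 0))) <= ?A * WC P + ?T * emeasure M P" using ac by simp
 qed
 also have "... = ?A * compsum U + ?T * emeasure M U" unfolding compsum_def using emeasure_components[OF U(1), of M] by (simp add: nn_integral_add nn_integral_cmult)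
 finally show ?thesis .
qed

lemma emeasure_thin_in_components:
 assumes U: "open U" "bounded U" and E: "E : sets borel" "E <= U" and h: "0 <= h"
  and thin: "!!x c. x < c ==> {x<..<c} <= U ==> c ~: U ==> leb (E Int {x<..<(x + c) / 2}) <= enn (h * (c - x))"
 shows "emeasure M E <= enn (8 * C0 * (4 * h) powr e0) * compsum U"
proof -
 let ?N = "density M (ind E)"
 have [measurable]: "E : sets M" using E by simp
 have eN: "emeasure ?N B = emeasure M (E Int B)" if "B : sets borel" for B using that E by (subst emeasure_density) (auto simp: indicator_inter_arith[symmetric])
 have "emeasure M E = emeasure ?N U" using E U by (simp add: eN Int_absorb2)
 also have "... = (nn_integral (count_space (components U)) (%C. emeasure ?N C))" by (intro emeasure_components U) simp
 also have "... <= (nn_integral (count_space (components U)) (%C. enn (8 * C0 * (4 * h) powr e0) * WC C))"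
 proof (rule nn_integral_mono)
  fix C assume "C : space (count_space (components U))"
  then have C: "C : components U" by simp
  obtain a c where ac: "a < c" "C = {a<..<c}" "a ~: U" "c ~: U" "C <= U" "WC C = W a c" using component_bounds[OF U C] .
  let ?J = "%n. {pt a c n<..<pt a c (Suc n)}"
  have "emeasure ?N C = emeasure M (E Int {a<..<c})" using ac by (simp add: eN)
  also have "... <= (\<Sum>n. emeasure M (E Int {a<..<c} Int ?J n))" using E by (intro emeasure_pieces ac) auto
  also have "... <= (\<Sum>n. enn (C0 * (4 * h) powr e0) * W (pt a c n) (pt a c (n + 2)))"
  proof (rule suminf_le[OF _ summableI summableI])
   fix n
   have mid: "(pt a c n + c) / 2 = pt a c (Suc n)" by (simp add: pt_def field_simps)
   have sub: "{pt a c n<..<c} <= U" using ac pt_ge[OF ac(1), of n] by auto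
   have "leb (E Int ?J n) <= enn (h * (c - pt a c n))" using thin[OF pt_less[OF ac(1)] sub ac(4)] by (simp only: mid)
   then have s: "leb (E Int ?J n) <= enn (h * (c - a) / 2 ^ n)" by (simp add: pt_diff)
   have "emeasure M (E Int {a<..<c} Int ?J n) <= emeasure M (E Int ?J n)" using E by (intro emeasure_mono) auto
   also have "... <= enn (C0 * (4 * h) powr e0) * W (pt a c n) (pt a c (n + 2))" by (rule piece_small[OF ac(1) _ _ s h]) (use E in auto)
   finally show "emeasure M (E Int {a<..<c} Int ?J n) <= enn (C0 * (4 * h) powr e0) * W (pt a c n) (pt a c (n + 2))" .
  qed
  also have "... = enn (C0 * (4 * h) powr e0) * (\<Sum>n. W (pt a c n) (pt a c (n + 2)))" by simp
  also have "... <= enn (C0 * (4 * h) powr e0) * (8 * W a c)" by (intro mult_left_mono W_pieces ac) simp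
  also have "... = enn (8 * C0 * (4 * h) powr e0) * WC C"
  proof -
   have "enn (8 * (C0 * (4 * h) powr e0)) = enn 8 * enn (C0 * (4 * h) powr e0)" using C0 by (intro ennreal_mult) auto
   then show ?thesis using ac by (simp add: mult_ac)
  qed
  finally show "emeasure ?N C <= enn (8 * C0 * (4 * h) powr e0) * WC C" .
 qed
 also have "... = enn (8 * C0 * (4 * h) powr e0) * compsum U" unfolding compsum_def by (intro nn_integral_cmult) simp
 finally show ?thesis .
qed

lemma compsum_subset_interval:
 assumes U: "open U" "U <= {a<..<c}" and ac: "a < c"
 shows "compsum U <= enn (K3 + K2 + (K1 + 5)) * W a c"
proof -
 have "U <= {a..c}" using U(2) by auto
 then have bU: "bounded U" by (rule bounded_subset[OF bounded_closed_interval])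
 have fQ: "fam (components U)" by (rule fam_components[OF U(1) bU]) auto
 have "compsum U <= enn (K3 * 1 powr r + K2 * q ^ 0) * W a c + enn (K1 * (real 0 + 1) + 5) * emeasure M {a<..<c}" unfolding compsum_def
 proof (rule sum_WC_le[OF fQ _ ac])
  show "\<Union> (components U) <= {a<..<c}" using U by simp
  fix D :: real assume "0 < D"
  have "leb (\<Union> (components U) Int {a<..<a + D}) <= leb {a<..<a + D}" by (intro emeasure_mono) auto
  then show "leb (\<Union> (components U) Int {a<..<a + D}) <= enn (1 * D)" using \<open>0 < D\<close> by simp
 qed simp
 also have "... <= enn (K3 + K2) * W a c + enn (K1 + 5) * W a c"
 proof -
  have "K1 * (real 0 + 1) + 5 = K1 + 5" "K3 * 1 powr r + K2 * q ^ 0 = K3 + K2" by simp_all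
  then show ?thesis using mult_left_mono[OF emeasure_le_W[OF ac], of "enn (K1 + 5)"] by (simp only: add_left_mono zero_le)
 qed
 also have "... = enn (K3 + K2 + (K1 + 5)) * W a c" using K3_ge K2_nonneg K1_pos by (subst ennreal_plus) (auto simp: distrib_right)
 finally show ?thesis .
qed

end

context one_sided_weight
begin

text \<open>The last condition is the a priori growth: it leaves any exponent above \<open>1\<close> for the left end points as
 \<open>j\<close> tends to \<open>- \<infinity>\<close>.\<close>

definition good_levels :: "nat => real => (int => real set) => bool" where
 "good_levels N h U \<longleftrightarrow>
   (ALL j. open (U j)) & (ALL i j. i <= j --> U j <= U i) &
   (ALL j a D. a ~: U j --> 0 < D --> leb (U (j + int N) Int {a<..<a + D}) <= enn (h * D)) &
   (ALL t>0. EX m>0. ALL j<=0. U j <= {- (m * 2 powr (- (1 + t) * of_int j))<..<m})"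

definition dominated_levels :: "nat => real => (int => real set) => (int => real set) => bool" where
 "dominated_levels N h O' U \<longleftrightarrow>
   (ALL j. O' j : sets borel) &
   (ALL j x c. x < c --> {x<..<c} <= U j --> c ~: U j -->
    leb ((U (j + int N) - O' (j + int N)) Int {x<..<(x + c) / 2}) <= enn (h * (c - x)))"

definition level_sum :: "real => (int => real set) => ennreal" where
 "level_sum p U = isum (%j. enn (2 powr (of_int j * p)) * emeasure M (U j))"

lemma W_power_growth:
 assumes p: "0 < p" "p <= r" and m: "0 < m" "0 <= m'"
 shows "W (- m') m <= enn (((m + m') / m) powr p) * (nn_integral M (%x. enn (tail 0 m x powr p)))"
proof -
 have "W (- m') m <= (nn_integral M (%x. enn (((m + m') / m) powr p) * enn (tail 0 m x powr p)))" unfolding W_def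
 proof (rule nn_integral_mono)
  fix x
  have t: "0 <= tail (- m') m x" "tail (- m') m x <= 1" "0 <= tail 0 m x" using m by (auto intro!: tail_nonneg tail_le_1)
  have "tail (- m') m x powr r <= tail (- m') m x powr p" using t p by (intro powr_mono') auto
  also have "... <= ((m + m') / m * tail 0 m x) powr p" using tail_extend[of "- m'" 0 m x] m t p by (intro powr_mono2) auto
  also have "... = ((m + m') / m) powr p * tail 0 m x powr p" by (rule powr_mult)
  finally show "enn (tail (- m') m x powr r) <= enn (((m + m') / m) powr p) * enn (tail 0 m x powr p)" by (simp add: ennreal_mult[symmetric] ennreal_leI)
 qed
 then show ?thesis by (simp add: nn_integral_cmult)
qed

lemma good_levels_subset_0:
 assumes "good_levels N h U" "0 < t"
 obtains m where "0 < m" "!!j. U j <= {- (m * 2 powr (- (1 + t) * of_int (min j 0)))<..<m}"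
proof -
 obtain m where m: "0 < m" "!!j. j <= 0 ==> U j <= {- (m * 2 powr (- (1 + t) * of_int j))<..<m}" using assms unfolding good_levels_def by blast
 have "U j <= U (min j 0)" for j using assms(1) unfolding good_levels_def by simp
 then have "U j <= {- (m * 2 powr (- (1 + t) * of_int (min j 0)))<..<m}" for j using m(2)[of "min j 0"] by fastforce
 then show ?thesis using that m by blast
qed

lemma good_levels_bounded: "good_levels N h U ==> bounded (U j)"
proof -
 assume g: "good_levels N h U"
 obtain m where "0 < m" "!!j. U j <= {- (m * 2 powr (- (1 + 1) * of_int (min j 0)))<..<m}" using good_levels_subset_0[OF g, of 1] by auto
 then have "U j <= {- (m * 2 powr (- (1 + 1) * of_int (min j 0)))..m}" by fastforce
 then show ?thesis by (rule bounded_subset[OF bounded_closed_interval])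
qed

text \<open>The measure of \<open>U (j + N)\<close> off \<open>O' (j + N)\<close> is a small multiple of \<open>compsum (U j)\<close>, and \<open>compsum\<close> satisfies
 the recursion of \<open>compsum_step\<close>. With \<open>N\<close> large and \<open>h\<close> small both coefficients fall below \<open>1 / 8\<close>; here
 \<open>p < r\<close> makes the factor \<open>2\<^sup>N\<^sup>p\<close> harmless against the density \<open>(4 / 2\<^sup>N)\<^sup>r\<close>.\<close>

theorem level_set_domination:
 assumes p: "0 < p" "p < r"
 shows "EX N>=1. EX h>0. EX C>0. ALL U O'. good_levels N (4 / 2 ^ N) U --> dominated_levels N h O' U -->
  (ALL m>0. (nn_integral M (%x. enn (tail 0 m x powr p))) < \<infinity>) --> level_sum p U <= enn C * level_sum p O'"
proof -
 obtain N where N: "1 <= N" "K3 * 4 powr r * (2 powr (p - r)) ^ N <= 1 / 16"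
 proof -
  have "2 powr (p - r) < 2 powr 0" using p by (intro powr_less_mono) auto
  then have "(%n. (2 powr (p - r)) ^ n) \<longlonglongrightarrow> 0" by (intro LIMSEQ_realpow_zero) auto
  then have "(%n. K3 * 4 powr r * (2 powr (p - r)) ^ n) \<longlonglongrightarrow> K3 * 4 powr r * 0" by (intro tendsto_mult_left)
  then have "\<forall>\<^sub>F n in sequentially. K3 * 4 powr r * (2 powr (p - r)) ^ n < 1 / 16" by (intro order_tendstoD) auto
  then obtain n0 where n0: "!!n. n0 <= n ==> K3 * 4 powr r * (2 powr (p - r)) ^ n < 1 / 16" unfolding eventually_sequentially by blast
  show ?thesis by (rule that[OF _ less_imp_le[OF n0[of "max 1 n0"]]]) simp_all
 qed
 define P where "P = 2 powr (real N * p)"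
 have P: "0 < P" by (simp add: P_def)
 obtain k where k: "P * (K2 * q ^ k) <= 1 / 16"
 proof -
  have "(%n. P * K2 * q ^ n) \<longlonglongrightarrow> P * K2 * 0" using q by (intro tendsto_mult_left LIMSEQ_realpow_zero) auto
  then have "\<forall>\<^sub>F n in sequentially. P * K2 * q ^ n < 1 / 16" by (intro order_tendstoD) auto
  then obtain n0 where n0: "!!n. n0 <= n ==> P * K2 * q ^ n < 1 / 16" unfolding eventually_sequentially by blast
  show ?thesis using less_imp_le[OF n0[of n0]] by (intro that[of n0]) (simp add: mult.assoc)
 qed
 have first: "P * (K3 * (4 / 2 ^ N) powr r) <= 1 / 16"
 proof -
  have "(4 / 2 ^ N :: real) = 4 * 2 powr (- real N)" by (simp add: powr_minus_divide powr_realpow)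
  then have "(4 / 2 ^ N :: real) powr r = 4 powr r * (2 powr (- real N)) powr r" by (simp only: powr_mult)
  then have "P * (K3 * (4 / 2 ^ N) powr r) = K3 * 4 powr r * (2 powr (real N * p) * 2 powr (- real N * r))" by (simp add: P_def powr_powr)
  also have "2 powr (real N * p) * 2 powr (- real N * r) = (2 powr (p - r)) powr real N" by (simp add: powr_add[symmetric] powr_powr algebra_simps)
  also have "(2 powr (p - r)) powr real N = (2 powr (p - r)) ^ N" by (simp add: powr_realpow)
  finally have "P * (K3 * (4 / 2 ^ N) powr r) = K3 * 4 powr r * (2 powr (p - r)) ^ N" by (simp only: mult_ac)
  then show ?thesis using N(2) by linarith
 qed
 define T where "T = P * (K1 * (real k + 1) + 5)"
 have T: "0 < T" using P K1_pos by (simp add: T_def add_nonneg_pos)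
 obtain h where h: "0 < h" "T * P * (8 * C0 * (4 * h) powr e0) <= 1 / 8"
 proof -
  have "((%h. T * P * (8 * C0 * (4 * h) powr e0)) \<longlongrightarrow> T * P * (8 * C0 * (4 * 0) powr e0)) (at_right 0)"
   using e0 by (intro tendsto_intros) (auto simp: eventually_at_right_field intro!: exI[of _ 1])
  then have "\<forall>\<^sub>F h in at_right 0. T * P * (8 * C0 * (4 * h) powr e0) < 1 / 8" by (intro order_tendstoD) auto
  then obtain d where d: "0 < d" "!!h. 0 < h ==> h < d ==> T * P * (8 * C0 * (4 * h) powr e0) < 1 / 8" unfolding eventually_at_right_field by blast
  show ?thesis by (rule that[OF _ less_imp_le[OF d(2)[of "d / 2"]]]) (use d in simp_all)
 qed
 define C where "C = 2 * T * P"
 have "level_sum p U <= enn C * level_sum p O'"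
  if g: "good_levels N (4 / 2 ^ N) U" and d: "dominated_levels N h O' U"
   and mom: "ALL m>0. (nn_integral M (%x. enn (tail 0 m x powr p))) < \<infinity>" for U O'
 proof -
  have op: "open (U j)" and mono: "i <= j ==> U j <= U i" for i j using g by (auto simp: good_levels_def)
  have thin: "a ~: U j ==> 0 < D ==> leb (U (j + int N) Int {a<..<a + D}) <= enn (4 / 2 ^ N * D)" for j a D using g by (auto simp: good_levels_def)
  have bd: "bounded (U j)" for j by (rule good_levels_bounded[OF g])
  have Ob [measurable]: "O' j : sets borel" for j using d by (auto simp: dominated_levels_def)
  define w where "w j = 2 powr (of_int j * p)" for j
  have w: "0 < w j" for j by (simp add: w_def)
  have wN: "w (j + int N) = P * w j" for j by (simp add: w_def P_def powr_add[symmetric] algebra_simps)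
  define F where "F j = enn (w j) * compsum (U j)" for j
  define R where "R j = enn (T * P) * (enn (w (j - 2 * int N)) * emeasure M (O' (j - int N)))" for j
  have step1: "F (j + int N) <= enn (1/8) * F j + enn T * (enn (w j) * emeasure M (U j))" for j
  proof -
   have "compsum (U (j + int N)) <= enn (K3 * (4 / 2 ^ N) powr r + K2 * q ^ k) * compsum (U j) + enn (K1 * (real k + 1) + 5) * emeasure M (U j)"
    by (rule compsum_step[OF op bd op]) (use thin mono in \<open>simp_all\<close>)
   then have "F (j + int N) <= enn (P * w j) * (enn (K3 * (4 / 2 ^ N) powr r + K2 * q ^ k) * compsum (U j) + enn (K1 * (real k + 1) + 5) * emeasure M (U j))"
    unfolding F_def wN by (rule mult_left_mono) simp
   also have "... = enn (P * (K3 * (4 / 2 ^ N) powr r + K2 * q ^ k)) * F j + enn T * (enn (w j) * emeasure M (U j))" unfolding F_def T_def using P w[of j] K3_ge K2_nonneg K1_pos q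
    by (simp add: ennreal_mult distrib_left mult_ac)
   also have "... <= enn (1/8) * F j + enn T * (enn (w j) * emeasure M (U j))" using first k by (intro add_mono mult_right_mono ennreal_leI) (auto simp: distrib_left)
   finally show ?thesis .
  qed
  have step2: "enn (w j) * emeasure M (U j) <= enn (P * (8 * C0 * (4 * h) powr e0)) * F (j - int N) + enn (w j) * emeasure M (O' j)" for j
  proof -
   have "emeasure M (U j - O' j) <= enn (8 * C0 * (4 * h) powr e0) * compsum (U (j - int N))"
   proof (rule emeasure_thin_in_components[OF op bd])
    show "U j - O' j : sets borel" using op by auto
    show "U j - O' j <= U (j - int N)" using mono[of "j - int N" j] by auto
    fix x c assume "x < c" "{x<..<c} <= U (j - int N)" "c ~: U (j - int N)"
    then have "leb ((U (j - int N + int N) - O' (j - int N + int N)) Int {x<..<(x + c) / 2}) <= enn (h * (c - x))" using d unfolding dominated_levels_def by blast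
    then show "leb ((U j - O' j) Int {x<..<(x + c) / 2}) <= enn (h * (c - x))" by simp
   qed (use h in auto)
   then have *: "enn (w j) * emeasure M (U j - O' j) <= enn (w j) * (enn (8 * C0 * (4 * h) powr e0) * compsum (U (j - int N)))" by (rule mult_left_mono) simp
   have wj: "w j = P * w (j - int N)" using wN[of "j - int N"] by simp
   have "enn (w j) * (enn (8 * C0 * (4 * h) powr e0) * compsum (U (j - int N))) = enn (P * (8 * C0 * (4 * h) powr e0)) * F (j - int N)"
   proof -
    have "enn (P * w (j - int N)) = enn P * enn (w (j - int N))"
     "enn (P * (8 * C0 * (4 * h) powr e0)) = enn P * enn (8 * C0 * (4 * h) powr e0)" using P by (simp_all add: ennreal_mult')
    then show ?thesis unfolding F_def wj by (simp only: mult_ac)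
   qed
   moreover have "emeasure M (U j) <= emeasure M (U j - O' j) + emeasure M (O' j)"
   proof -
    have "emeasure M (U j) <= emeasure M ((U j - O' j) Un O' j)" using op by (intro emeasure_mono) auto
    also have "... <= emeasure M (U j - O' j) + emeasure M (O' j)" using op by (intro emeasure_subadditive) auto
    finally show ?thesis .
   qed
   then have "enn (w j) * emeasure M (U j) <= enn (w j) * (emeasure M (U j - O' j) + emeasure M (O' j))" by (rule mult_left_mono) simp
   then have "enn (w j) * emeasure M (U j) <= enn (w j) * emeasure M (U j - O' j) + enn (w j) * emeasure M (O' j)" by (simp only: distrib_left)
   ultimately show ?thesis using * by (simp add: add_right_mono order_trans)
  qed
  have rec: "F j <= enn (1/8) * F (j - int N) + enn (1/8) * F (j - 2 * int N) + R j" for j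
  proof -
   have e: "j - int N + int N = j" "j - int N - int N = j - 2 * int N" by auto
   have "F j <= enn (1/8) * F (j - int N) + enn T * (enn (w (j - int N)) * emeasure M (U (j - int N)))" using step1[of "j - int N"] by (simp only: e)
   also have "... <= enn (1/8) * F (j - int N) + enn T * (enn (P * (8 * C0 * (4 * h) powr e0)) * F (j - 2 * int N) + enn (w (j - int N)) * emeasure M (O' (j - int N)))"
    using step2[of "j - int N"] by (intro add_left_mono mult_left_mono) (simp_all only: e zero_le)
   also have "... = enn (1/8) * F (j - int N) + (enn (T * (P * (8 * C0 * (4 * h) powr e0))) * F (j - 2 * int N) + R j)"
   proof -
    have wj: "w (j - int N) = P * w (j - 2 * int N)" using wN[of "j - 2 * int N"] by (simp add: algebra_simps)
    have "enn T * (enn (w (j - int N)) * emeasure M (O' (j - int N))) = R j"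
    proof -
     have "enn (P * w (j - 2 * int N)) = enn P * enn (w (j - 2 * int N))" "enn (T * P) = enn T * enn P" using P T by (simp_all add: ennreal_mult')
     then show ?thesis unfolding R_def wj by (simp only: mult_ac)
    qed
    moreover have "enn T * (enn (P * (8 * C0 * (4 * h) powr e0)) * F (j - 2 * int N)) = enn (T * (P * (8 * C0 * (4 * h) powr e0))) * F (j - 2 * int N)"
     using T P C0 by (subst ennreal_mult[of T]) (auto simp: mult.assoc)
    ultimately show ?thesis by (simp add: distrib_left)
   qed
   also have "... <= enn (1/8) * F (j - int N) + (enn (1/8) * F (j - 2 * int N) + R j)" using h by (intro add_left_mono add_right_mono mult_right_mono ennreal_leI) (auto simp: mult.assoc)
   finally show ?thesis by (simp add: add.assoc)
  qed
  have pre: "EX B<\<infinity>. ALL j. F j <= enn (w j) * (B * enn ((2 powr (- (1 + t) * of_int (min j 0))) powr p))" if t: "0 < t" for t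
  proof -
   obtain m where m: "0 < m" "!!j. U j <= {- (m * 2 powr (- (1 + t) * of_int (min j 0)))<..<m}" using good_levels_subset_0[OF g t] by blast
   define I where "I = (nn_integral M (%x. enn (tail 0 m x powr p)))"
   have I: "I < \<infinity>" using mom m by (simp add: I_def)
   define K where "K = K3 + K2 + (K1 + 5)"
   have K: "0 < K" using K3_ge K2_nonneg K1_pos by (simp add: K_def)
   have "F j <= enn (w j) * ((enn (K * 2 powr p) * I) * enn ((2 powr (- (1 + t) * of_int (min j 0))) powr p))" for j
   proof -
    define s where "s = 2 powr (- (1 + t) * of_int (min j 0))"
    have s: "1 <= s" unfolding s_def using t by (intro ge_one_powr_ge_zero) (auto intro!: mult_nonpos_nonpos simp: mult_le_0_iff)
    have "compsum (U j) <= enn K * W (- (m * s)) m" unfolding K_def using m s by (intro compsum_subset_interval op) (auto simp: s_def intro: less_trans[of _ 0])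
    also have "W (- (m * s)) m <= enn (((m + m * s) / m) powr p) * I" unfolding I_def using m s p by (intro W_power_growth) auto
    also have "((m + m * s) / m) powr p <= (2 * s) powr p" using m s p by (intro powr_mono2) (auto simp: field_simps)
    also have "(2 * s) powr p = 2 powr p * s powr p" by (rule powr_mult)
    finally have "compsum (U j) <= enn K * (enn (2 powr p * s powr p) * I)" by (simp add: mult_left_mono mult_right_mono ennreal_leI)
    also have "... = (enn (K * 2 powr p) * I) * enn (s powr p)" using K by (simp add: ennreal_mult mult_ac)
    finally show ?thesis unfolding F_def s_def by (rule mult_left_mono) simp
   qed
   moreover have "enn (K * 2 powr p) * I < \<infinity>" using I by (simp add: ennreal_mult_less_top)
   ultimately show ?thesis by blast
  qed
  have "isum F <= 2 * isum R"
  proof (rule absorb_recursion[OF _ rec])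
   show "0 < N" using N by simp
   show "F j < \<infinity>" for j
   proof -
    obtain B where B1: "B < \<infinity>" and B2: "!!j. F j <= enn (w j) * (B * enn ((2 powr (- (1 + 1) * of_int (min j 0))) powr p))" using pre[of 1] by auto
    show ?thesis using B1 by (intro le_less_trans[OF B2]) (simp add: ennreal_mult_less_top)
   qed
   fix t :: real assume t: "0 < t"
   obtain B where B: "B < \<infinity>" "!!j. F j <= enn (w j) * (B * enn ((2 powr (- (1 + t / p) * of_int (min j 0))) powr p))" using pre[of "t / p"] t p by auto
   have "F j <= B * enn (2 powr (- t * of_int j))" if "j <= 0" for j
   proof -
    have "w j * (2 powr (- (1 + t / p) * of_int j)) powr p = 2 powr (of_int j * p + (- (1 + t / p) * of_int j) * p)" by (simp add: w_def powr_powr powr_add)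
    also have "of_int j * p + (- (1 + t / p) * of_int j) * p = - t * of_int j" using p by (simp add: field_simps)
    finally have e: "w j * (2 powr (- (1 + t / p) * of_int j)) powr p = 2 powr (- t * of_int j)" .
    have "F j <= enn (w j) * (B * enn ((2 powr (- (1 + t / p) * of_int j)) powr p))" using B(2)[of j] that by simp
    also have "... = B * enn (w j * (2 powr (- (1 + t / p) * of_int j)) powr p)" using w by (subst ennreal_mult) (auto simp: mult_ac less_imp_le)
    finally show ?thesis by (simp only: e)
   qed
   then show "EX B<\<infinity>. ALL j<=0. F j <= B * enn (2 powr (- t * of_int j))" using B(1) by blast
  qed
  moreover have "level_sum p U <= isum F" unfolding level_sum_def F_def w_def by (intro nn_integral_mono mult_left_mono emeasure_le_compsum op bd) auto
  moreover have "isum R <= enn (T * P) * level_sum p O'"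
  proof -
   have "isum R = enn (T * P) * isum (%j. enn (w (j - 2 * int N)) * emeasure M (O' (j - int N)))" unfolding R_def by (intro nn_integral_cmult) simp
   also have "isum (%j. enn (w (j - 2 * int N)) * emeasure M (O' (j - int N))) <= isum (%j. enn (w (j - int N)) * emeasure M (O' (j - int N)))"
    unfolding w_def using p by (intro nn_integral_mono mult_right_mono ennreal_leI powr_mono) auto
   also have "... = level_sum p O'" using isum_shift[of "%j. enn (w j) * emeasure M (O' j)" "- int N"] by (simp add: level_sum_def w_def)
   finally show ?thesis by (simp add: mult_left_mono)
  qed
  ultimately have "level_sum p U <= 2 * (enn (T * P) * level_sum p O')" by (meson mult_left_mono order_trans zero_le)
  also have "... = enn C * level_sum p O'"
  proof -
   have "enn (2 * (T * P)) = enn 2 * enn (T * P)" using T P by (intro ennreal_mult) auto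
   then show ?thesis by (simp add: C_def mult.assoc)
  qed
  finally show ?thesis .
 qed
 moreover have "0 < C" using T P by (simp add: C_def)
 ultimately show ?thesis using N h by blast
qed

end

section \<open>Averages and almost orthogonality\<close>

definition L2c :: "(real => real) => bool" where
 "L2c g \<longleftrightarrow> g : Borel & integrable lborel (%x. (g x)^2) & (EX R. ALL x. R < abs x --> g x = 0)"

definition nrm :: "(real => real) => real" where
 "nrm g = (LINT x|lborel. (g x)^2)"

definition ip :: "(real => real) => (real => real) => real" where
 "ip g h = (LINT x|lborel. g x * h x)"

definition avg :: "int => (real => real) => real => real" where
 "avg j g x = mass g x (x + 2 powi j) / 2 powi j"

definition dif :: "int => (real => real) => real => real" where
 "dif j g x = avg j g x - avg (j - 1) g x"

lemma L2c_measurable: "L2c g ==> g : Borel" by (simp add: L2c_def)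

lemma L2c_integrable_mult:
 assumes "L2c g" "L2c h"
 shows "integrable lborel (%x. g x * h x)"
proof (rule Bochner_Integration.integrable_bound)
 show "integrable lborel (%x. (g x)^2 + (h x)^2)" using assms by (simp add: L2c_def)
 show "(%x. g x * h x) : borel_measurable lborel" using assms by (auto simp: L2c_def)
 have "abs (a * b) <= a^2 + b^2" for a b :: real
 proof -
  have "2 * (abs a * abs b) <= abs a^2 + abs b^2" using sum_squares_bound[of "abs a" "abs b"] by simp
  moreover have "0 <= abs a * abs b" by simp
  ultimately show ?thesis by (simp only: abs_mult power2_abs)
 qed
 then show "AE x in lborel. norm (g x * h x) <= norm ((g x)^2 + (h x)^2)" by (intro AE_I2) simp
qed

lemma L2c_ibs:
 assumes "L2c g" shows "ibs g"
proof -
 obtain R where R: "!!x. R < abs x ==> g x = 0" using assms by (auto simp: L2c_def)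
 have "integrable lborel g"
 proof (rule Bochner_Integration.integrable_bound)
  show "integrable lborel (%x. (g x)^2 + ind {-R..R} x :: real)" using assms
   by (intro Bochner_Integration.integrable_add integrable_real_indicator) (auto simp: L2c_def emeasure_lborel_Icc_eq)
  show "g : borel_measurable lborel" using assms by (simp add: L2c_def)
  have "abs a <= a^2 + 1" for a :: real using sum_squares_bound[of "abs a" 1] by simp
  then show "AE x in lborel. norm (g x) <= norm ((g x)^2 + ind {-R..R} x :: real)" using R by (intro AE_I2) (auto simp: indicator_def abs_le_iff not_le)
 qed
 then show ?thesis using R by (auto simp: ibs_def)
qed

lemma L2c_integrable: "L2c g ==> integrable lborel g" using L2c_ibs by (simp add: ibs_def)

lemma L2c_add:
 assumes "L2c g" "L2c h"
 shows "L2c (%x. a * g x + b * h x)" unfolding L2c_def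
proof (intro conjI)
 show "(%x. a * g x + b * h x) : Borel" using assms by (auto simp: L2c_def)
 have "(%x. (a * g x + b * h x)^2) = (%x. a^2 * (g x)^2 + b^2 * (h x)^2 + 2 * a * b * (g x * h x))" by (auto simp: power2_eq_square algebra_simps)
 moreover have "integrable lborel ..." using L2c_integrable_mult[OF assms] assms by (auto simp: L2c_def)
 ultimately show "integrable lborel (%x. (a * g x + b * h x)^2)" by simp
 obtain R R' where "!!x. R < abs x ==> g x = 0" "!!x. R' < abs x ==> h x = 0" using assms by (auto simp: L2c_def)
 then show "EX R. ALL x. R < abs x --> a * g x + b * h x = 0" by (intro exI[of _ "max R R'"]) auto
qed

lemma L2c_zero: "L2c (%x. 0)" by (simp add: L2c_def)

lemma L2c_scale: "L2c g ==> L2c (%x. a * g x)" using L2c_add[OF _ L2c_zero, of g a 0] by simp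

lemma L2c_sum: "finite A ==> (!!i. i : A ==> L2c (g i)) ==> L2c (%x. SUM i:A. c i * g i x)"
proof (induction A rule: finite_induct)
 case empty then show ?case by (simp add: L2c_zero)
next
 case (insert i A)
 then have "L2c (%x. c i * g i x + 1 * (SUM i:A. c i * g i x))" by (intro L2c_add) auto
 then show ?case using insert by simp
qed

lemma lborel_integral_shift: "(LINT x|lborel. f (x + t)) = (LINT x|lborel. f (x :: real) :: real)" using lborel_integral_real_affine[of 1 f t] by (simp add: add.commute)

lemma lborel_integrable_shift: "integrable lborel f ==> integrable lborel (%x. f (x + t :: real) :: real)" using lborel_integrable_real_affine[of f 1 t] by (simp add: add.commute)

lemma L2c_shift:
 assumes "L2c g" shows "L2c (%x. g (x + t))" unfolding L2c_def
proof (intro conjI)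
 have [measurable]: "g : Borel" using assms by (simp add: L2c_def)
 show "(%x. g (x + t)) : Borel" by measurable
 show "integrable lborel (%x. (g (x + t))^2)" using assms lborel_integrable_shift[of "%x. (g x)^2" t] by (simp add: L2c_def)
 obtain R where "!!x. R < abs x ==> g x = 0" using assms by (auto simp: L2c_def)
 then show "EX R. ALL x. R < abs x --> g (x + t) = 0" by (intro exI[of _ "R + abs t"]) auto
qed

lemma nrm_shift: "nrm (%x. g (x + t)) = nrm g" unfolding nrm_def by (rule lborel_integral_shift)

lemma ip_shift: "ip (%x. g (x + t)) (%x. h (x + t)) = ip g h" unfolding ip_def using lborel_integral_shift[of "%x. g x * h x" t] by simp

lemma nrm_nonneg: "0 <= nrm g" unfolding nrm_def by simp

lemma nrm_ip: "nrm g = ip g g" by (simp add: nrm_def ip_def power2_eq_square)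

lemma ip_commute: "ip g h = ip h g" by (simp add: ip_def mult.commute)

lemma ip_add:
 assumes "L2c g" "L2c g'" "L2c h"
 shows "ip (%x. a * g x + b * g' x) h = a * ip g h + b * ip g' h"
proof -
 have "(%x. (a * g x + b * g' x) * h x) = (%x. a * (g x * h x) + b * (g' x * h x))" by (auto simp: algebra_simps)
 then show ?thesis unfolding ip_def using assms by (simp add: L2c_integrable_mult)
qed

lemma ip_sum:
 assumes "finite A" "!!i. i : A ==> L2c (g i)" "L2c h"
 shows "ip h (%x. SUM i:A. c i * g i x) = (SUM i:A. c i * ip h (g i))" using assms(1,2)
proof (induction A rule: finite_induct)
 case empty then show ?case by (simp add: ip_def)
next
 case (insert i A)
 have "ip (%x. c i * g i x + 1 * (SUM i:A. c i * g i x)) h = c i * ip (g i) h + 1 * ip (%x. SUM i:A. c i * g i x) h" by (intro ip_add L2c_sum assms(3) insert.prems insert.hyps) auto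
 then show ?case using insert by (simp add: ip_commute[of h])
qed

lemma ip_bound:
 assumes "L2c g" "L2c h"
 shows "abs (ip g h) <= (nrm g + nrm h) / 2"
proof -
 have "abs (ip g h) <= (LINT x|lborel. abs (g x * h x))" unfolding ip_def by (rule integral_abs_bound)
 also have "... <= (LINT x|lborel. (1/2) * (g x)^2 + (1/2) * (h x)^2)"
 proof (rule integral_mono)
  show "integrable lborel (%x. abs (g x * h x))" using L2c_integrable_mult[OF assms] by (rule integrable_abs)
  show "integrable lborel (%x. (1/2) * (g x)^2 + (1/2) * (h x)^2)" using assms by (simp add: L2c_def)
  show "abs (g x * h x) <= (1/2) * (g x)^2 + (1/2) * (h x)^2" for x using sum_squares_bound[of "abs (g x)" "abs (h x)"] by (simp add: abs_mult)
 qed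
 also have "... = (nrm g + nrm h) / 2" using assms unfolding nrm_def L2c_def by simp
 finally show ?thesis .
qed

lemma nrm_half:
 assumes "L2c g" "L2c h"
 shows "nrm (%x. (g x + h x) / 2) + nrm (%x. (g x - h x) / 2) = (nrm g + nrm h) / 2"
proof -
 have i: "integrable lborel (%x. ((g x + h x) / 2)^2)" "integrable lborel (%x. ((g x - h x) / 2)^2)" using L2c_add[OF assms, of "1/2" "1/2"] L2c_add[OF assms, of "1/2" "-1/2"]
  by (auto simp: L2c_def add_divide_distrib diff_divide_distrib)
 have "nrm (%x. (g x + h x) / 2) + nrm (%x. (g x - h x) / 2) = (LINT x|lborel. ((g x + h x) / 2)^2 + ((g x - h x) / 2)^2)" unfolding nrm_def using i by simp
 also have "(%x. ((g x + h x) / 2)^2 + ((g x - h x) / 2)^2) = (%x. (1/2) * (g x)^2 + (1/2) * (h x)^2)" by (auto simp: power2_eq_square field_simps)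
 also have "(LINT x|lborel. (1/2) * (g x)^2 + (1/2) * (h x)^2) = (nrm g + nrm h) / 2" using assms unfolding nrm_def L2c_def by simp
 finally show ?thesis .
qed

lemma powi_pos [simp]: "0 < (2 :: real) powi j" by (simp add: zero_less_power_int)

lemma powi_Suc: "(2 :: real) powi (j + 1) = 2 * 2 powi j" by (simp add: power_int_add)

lemma powi_mono2: "i <= j ==> (2 :: real) powi i <= 2 powi j" by (rule power_int_increasing) auto

lemma avg_Suc:
 assumes "integrable lborel g"
 shows "avg (j + 1) g x = (avg j g x + avg j g (x + 2 powi j)) / 2"
proof -
 have p: "0 < (2 :: real) powi j" by simp
 have "mass g x (x + 2 powi (j + 1)) = mass g x (x + 2 powi j) + mass g (x + 2 powi j) (x + 2 powi j + 2 powi j)"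
 proof -
  have e: "x + 2 powi (j + 1) = x + 2 powi j + 2 powi j" by (simp only: powi_Suc)
  have "x <= x + 2 powi j" "x + 2 powi j <= x + 2 powi j + 2 powi j" using p by linarith+
  then show ?thesis unfolding e by (rule mass_split[OF assms])
 qed
 then show ?thesis unfolding avg_def powi_Suc by (simp add: add_divide_distrib)
qed

lemma dif_Suc:
 assumes "integrable lborel g"
 shows "dif (j + 1) g x = (avg j g (x + 2 powi j) - avg j g x) / 2" unfolding dif_def avg_Suc[OF assms] by (simp add: field_simps)

lemma mass_shift: "mass g (x + a) (x + b) = (LINT t|lborel. ind {a..b} t * g (x + t))"
proof -
 have "mass g (x + a) (x + b) = (LINT t|lborel. ind {x + a..x + b} t *\<^sub>R g t)" by (simp add: mass_def sli_def)
 also have "... = (LINT t|lborel. ind {x + a..x + b} (t + x) *\<^sub>R g (t + x))" by (rule lborel_integral_shift[symmetric])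
 also have "... = (LINT t|lborel. ind {a..b} t * g (x + t))" by (intro Bochner_Integration.integral_cong) (auto simp: indicator_def add.commute)
 finally show ?thesis .
qed

lemma mass_measurable:
 assumes [measurable]: "g : Borel"
 shows "(%x. mass g (x + a) (x + b)) : Borel" unfolding mass_shift by measurable

lemma avg_measurable: "g : Borel ==> avg j g : Borel" using mass_measurable[of g 0 "2 powi j"] unfolding avg_def[abs_def] by simp

lemma mass_sq_le:
 assumes "L2c g" and s: "0 <= s"
 shows "(mass g x (x + s))^2 <= s * mass (%t. (g t)^2) x (x + s)"
proof (cases "s = 0")
 case False
 then have s: "0 < s" using s by simp
 define m where "m = mass g x (x + s)"
 have i: "integrable lborel g" "integrable lborel (%t. (g t)^2)" using L2c_integrable[OF assms(1)] assms(1) by (simp_all add: L2c_def)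
 have ind: "integrable lborel (%t. ind {x..x + s} t :: real)" by (intro integrable_real_indicator) (auto simp: emeasure_lborel_Icc_eq)
 have "0 <= (LINT t|lborel. ind {x..x + s} t * (g t - m / s)^2)" by (intro integral_nonneg_AE) auto
 also have "(%t. ind {x..x + s} t * (g t - m / s)^2) = (%t. ind {x..x + s} t * (g t)^2 - 2 * (m / s) * (ind {x..x + s} t * g t) + (m / s)^2 * ind {x..x + s} t)"
  by (auto simp: power2_eq_square algebra_simps)
 also have "(LINT t|lborel. ... t) = mass (%t. (g t)^2) x (x + s) - 2 * (m / s) * m + (m / s)^2 * s"
  using set_integrable_Icc[OF i(1), of x "x + s"] set_integrable_Icc[OF i(2), of x "x + s"] s by (simp add: m_def mass_def sli_def set_integrable_def)
 also have "... = mass (%t. (g t)^2) x (x + s) - m^2 / s" using s by (simp add: power2_eq_square field_simps)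
 finally show ?thesis using s by (simp add: m_def field_simps)
qed simp

lemma nn_integral_mass:
 assumes [measurable]: "h : Borel" and h: "integrable lborel h" "!!t. 0 <= h t" and s: "0 <= s"
 shows "(lint (%x. enn (mass h x (x + s)))) = enn s * enn (LINT t|lborel. h t)"
proof -
 have "enn (mass h x (x + s)) = (lint (%t. ind {0..s} t * enn (h (x + t))))" for x
 proof -
  have "mass h (x + 0) (x + s) = (LINT t|lborel. ind {0..s} t * h (x + t))" by (rule mass_shift)
  moreover have "integrable lborel (%t. ind {0..s} t * h (x + t))" using integrable_mult_indicator[of "{0..s}" lborel "%t. h (t + x)"] lborel_integrable_shift[OF h(1), of x]
   by (simp add: add.commute)
  ultimately have "enn (mass h x (x + s)) = (lint (%t. enn (ind {0..s} t * h (x + t))))" using h(2) by (subst nn_integral_eq_integral) auto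
  also have "... = (lint (%t. ind {0..s} t * enn (h (x + t))))" by (intro nn_integral_cong) (auto simp: indicator_def)
  finally show ?thesis .
 qed
 then have "(lint (%x. enn (mass h x (x + s)))) = (lint (%x. (lint (%t. ind {0..s} t * enn (h (x + t))))))" by simp
 also have "... = (lint (%t. (lint (%x. ind {0..s} t * enn (h (x + t))))))" by (rule lborel_pair.Fubini') measurable
 also have "... = (lint (%t. enn (LINT t|lborel. h t) * ind {0..s} t))"
 proof (rule nn_integral_cong)
  fix t :: real
  have "(lint (%x. enn (h (x + t)))) = enn (LINT x|lborel. h (x + t))" using lborel_integrable_shift[OF h(1), of t] h(2) by (intro nn_integral_eq_integral) auto
  also have "... = enn (LINT x|lborel. h x)" by (simp only: lborel_integral_shift)
  finally show "(lint (%x. ind {0..s} t * enn (h (x + t)))) = enn (LINT t|lborel. h t) * ind {0..s} t" by (subst nn_integral_cmult) (simp_all add: mult.commute)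
 qed
 also have "... = enn s * enn (LINT t|lborel. h t)" using s by (subst nn_integral_cmult_indicator) (auto simp: mult.commute)
 finally show ?thesis .
qed

lemma avg_sq_le: "L2c g ==> (avg j g x)^2 <= mass (%t. (g t)^2) x (x + 2 powi j) / 2 powi j"
proof -
 assume "L2c g"
 from mass_sq_le[OF this, of "2 powi j" x]
 have "(mass g x (x + 2 powi j))^2 / (2 powi j)^2 <= 2 powi j * mass (%t. (g t)^2) x (x + 2 powi j) / (2 powi j)^2" by (intro divide_right_mono) (auto simp: less_imp_le)
 then show ?thesis by (simp add: avg_def power_divide power2_eq_square)
qed

lemma avg_L2c:
 assumes g: "L2c g"
 shows "L2c (avg j g)" "nrm (avg j g) <= nrm g"
proof -
 have [measurable]: "g : Borel" using g by (simp add: L2c_def)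
 have m [measurable]: "avg j g : Borel" by (rule avg_measurable) simp
 let ?s = "2 powi j :: real"
 have "(lint (%x. enn ((avg j g x)^2))) <= (lint (%x. enn (1 / ?s) * enn (mass (%t. (g t)^2) x (x + ?s))))"
 proof (rule nn_integral_mono)
  fix x
  have "enn ((avg j g x)^2) <= enn (1 / ?s * mass (%t. (g t)^2) x (x + ?s))" using avg_sq_le[OF g, of j x] by (intro ennreal_leI) simp
  also have "... = enn (1 / ?s) * enn (mass (%t. (g t)^2) x (x + ?s))" by (rule ennreal_mult') (simp add: less_imp_le)
  finally show "enn ((avg j g x)^2) <= enn (1 / ?s) * enn (mass (%t. (g t)^2) x (x + ?s))" .
 qed
 also have "... = enn (1 / ?s) * (enn ?s * enn (nrm g))"
 proof -
  have "(%x. mass (%t. (g t)^2) x (x + ?s)) : Borel" using mass_measurable[of "%t. (g t)^2" 0 ?s] by simp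
  moreover have "(lint (%x. enn (mass (%t. (g t)^2) x (x + ?s)))) = enn ?s * enn (nrm g)" unfolding nrm_def using g by (intro nn_integral_mass) (auto simp: L2c_def less_imp_le)
  ultimately show ?thesis by (subst nn_integral_cmult) auto
 qed
 also have "... = enn (nrm g)" using nrm_nonneg[of g] by (simp add: ennreal_mult[symmetric] mult.assoc[symmetric] less_imp_le)
 finally have le: "(lint (%x. enn ((avg j g x)^2))) <= enn (nrm g)" .
 have int: "integrable lborel (%x. (avg j g x)^2)" using le by (intro integrableI_bounded) (auto simp: le_less_trans)
 show "nrm (avg j g) <= nrm g"
 proof -
  have "enn (nrm (avg j g)) <= enn (nrm g)" using le int unfolding nrm_def[of "avg j g"] by (subst (asm) nn_integral_eq_integral) auto
  then show ?thesis using nrm_nonneg by simp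
 qed
 obtain R where R: "!!x. R < abs x ==> g x = 0" using g by (auto simp: L2c_def)
 have "avg j g x = 0" if x: "abs R + ?s < abs x" for x
 proof -
  have p: "0 < ?s" by simp
  have z: "ind {x..x + ?s} t *\<^sub>R g t = 0" for t
  proof (cases "t : {x..x + ?s}")
   case True
   then have "R < abs t" using x p by (auto simp: abs_if split: if_splits)
   then show ?thesis using R by simp
  qed simp
  show ?thesis unfolding avg_def mass_def sli_def z by simp
 qed
 then show "L2c (avg j g)" unfolding L2c_def using int m by blast
qed

lemma dif_L2c: "L2c g ==> L2c (dif j g)" using L2c_add[OF avg_L2c(1)[of g j] avg_L2c(1)[of g "j - 1"], of 1 "-1"] by (simp add: dif_def[abs_def])

text \<open>Pythagoras for one halving step: the averages form a telescoping square function.\<close>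

lemma nrm_step:
 assumes g: "L2c g"
 shows "nrm (avg (j + 1) g) + nrm (dif (j + 1) g) = nrm (avg j g)"
proof -
 have i: "integrable lborel g" by (rule L2c_integrable[OF g])
 have "nrm (avg (j + 1) g) + nrm (dif (j + 1) g) =
  nrm (%x. (avg j g (x + 2 powi j) + avg j g x) / 2) + nrm (%x. (avg j g (x + 2 powi j) - avg j g x) / 2)"
 proof -
  have "avg (j + 1) g = (%x. (avg j g (x + 2 powi j) + avg j g x) / 2)" using avg_Suc[OF i, of j] by (intro ext) (simp only: add.commute)
  moreover have "dif (j + 1) g = (%x. (avg j g (x + 2 powi j) - avg j g x) / 2)" using dif_Suc[OF i, of j] by (intro ext)
  ultimately show ?thesis by (simp only:)
 qed
 also have "... = (nrm (%x. avg j g (x + 2 powi j)) + nrm (avg j g)) / 2" using avg_L2c(1)[OF g, of j] by (intro nrm_half L2c_shift)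
 also have "... = nrm (avg j g)" by (simp add: nrm_shift)
 finally show ?thesis .
qed

lemma square_function:
 assumes g: "L2c g"
 shows "(SUM a<A. nrm (dif (m + 1 + int a) g)) <= nrm g"
proof -
 have "(SUM a<A. nrm (dif (m + 1 + int a) g)) = nrm (avg m g) - nrm (avg (m + int A) g)"
 proof (induction A)
  case (Suc A)
  then show ?case using nrm_step[OF g, of "m + int A"] by (simp add: algebra_simps)
 qed simp
 then show ?thesis using nrm_nonneg[of "avg (m + int A) g"] avg_L2c(2)[OF g, of m] by linarith
qed

lemma mass_sum:
 assumes "integrable lborel g" "0 <= s"
 shows "mass g x (x + real N * s) = (SUM m<N. mass g (x + real m * s) (x + real m * s + s))"
proof (induction N)
 case (Suc N)
 have "mass g x (x + real (Suc N) * s) = mass g x (x + real N * s) + mass g (x + real N * s) (x + real (Suc N) * s)" using assms by (intro mass_split) (auto simp: algebra_simps)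
 then show ?case using Suc by (simp add: algebra_simps)
qed simp

lemma avg_fine:
 assumes "integrable lborel g"
 shows "avg (i + int n) g x = (SUM m<2 ^ n. avg i g (x + real m * 2 powi i)) / 2 ^ n"
proof -
 let ?s = "2 powi i :: real"
 have "2 powi (i + int n) = 2 ^ n * ?s" by (simp add: power_int_add)
 then have "avg (i + int n) g x = mass g x (x + real (2 ^ n) * ?s) / (2 ^ n * ?s)" by (simp add: avg_def)
 also have "... = (SUM m<2 ^ n. mass g (x + real m * ?s) (x + real m * ?s + ?s)) / (2 ^ n * ?s)" by (subst mass_sum[OF assms]) (auto simp: less_imp_le)
 also have "... = (SUM m<2 ^ n. avg i g (x + real m * ?s)) / 2 ^ n" by (simp add: avg_def sum_divide_distrib mult.commute)
 finally show ?thesis .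
qed

text \<open>A difference at scale \<open>i + n\<close> is nearly constant at scale \<open>i\<close>, so shifting by \<open>2\<^sup>i\<close> gains cancellation.\<close>

lemma cross_term:
 assumes g: "L2c g"
 defines "q \<equiv> %i j x. (avg i g (x + 2 powi j) - avg i g x) / 2"
 shows "abs (ip (dif (i + 1) g) (dif (i + int n + 1) g)) <= nrm (q i (i + int n)) / 2 ^ n"
proof -
 note ig = L2c_integrable[OF g]
 define s where "s = (2 powi i :: real)"
 define N where "N = (2 :: nat) ^ n"
 define u where "u = avg i g"
 define h where "h = q i (i + int n)"
 have Ns: "2 powi (i + int n) = real N * s" by (simp add: power_int_add N_def s_def)
 have N: "0 < real N" by (simp add: N_def)
 have u: "L2c u" unfolding u_def by (rule avg_L2c[OF g])
 have h_eq: "h = (%x. (1/2) * u (x + real N * s) + (-1/2) * u x)" unfolding h_def q_def u_def Ns by (auto simp: field_simps)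
 have h: "L2c h" unfolding h_eq by (intro L2c_add L2c_shift u)
 have d1: "dif (i + 1) g = (%x. (1/2) * u (x + s) + (-1/2) * u x)" using dif_Suc[OF ig, of i] by (auto simp: u_def s_def field_simps)
 have d2: "dif (i + int n + 1) g = (%x. SUM m<N. (1 / real N) * h (x + real m * s))"
 proof
  fix x
  have "dif (i + int n + 1) g x = ((SUM m<N. u (x + real N * s + real m * s)) / real N - (SUM m<N. u (x + real m * s)) / real N) / 2"
   using dif_Suc[OF ig, of "i + int n" x] avg_fine[OF ig, of i n] unfolding Ns u_def s_def N_def by simp
  also have "... = (SUM m<N. (1 / real N) * h (x + real m * s))" unfolding h_eq by (simp add: sum_divide_distrib sum_subtractf[symmetric] field_simps)
  finally show "dif (i + int n + 1) g x = (SUM m<N. (1 / real N) * h (x + real m * s))" .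
 qed
 define a where "a t = ip u (%x. h (x + t))" for t
 have m: "ip (dif (i + 1) g) (%x. h (x + t)) = (1/2) * (a (t - s) - a t)" for t
 proof -
  have "ip (dif (i + 1) g) (%x. h (x + t)) = (1/2) * ip (%x. u (x + s)) (%x. h (x + t)) + (-1/2) * a t" unfolding d1 a_def by (intro ip_add L2c_shift u h)
  also have "ip (%x. u (x + s)) (%x. h (x + t)) = ip (%x. u (x + s)) (%x. h (x + s + (t - s)))" by (simp add: algebra_simps)
  also have "... = a (t - s)" unfolding a_def using ip_shift[of u s "%x. h (x + (t - s))"] by simp
  finally show ?thesis by (simp add: algebra_simps)
 qed
 have tele: "(SUM m<K. a (real m * s - s) - a (real m * s)) = a (- s) - a (real K * s - s)" for K :: nat by (induction K) (auto simp: algebra_simps)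
 have "ip (dif (i + 1) g) (dif (i + int n + 1) g) = (SUM m<N. (1 / real N) * ip (dif (i + 1) g) (%x. h (x + real m * s)))" unfolding d2 by (intro ip_sum L2c_shift h dif_L2c g) auto
 also have "... = (1 / real N) * (1/2) * (SUM m<N. a (real m * s - s) - a (real m * s))" by (simp add: m sum_distrib_left)
 also have "... = (1 / real N) * (1/2) * (a (- s) - a (real N * s - s))" by (simp only: tele)
 also have "a (real N * s - s) = ip (%x. u (x + - (real N * s))) (%x. h (x + - s))"
  unfolding a_def using ip_shift[of "%x. u (x + - (real N * s))" "real N * s" "%x. h (x + - s)"] by (simp add: algebra_simps)
 also have "a (- s) - ... = 2 * ip (%x. h (x + - (real N * s))) (%x. h (x + - s))"
 proof -
  have hs: "(%x. h (x + - (real N * s))) = (%x. (1/2) * u x + (-1/2) * u (x + - (real N * s)))" unfolding h_eq by auto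
  have "ip (%x. h (x + - (real N * s))) (%x. h (x + - s)) = (1/2) * ip u (%x. h (x + - s)) + (-1/2) * ip (%x. u (x + - (real N * s))) (%x. h (x + - s))"
   unfolding hs by (intro ip_add L2c_shift u h)
  then show ?thesis by (simp add: a_def)
 qed
 finally have "ip (dif (i + 1) g) (dif (i + int n + 1) g) = (1 / real N) * ip (%x. h (x + - (real N * s))) (%x. h (x + - s))" by simp
 then have "abs (ip (dif (i + 1) g) (dif (i + int n + 1) g)) = (1 / real N) * abs (ip (%x. h (x + - (real N * s))) (%x. h (x + - s)))" by (simp add: abs_mult)
 also have "... <= (1 / real N) * ((nrm (%x. h (x + - (real N * s))) + nrm (%x. h (x + - s))) / 2)" by (intro mult_left_mono ip_bound L2c_shift h) auto
 also have "... = nrm h / 2 ^ n" by (simp only: nrm_shift) (simp add: N_def)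
 finally show ?thesis by (simp add: h_def)
qed

lemma cross_norm:
 assumes g: "L2c g"
 shows "nrm (%x. (avg i g (x + 2 powi (i + int n)) - avg i g x) / 2) <= real (n + 1) * (SUM l<=n. nrm (dif (i + 1 + int l) g))"
proof -
 note ig = L2c_integrable[OF g]
 define s where "s = (2 powi (i + int n) :: real)"
 have tele: "avg i g x = avg (i + int n) g x - (SUM l<n. dif (i + 1 + int l) g x)" for x by (induction n) (auto simp: dif_def algebra_simps)
 define Q where "Q l x = (if l = n then dif (i + int n + 1) g x else - (dif (i + 1 + int l) g (x + s) - dif (i + 1 + int l) g x) / 2)" for l x
 have eq: "(avg i g (x + s) - avg i g x) / 2 = (SUM l<=n. Q l x)" for x
 proof -
  have "(avg i g (x + s) - avg i g x) / 2 = (avg (i + int n) g (x + s) - avg (i + int n) g x) / 2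
    + (SUM l<n. - (dif (i + 1 + int l) g (x + s) - dif (i + 1 + int l) g x) / 2)"
   unfolding tele by (simp add: sum_divide_distrib[symmetric] sum_subtractf sum_negf algebra_simps add_divide_distrib diff_divide_distrib)
  also have "(avg (i + int n) g (x + s) - avg (i + int n) g x) / 2 = Q n x" unfolding Q_def s_def using dif_Suc[OF ig, of "i + int n" x] by simp
  also have "(SUM l<n. - (dif (i + 1 + int l) g (x + s) - dif (i + 1 + int l) g x) / 2) = (SUM l<n. Q l x)" by (intro sum.cong) (auto simp: Q_def)
  finally show ?thesis by (simp add: lessThan_Suc_atMost[symmetric])
 qed
 have QL: "L2c (Q l)" for l
 proof (cases "l = n")
  case True then show ?thesis using dif_L2c[OF g] by (simp add: Q_def[abs_def])
 next
  case False
  have "L2c (%x. (-1/2) * dif (i + 1 + int l) g (x + s) + (1/2) * dif (i + 1 + int l) g x)" by (intro L2c_add L2c_shift dif_L2c g)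
  moreover have "Q l = (%x. (-1/2) * dif (i + 1 + int l) g (x + s) + (1/2) * dif (i + 1 + int l) g x)" using False by (auto simp: Q_def field_simps)
  ultimately show ?thesis by simp
 qed
 have Qn: "nrm (Q l) <= nrm (dif (i + 1 + int l) g)" for l
 proof (cases "l = n")
  case True then show ?thesis by (simp add: Q_def[abs_def] add_ac)
 next
  case False
  let ?d = "dif (i + 1 + int l) g"
  have "nrm (%x. (?d (x + s) + ?d x) / 2) + nrm (%x. (?d (x + s) - ?d x) / 2) = (nrm (%x. ?d (x + s)) + nrm ?d) / 2" by (intro nrm_half L2c_shift dif_L2c g)
  then have "nrm (%x. (?d (x + s) - ?d x) / 2) <= nrm ?d" using nrm_nonneg[of "%x. (?d (x + s) + ?d x) / 2"] by (simp add: nrm_shift)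
  moreover have "nrm (Q l) = nrm (%x. (?d (x + s) - ?d x) / 2)" using False by (simp add: nrm_def Q_def power_divide power2_commute)
  ultimately show ?thesis by simp
 qed
 have "nrm (%x. SUM l<=n. Q l x) <= (LINT x|lborel. real (n + 1) * (SUM l<=n. (Q l x)^2))" unfolding nrm_def
 proof (rule integral_mono)
  show "integrable lborel (%x. (SUM l<=n. Q l x)^2)" using L2c_sum[of "{..n}" Q "%_. 1"] QL by (simp add: L2c_def)
  show "integrable lborel (%x. real (n + 1) * (SUM l<=n. (Q l x)^2))" using QL by (auto simp: L2c_def)
  show "(SUM l<=n. Q l x)^2 <= real (n + 1) * (SUM l<=n. (Q l x)^2)" for x using sum_squared_le_sum_of_squares[of "%l. Q l x" "{..n}"] by (simp add: mult.commute)
 qed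
 also have "... = real (n + 1) * (SUM l<=n. nrm (Q l))" unfolding nrm_def using QL by (subst integral_mult_right_zero) (simp add: L2c_def)
 also have "... <= real (n + 1) * (SUM l<=n. nrm (dif (i + 1 + int l) g))" by (intro mult_left_mono sum_mono Qn) auto
 finally show ?thesis unfolding s_def[symmetric] eq .
qed

definition psum :: "(int => real) => int => nat => (real => real) => real => real" where
 "psum v m A g x = (SUM a<A. v (m + int a) * dif (m + int a) g x)"

lemma psum_L2c: "L2c g ==> L2c (psum v m A g)" unfolding psum_def[abs_def] by (intro L2c_sum dif_L2c) auto

lemma Suc_le_pow: "real n + 1 <= 2 * (3/2) ^ n"
proof (induction n)
 case (Suc n)
 have one: "1 <= (3/2 :: real) ^ n" by simp
 have "real (Suc n) + 1 <= 2 * (3/2) ^ n + (3/2) ^ n" using Suc one by linarith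
 then show ?case by simp
qed simp

lemma dist_power_sum: "(SUM a<A. (3/4 :: real) ^ ((a - l) + (l - a))) <= 8"
proof -
 let ?f = "%a. (3/4 :: real) ^ ((a - l) + (l - a))"
 have geo: "(SUM k<n. (3/4 :: real) ^ k) <= 4" for n by (subst sum_gp_strict) (simp add: field_simps)
 have "(SUM a<A. ?f a) <= (SUM a<Suc l + A. ?f a)" by (intro sum_mono2) auto
 also have "... = (SUM a<Suc l. ?f a) + (SUM a<A. ?f (Suc l + a))" by (induction A) auto
 also have "(SUM a<Suc l. ?f a) = (SUM a<Suc l. (3/4) ^ (Suc l - Suc a))" by (intro sum.cong) auto
 also have "... = (SUM k<Suc l. (3/4) ^ k)" by (rule sum.nat_diff_reindex)
 also have "... <= 4" by (rule geo)
 also have "(SUM a<A. ?f (Suc l + a)) <= (SUM a<A. (3/4) ^ a)" by (intro sum_mono power_decreasing) auto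
 also have "... <= 4" by (rule geo)
 finally show ?thesis by simp
qed

text \<open>The inner product decays geometrically in the distance of the scales, up to square function terms of the
 scales around them.\<close>

lemma almost_orthogonal:
 assumes g: "L2c g" and ab: "a < A" "b < A"
 shows "abs (ip (dif (m + int a) g) (dif (m + int b) g)) <=
  2 * (SUM l<A. (3/4) ^ ((a - l) + (l - a)) * (3/4) ^ ((b - l) + (l - b)) * nrm (dif (m + int l) g))"
proof -
 let ?e = "%l. nrm (dif (m + int l) g)"
 have main: "abs (ip (dif (m + int a) g) (dif (m + int b) g)) <=
  2 * (SUM l<A. (3/4) ^ ((a - l) + (l - a)) * (3/4) ^ ((b - l) + (l - b)) * ?e l)" if "a <= b" "b < A" for a b
 proof -
  define n where "n = b - a"
  have b: "b = a + n" using that by (simp add: n_def)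
  have "abs (ip (dif (m + int a - 1 + 1) g) (dif (m + int a - 1 + int n + 1) g)) <=
   nrm (%x. (avg (m + int a - 1) g (x + 2 powi (m + int a - 1 + int n)) - avg (m + int a - 1) g x) / 2) / 2 ^ n" by (rule cross_term[OF g])
  also have "... <= real (n + 1) * (SUM l<=n. nrm (dif (m + int a - 1 + 1 + int l) g)) / 2 ^ n" by (intro divide_right_mono cross_norm g) auto
  also have "... = real (n + 1) / 2 ^ n * (SUM l<=n. ?e (a + l))" by (simp add: algebra_simps)
  also have "... <= (2 * (3/4) ^ n) * (SUM l<=n. ?e (a + l))"
  proof (rule mult_right_mono)
   have "real (n + 1) / 2 ^ n <= 2 * (3/2) ^ n / 2 ^ n" using Suc_le_pow[of n] by (intro divide_right_mono) auto
   also have "... = 2 * (3/4) ^ n" 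
   proof -
    have "(3/2 :: real) ^ n / 2 ^ n = (3/4) ^ n" by (subst power_divide[symmetric]) simp
    then show ?thesis by (simp only: times_divide_eq_right[symmetric])
   qed
   finally show "real (n + 1) / 2 ^ n <= 2 * (3/4) ^ n" .
  qed (simp add: sum_nonneg nrm_nonneg)
  also have "... = 2 * (SUM l<=n. (3/4) ^ n * ?e (a + l))" by (simp add: sum_distrib_left mult.assoc)
  also have "(SUM l<=n. (3/4) ^ n * ?e (a + l)) = (SUM l:{a..b}. (3/4) ^ ((a - l) + (l - a)) * (3/4) ^ ((b - l) + (l - b)) * ?e l)"
   by (rule sum.reindex_bij_witness[of _ "%l. l - a" "%l. a + l"]) (auto simp: b power_add[symmetric])
  also have "... <= (SUM l<A. (3/4) ^ ((a - l) + (l - a)) * (3/4) ^ ((b - l) + (l - b)) * ?e l)" using that by (intro sum_mono2) (auto simp: nrm_nonneg)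
  finally have *: "abs (ip (dif (m + int a - 1 + 1) g) (dif (m + int a - 1 + int n + 1) g)) <=
   2 * (SUM l<A. (3/4) ^ ((a - l) + (l - a)) * (3/4) ^ ((b - l) + (l - b)) * ?e l)" by simp
  have e: "m + int a - 1 + 1 = m + int a" "m + int a - 1 + int n + 1 = m + int b" using b by simp_all
  show ?thesis using * unfolding e .
 qed
 show ?thesis
 proof (cases "a <= b")
  case True then show ?thesis using main ab by blast
 next
  case False
  have "abs (ip (dif (m + int b) g) (dif (m + int a) g)) <=
   2 * (SUM l<A. (3/4) ^ ((b - l) + (l - b)) * (3/4) ^ ((a - l) + (l - a)) * ?e l)" using False ab by (intro main) auto
  then show ?thesis by (simp add: ip_commute mult_ac)
 qed
qed

lemma psum_L2_bound:
 assumes g: "L2c g" and v: "!!j. abs (v j) <= V"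
 shows "nrm (psum v m A g) <= 128 * V^2 * nrm g"
proof -
 have V: "0 <= V" using v[of 0] by linarith
 let ?d = "%a. dif (m + int a) g"
 let ?e = "%l. nrm (?d l)"
 let ?k = "%a l. (3/4 :: real) ^ ((a - l) + (l - a))"
 have S: "L2c (%x. SUM a<A. v (m + int a) * ?d a x)" by (intro L2c_sum dif_L2c g) auto
 have "nrm (psum v m A g) = ip (%x. SUM a<A. v (m + int a) * ?d a x) (%x. SUM a<A. v (m + int a) * ?d a x)" unfolding nrm_ip psum_def[abs_def] ..
 also have "... = (SUM b<A. v (m + int b) * ip (%x. SUM a<A. v (m + int a) * ?d a x) (?d b))" by (intro ip_sum S dif_L2c g) auto
 also have "... = (SUM b<A. v (m + int b) * (SUM a<A. v (m + int a) * ip (?d b) (?d a)))" by (subst ip_commute, subst ip_sum) (auto intro!: dif_L2c g)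
 also have "... = (SUM b<A. SUM a<A. v (m + int b) * v (m + int a) * ip (?d b) (?d a))" by (simp add: sum_distrib_left mult.assoc)
 also have "... <= (SUM b<A. SUM a<A. V^2 * (2 * (SUM l<A. ?k b l * ?k a l * ?e l)))"
 proof (intro sum_mono)
  fix a b assume ab: "b : {..<A}" "a : {..<A}"
  have "v (m + int b) * v (m + int a) * ip (?d b) (?d a) <= abs (v (m + int b)) * abs (v (m + int a)) * abs (ip (?d b) (?d a))" by (metis abs_ge_self abs_mult)
  also have "... <= V * V * (2 * (SUM l<A. ?k b l * ?k a l * ?e l))" using ab v V by (intro mult_mono almost_orthogonal g) auto
  finally show "v (m + int b) * v (m + int a) * ip (?d b) (?d a) <= V^2 * (2 * (SUM l<A. ?k b l * ?k a l * ?e l))" by (simp add: power2_eq_square)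
 qed
 also have "... = 2 * V^2 * (SUM l<A. (SUM b<A. ?k b l) * (SUM a<A. ?k a l) * ?e l)"
 proof -
  have "(SUM b<A. SUM a<A. V^2 * (2 * (SUM l<A. ?k b l * ?k a l * ?e l))) = 2 * V^2 * (SUM b<A. SUM a<A. SUM l<A. ?k b l * ?k a l * ?e l)" by (simp add: sum_distrib_left mult_ac)
  also have "(SUM b<A. SUM a<A. SUM l<A. ?k b l * ?k a l * ?e l) = (SUM l<A. SUM b<A. SUM a<A. ?k b l * ?k a l * ?e l)"
  proof -
   have "(SUM b<A. SUM a<A. SUM l<A. ?k b l * ?k a l * ?e l) = (SUM b<A. SUM l<A. SUM a<A. ?k b l * ?k a l * ?e l)" by (intro sum.cong refl sum.swap)
   also have "... = (SUM l<A. SUM b<A. SUM a<A. ?k b l * ?k a l * ?e l)" by (rule sum.swap)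
   finally show ?thesis .
  qed
  also have "... = (SUM l<A. (SUM b<A. ?k b l) * (SUM a<A. ?k a l) * ?e l)" by (simp only: sum_product) (simp only: sum_distrib_right)
  finally show ?thesis .
 qed
 also have "... <= 2 * V^2 * (SUM l<A. 8 * 8 * ?e l)" by (intro mult_left_mono sum_mono mult_mono dist_power_sum) (auto simp: nrm_nonneg sum_nonneg)
 also have "... = 128 * V^2 * (SUM l<A. ?e l)" by (simp add: sum_distrib_left mult.assoc)
 also have "(SUM l<A. ?e l) <= nrm g" using square_function[OF g, of "m - 1" A] by simp
 finally show ?thesis by (simp add: mult_left_mono)
qed

definition lend :: "real set => real => real" where "lend U x = Sup {y. y <= x & y ~: U}"
definition rend :: "real set => real => real" where "rend U x = Inf {y. x <= y & y ~: U}"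

text \<open>The good part of a Calderon--Zygmund decomposition at the components of \<open>U\<close>; the ends \<open>lend\<close>
 and \<open>rend\<close> of the component of a point are monotone in the point, hence measurable.\<close>

definition comp_mean :: "real set => (real => real) => real => real" where
 "comp_mean U g x = (if x : U then mass g (lend U x) (rend U x) / (rend U x - lend U x) else g x)"

lemma ends_component:
 assumes ac: "a < c" "{a<..<c} <= U" "a ~: U" "c ~: U" "a < x" "x < c"
 shows "lend U x = a" "rend U x = c"
proof -
 show "lend U x = a" unfolding lend_def
 proof (rule cSup_eq_maximum)
  show "a : {y. y <= x & y ~: U}" using ac by auto
  fix y assume y: "y : {y. y <= x & y ~: U}"
  show "y <= a"
  proof (rule ccontr)
   assume "\<not> y <= a"
   then have "y : {a<..<c}" using y ac by auto
   from subsetD[OF ac(2) this] show False using y by auto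
  qed
 qed
 show "rend U x = c" unfolding rend_def
 proof (rule cInf_eq_minimum)
  show "c : {y. x <= y & y ~: U}" using ac by auto
  fix y assume y: "y : {y. x <= y & y ~: U}"
  show "c <= y"
  proof (rule ccontr)
   assume "\<not> c <= y"
   then have "y : {a<..<c}" using y ac by auto
   from subsetD[OF ac(2) this] show False using y by auto
  qed
 qed
qed

lemma bounded_open_component:
 assumes U: "open U" "bounded U" and x: "x : U"
 obtains a c where "a < x" "x < c" "{a<..<c} <= U" "a ~: U" "c ~: U" "{a<..<c} : components U"
  "lend U x = a" "rend U x = c"
proof -
 obtain C where C: "C : components U" "x : C" using x Union_components[of U] by blast
 obtain a c where ac: "a < c" "C = {a<..<c}" "a ~: U" "c ~: U" using component_Ioo[OF U C(1)] .
 have sub: "{a<..<c} <= U" using C ac in_components_subset by blast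
 have x': "a < x" "x < c" using C ac by auto
 show ?thesis by (rule that[OF x' sub ac(3,4)]) (use C ac ends_component[OF ac(1) sub ac(3,4) x'] in auto)
qed

lemma ends_bounds:
 assumes U: "open U" "bounded U"
 shows "lend U x <= x" "x <= rend U x"
proof -
 have "EX y. y <= x & y ~: U" "EX y. x <= y & y ~: U"
 proof -
  obtain B where B: "!!y. y : U ==> abs y <= B" using U(2) by (auto simp: bounded_iff)
  have "min x (- abs B - 1) ~: U" "max x (abs B + 1) ~: U" using B[of "min x (- abs B - 1)"] B[of "max x (abs B + 1)"] by auto
  then show "EX y. y <= x & y ~: U" "EX y. x <= y & y ~: U" by (metis min.cobounded1, metis max.cobounded1)
 qed
 then show "lend U x <= x" "x <= rend U x" unfolding lend_def rend_def by (auto intro!: cSup_least cInf_greatest)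
qed

lemma ends_mono:
 assumes U: "open U" "bounded U"
 shows "mono (lend U)" "mono (rend U)"
proof -
 obtain B where B: "!!y. y : U ==> abs y <= B" using U(2) by (auto simp: bounded_iff)
 have ne: "min x (- abs B - 1) ~: U" "max x (abs B + 1) ~: U" for x using B[of "min x (- abs B - 1)"] B[of "max x (abs B + 1)"] by auto
 show "mono (lend U)" unfolding lend_def
 proof (intro monoI cSup_subset_mono)
  fix x y :: real assume "x <= y"
  show "{z. z <= x & z ~: U} ~= {}" using ne(1)[of x] by (auto intro!: exI[of _ "min x (- abs B - 1)"])
  show "bdd_above {z. z <= y & z ~: U}" by (rule bdd_aboveI[of _ y]) auto
  show "{z. z <= x & z ~: U} <= {z. z <= y & z ~: U}" using \<open>x <= y\<close> by auto
 qed
 show "mono (rend U)" unfolding rend_def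
 proof (intro monoI cInf_superset_mono)
  fix x y :: real assume "x <= y"
  show "{z. y <= z & z ~: U} ~= {}" using ne(2)[of y] by (auto intro!: exI[of _ "max y (abs B + 1)"])
  show "bdd_below {z. x <= z & z ~: U}" by (rule bdd_belowI[of _ x]) auto
  show "{z. y <= z & z ~: U} <= {z. x <= z & z ~: U}" using \<open>x <= y\<close> by auto
 qed
qed

lemma mass_eq_Phi:
 assumes g: "integrable lborel g" and xy: "x <= y"
 shows "mass g x y = (LINT t:{..y}|lborel. g t) - (LINT t:{..x}|lborel. g t)"
proof -
 have i: "set_integrable lborel S g" if "S : sets borel" for S using that g unfolding set_integrable_def by (intro integrable_mult_indicator) auto
 have "(LINT t:{..y}|lborel. g t) = (LINT t:{..x} Un {x<..y}|lborel. g t)" using xy by (intro arg_cong[where f="%S. LINT t:S|lborel. g t"]) auto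
 also have "... = (LINT t:{..x}|lborel. g t) + (LINT t:{x<..y}|lborel. g t)" by (intro set_integral_Un i) auto
 also have "(LINT t:{x<..y}|lborel. g t) = mass g x y" unfolding mass_def sli_def
  by (intro integral_cong_AE) (use g AE_lborel_singleton[of x] in \<open>auto simp: indicator_def elim!: eventually_mono\<close>)
 finally show ?thesis by simp
qed

lemma Phi_mono_measurable:
 fixes g :: "real => real"
 assumes g: "integrable lborel g" "!!t. 0 <= g t"
 shows "(%y. LINT t:{..y}|lborel. g t) : Borel"
proof (rule borel_measurable_mono, rule monoI)
 fix x y :: real assume "x <= y"
 then show "(LINT t:{..x}|lborel. g t) <= (LINT t:{..y}|lborel. g t)" using mass_eq_Phi[OF g(1), of x y] mass_nonneg[of g x y] g(2) by simp
qed

lemma comp_mean_measurable: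
 assumes U: "open U" "bounded U" and g: "integrable lborel g" "!!t. 0 <= g t" "g : Borel"
 shows "comp_mean U g : Borel"
proof -
 have [measurable]: "lend U : Borel" "rend U : Borel" by (rule borel_measurable_mono[OF ends_mono(1)[OF U]], rule borel_measurable_mono[OF ends_mono(2)[OF U]])
 have [measurable]: "g : Borel" "U : sets borel" using g(3) U(1) by auto
 note [measurable] = Phi_mono_measurable[OF g(1,2)]
 have "comp_mean U g = (%x. if x : U then ((LINT t:{..rend U x}|lborel. g t) - (LINT t:{..lend U x}|lborel. g t)) / (rend U x - lend U x) else g x)"
  unfolding comp_mean_def using ends_bounds[OF U] by (intro ext if_cong refl, subst mass_eq_Phi[OF g(1)]) (auto intro: order_trans)
 also have "... : Borel" using measurable_compose[OF \<open>rend U : Borel\<close> Phi_mono_measurable[OF g(1,2)]]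
   measurable_compose[OF \<open>lend U : Borel\<close> Phi_mono_measurable[OF g(1,2)]] by measurable
 finally show ?thesis .
qed

lemma comp_mean_nonneg:
 assumes "open U" "bounded U" "!!t. 0 <= g t"
 shows "0 <= comp_mean U g x" using ends_bounds[OF assms(1,2), of x] assms(3) by (auto simp: comp_mean_def intro!: divide_nonneg_nonneg mass_nonneg)

lemma comp_mean_emeasure:
 assumes U: "open U" "bounded U" and g: "integrable lborel g" "!!t. 0 <= g t" "g : Borel"
  and xy: "x ~: U" "y ~: U"
 shows "(lint_on {x<..<y} (%t. enn (comp_mean U g t))) = (lint_on {x<..<y} (%t. enn (g t)))"
proof -
 let ?E = "comp_mean U g"
 have [measurable]: "?E : Borel" "g : Borel" "U : sets borel" using comp_mean_measurable[OF U g] g U by auto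
 let ?N1 = "density lborel (%t. enn (?E t))" and ?N2 = "density lborel (%t. enn (g t))"
 have fam: "fam (components U)" by (rule fam_components[OF U]) auto
 have eqC: "emeasure ?N1 (C Int {x<..<y}) = emeasure ?N2 (C Int {x<..<y})" if C: "C : components U" for C
 proof -
  obtain a c where ac: "a < c" "C = {a<..<c}" "a ~: U" "c ~: U" using component_Ioo[OF U C] .
  have sub: "{a<..<c} <= U" using C ac in_components_subset by blast
  have "\<not> (a < x & x < c)" "\<not> (a < y & y < c)" using sub xy by auto
  then consider "C Int {x<..<y} = {}" | "C Int {x<..<y} = {a<..<c}" using ac by fastforce
  then show ?thesis
  proof cases
   case 2
   have "emeasure ?N1 {a<..<c} = (lint (%t. enn (?E t) * ind {a<..<c} t))" by (intro emeasure_density) auto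
   also have "... = (lint (%t. enn (mass g a c / (c - a)) * ind {a<..<c} t))"
   proof (rule nn_integral_cong)
    fix t
    show "enn (?E t) * ind {a<..<c} t = enn (mass g a c / (c - a)) * ind {a<..<c} t"
    proof (cases "t : {a<..<c}")
     case True
     then show ?thesis using ends_component[OF ac(1) sub ac(3,4), of t] subsetD[OF sub True] by (simp add: comp_mean_def)
    qed simp
   qed
   also have "... = enn (mass g a c / (c - a)) * enn (c - a)" using ac by (subst nn_integral_cmult_indicator) auto
   also have "... = enn (mass g a c)" using ac mass_nonneg[of g a c] g(2) by (subst ennreal_mult[symmetric]) auto
   also have "... = emeasure ?N2 {a<..<c}" by (rule emeasure_density_Ioo[OF g, symmetric])
   finally show ?thesis using 2 by simp
  qed simp
 qed
 have "emeasure ?N1 (\<Union>(components U) Int {x<..<y}) = emeasure ?N2 (\<Union>(components U) Int {x<..<y})"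
 proof -
  have "(nn_integral (count_space (components U)) (%C. emeasure ?N1 (C Int {x<..<y}))) = (nn_integral (count_space (components U)) (%C. emeasure ?N2 (C Int {x<..<y})))"
   by (rule nn_integral_cong) (rule eqC, simp)
  moreover have "(nn_integral (count_space (components U)) (%C. emeasure ?N1 (C Int {x<..<y}))) = emeasure ?N1 (\<Union>(components U) Int {x<..<y})"
   by (rule fam_sum_measure[OF fam]) simp_all
  moreover have "(nn_integral (count_space (components U)) (%C. emeasure ?N2 (C Int {x<..<y}))) = emeasure ?N2 (\<Union>(components U) Int {x<..<y})"
   by (rule fam_sum_measure[OF fam]) simp_all
  ultimately show ?thesis by (simp only:)
 qed
 then have inU: "(lint_on (U Int {x<..<y}) (%t. enn (?E t))) = (lint_on (U Int {x<..<y}) (%t. enn (g t)))" by (simp add: emeasure_density)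
 have split: "(lint_on {x<..<y} (%t. enn (f t))) = (lint_on (U Int {x<..<y}) (%t. enn (f t))) + (lint_on ({x<..<y} - U) (%t. enn (f t)))"
  if [measurable]: "f : Borel" for f :: "real => real" by (subst nn_integral_add[symmetric]) (auto intro!: nn_integral_cong simp: indicator_def)
 have "(lint_on ({x<..<y} - U) (%t. enn (?E t))) = (lint_on ({x<..<y} - U) (%t. enn (g t)))" by (intro nn_integral_cong) (auto simp: comp_mean_def indicator_def)
 then show ?thesis using inU by (simp add: split)
qed

section \<open>The weak type inequality\<close>

lemma mass_add:
 assumes "integrable lborel g" "integrable lborel h"
 shows "mass (%t. a * g t + b * h t) x y = a * mass g x y + b * mass h x y"
proof -
 have "(%t. ind {x..y} t *\<^sub>R (a * g t + b * h t)) = (%t. a * (ind {x..y} t *\<^sub>R g t) + b * (ind {x..y} t *\<^sub>R h t))" by (auto simp: algebra_simps)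
 then show ?thesis using set_integrable_Icc[OF assms(1), of x y] set_integrable_Icc[OF assms(2), of x y] unfolding mass_def sli_def set_integrable_def by simp
qed

lemma avg_add:
 assumes "integrable lborel g" "integrable lborel h"
 shows "avg j (%t. a * g t + b * h t) x = a * avg j g x + b * avg j h x" unfolding avg_def mass_add[OF assms] by (simp add: add_divide_distrib)

lemma psum_add:
 assumes "integrable lborel g" "integrable lborel h"
 shows "psum v m A (%t. a * g t + b * h t) x = a * psum v m A g x + b * psum v m A h x" unfolding psum_def dif_def avg_add[OF assms]
 by (simp add: sum_distrib_left sum.distrib[symmetric] algebra_simps)

lemma mass_abs_le: "integrable lborel g ==> abs (mass g x y) <= mass (%t. abs (g t)) x y" unfolding mass_def sli_def
 using integral_abs_bound[of lborel "%t. ind {x..y} t *\<^sub>R g t"] by (simp add: abs_mult)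

lemma psum_le_avgs:
 assumes v: "!!j. abs (v j) <= V"
 shows "abs (psum v m A g x) <= 2 * V * (SUM a<Suc A. abs (avg (m - 1 + int a) g x))"
proof -
 have V: "0 <= V" using v[of 0] by linarith
 have "abs (psum v m A g x) <= (SUM a<A. abs (v (m + int a) * dif (m + int a) g x))" unfolding psum_def by (rule sum_abs)
 also have "... <= (SUM a<A. V * (abs (avg (m - 1 + int (Suc a)) g x) + abs (avg (m - 1 + int a) g x)))"
 proof (rule sum_mono)
  fix a
  have "abs (dif (m + int a) g x) <= abs (avg (m - 1 + int (Suc a)) g x) + abs (avg (m - 1 + int a) g x)" unfolding dif_def by (simp add: algebra_simps abs_triangle_ineq4)
  then show "abs (v (m + int a) * dif (m + int a) g x) <= V * (abs (avg (m - 1 + int (Suc a)) g x) + abs (avg (m - 1 + int a) g x))" unfolding abs_mult using v V by (intro mult_mono) auto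
 qed
 also have "... = V * ((SUM a<A. abs (avg (m - 1 + int (Suc a)) g x)) + (SUM a<A. abs (avg (m - 1 + int a) g x)))" by (simp only: sum_distrib_left[symmetric] sum.distrib)
 also have "... <= V * ((SUM a<Suc A. abs (avg (m - 1 + int a) g x)) + (SUM a<Suc A. abs (avg (m - 1 + int a) g x)))"
 proof (intro mult_left_mono add_mono V)
  show "(SUM a<A. abs (avg (m - 1 + int (Suc a)) g x)) <= (SUM a<Suc A. abs (avg (m - 1 + int a) g x))" by (subst sum.lessThan_Suc_shift) simp
  show "(SUM a<A. abs (avg (m - 1 + int a) g x)) <= (SUM a<Suc A. abs (avg (m - 1 + int a) g x))" by simp
 qed
 finally show ?thesis by (simp add: algebra_simps)
qed

lemma nn_integral_shift: 
 assumes "f : Borel"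
 shows "(lint (%x. f (x + t :: real))) = (lint (%x. f x))" using nn_integral_real_affine[of f 1 t] assms by (simp add: add.commute)

lemma emeasure_nrm_le:
 assumes "L2c g" "0 < l"
 shows "leb {x. l < abs (g x)} <= enn (nrm g / l^2)"
proof -
 have [measurable]: "g : Borel" using assms by (simp add: L2c_def)
 have "leb {x. l < abs (g x)} = (lint (%x. ind {x. l < abs (g x)} x))" by simp
 also have "... <= (lint (%x. enn ((g x)^2 / l^2)))"
 proof (rule nn_integral_mono)
  fix x
  show "ind {x. l < abs (g x)} x <= enn ((g x)^2 / l^2)"
  proof (cases "l < abs (g x)")
   case True
   then have "l^2 <= abs (g x)^2" using assms(2) by (intro power_mono) auto
   then have "1 <= (g x)^2 / l^2" using assms(2) by simp
   then show ?thesis using True by simp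
  qed simp
 qed
 also have "... = enn (LINT x|lborel. (g x)^2 / l^2)" using assms by (intro nn_integral_eq_integral) (auto simp: L2c_def)
 also have "(LINT x|lborel. (g x)^2 / l^2) = nrm g / l^2" by (simp add: nrm_def)
 finally show ?thesis .
qed

text \<open>The nonzero terms form a geometric series whose first term is below \<open>1\<close>.\<close>

lemma sum_scales_above:
 assumes l: "0 <= l"
 shows "(SUM a<n. if l < 2 powi (m + int a) then l / 2 powi (m + int a) else 0) <= (2 :: real)"
proof -
 define u where "u a = l / 2 powi (m + int a)" for a
 have u0: "0 <= u a" for a using l by (simp add: u_def less_imp_le)
 have us: "u (Suc a) = u a / 2" for a
 proof -
  have "(2 :: real) powi (m + int (Suc a)) = 2 * 2 powi (m + int a)" using powi_Suc[of "m + int a"] by (simp add: algebra_simps)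
  then show ?thesis by (simp add: u_def)
 qed
 have "(SUM a<n. if l < 2 powi (m + int a) then l / 2 powi (m + int a) else 0) <= (SUM a<n. 2 * (min 1 (u a) - min 1 (u (Suc a))))"
 proof (rule sum_mono)
  fix a
  have "(l < 2 powi (m + int a)) = (u a < 1)" by (simp add: u_def field_simps)
  then show "(if l < 2 powi (m + int a) then l / 2 powi (m + int a) else 0) <= 2 * (min 1 (u a) - min 1 (u (Suc a)))" using u0[of a] us[of a] by (auto simp: u_def[symmetric] min_def)
 qed
 also have "... = 2 * (min 1 (u 0) - min 1 (u n))" by (simp only: sum_distrib_left[symmetric] sum_lessThan_telescope'[of "%i. min 1 (u i)"])
 also have "... <= 2" using u0[of n] by (simp add: min_def)
 finally show ?thesis .
qed

text \<open>Calderon--Zygmund decomposition at height proportional to \<open>lam / V\<close>. The good part is estimated in \<open>L\<^sup>2\<close>. The bad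
 part has mean zero on components, so away from a neighbourhood of \<open>U\<close> an average only sees
 the component containing its right end point.\<close>

lemma weak_type_psum:
 assumes g: "L2c g" and v: "!!j. abs (v j) <= V" and V: "0 < V" and lam: "0 < lam"
 shows "leb {x. lam < abs (psum v m A g x)} <= enn (600 * V / lam * (LINT x|lborel. abs (g x)))"
proof -
 define al where "al = lam / V"
 have al: "0 < al" using V lam by (simp add: al_def)
 define G where "G = (LINT x|lborel. abs (g x))"
 have gm [measurable]: "g : Borel" using g by (simp add: L2c_def)
 have ig: "integrable lborel g" by (rule L2c_integrable[OF g])
 have iag: "integrable lborel (%x. abs (g x))" using ig by (rule integrable_abs)
 have G0: "0 <= G" by (simp add: G_def)
 obtain R where R: "!!x. R < abs x ==> g x = 0" using g by (auto simp: L2c_def)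
 define h where "h x = abs (g x) / al" for x
 have h0: "0 <= h x" for x using al by (simp add: h_def)
 have hm [measurable]: "h : Borel" unfolding h_def[abs_def] by measurable
 have ih: "integrable lborel h" unfolding h_def[abs_def] using iag by simp
 have ibh: "ibs h" unfolding ibs_def using ih R by (auto simp: h_def intro!: exI[of _ R])
 define U where "U = rset h"
 have U: "open U" "bounded U" unfolding U_def using open_rset[OF ih h0] bounded_rset[OF ibh h0] by auto
 have Ub [measurable]: "U : sets borel" using U by simp
 have UG: "leb U <= enn (G / al)" using rset_weak_type[OF ibh h0 hm] by (simp add: U_def h_def G_def)
 have massU: "mass (%t. abs (g t)) x y <= al * (y - x)" if "x ~: U" "x <= y" for x y
 proof -
  have "mass h x y <= y - x" using not_rset[of x h y] that by (simp add: U_def)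
  moreover have "mass h x y = mass (%t. abs (g t)) x y / al" using mass_add[OF iag iag, of "1 / al" 0 x y] by (simp add: h_def[abs_def])
  ultimately show ?thesis using al by (simp add: field_simps)
 qed
 define h4 where "h4 x = 4 * h x" for x
 have ibh4: "ibs h4" 
 proof -
  have "integrable lborel h4" unfolding h4_def[abs_def] using ih by simp
  then show ?thesis unfolding ibs_def using R by (auto simp: h_def h4_def intro!: exI[of _ R])
 qed
 define U4 where "U4 = rset h4"
 have U4b [measurable]: "U4 : sets borel" unfolding U4_def using open_rset[of h4] ibh4 h0 by (auto simp: ibs_def h4_def)
 have U4G: "leb U4 <= enn (4 * G / al)"
 proof -
  have "leb U4 <= enn (LINT t|lborel. h4 t)" unfolding U4_def using h0 by (intro rset_weak_type ibh4) (auto simp: h4_def[abs_def])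
  also have "(LINT t|lborel. h4 t) = 4 * G / al" by (simp add: h4_def h_def G_def)
  finally show ?thesis .
 qed
 have mass4: "mass h4 x y = 4 * mass h x y" for x y using mass_add[OF ih ih, of 4 0 x y] by (simp add: h4_def[abs_def])
 have UU4: "x : U4" if x: "x : U" for x
 proof -
  obtain y where "x < y" "y - x < mass h x y" using x by (auto simp: U_def rset_def)
  then have "y - x < mass h4 x y" unfolding mass4 by simp
  then show ?thesis using \<open>x < y\<close> by (auto simp: U4_def rset_def)
 qed
 have short: "rend U y - lend U y < y - x" if x: "x ~: U4" and y: "y : U" "x < y" for x y
 proof -
  obtain a c where ac: "a < y" "y < c" "{a<..<c} <= U" "a ~: U" "c ~: U" "lend U y = a" "rend U y = c" using bounded_open_component[OF U y(1)] by metis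
  have "x ~: U" using x UU4 by blast
  then have xa: "x <= a" using ac y(2) by (metis greaterThanLessThan_iff leI less_trans subsetD)
  have "c - a <= mass h a c" using ac unfolding U_def by (intro rset_component_ge'[OF ih h0]) auto
  also have "... <= mass h x c" using xa by (intro mass_subset ih h0) auto
  finally have "4 * (c - a) <= mass h4 x c" by (simp add: mass4)
  moreover have "mass h4 x c <= c - x" using not_rset[of x h4 c] x xa ac by (simp add: U4_def)
  ultimately have "4 * (c - a) <= c - x" by simp
  then have "c - a < y - x" using ac(1,2) by - (linarith | argo | (smt (verit)))
  then show ?thesis using ac(6,7) by simp
 qed
 define gp gn where "gp x = max 0 (g x)" and "gn x = max 0 (- g x)" for x
 have gpn: "g x = gp x - gn x" "abs (g x) = gp x + gn x" "0 <= gp x" "0 <= gn x" for x by (auto simp: gp_def gn_def max_def)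
 have gpm [measurable]: "gp : Borel" "gn : Borel" unfolding gp_def[abs_def] gn_def[abs_def] by measurable
 have igp: "integrable lborel gp" "integrable lborel gn" unfolding gp_def[abs_def] gn_def[abs_def] using ig by auto
 define cp cn where "cp = comp_mean U gp" and "cn = comp_mean U gn"
 have cm [measurable]: "cp : Borel" "cn : Borel" unfolding cp_def cn_def using comp_mean_measurable[OF U igp(1) gpn(3) gpm(1)] comp_mean_measurable[OF U igp(2) gpn(4) gpm(2)] by auto
 have c0: "0 <= cp x" "0 <= cn x" for x unfolding cp_def cn_def using comp_mean_nonneg[OF U gpn(3)] comp_mean_nonneg[OF U gpn(4)] by auto
 have csum: "cp x + cn x = comp_mean U (%t. abs (g t)) x" for x
 proof -
  have "mass (%t. abs (g t)) a b = mass gp a b + mass gn a b" for a b using mass_add[OF igp, of 1 1 a b] by (simp add: gpn(2))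
  then show ?thesis by (simp add: cp_def cn_def comp_mean_def add_divide_distrib gpn(2))
 qed
 have cal: "AE x in lborel. cp x + cn x <= al"
 proof -
  have "AE x in lborel. x ~: U --> h x <= 1" unfolding U_def by (rule rset_AE[OF ibh h0 hm])
  then show ?thesis
  proof eventually_elim
   fix x assume hx: "x ~: U --> h x <= 1"
   show "cp x + cn x <= al"
   proof (cases "x : U")
    case True
    obtain a c where ac: "a < x" "x < c" "a ~: U" "lend U x = a" "rend U x = c" using bounded_open_component[OF U True] by metis
    have "mass (%t. abs (g t)) a c <= al * (c - a)" using ac by (intro massU) auto
    then show ?thesis unfolding csum comp_mean_def using True ac by (simp add: field_simps)
   next
    case False
    then show ?thesis unfolding csum comp_mean_def using hx al by (simp add: h_def field_simps)
   qed
  qed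
 qed
 obtain B where B: "!!y. y : U ==> abs y <= B" using U(2) by (auto simp: bounded_iff)
 define R' where "R' = abs R + abs B + 1"
 have czero: "cp x = 0" "cn x = 0" if "R' <= abs x" for x
 proof -
  have "x ~: U" "g x = 0" using that B[of x] R[of x] by (auto simp: R'_def)
  then show "cp x = 0" "cn x = 0" by (auto simp: cp_def cn_def comp_mean_def gp_def gn_def)
 qed
 have Rn: "- R' ~: U" "R' ~: U" using B[of "- R'"] B[of R'] by (auto simp: R'_def)
 have nnc: "(lint (%x. enn (cp x))) = (lint (%x. enn (gp x)))"
  "(lint (%x. enn (cn x))) = (lint (%x. enn (gn x)))"
 proof -
  have gz: "g x = 0" if "R' <= abs x" for x using that R[of x] by (auto simp: R'_def)
  have res: "(lint (%x. enn (f x))) = (lint_on {-R'<..<R'} (%x. enn (f x)))"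
   if "!!x. R' <= abs x ==> f x = 0" for f by (intro nn_integral_cong) (use that in \<open>auto simp: indicator_def abs_real_def split: if_splits\<close>)
  show "(lint (%x. enn (cp x))) = (lint (%x. enn (gp x)))" using comp_mean_emeasure[OF U igp(1) gpn(3) gpm(1) Rn] res[of cp] res[of gp] czero gz by (simp add: cp_def gp_def)
  show "(lint (%x. enn (cn x))) = (lint (%x. enn (gn x)))" using comp_mean_emeasure[OF U igp(2) gpn(4) gpm(2) Rn] res[of cn] res[of gn] czero gz by (simp add: cn_def gn_def)
 qed
 have ic: "integrable lborel cp" "integrable lborel cn" using nnc igp c0 gpn(3,4) by (auto intro!: integrableI_nonneg simp: nn_integral_eq_integral)
 have intc: "(LINT x|lborel. cp x + cn x) = G"
 proof -
  have "(LINT x|lborel. cp x) = (LINT x|lborel. gp x)" "(LINT x|lborel. cn x) = (LINT x|lborel. gn x)" using nnc c0 gpn(3,4) by (auto simp: integral_eq_nn_integral)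
  then show ?thesis using ic igp by (simp add: G_def gpn(2))
 qed
 define good where "good x = cp x - cn x" for x
 have goodsq: "AE x in lborel. (good x)^2 <= al * (cp x + cn x)" using cal
 proof eventually_elim
  fix x assume a: "cp x + cn x <= al"
  have "abs (good x) <= cp x + cn x" using c0[of x] by (auto simp: good_def)
  then have "abs (good x) * abs (good x) <= al * (cp x + cn x)" using a c0[of x] al by (intro mult_mono) auto
  then show "(good x)^2 <= al * (cp x + cn x)" by (simp add: power2_eq_square flip: abs_mult)
 qed
 have goodm [measurable]: "good : Borel" unfolding good_def[abs_def] by measurable
 have igs: "integrable lborel (%x. (good x)^2)"
 proof (rule Bochner_Integration.integrable_bound)
  show "integrable lborel (%x. al * (cp x + cn x))" using ic by simp
  show "AE x in lborel. norm ((good x)^2) <= norm (al * (cp x + cn x))" using goodsq by eventually_elim (use c0 al in auto)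
 qed simp
 have goodL: "L2c good" unfolding L2c_def using igs goodm czero by (auto simp: good_def intro!: exI[of _ R'])
 have goodn: "nrm good <= al * G"
 proof -
  have "nrm good <= (LINT x|lborel. al * (cp x + cn x))" unfolding nrm_def using igs ic goodsq by (intro integral_mono_AE) auto
  then show ?thesis using intc by simp
 qed
 define bad where "bad x = g x - good x" for x
 have badL: "L2c bad" using L2c_add[OF g goodL, of 1 "-1"] by (simp add: bad_def[abs_def])
 have ibad: "integrable lborel bad" by (rule L2c_integrable[OF badL])
 have cmass: "mass cp x y = mass gp x y" "mass cn x y = mass gn x y" if "x ~: U" "y ~: U" for x y
 proof -
  note xyU = that
  have t: "mass (comp_mean U f) x y = mass f x y"
   if f: "integrable lborel f" "!!t. 0 <= f t" "f : Borel" "integrable lborel (comp_mean U f)" for f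
  proof -
   have cf: "comp_mean U f : Borel" "!!t. 0 <= comp_mean U f t" using comp_mean_measurable[OF U f(1-3)] comp_mean_nonneg[OF U f(2)] by auto
   have "enn (mass (comp_mean U f) x y) = emeasure (density lborel (%t. enn (comp_mean U f t))) {x<..<y}" by (rule emeasure_density_Ioo[OF f(4) cf(2,1), symmetric])
   also have "... = (lint_on {x<..<y} (%t. enn (comp_mean U f t)))" using cf(1) by (intro emeasure_density) auto
   also have "... = (lint_on {x<..<y} (%t. enn (f t)))" by (rule comp_mean_emeasure[OF U f(1-3) xyU])
   also have "... = emeasure (density lborel (%t. enn (f t))) {x<..<y}" using f(3) by (intro emeasure_density[symmetric]) auto
   also have "... = enn (mass f x y)" by (rule emeasure_density_Ioo[OF f(1-3)])
   finally have "enn (mass (comp_mean U f) x y) = enn (mass f x y)" .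
   then show ?thesis using mass_nonneg[of f x y] mass_nonneg[of "comp_mean U f" x y] f(2) cf(2) by (simp add: ennreal_inj)
  qed
  show "mass cp x y = mass gp x y" using t[of gp] igp gpn gpm ic by (simp add: cp_def)
  show "mass cn x y = mass gn x y" using t[of gn] igp gpn gpm ic by (simp add: cn_def)
 qed
 have badmass: "mass bad x y = mass gp x y - mass gn x y - (mass cp x y - mass cn x y)" for x y
 proof -
  have "mass bad x y = 1 * mass (%t. 1 * gp t + (-1) * gn t) x y + (-1) * mass (%t. 1 * cp t + (-1) * cn t) x y"
  proof -
   have "bad = (%t. 1 * (1 * gp t + (-1) * gn t) + (-1) * (1 * cp t + (-1) * cn t))" by (rule ext) (simp add: bad_def good_def gpn(1))
   then show ?thesis using igp ic by (simp only:) (intro mass_add, auto)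
  qed
  then show ?thesis unfolding mass_add[OF igp] mass_add[OF ic] by simp
 qed
 have bad0: "mass bad x y = 0" if "x ~: U" "y ~: U" for x y unfolding badmass cmass[OF that] by simp
 have badpart: "abs (mass bad x y) <= 2 * al * (rend U y - lend U y)" if x: "x ~: U" and y: "y : U" "x < y" for x y
 proof -
  obtain a c where ac: "a < y" "y < c" "{a<..<c} <= U" "a ~: U" "c ~: U" "lend U y = a" "rend U y = c" using bounded_open_component[OF U y(1)] by metis
  have xa: "x <= a" using x ac y(2) by (metis greaterThanLessThan_iff leI less_trans subsetD)
  have "mass bad x y = mass bad a y" using mass_split[OF ibad xa, of y] bad0[OF x ac(4)] ac by simp
  have "abs (mass bad a y) <= mass (%t. abs (bad t)) a y" by (rule mass_abs_le[OF ibad])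
  also have "... <= mass (%t. 1 * abs (g t) + 1 * (cp t + cn t)) a y"
  proof (rule mass_mono)
   show "integrable lborel (%t. abs (bad t))" using ibad by (rule integrable_abs)
   show "integrable lborel (%t. 1 * abs (g t) + 1 * (cp t + cn t))" using iag ic by simp
   fix t
   have "abs (bad t) <= abs (g t) + abs (good t)" unfolding bad_def by (rule abs_triangle_ineq4)
   moreover have "abs (good t) <= cp t + cn t" using c0[of t] by (auto simp: good_def)
   ultimately show "abs (bad t) <= 1 * abs (g t) + 1 * (cp t + cn t)" by simp
  qed
  also have "... <= mass (%t. 1 * abs (g t) + 1 * (cp t + cn t)) a c" using iag ic c0 ac by (intro mass_subset) (auto intro!: add_nonneg_nonneg)
  also have "... = mass (%t. abs (g t)) a c + mass (%t. 1 * cp t + 1 * cn t) a c" using iag ic by (subst mass_add) auto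
  also have "mass (%t. 1 * cp t + 1 * cn t) a c = mass gp a c + mass gn a c" unfolding mass_add[OF ic] using cmass[OF ac(4,5)] by simp
  also have "mass gp a c + mass gn a c = mass (%t. abs (g t)) a c" using mass_add[OF igp, of 1 1 a c] by (simp add: gpn(2))
  also have "mass (%t. abs (g t)) a c <= al * (c - a)" using ac by (intro massU) auto
  finally show ?thesis using \<open>mass bad x y = mass bad a y\<close> ac by simp
 qed
 define phi where "phi s y = (if y : U & rend U y - lend U y < s then (rend U y - lend U y) / s else 0)" for s y
 have [measurable]: "lend U : Borel" "rend U : Borel" by (rule borel_measurable_mono[OF ends_mono(1)[OF U]], rule borel_measurable_mono[OF ends_mono(2)[OF U]])
 have phim [measurable]: "phi s : Borel" for s unfolding phi_def[abs_def] by measurable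
 have len0: "0 <= rend U y - lend U y" for y using ends_bounds[OF U, of y] by simp
 have phi0: "0 <= s ==> 0 <= phi s y" for s y using len0[of y] by (simp add: phi_def)
 have avgbad: "abs (avg j bad x) <= 2 * al * phi (2 powi j) (x + 2 powi j)" if x: "x ~: U4" for x j
 proof -
  let ?y = "x + 2 powi j"
  have p: "0 < (2 :: real) powi j" by simp
  have xU: "x ~: U" using x UU4 by blast
  show ?thesis
  proof (cases "?y : U")
   case True
   have "abs (mass bad x ?y) <= 2 * al * (rend U ?y - lend U ?y)" using True p by (intro badpart xU) auto
   moreover have "rend U ?y - lend U ?y < 2 powi j" using short[OF x True] p by simp
   ultimately have ph: "phi (2 powi j) ?y = (rend U ?y - lend U ?y) / 2 powi j" and
    "abs (mass bad x ?y) / 2 powi j <= 2 * al * (rend U ?y - lend U ?y) / 2 powi j" using True p by (simp_all add: phi_def divide_right_mono)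
   moreover have "abs (avg j bad x) = abs (mass bad x ?y) / 2 powi j" using p by (simp only: avg_def abs_divide abs_of_pos)
   ultimately show ?thesis unfolding ph by simp
  next
   case False
   then show ?thesis using bad0[OF xU False] p al phi0[of "2 powi j" ?y] by (simp add: avg_def less_imp_le)
  qed
 qed
 have phisum: "(SUM a<n. phi (2 powi (k + int a)) y) <= 2 * ind U y" for n k y
 proof (cases "y : U")
  case True
  then show ?thesis using sum_scales_above[OF len0[of y], where n=n and m=k] by (simp add: phi_def)
 qed (simp add: phi_def)
 let ?int_bad = "\<integral>\<^sup>+x\<in>-U4. enn (abs (psum v m A bad x)) \<partial>lborel"
 have badint: "?int_bad <= enn (8 * V * G)"
 proof -
  have "?int_bad <=
   (lint (%x. (SUM a<Suc A. enn (4 * V * al) * enn (phi (2 powi (m - 1 + int a)) (x + 2 powi (m - 1 + int a))))))"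
  proof (rule nn_integral_mono)
   fix x
   show "enn (abs (psum v m A bad x)) * ind (- U4) x <= (SUM a<Suc A. enn (4 * V * al) * enn (phi (2 powi (m - 1 + int a)) (x + 2 powi (m - 1 + int a))))"
   proof (cases "x : U4")
    case False
    have "abs (psum v m A bad x) <= 2 * V * (SUM a<Suc A. abs (avg (m - 1 + int a) bad x))" by (rule psum_le_avgs[OF v])
    also have "... <= 2 * V * (SUM a<Suc A. 2 * al * phi (2 powi (m - 1 + int a)) (x + 2 powi (m - 1 + int a)))" using V by (intro mult_left_mono sum_mono avgbad False) auto
    also have "... = (SUM a<Suc A. (4 * V * al) * phi (2 powi (m - 1 + int a)) (x + 2 powi (m - 1 + int a)))" by (simp only: sum_distrib_left) (simp add: mult_ac)
    finally have "enn (abs (psum v m A bad x)) <= enn (SUM a<Suc A. (4 * V * al) * phi (2 powi (m - 1 + int a)) (x + 2 powi (m - 1 + int a)))" by (rule ennreal_leI)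
    also have "... = (SUM a<Suc A. enn ((4 * V * al) * phi (2 powi (m - 1 + int a)) (x + 2 powi (m - 1 + int a))))" using V al phi0 by (intro sum_ennreal[symmetric]) (auto simp: less_imp_le)
    also have "... = (SUM a<Suc A. enn (4 * V * al) * enn (phi (2 powi (m - 1 + int a)) (x + 2 powi (m - 1 + int a))))" using V al by (intro sum.cong refl ennreal_mult') auto
    finally show ?thesis using False by (simp only: indicator_simps mult_1_right Compl_iff not_False_eq_True)
   qed simp
  qed
  also have "... = (SUM a<Suc A. \<integral>\<^sup>+x. enn (4 * V * al) * enn (phi (2 powi (m - 1 + int a)) (x + 2 powi (m - 1 + int a))) \<partial>lborel)"
   by (intro nn_integral_sum) measurable
  also have "... = (SUM a<Suc A. enn (4 * V * al) * (lint (%x. enn (phi (2 powi (m - 1 + int a)) x))))"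
  proof (intro sum.cong refl)
   fix a
   let ?s = "2 powi (m - 1 + int a) :: real"
   have "(lint (%x. enn (phi ?s (x + ?s)))) = (lint (%x. enn (phi ?s x)))" by (rule nn_integral_shift[of "%x. enn (phi ?s x)"]) measurable
   moreover have "(lint (%x. enn (4 * V * al) * enn (phi ?s (x + ?s)))) = enn (4 * V * al) * (lint (%x. enn (phi ?s (x + ?s))))" by (rule nn_integral_cmult) measurable
   ultimately show "(lint (%x. enn (4 * V * al) * enn (phi ?s (x + ?s)))) = enn (4 * V * al) * (lint (%x. enn (phi ?s x)))" by (simp only:)
  qed
  also have "... = enn (4 * V * al) * (lint (%x. (SUM a<Suc A. enn (phi (2 powi (m - 1 + int a)) x))))" by (subst nn_integral_sum) (auto simp: sum_distrib_left simp del: sum.lessThan_Suc)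
  also have "(lint (%x. (SUM a<Suc A. enn (phi (2 powi (m - 1 + int a)) x)))) <= (lint (%x. 2 * ind U x))"
  proof (rule nn_integral_mono)
   fix x
   have "(SUM a<Suc A. enn (phi (2 powi (m - 1 + int a)) x)) = enn (SUM a<Suc A. phi (2 powi (m - 1 + int a)) x)" by (intro sum_ennreal phi0) (simp add: less_imp_le)
   also have "... <= enn (2 * ind U x)" by (intro ennreal_leI phisum)
   also have "... = 2 * ind U x" by (simp add: indicator_def)
   finally show "(SUM a<Suc A. enn (phi (2 powi (m - 1 + int a)) x)) <= 2 * ind U x" .
  qed
  also have "(lint (%x. 2 * ind U x)) = 2 * leb U" by (subst nn_integral_cmult_indicator) auto
  also have "... <= enn 2 * enn (G / al)" using UG by (simp add: mult_left_mono)
  also have "... = enn (2 * (G / al))" using G0 al by (intro ennreal_mult[symmetric]) auto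
  finally have "?int_bad <= enn (4 * V * al) * enn (2 * (G / al))" by (simp add: mult_left_mono)
  also have "... = enn (8 * V * G)" using V al G0 by (simp add: ennreal_mult[symmetric])
  finally show ?thesis .
 qed
 have pm [measurable]: "psum v m A good : Borel" "psum v m A bad : Borel" "psum v m A g : Borel"
  by (rule L2c_measurable[OF psum_L2c[OF goodL]], rule L2c_measurable[OF psum_L2c[OF badL]], rule L2c_measurable[OF psum_L2c[OF g]])
 let ?Good = "{x. lam / 2 < abs (psum v m A good x)}"
 have e1: "leb ?Good <= enn (512 * V / lam * G)"
 proof -
  have "leb ?Good <= enn (nrm (psum v m A good) / (lam / 2)^2)" using lam by (intro emeasure_nrm_le psum_L2c goodL) auto
  also have "... <= enn (128 * V^2 * (al * G) / (lam / 2)^2)"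
  proof (intro ennreal_leI divide_right_mono)
   have "nrm (psum v m A good) <= 128 * V^2 * nrm good" by (rule psum_L2_bound[OF goodL v])
   also have "... <= 128 * V^2 * (al * G)" by (intro mult_left_mono goodn) auto
   finally show "nrm (psum v m A good) <= 128 * V^2 * (al * G)" .
  qed simp
  also have "128 * V^2 * (al * G) / (lam / 2)^2 = 512 * V / lam * G" using V lam by (simp add: al_def power2_eq_square field_simps)
  finally show ?thesis .
 qed
 let ?Bad = "{x. x ~: U4 & lam / 2 < abs (psum v m A bad x)}"
 have e2: "leb ?Bad <= enn (16 * V / lam * G)"
 proof -
  have "leb ?Bad = (lint (%x. ind ?Bad x))" by simp
  also have "... <= (lint (%x. enn (2 / lam) * (enn (abs (psum v m A bad x)) * ind (-U4) x)))"
  proof (rule nn_integral_mono)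
   fix x
   show "ind ?Bad x <= enn (2 / lam) * (enn (abs (psum v m A bad x)) * ind (-U4) x)"
   proof (cases "x ~: U4 & lam / 2 < abs (psum v m A bad x)")
    case True
    then have "1 <= 2 / lam * abs (psum v m A bad x)" using lam by (simp add: field_simps)
    then have "1 <= enn (2 / lam) * enn (abs (psum v m A bad x))" using lam by (simp add: ennreal_mult[symmetric])
    then show ?thesis using True by simp
   qed simp
  qed
  also have "... = enn (2 / lam) * ?int_bad" by (intro nn_integral_cmult) measurable
  also have "... <= enn (2 / lam) * enn (8 * V * G)" by (intro mult_left_mono badint) simp
  also have "... = enn (16 * V / lam * G)" using lam V G0 by (simp add: ennreal_mult[symmetric])
  finally show ?thesis .
 qed
 have sub: "{x. lam < abs (psum v m A g x)} <= ?Good Un (?Bad Un U4)"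
 proof
  fix x assume x: "x : {x. lam < abs (psum v m A g x)}"
  have "psum v m A g x = psum v m A good x + psum v m A bad x" using psum_add[OF L2c_integrable[OF goodL] ibad, of v m A 1 1 x] by (simp add: bad_def)
  then show "x : ?Good Un (?Bad Un U4)" using x by (auto simp: abs_real_def split: if_splits)
 qed
 have "leb {x. lam < abs (psum v m A g x)} <= leb (?Good Un (?Bad Un U4))" by (intro emeasure_mono sub) measurable
 also have "... <= leb ?Good + leb (?Bad Un U4)" by (intro emeasure_subadditive) measurable
 also have "... <= leb ?Good + (leb ?Bad + leb U4)" by (intro add_left_mono emeasure_subadditive) measurable
 also have "... <= enn (512 * V / lam * G) + (enn (16 * V / lam * G) + enn (4 * G / al))" by (intro add_mono e1 e2 U4G)
 also have "... = enn (512 * V / lam * G + (16 * V / lam * G + 4 * G / al))" using V lam G0 al by (simp add: ennreal_plus[symmetric] del: ennreal_plus)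
 also have "... <= enn (600 * V / lam * G)"
 proof (rule ennreal_leI)
  have gen: "512 * z + (16 * z + 4 * z) <= 600 * z" if "0 <= z" for z :: real using that by simp
  have e0: "4 * G / al = 4 * (V / lam * G)" using V lam by (simp add: al_def)
  have z0: "0 <= V / lam * G" using V lam G0 by simp
  have e: "512 * V / lam * G = 512 * (V / lam * G)" "16 * V / lam * G = 16 * (V / lam * G)" "600 * V / lam * G = 600 * (V / lam * G)" by simp_all
  show "512 * V / lam * G + (16 * V / lam * G + 4 * G / al) <= 600 * V / lam * G" unfolding e0 e by (rule gen[OF z0])
 qed
 finally show ?thesis by (simp add: G_def)
qed

section \<open>Cotlar inequality and almost everywhere convergence\<close>

lemma powi_add_nat: "(2 :: real) powi (m + int a) = 2 powi m * 2 ^ a" by (simp add: power_int_add)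

lemma mass_cong: "(!!t. x <= t ==> t <= y ==> g t = h t) ==> mass g x y = mass h x y" unfolding mass_def sli_def by (intro Bochner_Integration.integral_cong) (auto simp: indicator_def)

lemma mass_eq_0: "(!!t. x <= t ==> t <= y ==> g t = 0) ==> mass g x y = 0" using mass_cong[of x y g "%_. 0"] by (simp add: mass_def sli_def)

lemma mass_divide: "mass (%t. g t / c) x y = mass g x y / c" unfolding mass_def by simp

lemma avg_far:
 assumes g: "integrable lborel g" and z: "!!t. t <= xi + H ==> g t = 0"
  and yz: "xi <= y" "y <= z" "z <= xi + H"
 shows "abs (avg j g z - avg j g y) <= mass (%t. abs (g t)) (xi + 2 powi j) (xi + 2 powi j + H) / 2 powi j"
proof -
 let ?s = "2 powi j :: real"
 have p: "0 < ?s" by simp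
 have m0: "mass g a b = 0" if "b <= xi + H" for a b using that z by (intro mass_eq_0) auto
 have "mass g y (y + ?s) + mass g (y + ?s) (z + ?s) = mass g y z + mass g z (z + ?s)" using mass_split[OF g, of y "y + ?s" "z + ?s"] mass_split[OF g, of y z "z + ?s"] yz p by simp
 moreover have "mass g y z = 0" using m0 yz by simp
 ultimately have "mass g z (z + ?s) - mass g y (y + ?s) = mass g (y + ?s) (z + ?s)" by simp
 then have "abs (avg j g z - avg j g y) = abs (mass g (y + ?s) (z + ?s)) / ?s" using p by (simp only: avg_def diff_divide_distrib[symmetric] abs_divide abs_of_pos)
 also have "... <= mass (%t. abs (g t)) (xi + ?s) (xi + ?s + H) / ?s"
 proof (rule divide_right_mono)
  have "abs (mass g (y + ?s) (z + ?s)) <= mass (%t. abs (g t)) (y + ?s) (z + ?s)" by (rule mass_abs_le[OF g])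
  also have "... <= mass (%t. abs (g t)) (xi + ?s) (xi + ?s + H)" using yz g by (intro mass_subset) auto
  finally show "abs (mass g (y + ?s) (z + ?s)) <= mass (%t. abs (g t)) (xi + ?s) (xi + ?s + H)" .
 qed (use p in simp)
 finally show ?thesis .
qed

text \<open>As \<open>g\<close> vanishes near both points, their averages of the same length differ only near the right ends of the
 intervals.\<close>

lemma psum_far:
 assumes g: "integrable lborel g" and z: "!!t. t <= xi + H ==> g t = 0"
  and v: "!!j. abs (v j) <= V" and y: "y : {xi..xi + H}" "z : {xi..xi + H}"
 shows "abs (psum v m A g z - psum v m A g y) <=
  2 * V * (SUM a<Suc A. mass (%t. abs (g t)) (xi + 2 powi (m - 1 + int a)) (xi + 2 powi (m - 1 + int a) + H) / 2 powi (m - 1 + int a))"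
proof -
 have V: "0 <= V" using v[of 0] by linarith
 let ?r = "%j. mass (%t. abs (g t)) (xi + 2 powi j) (xi + 2 powi j + H) / 2 powi j"
 have av: "abs (avg j g z - avg j g y) <= ?r j" for j
 proof (cases "y <= z")
  case True then show ?thesis using y by (intro avg_far g z) auto
 next
  case False
  then have "abs (avg j g y - avg j g z) <= ?r j" using y by (intro avg_far g z) auto
  then show ?thesis by (simp add: abs_minus_commute)
 qed
 have d: "psum v m A g z - psum v m A g y = (SUM a<A. v (m + int a) * (dif (m + int a) g z - dif (m + int a) g y))" by (simp add: psum_def sum_subtractf right_diff_distrib)
 have "abs (psum v m A g z - psum v m A g y) <= (SUM a<A. abs (v (m + int a) * (dif (m + int a) g z - dif (m + int a) g y)))" unfolding d by (rule sum_abs)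
 also have "... <= (SUM a<A. V * (?r (m - 1 + int (Suc a)) + ?r (m - 1 + int a)))"
 proof (rule sum_mono)
  fix a
  have "abs (dif (m + int a) g z - dif (m + int a) g y) <= abs (avg (m + int a) g z - avg (m + int a) g y) + abs (avg (m + int a - 1) g z - avg (m + int a - 1) g y)"
   unfolding dif_def by linarith
  also have "... <= ?r (m + int a) + ?r (m + int a - 1)" by (intro add_mono av)
  also have "... = ?r (m - 1 + int (Suc a)) + ?r (m - 1 + int a)" by (simp add: algebra_simps)
  finally show "abs (v (m + int a) * (dif (m + int a) g z - dif (m + int a) g y)) <= V * (?r (m - 1 + int (Suc a)) + ?r (m - 1 + int a))"
   unfolding abs_mult using v V by (intro mult_mono) auto
 qed
 also have "... = V * ((SUM a<A. ?r (m - 1 + int (Suc a))) + (SUM a<A. ?r (m - 1 + int a)))" by (simp only: sum_distrib_left[symmetric] sum.distrib)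
 also have "... <= V * ((SUM a<Suc A. ?r (m - 1 + int a)) + (SUM a<Suc A. ?r (m - 1 + int a)))"
 proof (intro mult_left_mono add_mono V)
  have r0: "0 <= ?r j" for j by (intro divide_nonneg_nonneg mass_nonneg) (auto simp: less_imp_le)
  show "(SUM a<A. ?r (m - 1 + int (Suc a))) <= (SUM a<Suc A. ?r (m - 1 + int a))" using r0[of "m - 1 + int 0"] by (simp only: sum.lessThan_Suc_shift)
  show "(SUM a<A. ?r (m - 1 + int a)) <= (SUM a<Suc A. ?r (m - 1 + int a))" using r0[of "m - 1 + int A"] by (simp only: sum.lessThan_Suc)
 qed
 finally show ?thesis by (simp only: mult_2 distrib_left mult.assoc distrib_right)
qed

lemma L2c_indicator_mult:
 assumes "L2c g" "S : sets borel"
 shows "L2c (%t. ind S t * g t)" unfolding L2c_def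
proof (intro conjI)
 have [measurable]: "g : Borel" "S : sets borel" using assms by (auto simp: L2c_def)
 show "(%t. ind S t * g t) : Borel" by measurable
 have "(%t. (ind S t * g t)^2) = (%t. ind S t *\<^sub>R (g t)^2)" by (auto simp: indicator_def)
 then show "integrable lborel (%t. (ind S t * g t)^2)" using integrable_mult_indicator[of S lborel "%t. (g t)^2"] assms by (simp add: L2c_def)
 show "EX R. ALL x. R < abs x --> ind S x * g x = 0" using assms(1) unfolding L2c_def by (metis mult_zero_right)
qed

lemma sum_lessThan_add: "(SUM a<i + k. f a) = (SUM a<i. f a) + (SUM a<k. f (i + a) :: real)" for i k :: nat by (induction k) (auto simp: add.assoc)

lemma geo_sum_le: "(SUM a<n. (1 / 2 :: real) ^ a) <= 2" "(SUM a<n. (3 / 4 :: real) ^ a) <= 4" by (subst sum_gp_strict, simp add: field_simps)+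

text \<open>The sum over large scales is compared at \<open>x\<close> and at points near \<open>x\<close>, where the full sum is controlled in
 mean square by the first rising sun set and the small scales by the second.\<close>

lemma cotlar:
 assumes g: "L2c g" and v: "!!j. abs (v j) <= V" and lam: "0 < lam"
  and x1: "x ~: rset (%t. (psum v m A g t)^2 / lam^2)" and x2: "x ~: rset (%t. (g t)^2 / lam^2)"
  and i: "i <= A"
 shows "abs (psum v (m + int i) (A - i) g x) <= (2 + 65 * V) * lam"
proof -
 have V: "0 <= V" using v[of 0] by linarith
 define s where "s = (2 powi (m + int i - 1) :: real)"
 have s: "0 < s" by (simp add: s_def)
 let ?S1 = "{x..x + 4 * s}" and ?S2 = "{x + 4 * s<..}"
 define g1 g2 g0 where "g1 t = ind ?S1 t * g t" and "g2 t = ind ?S2 t * g t" and "g0 t = ind {..<x} t * g t" for t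
 have L: "L2c g1" "L2c g2" "L2c g0" unfolding g1_def[abs_def] g2_def[abs_def] g0_def[abs_def] by (intro L2c_indicator_mult g; simp)+
 have ig: "integrable lborel g" "integrable lborel g1" "integrable lborel g2" "integrable lborel g0" using L2c_integrable g L by auto
 have isq: "integrable lborel (%t. (g t)^2)" "integrable lborel (%t. (psum v m A g t)^2)" "integrable lborel (%t. (psum v m A g1 t)^2)" "integrable lborel (%t. (psum v m A g2 t)^2)"
  using g psum_L2c[OF g] psum_L2c[OF L(1)] psum_L2c[OF L(2)] by (auto simp: L2c_def)
 have msq: "mass (%t. (g t)^2) x (x + d) <= lam^2 * d" if "0 <= d" for d
 proof -
  have "mass (%t. (g t)^2 / lam^2) x (x + d) <= d" using not_rset[OF x2, of "x + d"] that by simp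
  then show ?thesis using lam unfolding mass_divide by (simp add: field_simps)
 qed
 have msqP: "mass (%t. (psum v m A g t)^2) x (x + d) <= lam^2 * d" if "0 <= d" for d
 proof -
  have "mass (%t. (psum v m A g t)^2 / lam^2) x (x + d) <= d" using not_rset[OF x1, of "x + d"] that by simp
  then show ?thesis using lam unfolding mass_divide by (simp add: field_simps)
 qed
 have dec: "psum v m' A' g y = psum v m' A' g1 y + psum v m' A' g2 y" if y: "x <= y" for m' A' y
 proof -
  have "avg j g y = avg j (%t. 1 * g1 t + 1 * g2 t) y" for j unfolding avg_def using y s by (intro arg_cong[where f="%z. z / _"] mass_cong) (auto simp: g1_def g2_def indicator_def)
  then have "psum v m' A' g y = psum v m' A' (%t. 1 * g1 t + 1 * g2 t) y" by (simp add: psum_def dif_def)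
  then show ?thesis using psum_add[OF ig(2,3), of v m' A' 1 1 y] by simp
 qed
 text \<open>The part near the point is controlled by averages.\<close>
 have sc: "2 powi (m + int i - 1 + int a) = s * 2 ^ a" for a unfolding s_def by (rule powi_add_nat)
 have near: "abs (psum v (m + int i) (A - i) g1 x) <= 16 * V * lam"
 proof -
  have ml: "mass (%t. abs (g t)) x (x + 4 * s) <= 4 * s * lam"
  proof -
   have "L2c (%t. abs (g t))" using g by (auto simp: L2c_def)
   from mass_sq_le[OF this, of "4 * s" x] s
   have "(mass (%t. abs (g t)) x (x + 4 * s))^2 <= 4 * s * mass (%t. (g t)^2) x (x + 4 * s)" by simp
   also have "... <= 4 * s * (lam^2 * (4 * s))" using s by (intro mult_left_mono msq) auto
   also have "... = (4 * s * lam)^2" by (simp add: power2_eq_square)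
   finally have le2: "(mass (%t. abs (g t)) x (x + 4 * s))^2 <= (4 * s * lam)^2" .
   show ?thesis by (rule power2_le_imp_le[OF le2]) (use s lam in simp)
  qed
  have "abs (avg (m + int i - 1 + int a) g1 x) <= 4 * lam * (1/2) ^ a" for a
  proof -
   let ?j = "m + int i - 1 + int a"
   have p: "0 < (2 :: real) powi ?j" by simp
   have "abs (mass g1 x (x + 2 powi ?j)) <= mass (%t. abs (g1 t)) x (x + 2 powi ?j)" by (rule mass_abs_le[OF ig(2)])
   also have "... <= mass (%t. abs (g t)) x (x + 4 * s)" unfolding mass_def sli_def
   proof (rule integral_mono)
    show "integrable lborel (%t. ind {x..x + 2 powi ?j} t *\<^sub>R (abs (g1 t)))"
     using set_integrable_Icc[OF integrable_abs[OF ig(2)], of x "x + 2 powi ?j"] by (simp add: set_integrable_def)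
    show "integrable lborel (%t. ind {x..x + 4 * s} t *\<^sub>R (abs (g t)))" using set_integrable_Icc[OF integrable_abs[OF ig(1)], of x "x + 4 * s"] by (simp add: set_integrable_def)
   qed (auto simp: g1_def indicator_def)
   finally have "abs (mass g1 x (x + 2 powi ?j)) / 2 powi ?j <= (4 * s * lam) / 2 powi ?j" using ml p by (intro divide_right_mono) auto
   also have "... = 4 * lam * (1/2) ^ a" unfolding sc using s by (simp add: power_divide)
   finally show ?thesis using p by (simp only: avg_def abs_divide abs_of_pos)
  qed
  then have av: "abs (avg (m + int i - 1 + int a) g1 x) <= 4 * lam * (1/2) ^ a" for a .
  have "abs (psum v (m + int i) (A - i) g1 x) <= 2 * V * (SUM a<Suc (A - i). abs (avg (m + int i - 1 + int a) g1 x))" by (rule psum_le_avgs[OF v])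
  also have "... <= 2 * V * (SUM a<Suc (A - i). 4 * lam * (1/2) ^ a)" using V by (intro mult_left_mono sum_mono av) auto
  also have "... = 2 * V * (4 * lam * (SUM a<Suc (A - i). (1/2) ^ a))" by (simp only: sum_distrib_left)
  also have "... <= 2 * V * (4 * lam * 2)" by (intro mult_left_mono geo_sum_le(1)) (use V lam in auto)
  finally show ?thesis by simp
 qed
 text \<open>The far part hardly varies over an interval of the truncation length.\<close>
 have far: "abs (psum v (m + int i) (A - i) g2 y - psum v (m + int i) (A - i) g2 x) <= 16 * V * lam" if y: "y : {x..x + s}" for y
 proof -
  have r: "mass (%t. abs (g2 t)) (x + 2 powi (m + int i - 1 + int a)) (x + 2 powi (m + int i - 1 + int a) + s) / 2 powi (m + int i - 1 + int a) <= 2 * lam * (3/4) ^ a" for a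
  proof -
   let ?t = "2 powi (m + int i - 1 + int a) :: real"
   have t: "s <= ?t" unfolding sc using s by simp
   have tp: "0 < ?t" by simp
   have "L2c (%t. abs (g2 t))" using L(2) by (auto simp: L2c_def)
   from mass_sq_le[OF this, of s "x + ?t"] s
   have "(mass (%t. abs (g2 t)) (x + ?t) (x + ?t + s))^2 <= s * mass (%t. (g2 t)^2) (x + ?t) (x + ?t + s)" by simp
   also have "mass (%t. (g2 t)^2) (x + ?t) (x + ?t + s) <= mass (%t. (g t)^2) (x + ?t) (x + ?t + s)" using isq(1) L(2) by (intro mass_mono) (auto simp: L2c_def g2_def indicator_def)
   also have "... <= mass (%t. (g t)^2) x (x + 2 * ?t)" using isq(1) t tp by (intro mass_subset) auto
   also have "... <= lam^2 * (2 * ?t)" using tp by (intro msq) auto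
   finally have "(mass (%t. abs (g2 t)) (x + ?t) (x + ?t + s))^2 <= s * (lam^2 * (2 * ?t))" using s by (simp add: mult_left_mono)
   also have "... <= (2 * lam * (3/4) ^ a * ?t)^2"
   proof -
    have q: "(1 :: real) <= 2 * ((3/4) ^ a)^2 * 2 ^ a"
    proof -
     have "((3/4) ^ a)^2 * 2 ^ a = (9/8 :: real) ^ a" by (simp add: power_mult_distrib[symmetric] power2_eq_square)
     moreover have "(1 :: real) <= (9/8) ^ a" by simp
     ultimately have "(1 :: real) <= 2 * (((3/4) ^ a)^2 * 2 ^ a)" by (simp del: power_le_one_iff one_le_power)
     then show ?thesis by (simp only: mult.assoc)
    qed
    have "s * (lam^2 * (2 * ?t)) = 2 * lam^2 * s * ?t * 1" by simp
    also have "... <= 2 * lam^2 * s * ?t * (2 * ((3/4) ^ a)^2 * 2 ^ a)" using s tp by (intro mult_left_mono q) auto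
    also have "... = (2 * lam * (3/4) ^ a * ?t)^2"
    proof -
     have e: "s * 2 ^ a = ?t" using sc by simp
     have "2 * lam^2 * s * T * (2 * K^2 * P) = (2 * lam * K)^2 * T * (s * P)" for T K P :: real by (simp add: power2_eq_square)
     from this[of ?t "(3/4) ^ a" "2 ^ a"] show ?thesis unfolding e by (simp add: power2_eq_square)
    qed
    finally show ?thesis .
   qed
   finally have "mass (%t. abs (g2 t)) (x + ?t) (x + ?t + s) <= 2 * lam * (3/4) ^ a * ?t" by (rule power2_le_imp_le) (use lam tp in \<open>auto simp: less_imp_le\<close>)
   then show ?thesis using tp by (simp add: pos_divide_le_eq)
  qed
  have ar: "m + int i - 1 + int a = m + int i - 1 + int a" for a ..
  have "abs (psum v (m + int i) (A - i) g2 y - psum v (m + int i) (A - i) g2 x) <=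
   2 * V * (SUM a<Suc (A - i). mass (%t. abs (g2 t)) (x + 2 powi (m + int i - 1 + int a)) (x + 2 powi (m + int i - 1 + int a) + s) / 2 powi (m + int i - 1 + int a))"
   using y s by (intro psum_far ig v) (auto simp: g2_def indicator_def)
  also have "... <= 2 * V * (SUM a<Suc (A - i). 2 * lam * (3/4) ^ a)" using V by (intro mult_left_mono sum_mono r) auto
  also have "... = 2 * V * (2 * lam * (SUM a<Suc (A - i). (3/4) ^ a))" by (simp only: sum_distrib_left)
  also have "... <= 2 * V * (2 * lam * 4)" by (intro mult_left_mono geo_sum_le(2)) (use V lam in auto)
  finally show ?thesis by simp
 qed
 have same: "psum v (m + int i) (A - i) g2 y = psum v m A g2 y" if y: "y : {x..x + s}" for y
 proof -
  have av0: "avg j g2 y = 0" if j: "j <= m + int i - 1" for j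
  proof -
   have "2 powi j <= s" unfolding s_def by (rule powi_mono2[OF j])
   then have "mass g2 y (y + 2 powi j) = 0" using y s by (intro mass_eq_0) (auto simp: g2_def indicator_def)
   then show ?thesis unfolding avg_def by simp
  qed
  have "psum v m A g2 y = (SUM a<i + (A - i). v (m + int a) * dif (m + int a) g2 y)" using i by (simp add: psum_def)
  also have "... = (SUM a<i. v (m + int a) * dif (m + int a) g2 y) + (SUM a<A - i. v (m + int (i + a)) * dif (m + int (i + a)) g2 y)" by (rule sum_lessThan_add)
  also have "(SUM a<i. v (m + int a) * dif (m + int a) g2 y) = 0" by (intro sum.neutral ballI) (auto simp: dif_def av0)
  finally show ?thesis by (simp add: psum_def add.assoc)
 qed
 define K where "K = 2 + 33 * V"
 have "EX y:{x..x + s}. abs (psum v m A g2 y) <= K * lam"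
 proof (rule ccontr)
  assume "\<not> ?thesis"
  then have big: "K * lam < abs (psum v m A g2 y)" if "y : {x..x + s}" for y using that by force
  have K0: "0 <= K * lam" using V lam by (simp add: K_def)
  have "(K * lam)^2 * s = mass (%t. (K * lam)^2 * ind {x..x + s} t) x (x + s)" using s by (subst mass_indicator) auto
  also have "... <= mass (%t. 2 * (psum v m A g t)^2 + 2 * (psum v m A g1 t)^2) x (x + s)"
  proof (rule mass_mono)
   show "integrable lborel (%t. (K * lam)^2 * ind {x..x + s} t)" by (intro integrable_mult_right integrable_real_indicator) (auto simp: emeasure_lborel_Icc_eq)
   show "integrable lborel (%t. 2 * (psum v m A g t)^2 + 2 * (psum v m A g1 t)^2)" using isq by simp
   fix t assume t: "x <= t" "t <= x + s"
   have "(K * lam)^2 <= abs (psum v m A g2 t)^2" using big[of t] t K0 by (intro power_mono) auto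
   also have "... = (psum v m A g t - psum v m A g1 t)^2" using dec[of t m A] t by simp
   also have "... <= 2 * (psum v m A g t)^2 + 2 * (psum v m A g1 t)^2" using zero_le_power2[of "psum v m A g t + psum v m A g1 t"] by (simp add: power2_eq_square algebra_simps)
   finally show "(K * lam)^2 * ind {x..x + s} t <= 2 * (psum v m A g t)^2 + 2 * (psum v m A g1 t)^2" using t by simp
  qed
  also have "... = 2 * mass (%t. (psum v m A g t)^2) x (x + s) + 2 * mass (%t. (psum v m A g1 t)^2) x (x + s)" by (rule mass_add[OF isq(2,3)])
  also have "... <= 2 * (lam^2 * s) + 2 * (128 * V^2 * (lam^2 * (4 * s)))"
  proof (intro add_mono mult_left_mono msqP)
   have "mass (%t. (psum v m A g1 t)^2) x (x + s) <= nrm (psum v m A g1)" unfolding mass_def sli_def nrm_def using set_integrable_Icc[OF isq(3), of x "x + s"] isq(3)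
    by (intro integral_mono) (auto simp: set_integrable_def indicator_def)
   also have "... <= 128 * V^2 * nrm g1" by (rule psum_L2_bound[OF L(1) v])
   also have "nrm g1 = mass (%t. (g t)^2) x (x + 4 * s)" unfolding mass_def sli_def nrm_def g1_def by (intro Bochner_Integration.integral_cong) (auto simp: indicator_def)
   also have "128 * V^2 * mass (%t. (g t)^2) x (x + 4 * s) <= 128 * V^2 * (lam^2 * (4 * s))" using s by (intro mult_left_mono msq) auto
   finally show "mass (%t. (psum v m A g1 t)^2) x (x + s) <= 128 * V^2 * (lam^2 * (4 * s))" .
  qed (use s in auto)
  also have "... = (2 + 1024 * V^2) * (lam^2 * s)" by (simp add: algebra_simps)
  finally have "K^2 * (lam^2 * s) <= (2 + 1024 * V^2) * (lam^2 * s)" by (simp add: power_mult_distrib mult.assoc)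
  then have "K^2 <= 2 + 1024 * V^2" using lam s by (simp add: mult_le_cancel_right)
  moreover have "K^2 = 4 + 132 * V + 1089 * V^2" by (simp add: K_def power2_eq_square algebra_simps)
  moreover have "0 <= V^2" by simp
  ultimately show False using V by linarith
 qed
 then obtain y where y: "y : {x..x + s}" "abs (psum v m A g2 y) <= K * lam" by blast
 have "abs (psum v (m + int i) (A - i) g2 x) <= 16 * V * lam + K * lam" using far[OF y(1)] y(2) same[OF y(1)] by linarith
 then have "abs (psum v (m + int i) (A - i) g x) <= 16 * V * lam + (16 * V * lam + K * lam)" using near dec[of x "m + int i" "A - i"] by linarith
 also have "... = (2 + 65 * V) * lam" by (simp add: K_def algebra_simps)
 finally show ?thesis .
qed

definition small_sum :: "(int => real) => nat => (real => real) => real => real" where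
 "small_sum v k g x = psum v (- int k) k g x"

definition psum2 :: "(int => real) => (real => real) => real => nat \<times> nat => real" where
 "psum2 v g x = (%(m, n). psum v (- int m) (m + n + 1) g x)"

lemma psum2_split: "psum2 v g x (m, n) = small_sum v m g x + psum v 0 (Suc n) g x"
proof -
 have "psum2 v g x (m, n) = (SUM a<m + Suc n. v (- int m + int a) * dif (- int m + int a) g x)" by (simp add: psum2_def psum_def)
 also have "... = (SUM a<m. v (- int m + int a) * dif (- int m + int a) g x) + (SUM a<Suc n. v (- int m + int (m + a)) * dif (- int m + int (m + a)) g x)" by (rule sum_lessThan_add)
 also have "... = small_sum v m g x + psum v 0 (Suc n) g x" by (simp add: small_sum_def psum_def)
 finally show ?thesis .
qed

lemma small_sum_trunc: "k <= M ==> small_sum v k g x = psum v (- int M + int (M - k)) (M - (M - k)) g x" by (simp add: small_sum_def of_nat_diff)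

lemma small_sum_measurable: "L2c g ==> small_sum v k g : Borel" unfolding small_sum_def[abs_def] by (rule L2c_measurable[OF psum_L2c])

lemma maximal_small_sum:
 assumes g: "L2c g" and v: "!!j. abs (v j) <= V" and lam: "0 < lam"
 shows "leb {x. EX k. (2 + 65 * V) * lam < abs (small_sum v k g x)} <= enn ((128 * V^2 + 1) * nrm g / lam^2)"
proof -
 let ?K = "(2 + 65 * V) * lam"
 let ?B = "%M. {x. EX k<=M. ?K < abs (small_sum v k g x)}"
 have sm [measurable]: "small_sum v k g : Borel" for k by (rule small_sum_measurable[OF g])
 have Bm: "?B M : sets borel" for M by measurable
 let ?bound = "(128 * V^2 + 1) * nrm g / lam^2"
 have bound: "leb (?B M) <= enn ?bound" for M
 proof -
  let ?h = "%t. (psum v (- int M) M g t)^2 / lam^2" and ?h' = "%t. (g t)^2 / lam^2"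
  have P: "L2c (psum v (- int M) M g)" by (rule psum_L2c[OF g])
  have ib: "ibs ?h" "ibs ?h'" using P g by (auto simp: ibs_def L2c_def)
  have m: "?h : Borel" "?h' : Borel" using P g by (auto simp: L2c_def)
  have sub: "?B M <= rset ?h Un rset ?h'"
  proof
   fix x assume "x : ?B M"
   then obtain k where k: "k <= M" "?K < abs (small_sum v k g x)" by auto
   show "x : rset ?h Un rset ?h'"
   proof (rule ccontr)
    assume "x ~: rset ?h Un rset ?h'"
    then have "abs (psum v (- int M + int (M - k)) (M - (M - k)) g x) <= ?K" by (intro cotlar[OF g v lam]) auto
    then show False using k(2) unfolding small_sum_trunc[OF k(1)] by simp
   qed
  qed
  have op: "rset ?h : sets borel" "rset ?h' : sets borel" using open_rset[of ?h] open_rset[of ?h'] ib by (auto simp: ibs_def)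
  have "leb (?B M) <= leb (rset ?h Un rset ?h')" using op by (intro emeasure_mono sub) auto
  also have "... <= leb (rset ?h) + leb (rset ?h')" using op by (intro emeasure_subadditive) auto
  also have "... <= enn (LINT t|lborel. ?h t) + enn (LINT t|lborel. ?h' t)" by (intro add_mono rset_weak_type ib m) auto
  also have "... = enn (nrm (psum v (- int M) M g) / lam^2 + nrm g / lam^2)" by (simp add: nrm_def ennreal_plus[symmetric] del: ennreal_plus)
  also have "... <= enn ?bound"
  proof (rule ennreal_leI)
   have "nrm (psum v (- int M) M g) + nrm g <= (128 * V^2 + 1) * nrm g" using psum_L2_bound[of g v V "- int M" M, OF g v] unfolding distrib_right by linarith
   then show "nrm (psum v (- int M) M g) / lam^2 + nrm g / lam^2 <= (128 * V^2 + 1) * nrm g / lam^2" unfolding add_divide_distrib[symmetric] by (intro divide_right_mono) auto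
  qed
  finally show ?thesis .
 qed
 have "{x. EX k. ?K < abs (small_sum v k g x)} = (\<Union>M. ?B M)" by auto
 also have "leb (\<Union>M. ?B M) = (SUP M. leb (?B M))" using Bm by (intro SUP_emeasure_incseq[symmetric]) (auto simp: incseq_def intro: order_trans)
 also have "... <= enn ?bound" by (rule SUP_least) (rule bound)
 finally show ?thesis .
qed

definition conv_ae :: "(int => real) => (real => real) => bool" where
 "conv_ae v g \<longleftrightarrow> (AE x in lborel. convergent (%k. small_sum v k g x))"

lemma small_sum_add:
 assumes "L2c g" "L2c h"
 shows "small_sum v k (%t. a * g t + b * h t) x = a * small_sum v k g x + b * small_sum v k h x"
 unfolding small_sum_def by (rule psum_add[OF L2c_integrable[OF assms(1)] L2c_integrable[OF assms(2)]])

lemma conv_ae_add: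
 assumes "L2c g" "L2c h" "conv_ae v g" "conv_ae v h"
 shows "conv_ae v (%t. a * g t + b * h t)" using assms(3,4) unfolding conv_ae_def small_sum_add[OF assms(1,2)] by eventually_elim (intro convergent_add convergent_mult convergent_const)

text \<open>The maximal inequality bounds the oscillation of the partial sums at almost every point by that of the error of
 an approximation.\<close>

lemma conv_ae_limit:
 assumes g: "L2c g" and v: "!!j. abs (v j) <= V"
  and approx: "!!e. 0 < e ==> EX h. L2c h & conv_ae v h & nrm (%x. g x - h x) <= e"
 shows "conv_ae v g"
proof -
 have V: "0 <= V" using v[of 0] by linarith
 have sm [measurable]: "small_sum v k g : Borel" for k by (rule small_sum_measurable[OF g])
 let ?S = "%x k. small_sum v k g x"
 have osc: "AE x in lborel. EX N. ALL k>=N. ALL l>=N. abs (?S x k - ?S x l) < d" if d: "0 < d" for d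
 proof -
  define lam where "lam = d / (4 * (2 + 65 * V))"
  have lam: "0 < lam" using d V by (simp add: lam_def)
  have Kl: "(2 + 65 * V) * lam = d / 4"
  proof -
   have c: "0 < 2 + 65 * V" using V by linarith
   have "c * (d / (4 * c)) = d / 4" if "0 < c" for c using that by simp
   then show ?thesis unfolding lam_def using c by blast
  qed
  let ?N = "{x. \<not> (EX N. ALL k>=N. ALL l>=N. abs (?S x k - ?S x l) < d)}"
  have [measurable]: "Measurable.pred borel (%x. abs (?S x k - ?S x l) < d)" for k l by measurable
  have Nm: "?N : sets borel" by measurable
  have "leb ?N <= enn e" if e: "0 < e" for e
  proof -
   obtain h where h: "L2c h" "conv_ae v h" "nrm (%x. g x - h x) <= e * lam^2 / (128 * V^2 + 1)" using approx[of "e * lam^2 / (128 * V^2 + 1)"] e lam by (auto simp: add_nonneg_pos)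
   have gh: "L2c (%x. 1 * g x + (-1) * h x)" by (intro L2c_add g h)
   let ?r = "%x. 1 * g x + (-1) * h x"
   let ?B = "{x. EX k. (2 + 65 * V) * lam < abs (small_sum v k ?r x)}"
   have [measurable]: "small_sum v k ?r : Borel" for k by (rule small_sum_measurable[OF gh])
   have Bm: "?B : sets borel" by measurable
   have "leb ?N <= leb ?B"
   proof (rule emeasure_mono_AE)
    show "AE x in lborel. x : ?N --> x : ?B" using h(2) unfolding conv_ae_def
    proof eventually_elim
     fix x assume "convergent (%k. small_sum v k h x)"
     then have "Cauchy (%k. small_sum v k h x)" by (rule convergent_Cauchy)
     then obtain N where N: "!!k l. N <= k ==> N <= l ==> abs (small_sum v k h x - small_sum v l h x) < d / 2" using d unfolding Cauchy_def dist_real_def by (meson half_gt_zero)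
     show "x : ?N --> x : ?B"
     proof (rule impI, rule ccontr)
      assume xN: "x : ?N" and "x ~: ?B"
      then have B: "abs (small_sum v k ?r x) <= d / 4" for k using Kl by (auto simp: not_less)
      have "abs (?S x k - ?S x l) < d" if "N <= k" "N <= l" for k l
      proof -
       have "small_sum v k ?r x = ?S x k - small_sum v k h x" for k using small_sum_add[OF g h(1), of v k 1 "-1" x] by simp
       then show ?thesis using B[of k] B[of l] N[OF that] by (simp add: abs_real_def split: if_splits)
      qed
      then show False using xN by blast
     qed
    qed
   qed (use Bm in auto)
   also have "... <= enn ((128 * V^2 + 1) * nrm ?r / lam^2)" by (rule maximal_small_sum[of ?r v V lam, OF gh v lam])
   also have "... <= enn e"
   proof (rule ennreal_leI)
    have V1: "0 < 128 * V^2 + 1" by (simp add: add_nonneg_pos)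
    have "(128 * V^2 + 1) * nrm ?r <= (128 * V^2 + 1) * (e * lam^2 / (128 * V^2 + 1))" using h(3) V1 by (intro mult_left_mono) auto
    also have "... = e * lam^2" using V1 by simp
    finally show "(128 * V^2 + 1) * nrm ?r / lam^2 <= e" using lam by (simp add: divide_le_eq)
   qed
   finally show ?thesis .
  qed
  then have "leb ?N <= 0 + enn e" if "0 < e" for e using that by simp
  then have "leb ?N <= 0" by (rule ennreal_le_epsilon)
  then have "?N : null_sets lborel" using Nm by (auto simp: null_sets_def)
  then show ?thesis by (rule AE_I') auto
 qed
 have "AE x in lborel. ALL n. EX N. ALL k>=N. ALL l>=N. abs (?S x k - ?S x l) < 1 / real (Suc n)" unfolding AE_all_countable by (rule allI, rule osc) simp
 then show ?thesis unfolding conv_ae_def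
 proof eventually_elim
  fix x assume *: "ALL n. EX N. ALL k>=N. ALL l>=N. abs (?S x k - ?S x l) < 1 / real (Suc n)"
  have "Cauchy (?S x)" unfolding Cauchy_def dist_real_def
  proof (intro allI impI)
   fix e :: real assume "0 < e"
   then obtain n where n: "1 / real (Suc n) < e" using nat_approx_posE by (auto simp: inverse_eq_divide)
   obtain N where "ALL k>=N. ALL l>=N. abs (?S x k - ?S x l) < 1 / real (Suc n)" using * by blast
   then show "EX M. ALL k>=M. ALL l>=M. abs (?S x k - ?S x l) < e" using n by (meson less_trans)
  qed
  then show "convergent (?S x)" by (rule Cauchy_convergent)
 qed
qed

lemma small_sum_Suc: "small_sum v (Suc k) g x = v (- int k - 1) * dif (- int k - 1) g x + small_sum v k g x"
proof -
 have "small_sum v (Suc k) g x = v (- int (Suc k) + int 0) * dif (- int (Suc k) + int 0) g x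
   + (SUM a<k. v (- int (Suc k) + int (Suc a)) * dif (- int (Suc k) + int (Suc a)) g x)" unfolding small_sum_def psum_def by (rule sum.lessThan_Suc_shift)
 moreover have "- int (Suc k) + int (Suc a) = - int k + int a" "- int (Suc k) + int 0 = - int k - 1" for a by simp_all
 ultimately show ?thesis by (simp only: small_sum_def psum_def)
qed

text \<open>Small averages of a function that is constant to the right of \<open>x\<close> coincide.\<close>

lemma convergent_locally_constant:
 assumes d: "0 < d" and c: "!!t. x <= t ==> t <= x + d ==> g t = c"
 shows "convergent (%k. small_sum v k g x)"
proof -
 obtain N where N: "1 / 2 ^ N < d" using d real_arch_pow_inv[of d "1/2"] by (auto simp: power_one_over)
 have av: "avg j g x = c" if "j <= - int N" for j
 proof -
  have "2 powi j <= (2 :: real) powi (- int N)" by (rule powi_mono2[OF that])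
  also have "(2 :: real) powi (- int N) = 1 / 2 ^ N" by (simp add: power_int_minus inverse_eq_divide)
  finally have le: "2 powi j <= d" using N by simp
  have "mass g x (x + 2 powi j) = mass (%t. c * ind {x..x + 2 powi j} t) x (x + 2 powi j)" using le by (intro mass_cong) (auto simp: c)
  also have "... = c * 2 powi j" by (subst mass_indicator) (auto simp: less_imp_le)
  finally show ?thesis by (simp add: avg_def)
 qed
 have "small_sum v (k + N) g x = small_sum v N g x" for k
 proof (induction k)
  case (Suc k)
  then show ?case using av[of "- int (k + N) - 1"] av[of "- int (k + N) - 1 - 1"] by (simp add: small_sum_Suc dif_def)
 qed simp
 then have "(%k. small_sum v (k + N) g x) \<longlonglongrightarrow> small_sum v N g x" by simp
 then have "(%k. small_sum v k g x) \<longlonglongrightarrow> small_sum v N g x" by (rule LIMSEQ_offset)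
 then show ?thesis by (rule convergentI)
qed

lemma L2c_indicator: "E : sets borel ==> E <= {-R..R} ==> L2c (ind E)" unfolding L2c_def
proof (intro conjI exI[of _ R] allI impI)
 assume E: "E : sets borel" "E <= {-R..R}"
 have "(%x. (ind E x)^2) = (ind E :: real => real)" by (auto simp: indicator_def)
 moreover have "integrable lborel (ind E :: real => real)" using ibs_scaled_indicator[OF E, of 1] by (simp add: ibs_def)
 ultimately show "integrable lborel (%x. (ind E x :: real)^2)" by simp
 show "ind E x = (0 :: real)" if "R < abs x" for x
 proof -
  have "x ~: {-R..R}" using that by auto
  then show ?thesis using E(2) by (auto simp: indicator_def)
 qed
qed auto

lemma nrm_indicator_diff:
 assumes "E : sets borel" "F : sets borel" "E <= F"
 shows "nrm (%x. ind F x - ind E x) = rleb (F - E)"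
proof -
 have "(%x. (ind F x - ind E x :: real)^2) = ind (F - E)" using assms(3) by (auto simp: indicator_def fun_eq_iff)
 then show ?thesis using assms by (simp add: nrm_def)
qed

text \<open>Finite unions of intervals are locally constant almost everywhere and exhaust \<open>G\<close>.\<close>

lemma conv_ae_open:
 assumes v: "!!j. abs (v j) <= V" and G: "open G" "G <= {-R..R}"
 shows "conv_ae v (ind G)"
proof (rule conv_ae_limit[OF L2c_indicator[OF _ G(2)] v])
 show "G : sets borel" using G by simp
 fix e :: real assume e: "0 < e"
 have finG: "leb G < \<infinity>"
 proof -
  have "G = G Int {-R..R}" using G by auto
  then show ?thesis using finite_emeasure_Int_Icc[of G "-R" R] by simp
 qed
 obtain D where D: "G = (\<Union>i. D i)" "!!i :: nat. EX a b. D i = {a<..<b}"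
 proof -
  obtain E where E: "countable E" "E <= {{a<..<b} | a b. True}" "\<Union>E = G"
  proof -
   obtain E where E: "countable E" "E <= Pow G" "!!X. X : E ==> EX a b. X = box a b" "\<Union>E = G" using open_countable_Union_open_box[OF G(1)] by metis
   then show ?thesis by (intro that[of E]) (auto simp: box_real)
  qed
  show ?thesis
  proof (cases "E = {}")
   case True
   then show ?thesis using E by (intro that[of "%_. {1<..<0}"]) auto
  next
   case False
   then show ?thesis using E from_nat_into[OF False] range_from_nat_into[OF False E(1)] by (intro that[of "from_nat_into E"]) auto
  qed
 qed
 define F where "F n = (\<Union>i<n. D i)" for n
 have Fo: "open (F n)" for n unfolding F_def by (intro open_UN ballI) (metis D(2) open_greaterThanLessThan)
 have FG: "F n <= G" for n unfolding F_def D(1) by auto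
 have Fb: "F n : sets borel" for n using Fo by simp
 have lim: "(%n. rleb (G - F n)) \<longlonglongrightarrow> 0"
 proof -
  have "(%n. rleb (G - F n)) \<longlonglongrightarrow> rleb (\<Inter>n. G - F n)"
  proof (rule Lim_measure_decseq)
   show "range (%n. G - F n) <= sets lborel" using Fb G by auto
   show "decseq (%n. G - F n)" unfolding F_def by (force simp: decseq_def)
   show "leb (G - F i) ~= \<infinity>" for i using emeasure_mono[of "G - F i" G lborel] finG G by (auto simp: top_unique)
  qed
  moreover have eq: "(\<Inter>n. G - F n) = {}"
  proof -
   have "x : F (Suc i)" if "x : D i" for x i using that unfolding F_def by auto
   then have "EX n. x : F n" if "x : G" for x using that unfolding D(1) by blast
   then show ?thesis by auto
  qed
  ultimately show ?thesis unfolding eq by simp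
 qed
 obtain n where n: "rleb (G - F n) <= e" using order_tendstoD(2)[OF lim e] unfolding eventually_sequentially by (auto intro: less_imp_le)
 have FL: "F n <= {-R..R}" using FG G by blast
 have "conv_ae v (ind (F n))"
 proof -
  obtain a b where ab: "!!i. D i = {a i<..<b i}" using D(2) by metis
  have "AE x in lborel. ALL i. x ~= a i & x ~= b i" unfolding AE_all_countable using AE_lborel_singleton by (auto intro!: AE_conjI)
  then show ?thesis unfolding conv_ae_def
  proof eventually_elim
   fix x assume x: "ALL i. x ~= a i & x ~= b i"
   have "EX d>0. ALL t. x <= t --> t <= x + d --> (t : F n \<longleftrightarrow> x : F n)"
   proof -
    have "EX d>0. ALL t. x <= t --> t <= x + d --> (t : D i \<longleftrightarrow> x : D i)" for i
    proof -
     consider "x < a i" | "a i < x" "x < b i" | "a i < x" "b i < x" using x by (metis linorder_neqE)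
     then show ?thesis
     proof cases
      case 1 then show ?thesis unfolding ab by (intro exI[of _ "(a i - x) / 2"]) (auto simp: field_simps)
     next
      case 2 then show ?thesis unfolding ab by (intro exI[of _ "(b i - x) / 2"]) (auto simp: field_simps)
     next
      case 3 then show ?thesis unfolding ab by (intro exI[of _ 1]) auto
     qed
    qed
    then obtain d where d: "!!i. 0 < d i" "!!i t. x <= t ==> t <= x + d i ==> (t : D i \<longleftrightarrow> x : D i)" by metis
    define d0 where "d0 = Min (insert 1 (d ` {..<n}))"
    have d0: "0 < d0" "!!i. i < n ==> d0 <= d i" unfolding d0_def using d(1) by auto
    have "t : D i \<longleftrightarrow> x : D i" if "i < n" "x <= t" "t <= x + d0" for i t using d(2)[of t i] d0(2)[of i] that by auto
    then have "t : F n \<longleftrightarrow> x : F n" if "x <= t" "t <= x + d0" for t using that unfolding F_def by blast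
    then show ?thesis using d0(1) by blast
   qed
   then obtain d where d: "0 < d" "!!t. x <= t ==> t <= x + d ==> (t : F n \<longleftrightarrow> x : F n)" by blast
   have "ind (F n) t = (ind (F n) x :: real)" if "x <= t" "t <= x + d" for t by (simp add: indicator_def d(2)[OF that])
   then show "convergent (%k. small_sum v k (ind (F n)) x)" by (rule convergent_locally_constant[OF d(1)])
  qed
 qed
 moreover have "nrm (%x. ind G x - ind (F n) x) <= e" using n nrm_indicator_diff[OF Fb _ FG, of n] G by simp
 ultimately show "EX h. L2c h & conv_ae v h & nrm (%x. ind G x - h x) <= e" using L2c_indicator[OF Fb FL] by blast
qed

lemma nrm_minus_commute: "nrm (%x. g x - h x) = nrm (%x. h x - g x)" by (simp add: nrm_def power2_commute)

lemma conv_ae_borel: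
 assumes v: "!!j. abs (v j) <= V" and E: "E : sets borel" "E <= {-R..R}"
 shows "conv_ae v (ind E)"
proof (rule conv_ae_limit[OF L2c_indicator[OF E] v])
 fix e :: real assume e: "0 < e"
 obtain G0 where G0: "open G0" "E <= G0" "leb (G0 - E) < enn e" using outer_regular_lborel[OF E(1) e] by auto
 define G where "G = G0 Int {-R - 1<..<R + 1}"
 have G: "open G" "G <= {-(R + 1)..R + 1}" "E <= G" "G <= G0" unfolding G_def using G0 E by auto
 have Gb: "G : sets borel" using G by simp
 have "rleb (G - E) <= e" unfolding measure_def
 proof (intro enn2real_leI)
  have "leb (G - E) <= leb (G0 - E)" using G G0 E by (intro emeasure_mono) auto
  then show "leb (G - E) <= enn e" using G0(3) by simp
 qed (use e in simp)
 then have "nrm (%x. ind E x - ind G x) <= e" using nrm_indicator_diff[OF E(1) Gb G(3)] nrm_minus_commute[of "ind E" "ind G"] by simp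
 then show "EX h. L2c h & conv_ae v h & nrm (%x. ind E x - h x) <= e" using conv_ae_open[of v V G "R + 1", OF v G(1,2)] L2c_indicator[OF Gb G(2)] by blast
qed

lemma conv_ae_sum:
 assumes "finite A" "!!i. i : A ==> L2c (g i)" "!!i. i : A ==> conv_ae v (g i)"
 shows "conv_ae v (%x. SUM i:A. c i * g i x)" using assms
proof (induction A rule: finite_induct)
 case empty
 have "convergent (%k. small_sum v k (%x. 0) x)" for x by (rule convergent_locally_constant[of 1]) auto
 then show ?case by (simp add: conv_ae_def)
next
 case (insert i A)
 then have "conv_ae v (%x. c i * g i x + 1 * (SUM i:A. c i * g i x))" by (intro conv_ae_add L2c_sum) auto
 then show ?case using insert by simp
qed

lemma conv_ae_L2c:
 assumes v: "!!j. abs (v j) <= V" and g: "L2c g"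
 shows "conv_ae v g"
proof (rule conv_ae_limit[OF g v])
 fix e :: real assume e: "0 < e"
 have gm: "g : borel_measurable lborel" using g by (simp add: L2c_def)
 obtain R where R: "!!x. R < abs x ==> g x = 0" using g by (auto simp: L2c_def)
 obtain s where s: "!!i :: nat. simple_function lborel (s i)" "!!x. (%i. s i x) \<longlonglongrightarrow> g x"
  "!!i x. dist (s i x) 0 <= 2 * dist (g x) 0" using borel_measurable_implies_sequence_metric[OF gm, of 0] by auto
 have sb: "abs (s i x) <= 2 * abs (g x)" for i x using s(3)[of i x] by simp
 have sm [measurable]: "s i : Borel" for i using borel_measurable_simple_function[OF s(1)[of i]] by simp
 have [measurable]: "g : Borel" using g by (simp add: L2c_def)
 have lim: "(%i. nrm (%x. g x - s i x)) \<longlonglongrightarrow> nrm (%x. 0)" unfolding nrm_def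
 proof (rule integral_dominated_convergence)
  show "integrable lborel (%x. 9 * (g x)^2)" using g by (simp add: L2c_def)
  show "AE x in lborel. (%i. (g x - s i x)^2) \<longlonglongrightarrow> 0^2"
  proof (rule AE_I2)
   fix x
   have "(%i. (g x - s i x)^2) \<longlonglongrightarrow> (g x - g x)^2" by (intro tendsto_intros s(2))
   then show "(%i. (g x - s i x)^2) \<longlonglongrightarrow> 0^2" by simp
  qed
  show "AE x in lborel. norm ((g x - s i x)^2) <= 9 * (g x)^2" for i
  proof (rule AE_I2)
   fix x
   have "abs (g x - s i x) <= 3 * abs (g x)" using sb[of i x] by linarith
   then have "abs (g x - s i x)^2 <= (3 * abs (g x))^2" by (rule power_mono) simp
   then show "norm ((g x - s i x)^2) <= 9 * (g x)^2" by (simp add: power_mult_distrib)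
  qed
 qed measurable
 then obtain i where i: "nrm (%x. g x - s i x) <= e" using order_tendstoD(2)[OF lim, of e] e unfolding eventually_sequentially by (auto simp: nrm_def intro: less_imp_le)
 let ?Y = "s i ` UNIV - {0}"
 have fin: "finite ?Y" using simple_functionD(1)[OF s(1)[of i]] by simp
 have rep: "s i x = (SUM y:?Y. y * ind (s i -` {y}) x)" for x
 proof (cases "s i x = 0")
  case True
  have "(SUM y:?Y. y * ind (s i -` {y}) x) = 0" using True by (intro sum.neutral) (auto simp: indicator_def)
  then show ?thesis using True by simp
 next
  case False
  have "(SUM y:?Y. y * ind (s i -` {y}) x) = (SUM y:{s i x}. y * ind (s i -` {y}) x)" using fin False by (intro sum.mono_neutral_right) (auto simp: indicator_def)
  then show ?thesis by simp
 qed
 have lev: "s i -` {y} : sets borel" "s i -` {y} <= {-R..R}" if "y : ?Y" for y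
 proof -
  show "s i -` {y} : sets borel" using measurable_sets[OF sm[of i], of "{y}"] by simp
  show "s i -` {y} <= {-R..R}"
  proof
   fix x assume "x : s i -` {y}"
   then have "s i x ~= 0" using that by auto
   then have "g x ~= 0" using sb[of i x] by auto
   then have "\<not> R < abs x" using R by auto
   then show "x : {-R..R}" by auto
  qed
 qed
 have "conv_ae v (%x. SUM y:?Y. y * ind (s i -` {y}) x)" by (intro conv_ae_sum fin L2c_indicator[OF lev] conv_ae_borel[of v V _ R, OF v lev])
 moreover have "L2c (%x. SUM y:?Y. y * ind (s i -` {y}) x)" by (intro L2c_sum fin L2c_indicator[OF lev])
 ultimately show "EX h. L2c h & conv_ae v h & nrm (%x. g x - h x) <= e" using i unfolding ext[of "s i", OF rep, symmetric] by blast
qed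

lemma large_scales_convergent:
 assumes g: "integrable lborel g" and v: "!!j. abs (v j) <= V"
 shows "convergent (%n. psum v 0 (Suc n) g x)"
proof -
 define G where "G = (LINT t|lborel. abs (g t))"
 have V: "0 <= V" using v[of 0] by linarith
 have G0: "0 <= G" by (simp add: G_def)
 have av: "abs (avg j g x) <= G / 2 powi j" for j
 proof -
  have "abs (mass g x (x + 2 powi j)) <= mass (%t. abs (g t)) x (x + 2 powi j)" by (rule mass_abs_le[OF g])
  also have "... <= G" unfolding G_def mass_def sli_def using set_integrable_Icc[OF integrable_abs[OF g], of x "x + 2 powi j"] g
   by (intro integral_mono) (auto simp: set_integrable_def indicator_def)
  finally show ?thesis by (simp only: avg_def abs_divide abs_of_pos[OF powi_pos]) (simp add: divide_right_mono less_imp_le)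
 qed
 have "summable (%a. v (int a) * dif (int a) g x)"
 proof (rule summable_comparison_test')
  show "summable (%a. V * (3 * G) * (1/2) ^ a)" by (intro summable_mult summable_geometric) simp
  fix a :: nat
  have "abs (dif (int a) g x) <= G / 2 powi (int a) + G / 2 powi (int a - 1)" unfolding dif_def using av[of "int a"] av[of "int a - 1"] by linarith
  also have "(2 :: real) powi (int a - 1) = 2 ^ a / 2" by (simp add: power_int_diff)
  finally have "abs (dif (int a) g x) <= 3 * G * (1/2) ^ a" by (simp add: power_divide)
  then show "norm (v (int a) * dif (int a) g x) <= V * (3 * G) * (1/2) ^ a" using v[of "int a"] V G0 by (simp add: abs_mult mult.assoc) (intro mult_mono, auto)
 qed
 then have "convergent (%n. SUM a<n. v (int a) * dif (int a) g x)" by (simp add: summable_iff_convergent)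
 then show ?thesis unfolding psum_def by (subst (asm) convergent_Suc_iff[symmetric]) simp
qed

definition Tlim :: "(int => real) => (real => real) => real => real" where
 "Tlim v g x = lim (%n. psum2 v g x (n, n))"

definition Tconv :: "(int => real) => (real => real) => real => bool" where
 "Tconv v g x \<longleftrightarrow> (psum2 v g x \<longlongrightarrow> Tlim v g x) (sequentially \<times>\<^sub>F sequentially)"

lemma Tconv_AE:
 assumes g: "L2c g" and v: "!!j. abs (v j) <= V"
 shows "AE x in lborel. Tconv v g x" using conv_ae_L2c[OF v g] unfolding conv_ae_def
proof eventually_elim
 fix x assume "convergent (%k. small_sum v k g x)"
 then obtain a where a: "(%k. small_sum v k g x) \<longlonglongrightarrow> a" by (auto simp: convergent_def)
 obtain b where b: "(%n. psum v 0 (Suc n) g x) \<longlonglongrightarrow> b" using large_scales_convergent[of g v V x, OF L2c_integrable[OF g] v] by (auto simp: convergent_def)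
 have "psum2 v g x = (%p. small_sum v (fst p) g x + psum v 0 (Suc (snd p)) g x)"
 proof
  show "psum2 v g x p = small_sum v (fst p) g x + psum v 0 (Suc (snd p)) g x" for p using psum2_split[of v g x "fst p" "snd p"] by simp
 qed
 then have lim2: "(psum2 v g x \<longlongrightarrow> a + b) (sequentially \<times>\<^sub>F sequentially)"
  using tendsto_add[OF filterlim_compose[OF a filterlim_fst] filterlim_compose[OF b filterlim_snd]] by simp
 have "(%n. psum2 v g x (n, n)) \<longlonglongrightarrow> a + b" using tendsto_add[OF a b] unfolding psum2_split .
 then have "Tlim v g x = a + b" unfolding Tlim_def by (rule limI)
 then show "Tconv v g x" using lim2 by (simp add: Tconv_def)
qed

lemma Tconv_diag: "Tconv v g x ==> (%n. psum2 v g x (n, n)) \<longlonglongrightarrow> Tlim v g x"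
 unfolding Tconv_def by (rule filterlim_compose[of _ _ _ "%n. (n, n)"]) (auto intro: filterlim_Pair filterlim_ident)

lemma Tlim_measurable: "L2c g ==> Tlim v g : Borel" unfolding Tlim_def[abs_def] psum2_def by (intro borel_measurable_lim_metric) (auto intro!: L2c_measurable[OF psum_L2c])

text \<open>Fatou's lemma along the diagonal partial sums.\<close>

lemma Tlim_weak_type:
 assumes g: "L2c g" and v: "!!j. abs (v j) <= V" and V: "0 < V" and lam: "0 < lam"
 shows "leb {x. lam < abs (Tlim v g x)} <= enn (600 * V / lam * (LINT x|lborel. abs (g x)))"
proof -
 let ?K = "enn (600 * V / lam * (LINT x|lborel. abs (g x)))"
 have pm [measurable]: "(%x. psum2 v g x (n, n)) : Borel" for n unfolding psum2_def by (auto intro!: L2c_measurable[OF psum_L2c] g)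
 have [measurable]: "Tlim v g : Borel" by (rule Tlim_measurable[OF g])
 have "leb {x. lam < abs (Tlim v g x)} = (lint (%x. ind {x. lam < abs (Tlim v g x)} x))" by simp
 also have "... <= (lint (%x. liminf (%n. ind {x. lam < abs (psum2 v g x (n, n))} x)))"
 proof (rule nn_integral_mono_AE)
  show "AE x in lborel. ind {x. lam < abs (Tlim v g x)} x <= liminf (%n. ind {x. lam < abs (psum2 v g x (n, n))} x :: ennreal)" using Tconv_AE[OF g v]
  proof eventually_elim
   fix x assume "Tconv v g x"
   then have lim: "(%n. abs (psum2 v g x (n, n))) \<longlonglongrightarrow> abs (Tlim v g x)" by (intro tendsto_rabs Tconv_diag)
   show "ind {x. lam < abs (Tlim v g x)} x <= liminf (%n. ind {x. lam < abs (psum2 v g x (n, n))} x :: ennreal)"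
   proof (cases "lam < abs (Tlim v g x)")
    case True
    have "\<forall>\<^sub>F n in sequentially. lam < abs (psum2 v g x (n, n))" by (rule order_tendstoD(1)[OF lim True])
    then have "1 <= liminf (%n. ind {x. lam < abs (psum2 v g x (n, n))} x :: ennreal)" by (intro Liminf_bounded) (auto elim!: eventually_mono)
    then show ?thesis using True by simp
   qed simp
  qed
 qed
 also have "... <= liminf (%n. \<integral>\<^sup>+x. ind {x. lam < abs (psum2 v g x (n, n))} x \<partial>lborel)" by (intro nn_integral_liminf) measurable
 also have "... <= liminf (%n. ?K)"
 proof (intro Liminf_mono always_eventually allI)
  fix n
  have "(lint (%x. ind {x. lam < abs (psum2 v g x (n, n))} x)) = leb {x. lam < abs (psum2 v g x (n, n))}" by (rule nn_integral_indicator) measurable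
  also have "... <= ?K" unfolding psum2_def using weak_type_psum[OF g v V lam] by simp
  finally show "(lint (%x. ind {x. lam < abs (psum2 v g x (n, n))} x)) <= ?K" .
 qed
 also have "... = ?K" by (simp add: Liminf_const)
 finally show ?thesis .
qed

section \<open>Bounded mean oscillation\<close>

definition mean :: "(real => real) => real => real => real" where
 "mean g x y = mass g x y / (y - x)"

definition dbl_mean :: "(real => real) => real => real => real" where
 "dbl_mean g q q' = mean g (2 * q - q') q'"

lemma power_le_exp: "0 <= y ==> y ^ m <= (24 * real m) ^ m * exp (y / 24)"
proof (cases "m = 0")
 case False
 assume y: "0 <= y"
 have "(y / 24 / real m) ^ m <= (1 + y / 24 / real m) ^ m" using y by (intro power_mono) auto
 also have "... <= exp (y / 24)" using False y by (intro exp_ge_one_plus_x_over_n_power_n) auto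
 finally show ?thesis using False by (simp add: power_divide power_mult_distrib field_simps)
qed simp

locale bmo_unit =
 fixes b :: "real => real"
 assumes b_meas [measurable]: "b : Borel"
  and b_loc: "!!x y. set_integrable lborel {x..y} b"
  and osc: "!!x y. x < y ==> mass (%t. abs (b t - mean b x y)) x y <= y - x"
begin

lemma integrable_dev: "integrable lborel (%t. ind {x..y} t * abs (b t - k))"
proof -
 have "set_integrable lborel {x..y} (%t. k)" unfolding set_integrable_def by (intro integrable_scaleR_left integrable_real_indicator) (auto simp: emeasure_lborel_Icc_eq)
 from set_integrable_abs[OF set_integral_diff(1)[OF b_loc this]] show ?thesis by (simp add: set_integrable_def)
qed

lemma mass_dev_subset:
 assumes "x <= x'" "y' <= y"
 shows "mass (%t. abs (b t - k)) x' y' <= mass (%t. abs (b t - k)) x y" using mass_subset[OF integrable_dev[of x y k], of x x' y' y] assms by (simp add: mass_restrict)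

lemma mean_compare:
 assumes "x <= y"
 shows "(y - x) * abs (k - k') <= mass (%t. abs (b t - k)) x y + mass (%t. abs (b t - k')) x y"
proof -
 let ?g = "%k t. ind {x..y} t * abs (b t - k)"
 have "(y - x) * abs (k - k') = mass (%t. abs (k - k') * ind {x..y} t) x y" using assms by (subst mass_indicator) auto
 also have "... <= mass (%t. 1 * ?g k t + 1 * ?g k' t) x y"
 proof (rule mass_mono)
  show "integrable lborel (%t. abs (k - k') * ind {x..y} t)" by (intro integrable_mult_right integrable_real_indicator) (auto simp: emeasure_lborel_Icc_eq)
  show "integrable lborel (%t. 1 * ?g k t + 1 * ?g k' t)" using integrable_dev by simp
  fix t assume "x <= t" "t <= y"
  then show "abs (k - k') * ind {x..y} t <= 1 * ?g k t + 1 * ?g k' t" by (simp add: indicator_def)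
 qed
 also have "... = mass (?g k) x y + mass (?g k') x y" using mass_add[OF integrable_dev[of x y k] integrable_dev[of x y k'], of 1 1] by simp
 finally show ?thesis by (simp add: mass_restrict)
qed

text \<open>John--Nirenberg: the rising sun lemma for \<open>\<bar>b - be\<bar> / 4\<close> selects intervals of at most half the total
 length, outside of which \<open>\<bar>b - be\<bar> \<le> 4\<close>, and on whose doubles the mean of \<open>b\<close> moved by at most \<open>6\<close>.
 Doubling to the left keeps every selected interval inside the region where the oscillation is
 controlled.\<close>

lemma john_nirenberg:
 assumes "q < q'"
 shows "leb {x : {q..q'}. 6 * real n < abs (b x - dbl_mean b q q')} <= enn ((q' - q) / 2 ^ n)" using assms
proof (induction n arbitrary: q q')
 case 0
 have "leb {x : {q..q'}. 6 * real 0 < abs (b x - dbl_mean b q q')} <= leb {q..q'}" by (intro emeasure_mono) auto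
 then show ?case using 0 by simp
next
 case (Suc n)
 define be where "be = dbl_mean b q q'"
 (* the left end of the doubled interval: selected intervals that meet {q..q'} have at most half its length, so they stay right of q0 *)
 define q0 where "q0 = 2 * q - q'"
 define g where "g t = ind {q0..q'} t * abs (b t - be) / 4" for t
 let ?S = "{x : {q..q'}. 6 * real (Suc n) < abs (b x - be)}"
 have q: "q0 < q" "q - q0 = q' - q" "q < q'" using Suc.prems by (auto simp: q0_def)
 have gi: "integrable lborel g" unfolding g_def by (intro integrable_divide integrable_dev)
 have ibs: "ibs g" unfolding ibs_def
 proof (intro conjI gi exI allI impI)
  fix x assume "abs q0 + abs q' < abs x"
  then show "g x = 0" by (auto simp: g_def indicator_def)
 qed
 have gm: "g : Borel" and nn: "!!t. 0 <= g t" unfolding g_def[abs_def] by auto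
 have [measurable]: "?S : sets borel" by measurable
 have U: "open (rset g)" "bounded (rset g)" using open_rset[OF gi nn] bounded_rset[OF ibs nn] by auto
 then have [measurable]: "rset g : sets borel" by simp
 have m4: "mass g x y = mass (%t. abs (b t - be)) x y / 4" if "q0 <= x" "y <= q'" for x y using mass_restrict[of q0 x y q' "%t. abs (b t - be)"] that unfolding g_def mass_divide by simp
 have "(LINT t|lborel. g t) = mass g q0 q'" unfolding mass_def sli_def by (intro Bochner_Integration.integral_cong) (auto simp: g_def indicator_def)
 also have "... <= (q' - q) / 2" using osc[of q0 q'] q by (simp add: m4 be_def dbl_mean_def q0_def)
 finally have eU: "leb (rset g) <= enn ((q' - q) / 2)" using rset_weak_type[OF ibs nn gm] by (meson ennreal_leI order_trans)
 let ?M = "density lborel (ind ?S :: real => ennreal)"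
 have M: "emeasure ?M X = leb (?S Int X)" if "X : sets borel" for X using that by (simp add: emeasure_density indicator_inter_arith[symmetric])
 have comp: "emeasure ?M C <= enn (1 / 2 ^ n) * leb C" if C: "C : components (rset g)" for C
 proof (cases "C Int {q..q'} = {}")
  case True
  have "open C" using U(1) C by (rule open_components)
  moreover have "?S Int C = {}" using True by blast
  ultimately show ?thesis using M[of C] by simp
 next
  case False
  obtain a c where ac: "a < c" "C = {a<..<c}" "a ~: rset g" "c ~: rset g" using component_Ioo[OF U C] by metis
  have sub: "C <= rset g" using C by (rule in_components_subset)
  have "enn (c - a) <= enn ((q' - q) / 2)" using emeasure_mono[OF sub, of lborel] eU ac by simp
  then have len: "c - a <= (q' - q) / 2" using q by simp
  have "c <= q'"
  proof (rule ccontr)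
   assume "\<not> c <= q'"
   then have "(max a q' + c) / 2 : rset g" using sub ac by (auto simp: max_def field_simps)
   then obtain y where "y > (max a q' + c) / 2" "y - (max a q' + c) / 2 < mass g ((max a q' + c) / 2) y" by (auto simp: rset_def)
   moreover have "mass g ((max a q' + c) / 2) y = 0" using \<open>\<not> c <= q'\<close> by (intro mass_eq_0) (auto simp: g_def indicator_def max_def split: if_splits)
   ultimately show False by simp
  qed
  moreover have "q <= c" using False ac by auto
  ultimately have in_: "q0 <= a" "c <= q'" using len q by auto
  define be' where "be' = dbl_mean b a c"
  have "mass (%t. abs (b t - be)) a c <= 4 * (c - a)" using not_rset[OF ac(3), of c] ac(1) m4[OF in_] by simp
  moreover have "mass (%t. abs (b t - be')) a c <= 2 * (c - a)" using mass_dev_subset[of "2 * a - c" a c c be'] osc[of "2 * a - c" c] ac(1) by (simp add: be'_def dbl_mean_def)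
  ultimately have "(c - a) * abs (be - be') <= (c - a) * 6" using mean_compare[of a c be be'] ac(1) by simp
  then have 6: "abs (be - be') <= 6" using ac(1) by (simp only: mult_le_cancel_left_pos diff_gt_0_iff_gt)
  have "?S Int C <= {x : {a..c}. 6 * real n < abs (b x - be')}" using 6 ac(2) by auto
  then have "leb (?S Int C) <= leb {x : {a..c}. 6 * real n < abs (b x - be')}" by (rule emeasure_mono) measurable
  also have "... <= enn ((c - a) / 2 ^ n)" using Suc.IH[OF ac(1)] by (simp only: be'_def)
  also have "... = enn (1 / 2 ^ n) * leb C" using ac by (simp add: ennreal_mult'[symmetric])
  finally show ?thesis using M[of C] ac by simp
 qed
 have "leb ?S <= leb (?S Int rset g)"
 proof (rule emeasure_mono_AE)
  show "AE x in lborel. x : ?S --> x : ?S Int rset g" using rset_AE[OF ibs nn gm]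
  proof eventually_elim
   fix x assume "x ~: rset g --> g x <= 1"
   then show "x : ?S --> x : ?S Int rset g" using q by (auto simp: g_def indicator_def)
  qed
 qed simp
 also have "... = emeasure ?M (rset g)" by (rule M[symmetric]) measurable
 also have "... = (\<integral>\<^sup>+C. emeasure ?M C \<partial>count_space (components (rset g)))" by (intro emeasure_components U) simp
 also have "... <= (\<integral>\<^sup>+C. enn (1 / 2 ^ n) * leb C \<partial>count_space (components (rset g)))" by (intro nn_integral_mono comp) simp
 also have "... = enn (1 / 2 ^ n) * (\<integral>\<^sup>+C. leb C \<partial>count_space (components (rset g)))" by (rule nn_integral_cmult) simp
 also have "... = enn (1 / 2 ^ n) * leb (rset g)" using emeasure_components[OF U(1), of lborel] by simp
 also have "... <= enn (1 / 2 ^ n) * enn ((q' - q) / 2)" by (intro mult_left_mono eU) simp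
 also have "... = enn ((q' - q) / 2 ^ Suc n)" by (simp add: ennreal_mult'[symmetric] mult.commute)
 finally show ?case by (simp add: be_def)
qed

lemma john_nirenberg_exp:
 assumes "q < q'"
 shows "(lint_on {q..q'} (%x. enn (exp (abs (b x - dbl_mean b q q') / 24)))) <= enn (5 * (q' - q))"
proof -
 let ?u = "%x. abs (b x - dbl_mean b q q')"
 let ?E = "%n. {x : {q..q'}. 6 * real n < ?u x}"
 have [measurable]: "?E n : sets borel" for n by measurable
 have "exp (1 / 4 :: real) <= 4 / 3" using exp_ge_add_one_self[of "-1/4 :: real"] by (simp add: exp_minus field_simps)
 then have e4: "exp ((1 + real n) / 4) <= (4 / 3) ^ Suc n" for n
  using power_mono[of "exp (1 / 4 :: real)" "4 / 3" "Suc n"] exp_of_nat_mult[of "Suc n" "1 / 4 :: real", symmetric] by (simp del: power_Suc)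
 have pt: "enn (exp (?u x / 24)) * ind {q..q'} x
   <= ind {q..q'} x + (\<Sum>n. enn ((4 / 3) ^ Suc n) * ind (?E n) x)" for x
 proof (cases "x : {q..q'} & ?u x ~= 0")
  case True
  define n where "n = nat (\<lceil>?u x / 6\<rceil> - 1)"
  have "0 < \<lceil>?u x / 6\<rceil>" using True by simp
  then have "real n = of_int \<lceil>?u x / 6\<rceil> - 1" unfolding n_def by simp
  then have n: "6 * real n < ?u x" "?u x <= 6 * (1 + real n)" using ceiling_correct[of "?u x / 6"] by (simp_all only: field_simps) linarith+
  have "exp (?u x / 24) <= exp ((1 + real n) / 4)" using n(2) by simp
  also have "... <= (4 / 3) ^ Suc n" by (rule e4)
  finally have "enn (exp (?u x / 24)) <= enn ((4 / 3) ^ Suc n) * ind (?E n) x" using n(1) True by (auto intro!: ennreal_leI simp del: power_Suc)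
  also have "... <= (\<Sum>n. enn ((4 / 3) ^ Suc n) * ind (?E n) x)"
  proof -
   have "h n <= suminf h" for h :: "nat => ennreal" using sum_le_suminf[of h "{n}"] by simp
   then show ?thesis .
  qed
  finally have "enn (exp (?u x / 24)) <= (\<Sum>n. enn ((4 / 3) ^ Suc n) * ind (?E n) x)" .
  moreover have "ind {q..q'} x = (1 :: ennreal)" using True by simp
  ultimately show ?thesis by (simp only: mult_1_right add_increasing zero_le_one)
 qed (auto simp: indicator_def)
 have "(lint_on {q..q'} (%x. enn (exp (?u x / 24))))
   <= (lint (%x. ind {q..q'} x + (\<Sum>n. enn ((4 / 3) ^ Suc n) * ind (?E n) x)))" by (intro nn_integral_mono pt)
 also have "... = leb {q..q'} + (\<Sum>n. enn ((4 / 3) ^ Suc n) * leb (?E n))" by (subst nn_integral_add) (auto simp del: power_Suc simp: nn_integral_suminf nn_integral_cmult_indicator)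
 also have "... <= enn (q' - q) + (\<Sum>n. enn (4 / 3 * (q' - q) * (2 / 3) ^ n))"
 proof (intro add_mono suminf_le summableI)
  show "leb {q..q'} <= enn (q' - q)" using assms by simp
  fix n
  have "enn ((4 / 3) ^ Suc n) * leb (?E n) <= enn ((4 / 3) ^ Suc n) * enn ((q' - q) / 2 ^ n)" by (intro mult_left_mono john_nirenberg assms) simp
  also have "... = enn (4 / 3 * (q' - q) * (2 / 3) ^ n)"
  proof -
   have "(2 / 3 :: real) ^ n * 2 ^ n = (4 / 3) ^ n" by (simp add: power_mult_distrib[symmetric])
   then have "(4 / 3 :: real) ^ n / 2 ^ n = (2 / 3) ^ n" by (simp add: field_simps)
   moreover have "(4 / 3) ^ Suc n * ((q' - q) / 2 ^ n) = 4 / 3 * (q' - q) * ((4 / 3) ^ n / 2 ^ n)" by simp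
   ultimately have "(4 / 3) ^ Suc n * ((q' - q) / 2 ^ n) = 4 / 3 * (q' - q) * (2 / 3) ^ n" by (simp only:)
   then show ?thesis by (simp only: ennreal_mult'[symmetric] zero_le_power zero_le_divide_iff zero_le_numeral simp_thms)
  qed
  finally show "enn ((4 / 3) ^ Suc n) * leb (?E n) <= enn (4 / 3 * (q' - q) * (2 / 3) ^ n)" .
 qed
 also have "(\<Sum>n. enn (4 / 3 * (q' - q) * (2 / 3) ^ n)) = enn (4 * (q' - q))"
 proof (rule suminf_ennreal_eq)
  show "(%n. 4 / 3 * (q' - q) * (2 / 3) ^ n) sums (4 * (q' - q))"
  proof -
   have "(%n. (2 / 3 :: real) ^ n) sums (1 / (1 - 2 / 3))" by (rule geometric_sums) simp
   from sums_mult[OF this, of "4 / 3 * (q' - q)"] show ?thesis by (rule back_subst[of "%y. (%n. 4 / 3 * (q' - q) * (2 / 3) ^ n) sums y"]) simp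
  qed
 qed (use assms in simp)
 also have "enn (q' - q) + enn (4 * (q' - q)) = enn (5 * (q' - q))" using assms by (simp add: ennreal_plus[symmetric] del: ennreal_plus)
 finally show ?thesis .
qed

lemma mean_dbl:
 assumes "0 < L"
 shows "abs (dbl_mean b x (x + 2 * L) - dbl_mean b x (x + L)) <= 3"
proof -
 let ?k = "dbl_mean b x (x + 2 * L)" and ?k' = "dbl_mean b x (x + L)"
 have "(x + L - (x - L)) * abs (?k - ?k') <= mass (%t. abs (b t - ?k)) (x - L) (x + L) + mass (%t. abs (b t - ?k')) (x - L) (x + L)" using assms by (intro mean_compare) simp
 also have "mass (%t. abs (b t - ?k')) (x - L) (x + L) <= 2 * L" using osc[of "x - L" "x + L"] assms by (simp add: dbl_mean_def)
 also have "mass (%t. abs (b t - ?k)) (x - L) (x + L) <= mass (%t. abs (b t - ?k)) (x - 2 * L) (x + 2 * L)" using assms by (intro mass_dev_subset) auto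
 also have "... <= 4 * L" using osc[of "x - 2 * L" "x + 2 * L"] assms by (simp add: dbl_mean_def)
 finally have "2 * L * abs (?k - ?k') <= 2 * L * 3" by simp
 then show ?thesis using assms by simp
qed

lemma L2c_dev_power:
 assumes [measurable]: "f : Borel" and F: "!!t. abs (f t) <= K" and R: "!!t. R < abs t ==> f t = 0"
 shows "L2c (%t. (c - b t) ^ m * f t)" unfolding L2c_def
proof (intro conjI exI[of _ R] allI impI)
 let ?h = "%t. ((c - b t) ^ m * f t)^2"
 define R' where "R' = abs R + 1"
 define be where "be = dbl_mean b (-R') R'"
 define C where "C = K^2 * ((24 * real (2 * m)) ^ (2 * m) * exp (abs (c - be) / 24))"
 have bd: "?h t <= C * exp (abs (b t - be) / 24)" for t
 proof -
  have "abs (c - b t) ^ (2 * m) <= (24 * real (2 * m)) ^ (2 * m) * exp (abs (c - b t) / 24)" by (rule power_le_exp) simp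
  also have "... <= (24 * real (2 * m)) ^ (2 * m) * (exp (abs (c - be) / 24) * exp (abs (b t - be) / 24))" unfolding exp_add[symmetric] by (intro mult_left_mono) auto
  finally have 1: "((c - b t) ^ m)^2 <= (24 * real (2 * m)) ^ (2 * m) * exp (abs (c - be) / 24) * exp (abs (b t - be) / 24)"
   by (simp add: power_mult[symmetric] power_even_abs mult.commute mult.left_commute)
  have "(f t)^2 <= K^2" using power_mono[OF F[of t], of 2] by simp
  from mult_mono[OF this 1] show ?thesis by (simp add: C_def power_mult_distrib mult_ac)
 qed
 have "(lint (%t. enn (norm (?h t)))) <= (lint (%t. enn C * (enn (exp (abs (b t - be) / 24)) * ind {-R'..R'} t)))"
 proof (rule nn_integral_mono)
  fix t
  show "enn (norm (?h t)) <= enn C * (enn (exp (abs (b t - be) / 24)) * ind {-R'..R'} t)"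
  proof (cases "t : {-R'..R'}")
   case True
   then show ?thesis using bd[of t] by (simp add: ennreal_mult''[symmetric] ennreal_leI)
  next
   case False
   then have "R < abs t" by (auto simp: R'_def)
   then show ?thesis using R by simp
  qed
 qed
 also have "... = enn C * (lint_on {-R'..R'} (%t. enn (exp (abs (b t - be) / 24))))" by (rule nn_integral_cmult) measurable
 also have "... <= enn C * enn (5 * (R' - (-R')))" unfolding be_def by (intro mult_left_mono john_nirenberg_exp) (auto simp: R'_def)
 also have "... < \<infinity>" by (simp add: ennreal_mult_less_top)
 finally show "integrable lborel ?h" by (intro integrableI_bounded) auto
 show "(c - b t) ^ m * f t = 0" if "R < abs t" for t using R[OF that] by simp
qed measurable

end

section \<open>The Young function\<close>

lemma log_plus_mono: "s <= t ==> log_plus s <= log_plus t" by (auto simp: log_plus_def intro: max.coboundedI1)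

lemma log_plus_nonneg [simp]: "0 <= log_plus s" by (simp add: log_plus_def)

lemma log_plus_measurable [measurable]: "log_plus : Borel" unfolding log_plus_def[abs_def] by measurable

definition log_factor :: "nat => real => real => real" where
 "log_factor k e u = (1 + log_plus u) ^ (1 + k) * (1 + log_plus (log_plus u)) powr (1 + e)"

lemma LlogL_factor: "LL k e u = u * log_factor k e u" by (simp add: LlogL_loglogL_def log_factor_def mult.assoc)

lemma log_factor_ge1: "0 < e ==> 1 <= log_factor k e u" using mult_mono[OF one_le_power[of "1 + log_plus u" "1 + k"] ge_one_powr_ge_zero[of "1 + log_plus (log_plus u)" "1 + e"]]
 by (simp add: log_factor_def)

lemma log_factor_mono: "0 < e ==> u <= u' ==> log_factor k e u <= log_factor k e u'" unfolding log_factor_def by (intro mult_mono power_mono powr_mono2 add_left_mono log_plus_mono) auto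

lemma LlogL_ge: "0 < e ==> 0 <= u ==> u <= LL k e u" unfolding LlogL_factor using mult_left_mono[OF log_factor_ge1[of e k u], of u] by simp

lemma LlogL_nonneg: "0 < e ==> 0 <= u ==> 0 <= LL k e u" using LlogL_ge[of e u k] by linarith

lemma LlogL_mono: "0 < e ==> 0 <= u ==> u <= u' ==> LL k e u <= LL k e u'" unfolding LlogL_factor using log_factor_ge1[of e k u] by (intro mult_mono log_factor_mono) auto

lemma LlogL_scale: "0 < e ==> 0 <= u ==> 0 <= c ==> c <= 1 ==> LL k e (c * u) <= c * LL k e u" unfolding LlogL_factor using log_factor_mono[of e "c * u" u k]
 by (simp add: mult.assoc mult_left_le_one_le mult_left_mono)

lemma LlogL_measurable [measurable]: "LL k e : Borel" unfolding LlogL_loglogL_def[abs_def] by measurable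

definition young_coeff :: "real => nat => real" where
 "young_coeff e n = 1 / ((1 + real n / 8) * (1 + log_plus (real n / 8)) powr (1 + e))"

lemma young_coeff_nonneg: "0 <= young_coeff e n" by (simp add: young_coeff_def)

text \<open>The extra double logarithm makes the coefficients summable (Cauchy condensation).\<close>

lemma summable_young_coeff:
 assumes "0 < e" shows "summable (young_coeff e)"
proof -
 have "young_coeff e (Suc m) <= young_coeff e m" if "0 < m" for m unfolding young_coeff_def using assms
  by (intro divide_left_mono mult_mono powr_mono2 add_left_mono log_plus_mono mult_pos_pos)
   (auto intro!: add_pos_nonneg simp: add_nonneg_eq_0_iff)
 moreover have "summable (%j. 2 ^ j * young_coeff e (2 ^ j))"
 proof (rule summable_comparison_test')
  show "summable (%j. 8 * 8 powr (1 + e) * real (j + 1) powr (- 1 - e))" using assms by (intro summable_mult summable_ignore_initial_segment) (simp add: summable_real_powr_iff)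
  fix j :: nat
  define l where "l = log_plus (2 ^ j / 8)"
  have "ln (2 ^ j / 8 :: real) = (real j - 3) * ln 2" using ln_realpow[of 2 3] by (simp add: ln_div ln_realpow left_diff_distrib)
  moreover have "1 / 2 <= ln (2 :: real)" using ln_one_minus_pos_lower_bound[of "1/2 :: real"] ln_2_less_1 ln_ge_iff[of 2 "1/2"] exp_half_le2 by simp
  ultimately have "(real j - 3) / 2 <= l" if "3 <= j" using mult_left_mono[of "1 / 2" "ln 2" "real j - 3"] that by (auto simp: l_def log_plus_def)
  moreover have "0 <= l" by (simp add: l_def)
  ultimately have "real (j + 1) / 8 <= 1 + l" by (cases "3 <= j") auto
  then have "(real (j + 1) / 8) powr (1 + e) <= (1 + l) powr (1 + e)" using assms by (intro powr_mono2) auto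
  then have "2 ^ j / 8 * (real (j + 1) / 8) powr (1 + e) <= (1 + 2 ^ j / 8) * (1 + l) powr (1 + e)" by (intro mult_mono) auto
  then have "young_coeff e (2 ^ j) <= 1 / (2 ^ j / 8 * (real (j + 1) / 8) powr (1 + e))"
   unfolding young_coeff_def l_def by (intro divide_left_mono) (auto intro!: mult_pos_pos add_pos_nonneg simp: add_nonneg_eq_0_iff)
  then have "2 ^ j * young_coeff e (2 ^ j) <= 2 ^ j * (1 / (2 ^ j / 8 * (real (j + 1) / 8) powr (1 + e)))" by (intro mult_left_mono) auto
  also have "... = 8 * (1 / (real (j + 1) / 8) powr (1 + e))" by simp
  also have "1 / (real (j + 1) / 8) powr (1 + e) = 8 powr (1 + e) * real (j + 1) powr (- 1 - e)" using powr_minus_divide[of "real (j + 1)" "1 + e"] by (simp add: powr_divide minus_add)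
  finally show "norm (2 ^ j * young_coeff e (2 ^ j)) <= 8 * 8 powr (1 + e) * real (j + 1) powr (- 1 - e)" by (simp add: young_coeff_nonneg)
 qed
 ultimately show ?thesis using condensation_test[of "young_coeff e"] young_coeff_nonneg by blast
qed

definition young_const :: "nat => real" where
 "young_const k = (96 * real k) ^ k * exp 1 + 96 ^ k"

text \<open>A Young-type inequality. If \<open>u\<close> is at most \<open>exp (w / 96 + n / 8)\<close>, powers of \<open>w\<close> are absorbed by the
 exponential; otherwise \<open>w + n\<close> is at most a multiple of \<open>log u\<close>, and the spare factor
 \<open>log u (log log u)\<^sup>1\<^sup>+\<^sup>e\<close> of the Young function pays for the coefficient.\<close>

lemma young_ineq:
 assumes e: "0 < e" and n: "1 <= n" and w: "0 <= w" and u: "0 <= u" and i: "i <= k"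
 shows "u * (w + real n) ^ i <= young_const k * (real n ^ k * (exp (- (real n / 8)) * exp (w / 24) + exp (3 * real n / 8))
  + LL k e u * young_coeff e n)"
proof (cases "u <= exp (w / 96 + real n / 8)")
 case True
 let ?Z = "exp (- (real n / 8)) * exp (w / 24) + exp (3 * real n / 8)"
 have w1: "((1 + w) / 4) ^ k <= (24 * real k) ^ k * exp ((1 + w) / 4 / 24)" using w by (intro power_le_exp) simp
 have "(w + real n) ^ i <= (real n * (1 + w)) ^ i" 
 proof (rule power_mono)
  show "w + real n <= real n * (1 + w)" using n w mult_right_mono[of 1 "real n" w] by (simp add: algebra_simps)
 qed (use w in simp)
 also have "... <= (real n * (1 + w)) ^ k" using n w mult_mono[of 1 "real n" 1 "1 + w"] by (intro power_increasing i) auto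
 also have "... = real n ^ k * 4 ^ k * ((1 + w) / 4) ^ k" by (simp add: power_mult_distrib power_divide)
 also have "... <= real n ^ k * 4 ^ k * ((24 * real k) ^ k * exp ((1 + w) / 4 / 24))" by (intro mult_left_mono w1) simp
 also have "... <= real n ^ k * 4 ^ k * ((24 * real k) ^ k * (exp 1 * exp (w / 96)))" unfolding exp_add[symmetric] by (intro mult_left_mono) auto
 also have "... = (96 * real k) ^ k * exp 1 * (real n ^ k * exp (w / 96))"

 proof -
  have "(96 * real k) ^ k = 4 ^ k * (24 * real k) ^ k" using power_mult_distrib[of 4 "24 * real k" k] by simp
  then show ?thesis by (simp only: mult_ac)
 qed
 finally have "u * (w + real n) ^ i <= exp (w / 96 + real n / 8) * ((96 * real k) ^ k * exp 1 * (real n ^ k * exp (w / 96)))" using True u w by (intro mult_mono) auto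
 also have "... = (96 * real k) ^ k * exp 1 * (real n ^ k * exp (w / 48 + real n / 8))"

 proof -
  have "exp (w / 48 + real n / 8) = exp (w / 96 + real n / 8) * exp (w / 96)" unfolding exp_add[symmetric] by simp
  then show ?thesis by (simp only: mult_ac)
 qed
 also have "exp (w / 48 + real n / 8) <= ?Z"
 proof (cases "w / 48 <= real n / 4")
  case True
  then have "exp (w / 48 + real n / 8) <= exp (3 * real n / 8)" by simp
  then show ?thesis by (intro add_increasing) auto
 next
  case False
  then have "exp (w / 48 + real n / 8) <= exp (- (real n / 8) + w / 24)" by simp
  then show ?thesis unfolding exp_add[of "- (real n / 8)"] by (intro add_increasing2) auto
 qed
 finally have "u * (w + real n) ^ i <= (96 * real k) ^ k * exp 1 * (real n ^ k * ?Z)" by (simp add: mult_left_mono)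
 also have "... <= young_const k * (real n ^ k * ?Z + LL k e u * young_coeff e n)"
  unfolding young_const_def using LlogL_nonneg[OF e u, of k] young_coeff_nonneg[of e n] by (intro mult_mono) auto
 finally show ?thesis .
next
 case False
 then have u: "exp (w / 96 + real n / 8) < u" by simp
 then have u0: "0 < u" by (meson exp_gt_zero less_trans)
 then have ln: "w / 96 + real n / 8 < ln u" using u ln_less_cancel_iff[of "exp (w / 96 + real n / 8)" u] by simp
 then have lp: "w / 96 + real n / 8 < log_plus u" using u0 by (simp add: log_plus_def)
 have "(w + real n) ^ i <= (96 * (1 + log_plus u)) ^ i" using lp w by (intro power_mono) auto
 also have "... <= (96 * (1 + log_plus u)) ^ k" using log_plus_nonneg[of u] by (intro power_increasing i) simp
 finally have 1: "u * (w + real n) ^ i <= u * (96 ^ k * (1 + log_plus u) ^ k)" using u0 by (simp only: power_mult_distrib mult_left_mono less_imp_le)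
 let ?D = "%l. (1 + l) * (1 + log_plus l) powr (1 + e)"
 have "?D (real n / 8) <= ?D (log_plus u)" using lp w e by (intro mult_mono powr_mono2 add_left_mono log_plus_mono) auto
 moreover have D0: "0 < ?D (real n / 8)" by (intro mult_pos_pos) (auto intro!: add_pos_nonneg simp: add_nonneg_eq_0_iff)
 ultimately have "1 <= ?D (log_plus u) * young_coeff e n" unfolding young_coeff_def by simp
 then have "u * (96 ^ k * (1 + log_plus u) ^ k) * 1 <= u * (96 ^ k * (1 + log_plus u) ^ k) * (?D (log_plus u) * young_coeff e n)" using u0 by (intro mult_left_mono) auto
 also have "... = 96 ^ k * (LL k e u * young_coeff e n)" by (simp add: LlogL_loglogL_def mult_ac)
 also have "... <= young_const k * (real n ^ k * (exp (- (real n / 8)) * exp (w / 24) + exp (3 * real n / 8)) + LL k e u * young_coeff e n)"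
  using LlogL_nonneg[OF e, of u k] u0 young_coeff_nonneg[of e n] unfolding young_const_def by (intro mult_mono) auto
 finally show ?thesis using 1 by simp
qed

definition young_sum :: "nat => real => nat => real" where
 "young_sum k e n = 3 ^ k * young_const k * (7 * real n ^ k * exp (- (real n / 8)) + young_coeff e n)"

lemma young_const_pos: "0 < young_const k" unfolding young_const_def by (intro add_nonneg_pos) auto

lemma young_sum_nonneg: "0 <= young_sum k e n" unfolding young_sum_def using young_const_pos[of k] young_coeff_nonneg[of e n] by simp

lemma summable_young_sum:
 assumes "0 < e" shows "summable (young_sum k e)"
proof -
 have "summable (%n. real n ^ k * exp (- (real n / 8)))"
 proof (rule summable_comparison_test')
  show "summable (%n. (24 * real k) ^ k * exp (- (1 / 12)) ^ n)" by (intro summable_mult summable_geometric) simp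
  fix n
  have "real n ^ k * exp (- (real n / 8)) <= (24 * real k) ^ k * exp (real n / 24) * exp (- (real n / 8))" by (intro mult_right_mono power_le_exp) auto
  also have "... = (24 * real k) ^ k * exp (- (1 / 12)) ^ n" by (simp add: exp_of_nat_mult[symmetric] exp_add[symmetric] mult.assoc)
  finally show "norm (real n ^ k * exp (- (real n / 8))) <= (24 * real k) ^ k * exp (- (1 / 12)) ^ n" by simp
 qed
 then have "summable (%n. 3 ^ k * young_const k * (7 * (real n ^ k * exp (- (real n / 8))) + young_coeff e n))" by (intro summable_mult summable_add summable_young_coeff assms)
 then show ?thesis by (simp add: young_sum_def[abs_def] mult.assoc)
qed

definition bcs :: "(real => real) => bool" where
 "bcs f \<longleftrightarrow> f : Borel & (EX K. ALL t. abs (f t) <= K) & (EX R. ALL t. R < abs t --> f t = 0)"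

definition Om :: "nat => real => (real => real) => real => real set" where
 "Om k e f s = rset (%t. LL k e (abs (f t) / s))"

lemma ibs_bounded:
 assumes [measurable]: "g : Borel" and K: "!!t. abs (g t) <= K" and R: "!!t. R < abs t ==> g t = 0"
 shows "ibs g" unfolding ibs_def
proof (intro conjI exI[of _ R] allI impI R)
 show "integrable lborel g"
 proof (rule Bochner_Integration.integrable_bound)
  show "integrable lborel (%t. K * ind {-abs R..abs R} t)" by (intro integrable_mult_right integrable_real_indicator) (auto simp: emeasure_lborel_Icc_eq)
  show "AE t in lborel. norm (g t) <= norm (K * ind {-abs R..abs R} t)"
  proof (rule AE_I2)
   fix t
   show "norm (g t) <= norm (K * ind {-abs R..abs R} t)"
   proof (cases "R < abs t")
    case False
    then have "t : {-abs R..abs R}" by auto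
    then show ?thesis using K[of t] by simp
   qed (simp add: R)
  qed
 qed simp
qed

lemma ibs_LlogL:
 assumes f: "bcs f" and e: "0 < e" and s: "0 < s"
 shows "ibs (%t. LL k e (abs (f t) / s))" "(%t. LL k e (abs (f t) / s)) : Borel"
  "0 <= LL k e (abs (f t) / s)"
proof -
 obtain K R where K: "!!t. abs (f t) <= K" and R: "!!t. R < abs t ==> f t = 0" using f by (auto simp: bcs_def)
 have [measurable]: "f : Borel" using f by (simp add: bcs_def)
 show m: "(%t. LL k e (abs (f t) / s)) : Borel" by measurable
 show nn: "0 <= LL k e (abs (f t) / s)" for t using e s by (intro LlogL_nonneg) auto
 show "ibs (%t. LL k e (abs (f t) / s))"
 proof (rule ibs_bounded[OF m, of "LL k e (K / s)" R])
  fix t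
  show "abs (LL k e (abs (f t) / s)) <= LL k e (K / s)" using nn[of t] e s K[of t] by (simp add: LlogL_mono divide_right_mono)
  show "R < abs t ==> LL k e (abs (f t) / s) = 0" by (simp add: R LlogL_loglogL_def)
 qed
qed

lemma nn_mass:
 assumes "integrable lborel g" "!!t. 0 <= g t" "g : Borel"
 shows "(lint_on {x..y} (%t. enn (g t))) = enn (mass g x y)" using emeasure_density_Icc[OF assms, of x y] assms(3) by (simp add: emeasure_density)

context bmo_unit
begin

text \<open>On a piece of length comparable to \<open>D exp (- n / 2)\<close> of an interval of length \<open>D\<close> to the right of a
 point outside \<open>Om s\<close>, the integral of \<open>\<bar>be - b\<bar>\<^sup>i \<bar>f\<bar>\<close> is at most \<open>s D\<close> times the term of a convergent
 series in \<open>n\<close>.\<close>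

lemma block_bound:
 assumes f: "bcs f" and e: "0 < e" and s: "0 < s" and xi: "xi ~: Om k e f s" and D: "0 < D"
  and xy: "xi <= x" "x <= y" "y <= xi + D" and n: "1 <= n" and len: "y - x <= 2 * D * exp (- (real n / 2))"
  and i: "i <= k" and be: "abs (be - dbl_mean b xi (xi + D)) <= 3 * real n"
 shows "mass (%t. abs ((be - b t) ^ i * f t)) x y <= s * D * young_sum k e n"
proof -
 have [measurable]: "f : Borel" using f by (simp add: bcs_def)
 have L: "L2c (%t. (be - b t) ^ i * f t)" using f L2c_dev_power[of f] unfolding bcs_def by blast
 let ?A = "%t. LL k e (abs (f t) / s)"
 let ?w = "%t. abs (b t - dbl_mean b xi (xi + D))"
 note A = ibs_LlogL[OF f e s, of k]
 define P where "P = s * (3 ^ k * young_const k)"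
 have P: "0 <= P" using s young_const_pos[of k] by (simp add: P_def)
 define c1 c2 c3 where "c1 = P * (real n ^ k * exp (- (real n / 8)))" and "c2 = P * (real n ^ k * exp (3 * real n / 8))"
  and "c3 = P * young_coeff e n"
 have c: "0 <= c1" "0 <= c2" "0 <= c3" using P young_coeff_nonneg[of e n] by (auto simp: c1_def c2_def c3_def)
 have pt: "abs ((be - b t) ^ i * f t) <= c1 * exp (?w t / 24) + c2 + c3 * ?A t" for t
 proof -
  have "abs (be - b t) ^ i <= (3 * (?w t + real n)) ^ i" 
  proof (rule power_mono)
   have "0 <= ?w t" by simp
   moreover have "abs (be - b t) <= ?w t + abs (be - dbl_mean b xi (xi + D))" by linarith
   moreover have "z <= 3 * (w' + m)" if "0 <= w'" "z <= w' + c" "c <= 3 * m" for z w' c m :: real using that by argo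
   ultimately show "abs (be - b t) <= 3 * (?w t + real n)" using be by blast
  qed simp
  also have "... <= 3 ^ k * (?w t + real n) ^ i" unfolding power_mult_distrib by (intro mult_right_mono power_increasing i) auto
  finally have "abs ((be - b t) ^ i * f t) <= 3 ^ k * (?w t + real n) ^ i * abs (f t)" by (simp add: abs_mult power_abs mult_right_mono)
  also have "... = s * 3 ^ k * (abs (f t) / s * (?w t + real n) ^ i)" using s by simp
  also have "... <= s * 3 ^ k * (young_const k * (real n ^ k * (exp (- (real n / 8)) * exp (?w t / 24) + exp (3 * real n / 8)) + ?A t * young_coeff e n))"
   using s by (intro mult_left_mono young_ineq e n i) auto
  also have "... = c1 * exp (?w t / 24) + c2 + c3 * ?A t" by (simp add: c1_def c2_def c3_def P_def algebra_simps)
  finally show ?thesis .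
 qed
 have "enn (mass (%t. abs ((be - b t) ^ i * f t)) x y) = (lint_on {x..y} (%t. enn (abs ((be - b t) ^ i * f t))))" using L2c_integrable[OF L] by (intro nn_mass[symmetric] integrable_abs) auto
 also have "... <= (\<integral>\<^sup>+t. enn c1 * (enn (exp (?w t / 24)) * ind {xi..xi + D} t) + enn c2 * ind {x..y} t
   + enn c3 * (enn (?A t) * ind {xi..xi + D} t) \<partial>lborel)"
 proof (rule nn_integral_mono)
  fix t
  show "enn (abs ((be - b t) ^ i * f t)) * ind {x..y} t <= enn c1 * (enn (exp (?w t / 24)) * ind {xi..xi + D} t)
   + enn c2 * ind {x..y} t + enn c3 * (enn (?A t) * ind {xi..xi + D} t)"
  proof (cases "t : {x..y}")
   case True
   then have i1: "ind {x..y} t = (1 :: ennreal)" "ind {xi..xi + D} t = (1 :: ennreal)" using xy by auto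
   have "enn (abs ((be - b t) ^ i * f t)) <= enn (c1 * exp (?w t / 24) + c2 + c3 * ?A t)" by (rule ennreal_leI[OF pt])
   also have "... = enn c1 * enn (exp (?w t / 24)) + enn c2 + enn c3 * enn (?A t)" using c A(3)[of t] by (simp add: ennreal_plus ennreal_mult)
   finally show ?thesis unfolding i1 by simp
  qed simp
 qed
 also have "... = enn c1 * (lint_on {xi..xi + D} (%t. enn (exp (?w t / 24)))) + enn c2 * leb {x..y}
   + enn c3 * (lint_on {xi..xi + D} (%t. enn (?A t)))" by (simp add: nn_integral_add nn_integral_cmult nn_integral_cmult_indicator)
 also have "... <= enn c1 * enn (5 * D) + enn c2 * enn (2 * D * exp (- (real n / 2))) + enn c3 * enn D"
 proof (intro add_mono mult_left_mono)
  show "(lint_on {xi..xi + D} (%t. enn (exp (?w t / 24)))) <= enn (5 * D)" using john_nirenberg_exp[of xi "xi + D"] D by simp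
  show "leb {x..y} <= enn (2 * D * exp (- (real n / 2)))" using len xy by (simp add: ennreal_leI)
  have "(lint_on {xi..xi + D} (%t. enn (?A t))) = enn (mass ?A xi (xi + D))" using A by (intro nn_mass) (auto simp: ibs_def)
  also have "... <= enn D" using not_rset[of xi ?A "xi + D"] xi D by (simp add: Om_def ennreal_leI)
  finally show "(lint_on {xi..xi + D} (%t. enn (?A t))) <= enn D" .
 qed auto
 also have "... = enn (c1 * (5 * D) + c2 * (2 * D * exp (- (real n / 2))) + c3 * D)" using c D by (simp add: ennreal_plus ennreal_mult)
 also have "c1 * (5 * D) + c2 * (2 * D * exp (- (real n / 2))) + c3 * D = s * D * young_sum k e n"
 proof -
  have "exp (3 * real n / 8) * exp (- (real n / 2)) = exp (- (real n / 8))" unfolding exp_add[symmetric] by simp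
  moreover have "c2 * (2 * D * z) = P * real n ^ k * (2 * D) * (exp (3 * real n / 8) * z)" for z by (simp only: c2_def mult_ac)
  ultimately have "c2 * (2 * D * exp (- (real n / 2))) = P * real n ^ k * (2 * D) * exp (- (real n / 8))" by (simp only:)
  then show ?thesis by (simp add: c1_def c3_def P_def young_sum_def algebra_simps)
 qed
 finally show ?thesis using s D young_sum_nonneg[of k e n] by (simp add: ennreal_le_iff)
qed

end

section \<open>Oscillation of commutators\<close>

lemma psum2_cong_right: "(!!t. x <= t ==> g t = h t) ==> psum2 v g x = psum2 v h x" unfolding psum2_def psum_def dif_def avg_def using mass_cong[of x _ g h] by simp

lemma Tlim_cong_right: "(!!t. x <= t ==> g t = h t) ==> Tlim v g x = Tlim v h x" unfolding Tlim_def using psum2_cong_right[of x g h v] by simp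

lemma Tlim_add:
 assumes "L2c g" "L2c h" "Tconv v g x" "Tconv v h x"
 shows "Tconv v (%t. a * g t + c * h t) x" "Tlim v (%t. a * g t + c * h t) x = a * Tlim v g x + c * Tlim v h x"
proof -
 have eq: "psum2 v (%t. a * g t + c * h t) x = (%p. a * psum2 v g x p + c * psum2 v h x p)"
  using psum_add[OF L2c_integrable[OF assms(1)] L2c_integrable[OF assms(2)]] by (auto simp: psum2_def fun_eq_iff)
 have lim: "(psum2 v (%t. a * g t + c * h t) x \<longlongrightarrow> a * Tlim v g x + c * Tlim v h x) (sequentially \<times>\<^sub>F sequentially)"
  unfolding eq using assms(3,4) unfolding Tconv_def by (intro tendsto_intros)
 have "(%n. psum2 v (%t. a * g t + c * h t) x (n, n)) \<longlonglongrightarrow> a * Tlim v g x + c * Tlim v h x" unfolding eq by (intro tendsto_intros Tconv_diag assms)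
 then show T: "Tlim v (%t. a * g t + c * h t) x = a * Tlim v g x + c * Tlim v h x" unfolding Tlim_def[of v "%t. a * g t + c * h t"] by (rule limI)
 show "Tconv v (%t. a * g t + c * h t) x" unfolding Tconv_def T by (rule lim)
qed

lemma Tlim_zero: "Tconv v (%t. 0) x" "Tlim v (%t. 0) x = 0"
proof -
 have eq: "psum2 v (%t. 0) x = (%p. 0)" by (auto simp: psum2_def psum_def dif_def avg_def mass_eq_0 fun_eq_iff)
 show T: "Tlim v (%t. 0) x = 0" unfolding Tlim_def eq by (rule limI) simp
 show "Tconv v (%t. 0) x" unfolding Tconv_def T eq by simp
qed

lemma Tlim_sum:
 assumes "finite A" "!!q. q : A ==> L2c (g q)" "!!q. q : A ==> Tconv v (g q) x"
 shows "Tconv v (%t. SUM q:A. c q * g q t) x & Tlim v (%t. SUM q:A. c q * g q t) x = (SUM q:A. c q * Tlim v (g q) x)" using assms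
proof (induction A rule: finite_induct)
 case (insert q A)
 note * = Tlim_add[of "g q" "%t. SUM q:A. c q * g q t" v x "c q" 1]
 show ?case using insert *  L2c_sum[of A g c] by simp
qed (simp add: Tlim_zero)

lemma far_sum_le:
 assumes "summable ga" "!!n. 0 <= ga n"
 shows "(SUM a<A. if h < m + int a then ga (nat (m + int a - h)) else 0) <= (suminf ga :: real)"
proof -
 let ?S = "{a. a < A & h < m + int a}" and ?n = "%a. nat (m + int a - h)"
 have "(SUM a<A. if h < m + int a then ga (?n a) else 0) = (SUM a:?S. ga (?n a))" by (rule sum.mono_neutral_cong_right) auto
 also have "... = sum ga (?n ` ?S)" by (rule sum.reindex_cong[symmetric, OF _ refl]) (auto simp: inj_on_def)
 also have "... <= suminf ga" by (intro sum_le_suminf assms) auto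
 finally show ?thesis .
qed

lemma exp_half_n: "exp (real n / 2) <= 2 ^ n"
proof -
 have "exp (1 / 2 :: real) <= 2" using exp_ge_add_one_self[of "-1/2 :: real"] by (simp add: exp_minus field_simps)
 then have "exp (1 / 2 :: real) ^ n <= 2 ^ n" by (intro power_mono) auto
 then show ?thesis by (simp add: exp_of_nat_mult[symmetric])
qed

definition Fcom :: "(int => real) => (real => real) => nat => (real => real) => real => real" where
 "Fcom v b i f y = (SUM l<=i. of_nat (i choose l) * b y ^ (i - l) * Tlim v (%t. (- b t) ^ l * f t) y)"

context bmo_unit
begin

lemma L2c_power: "bcs f ==> L2c (%t. (c - b t) ^ m * f t)" using L2c_dev_power[of f] unfolding bcs_def by blast

lemma L2c_power_minus: "bcs f ==> L2c (%t. (- b t) ^ m * f t)" using L2c_power[of f 0 m] by simp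

lemma Fcom_measurable [measurable]: "bcs f ==> Fcom v b i f : Borel" unfolding Fcom_def[abs_def] using Tlim_measurable[OF L2c_power_minus] by measurable

lemma Fcom_eq:
 assumes f: "bcs f" and conv: "!!l. l <= i ==> Tconv v (%t. (- b t) ^ l * f t) y"
 shows "Tconv v (%t. (b y - b t) ^ i * f t) y & Fcom v b i f y = Tlim v (%t. (b y - b t) ^ i * f t) y"
proof -
 have "(b y - b t) ^ i * f t = (SUM l<=i. of_nat (i choose l) * b y ^ (i - l) * ((- b t) ^ l * f t))" for t using binomial_ring[of "- b t" "b y" i] by (simp add: sum_distrib_left mult_ac)
 then show ?thesis unfolding Fcom_def using Tlim_sum[of "{..i}" "%l t. (- b t) ^ l * f t" v y "%l. of_nat (i choose l) * b y ^ (i - l)"] L2c_power_minus[OF f] conv by simp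
qed

text \<open>Expanding \<open>(be - b)\<^sup>i = ((b y - b) + (be - b y))\<^sup>i\<close> at the point \<open>y\<close>.\<close>

lemma Fcom_shift:
 assumes f: "bcs f" and conv: "!!l. l <= i ==> Tconv v (%t. (- b t) ^ l * f t) y"
 shows "Tlim v (%t. (be - b t) ^ i * f t) y = (SUM l<=i. of_nat (i choose l) * (be - b y) ^ (i - l) * Fcom v b l f y)"
proof -
 have *: "Tconv v (%t. (b y - b t) ^ l * f t) y" "Fcom v b l f y = Tlim v (%t. (b y - b t) ^ l * f t) y" if "l <= i" for l using Fcom_eq[OF f, of l v y] conv that by auto
 have "(be - b t) ^ i * f t = (SUM l<=i. of_nat (i choose l) * (be - b y) ^ (i - l) * ((b y - b t) ^ l * f t))" for t
  using binomial_ring[of "b y - b t" "be - b y" i] by (simp add: sum_distrib_left mult_ac)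
 then show ?thesis using Tlim_sum[of "{..i}" "%l t. (b y - b t) ^ l * f t" v y "%l. of_nat (i choose l) * (be - b y) ^ (i - l)"] L2c_power[OF f] * by simp
qed

lemma dbl_mean_chain: "0 < L ==> abs (dbl_mean b x (x + L) - dbl_mean b x (x + 2 ^ n * L)) <= 3 * real n"
proof (induction n)
 case (Suc n)
 then show ?case using mean_dbl[of "2 ^ n * L" x] by (simp add: mult.assoc)
qed simp

text \<open>The constant is the value of the transform of the far part \<open>g2\<close> at some point of convergence; its variation
 is summed over the blocks of \<open>block_bound\<close>, and the near part \<open>g1\<close> is of weak type.\<close>

lemma oscillation_T:
 fixes h :: int
 assumes f: "bcs f" and e: "0 < e" and s: "0 < s" and v: "!!j. abs (v j) <= V" and V: "0 < V"
  and xi: "xi ~: Om k e f s" and i: "i <= k" and lam: "0 < lam"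
 defines "H \<equiv> 2 powi h" and "g \<equiv> %t. (dbl_mean b xi (xi + 4 * 2 powi h) - b t) ^ i * f t"
 shows "EX c0. leb {y : {xi<..<xi + H}. lam + 4 * V * s * suminf (young_sum k e) < abs (Tlim v g y - c0)}
  <= enn (600 * V / lam * (s * (4 * H) * young_sum k e 1))"
proof -
 let ?ga = "young_sum k e"
 let ?be = "dbl_mean b xi (xi + 4 * H)"
 have H: "0 < H" by (simp add: H_def)
 have g: "g = (%t. (?be - b t) ^ i * f t)" by (simp add: g_def H_def)
 have L: "L2c g" unfolding g by (rule L2c_power[OF f])
 define g1 where "g1 t = ind {xi..xi + 4 * H} t * g t" for t
 define g2 where "g2 t = ind {xi + 4 * H<..} t * g t" for t
 have L1: "L2c g1" "L2c g2" unfolding g1_def[abs_def] g2_def[abs_def] by (intro L2c_indicator_mult L; simp)+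
 have split: "Tlim v g y = Tlim v g1 y + Tlim v g2 y" if "Tconv v g1 y" "Tconv v g2 y" "xi <= y" for y
 proof -
  have "Tlim v g y = Tlim v (%t. 1 * g1 t + 1 * g2 t) y" using that(3) by (intro Tlim_cong_right) (auto simp: g1_def g2_def indicator_def)
  then show ?thesis using Tlim_add(2)[OF L1 that(1,2), of 1 1] by simp
 qed
 have trm: "mass (%t. abs (g2 t)) (xi + 2 powi j) (xi + 2 powi j + H) / 2 powi j <= (if h < j then 2 * s * ?ga (nat (j - h)) else 0)" for j
 proof (cases "h < j")
  case False
  then have "2 powi j <= H" unfolding H_def by (intro powi_mono2) simp
  then have "mass (%t. abs (g2 t)) (xi + 2 powi j) (xi + 2 powi j + H) = 0" using H by (intro mass_eq_0) (auto simp: g2_def)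
  then show ?thesis using False by simp
 next
  case True
  define n where "n = nat (j - h)"
  have "0 < n" "j = h + int n" using True by (auto simp: n_def)
  then obtain n' where n': "n = Suc n'" "j = h + int n" using gr0_implies_Suc by blast
  have j: "2 powi j = H * 2 ^ n" unfolding H_def n'(2) by (rule powi_add_nat)
  have "mass (%t. abs (g2 t)) (xi + 2 powi j) (xi + 2 powi j + H) <= mass (%t. abs (g t)) (xi + 2 powi j) (xi + 2 powi j + H)"
  proof (rule mass_mono[OF integrable_abs[OF L2c_integrable[OF L1(2)]] integrable_abs[OF L2c_integrable[OF L]]])
   show "abs (g2 t) <= abs (g t)" for t by (simp add: g2_def indicator_def)
  qed
  also have "... <= s * (2 * 2 powi j) * ?ga n" unfolding g
  proof (rule block_bound[OF f e s xi])
   show "xi + 2 powi j + H <= xi + 2 * 2 powi j" unfolding j using H mult_left_mono[of 1 "2 ^ n" H] by simp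
   have "1 <= 2 ^ n * exp (- (real n / 2))" using mult_right_mono[OF exp_half_n[of n], of "exp (- (real n / 2))"] by (simp add: exp_minus)
   then have "H * 1 <= H * (4 * (2 ^ n * exp (- (real n / 2))))" using H by (intro mult_left_mono) auto
   then show "xi + 2 powi j + H - (xi + 2 powi j) <= 2 * (2 * 2 powi j) * exp (- (real n / 2))" unfolding j by (simp add: mult_ac)
   have 2: "2 * 2 powi j = 2 ^ n' * (4 * H)" using j n'(1) by simp
   show "abs (?be - dbl_mean b xi (xi + 2 * 2 powi j)) <= 3 * real n" unfolding 2 using order_trans[OF dbl_mean_chain[of "4 * H" xi n'], of "3 * real n"] H n'(1) by simp
  qed (use H n' i in auto)
  finally show ?thesis using True by (simp add: n_def[symmetric] divide_le_eq mult_ac)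
 qed
 have far: "abs (psum v m A g2 z - psum v m A g2 y) <= 4 * V * s * suminf ?ga"
  if yz: "y : {xi..xi + H}" "z : {xi..xi + H}" for m A y z
 proof -
  have "abs (psum v m A g2 z - psum v m A g2 y) <=
   2 * V * (SUM a<Suc A. mass (%t. abs (g2 t)) (xi + 2 powi (m - 1 + int a)) (xi + 2 powi (m - 1 + int a) + H) / 2 powi (m - 1 + int a))"
   using H by (intro psum_far L2c_integrable[OF L1(2)] v yz) (auto simp: g2_def)
  also have "... <= 2 * V * (SUM a<Suc A. (2 * s) * (if h < m - 1 + int a then ?ga (nat (m - 1 + int a - h)) else 0))" using V by (intro mult_left_mono sum_mono order_trans[OF trm]) auto
  also have "... = 4 * V * s * (SUM a<Suc A. if h < m - 1 + int a then ?ga (nat (m - 1 + int a - h)) else 0)" unfolding sum_distrib_left by (intro sum.cong refl) simp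
  also have "... <= 4 * V * s * suminf ?ga" using V s by (intro mult_left_mono far_sum_le summable_young_sum e young_sum_nonneg) auto
  finally show ?thesis .
 qed
 have "EX z:{xi<..<xi + H}. Tconv v g2 z"
 proof (rule ccontr)
  assume no: "\<not> ?thesis"
  have "AE x in lborel. x ~: {xi<..<xi + H}" using Tconv_AE[of g2 v V, OF L1(2) v] by eventually_elim (use no in blast)
  then have "{xi<..<xi + H} : null_sets lborel" by (subst (asm) AE_iff_null_sets[symmetric]) auto
  then show False using H by (auto simp: null_sets_def)
 qed
 then obtain z where z: "z : {xi<..<xi + H}" "Tconv v g2 z" by blast
 have [measurable]: "Tlim v g : Borel" "Tlim v g1 : Borel" by (intro Tlim_measurable L L1)+
 let ?large = "{y : {xi<..<xi + H}. lam + 4 * V * s * suminf ?ga < abs (Tlim v g y - Tlim v g2 z)}"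
 have "leb ?large <= leb {y. lam < abs (Tlim v g1 y)}"
 proof (rule emeasure_mono_AE)
  show "AE y in lborel. y : ?large --> y : {y. lam < abs (Tlim v g1 y)}" using Tconv_AE[of g1 v V, OF L1(1) v] Tconv_AE[of g2 v V, OF L1(2) v]
  proof eventually_elim
   fix y assume c: "Tconv v g1 y" "Tconv v g2 y"
   show "y : ?large --> y : {y. lam < abs (Tlim v g1 y)}"
   proof
    assume y: "y : ?large"
    have "(%n. abs (psum2 v g2 y (n, n) - psum2 v g2 z (n, n))) \<longlonglongrightarrow> abs (Tlim v g2 y - Tlim v g2 z)" by (intro tendsto_intros Tconv_diag c z)
    then have "abs (Tlim v g2 y - Tlim v g2 z) <= 4 * V * s * suminf ?ga" using y z(1) far[of z y] by (intro LIMSEQ_le_const2) (auto simp: psum2_def)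
    moreover have "Tlim v g y = Tlim v g1 y + Tlim v g2 y" using y by (intro split c) auto
    ultimately show "y : {y. lam < abs (Tlim v g1 y)}" using y by auto
   qed
  qed
 qed measurable
 also have "... <= enn (600 * V / lam * (LINT x|lborel. abs (g1 x)))" by (rule Tlim_weak_type[of g1 v V, OF L1(1) v V lam])
 also have "... <= enn (600 * V / lam * (s * (4 * H) * ?ga 1))"
 proof (intro ennreal_leI mult_left_mono)
  have "(LINT x|lborel. abs (g1 x)) = mass (%t. abs (g t)) xi (xi + 4 * H)" unfolding mass_def sli_def g1_def by (simp add: abs_mult)
  also have "... <= s * (4 * H) * ?ga 1" unfolding g
  proof (rule block_bound[OF f e s xi])
   have "1 <= 2 * exp (- (1 / 2) :: real)" using mult_right_mono[OF exp_half_n[of 1], of "exp (- (1 / 2))"] by (simp add: exp_minus)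
   from mult_left_mono[OF this, of "4 * H"] show "xi + 4 * H - xi <= 2 * (4 * H) * exp (- (real 1 / 2))" using H by simp
  qed (use H i in auto)
  finally show "(LINT x|lborel. abs (g1 x)) <= s * (4 * H) * ?ga 1" .
 qed (use V lam in simp)
 finally show ?thesis by blast
qed

end

text \<open>Apart from lower order commutators with small coefficients, the commutator is the transform of
 \<open>(be - b)\<^sup>i f\<close>, where \<open>be\<close> is a mean of \<open>b\<close> near the point. The lower orders are small off a small set by hypothesis and \<open>b - be\<close>
 is bounded off a small set by John and Nirenberg.\<close>

lemma oscillation_bound:
 assumes e: "0 < e" and V: "0 < V" and de: "0 < de"
 shows "EX si>0. EX et>0. ALL b f v xi h lam R' i. bmo_unit b --> bcs f --> (ALL j. abs (v j) <= V) --> i <= k --> 0 < lam -->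
  xi ~: Om k e f (si * lam) -->
  (ALL l<i. leb {y : {xi<..<xi + 2 powi h}. R' < y & si * lam < abs (Fcom v b l f y)} <= enn (et * 2 powi h)) -->
  (EX c0. leb {y : {xi<..<xi + 2 powi h}. R' < y & lam / 4 < abs (Fcom v b i f y - c0)} <= enn (de * 2 powi h))"
proof -
 obtain n where n: "(1 / 2) ^ n < de / 12" using real_arch_pow_inv[of "de / 12" "1/2 :: real"] de by auto
 define K where "K = 6 * real n"
 define Ga where "Ga = suminf (young_sum k e)"
 have Ga: "0 <= Ga" unfolding Ga_def by (intro suminf_nonneg summable_young_sum e young_sum_nonneg)
 (* one summand each for the lower orders, for the far part and for the near part *)
 define q1 q2 q3 where "q1 = 16 * (1 + K) ^ k" and "q2 = 64 * V * Ga" and "q3 = 115200 * V * young_sum k e 1 / de"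
 have q: "16 <= q1" "0 <= q2" "0 <= q3" using V de Ga young_sum_nonneg[of k e 1] by (auto simp: q1_def q2_def q3_def K_def)
 define si where "si = 1 / (q1 + q2 + q3)"
 have si: "0 < si" "q1 * si <= 1" "q2 * si <= 1" "q3 * si <= 1" using q by (auto simp: si_def divide_le_eq)
 define et where "et = de / (3 * (real k + 1))"
 have et: "0 < et" "real i * et <= de / 3" if "i <= k" for i
 proof -
  show "0 < et" using de by (simp add: et_def)
  have "real i * de <= (real k + 1) * de" using de that by (intro mult_right_mono) auto
  then show "real i * et <= de / 3" by (simp add: et_def divide_le_eq algebra_simps)
 qed
 show ?thesis
 proof (rule exI[of _ si], rule conjI[OF si(1)], rule exI[of _ et], rule conjI[OF et(1)[of 0, OF le0]], intro allI impI)
  fix b f v xi h lam R' i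
  assume b: "bmo_unit b" and f: "bcs f" and v: "ALL j. abs (v j :: real) <= V" and i: "i <= k" and lam: "0 < (lam :: real)"
   and xi: "xi ~: Om k e f (si * lam)"
   and small: "ALL l<i. leb {y : {xi<..<xi + 2 powi h}. R' < y & si * lam < abs (Fcom v b l f y)} <= enn (et * 2 powi h)"
  interpret bmo_unit b by (rule b)
  define H :: real where "H = 2 powi h"
  have H: "0 < H" by (simp add: H_def)
  define be where "be = dbl_mean b xi (xi + 4 * H)"
  let ?g = "%t. (be - b t) ^ i * f t"
  let ?local = "si * lam * (4 * H) * young_sum k e 1"
  have "EX c0. leb {y : {xi<..<xi + H}. lam / 16 + 4 * V * (si * lam) * suminf (young_sum k e) < abs (Tlim v ?g y - c0)}
   <= enn (600 * V / (lam / 16) * ?local)" unfolding be_def H_def using v lam si(1) by (intro oscillation_T f e V xi i) auto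
  then obtain c0 where c0: "leb {y : {xi<..<xi + H}. lam / 16 + 4 * V * (si * lam) * Ga < abs (Tlim v ?g y - c0)}
   <= enn (600 * V / (lam / 16) * ?local)" unfolding Ga_def by blast
  let ?B1 = "{y : {xi<..<xi + H}. lam / 16 + 4 * V * (si * lam) * Ga < abs (Tlim v ?g y - c0)}"
  let ?B2 = "{y : {xi..xi + 4 * H}. K < abs (b y - be)}"
  let ?B3 = "%l. {y : {xi<..<xi + H}. R' < y & si * lam < abs (Fcom v b l f y)}"
  let ?B = "{y : {xi<..<xi + H}. R' < y & lam / 4 < abs (Fcom v b i f y - c0)}"
  have [measurable]: "Tlim v ?g : Borel" by (intro Tlim_measurable L2c_power f)
  have [measurable]: "Fcom v b l f : Borel" for l by (rule Fcom_measurable[OF f])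
  have m [measurable]: "?B1 : sets borel" "?B2 : sets borel" "!!l. ?B3 l : sets borel" by measurable
  have "600 * V / (lam / 16) * ?local = (q3 * si) * (de / 3 * H)" using lam de by (simp add: q3_def)
  also have "... <= 1 * (de / 3 * H)" using si(4) de H by (intro mult_right_mono) auto
  finally have "600 * V / (lam / 16) * ?local <= de / 3 * H" by simp
  from order_trans[OF c0 ennreal_leI[OF this]] have e1: "leb ?B1 <= enn (de / 3 * H)" .
  have "leb ?B2 <= enn (4 * H / 2 ^ n)" using john_nirenberg[of xi "xi + 4 * H" n] H by (simp add: K_def be_def)
  also have "4 * H / 2 ^ n <= de / 3 * H" using mult_left_mono[OF less_imp_le[OF n], of "4 * H"] H by (simp add: power_divide mult_ac)
  finally have e2: "leb ?B2 <= enn (de / 3 * H)" by (simp add: ennreal_leI)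
  have "leb (\<Union>l<i. ?B3 l) <= (SUM l<i. leb (?B3 l))" by (intro emeasure_subadditive_finite) auto
  also have "... <= (SUM l<i. enn (et * H))" using small unfolding H_def by (intro sum_mono) auto
  also have "... = enn (real i * et * H)" using et(1)[OF i] H by (simp add: ennreal_mult ennreal_of_nat_eq_real_of_nat mult.assoc)
  also have "... <= enn (de / 3 * H)" using et(2)[OF i] H by (intro ennreal_leI mult_right_mono) auto
  finally have e3: "leb (\<Union>l<i. ?B3 l) <= enn (de / 3 * H)" .
  have "leb ?B <= leb (?B1 Un ?B2 Un (\<Union>l<i. ?B3 l))"
  proof (rule emeasure_mono_AE)
   have "AE y in lborel. ALL l. Tconv v (%t. (- b t) ^ l * f t) y" unfolding AE_all_countable
   proof
    fix l show "AE y in lborel. Tconv v (%t. (- b t) ^ l * f t) y" using v by (intro Tconv_AE[of _ v V, OF L2c_power_minus[OF f]]) auto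
   qed
   then show "AE y in lborel. y : ?B --> y : ?B1 Un ?B2 Un (\<Union>l<i. ?B3 l)"
   proof eventually_elim
    fix y assume c: "ALL l. Tconv v (%t. (- b t) ^ l * f t) y"
    show "y : ?B --> y : ?B1 Un ?B2 Un (\<Union>l<i. ?B3 l)"
    proof (rule impI, rule ccontr)
     assume y: "y : ?B" and no: "y ~: ?B1 Un ?B2 Un (\<Union>l<i. ?B3 l)"
     then have yI: "y : {xi<..<xi + H}" "R' < y" "y : {xi..xi + 4 * H}" using H by auto
     have 1: "abs (Tlim v ?g y - c0) <= lam / 16 + 4 * V * (si * lam) * Ga" and 2: "abs (be - b y) <= K"
      and 3: "!!l. l < i ==> abs (Fcom v b l f y) <= si * lam" using no yI by (auto simp: not_less abs_minus_commute)
     define S where "S = (SUM l<i. of_nat (i choose l) * (be - b y) ^ (i - l) * Fcom v b l f y)"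
     have "Tlim v ?g y = S + Fcom v b i f y" using Fcom_shift[OF f, of i v y be] c by (simp add: S_def lessThan_Suc_atMost[symmetric])
     moreover have "abs S <= lam / 16"
     proof -
      have "abs S <= (SUM l<i. of_nat (i choose l) * K ^ (i - l) * (si * lam))" unfolding S_def using 2 3
       by (intro order_trans[OF sum_abs] sum_mono) (auto simp: abs_mult power_abs intro!: mult_mono power_mono)
      also have "... <= (SUM l<=i. of_nat (i choose l) * K ^ (i - l) * (si * lam))" using si(1) lam by (intro sum_mono2) (auto simp: K_def)
      also have "... = (1 + K) ^ i * (si * lam)" using binomial_ring[of 1 K i] by (simp add: sum_distrib_right)
      also have "... <= (1 + K) ^ k * (si * lam)" using si(1) lam by (intro mult_right_mono power_increasing i) (auto simp: K_def)
      also have "... = (q1 * si) * (lam / 16)" by (simp add: q1_def)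
      also have "... <= 1 * (lam / 16)" using si(2) lam by (intro mult_right_mono) auto
      finally show ?thesis by simp
     qed
     moreover have "4 * V * (si * lam) * Ga = (q2 * si) * (lam / 16)" by (simp add: q2_def)
     moreover have "(q2 * si) * (lam / 16) <= 1 * (lam / 16)" using si(3) lam by (intro mult_right_mono) auto
     moreover have "lam / 4 < abs (Fcom v b i f y - c0)" using y by simp
     ultimately show False using 1 lam by linarith
    qed
   qed
  qed (use m in auto)
  also have "... <= leb ?B1 + leb ?B2 + leb (\<Union>l<i. ?B3 l)" by (intro order_trans[OF emeasure_subadditive] add_mono emeasure_subadditive order_refl) auto
  also have "... <= enn (de / 3 * H) + enn (de / 3 * H) + enn (de / 3 * H)" by (intro add_mono e1 e2 e3)
  also have "... = enn (de * H)" using de H by (simp add: ennreal_plus[symmetric] del: ennreal_plus)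
  finally show "EX c0. leb {y : {xi<..<xi + 2 powi h}. R' < y & lam / 4 < abs (Fcom v b i f y - c0)} <= enn (de * 2 powi h)" unfolding H_def by blast
 qed
qed

section \<open>Level sets of commutators\<close>

lemma dyadic_between:
 fixes d :: real
 assumes "0 < d"
 obtains h :: int where "d <= 2 powi h" "2 powi h < 2 * d"
proof -
 define h where "h = \<lceil>log 2 d\<rceil>"
 have p: "2 powr real_of_int h = 2 powi h" by (rule powr_real_of_int') auto
 have "2 powr log 2 d <= 2 powr of_int h" "2 powr of_int h < 2 powr (1 + log 2 d)" unfolding h_def by (intro powr_mono powr_less_mono; linarith)+
 then show ?thesis using that[of h] assms p by (simp add: powr_add)
qed

lemma rset_mono:
 assumes "integrable lborel g" "integrable lborel g'" "!!t. g t <= g' t"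
 shows "rset g <= rset g'"
proof
 fix x assume "x : rset g"
 then obtain y where "x < y" "y - x < mass g x y" by (auto simp: rset_def)
 moreover have "mass g x y <= mass g' x y" by (intro mass_mono assms)
 ultimately show "x : rset g'" by (auto simp: rset_def intro!: exI[of _ y])
qed

lemma fmeasurable_bounded: "E : sets borel ==> E <= {x..y::real} ==> E : fmeasurable lborel" using finite_emeasure_Int_Icc[of E x y] by (intro fmeasurableI) (auto simp: Int_absorb2)

lemma measure_le_of_emeasure: "emeasure M A <= enn c ==> 0 <= c ==> measure M A <= c" unfolding measure_def by (rule enn2real_leI)

text \<open>A point of \<open>M\<close> outside the exceptional set where \<open>F\<close> is at most \<open>l\<close> bounds the constant by \<open>5 l / 4\<close>; then
 \<open>F\<close> exceeds \<open>2 l\<close> only on the exceptional set.\<close>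

lemma small_from_oscillation:
 fixes F :: "real => real"
 assumes [measurable]: "F : Borel" "M : sets borel"
  and osc: "leb {y : {xi<..<xi + H}. R' < y & l / 4 < abs (F y - c0)} <= enn (de * H)"
  and M: "M <= {xi<..<xi + H} Int {R'<..}" "H / 8 <= rleb M"
  and half: "rleb (M Int {y. R' < y & l < abs (F y)}) <= rleb M / 2"
  and de: "0 < de" "de < 1 / 16" and H: "0 < H" and l: "0 < l"
 shows "rleb ({y. R' < y & 2 * l < abs (F y)} Int {xi<..<xi + H}) <= de * H"
proof -
 let ?S = "{y : {xi<..<xi + H}. R' < y & l / 4 < abs (F y - c0)}"
 let ?E = "%l. {y. R' < y & l < abs (F y)}"
 have [measurable]: "?S : sets borel" "?E l : sets borel" for l by measurable
 have fm: "?S : fmeasurable lborel" "M : fmeasurable lborel" "M Int ?E l : fmeasurable lborel" using M(1) by (intro fmeasurable_bounded[of _ xi "xi + H"]; auto)+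
 have S: "rleb ?S <= de * H" using osc de H by (intro measure_le_of_emeasure) auto
 have "\<not> M <= ?S Un (M Int ?E l)"
 proof
  assume "M <= ?S Un (M Int ?E l)"
  then have "rleb M <= rleb (?S Un (M Int ?E l))" using fm by (intro measure_mono_fmeasurable) auto
  also have "... <= rleb ?S + rleb (M Int ?E l)" by (intro measure_Un_le) auto
  also have "... <= de * H + rleb M / 2" by (intro add_mono S half)
  finally have "H / 16 <= de * H" using M(2) by linarith
  then show False using de H by simp
 qed
 then obtain y0 where "y0 : M" "y0 ~: ?S" "y0 ~: ?E l" by blast
 then have "abs (F y0 - c0) <= l / 4" "abs (F y0) <= l" using M(1) by auto
 then have c0: "abs c0 <= 5 / 4 * l" by linarith
 have "?E (2 * l) Int {xi<..<xi + H} <= ?S"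
 proof
  fix y assume y: "y : ?E (2 * l) Int {xi<..<xi + H}"
  then have "2 * l < abs (F y)" by auto
  then have "l / 4 < abs (F y - c0)" using c0 l by linarith
  then show "y : ?S" using y by auto
 qed
 then have "rleb (?E (2 * l) Int {xi<..<xi + H}) <= rleb ?S" using fm by (intro measure_mono_fmeasurable) auto
 then show ?thesis using S by simp
qed

context one_sided_weight
begin

text \<open>Outside \<open>L (j + N)\<close>, a single interval on which \<open>F\<close> is small most of the time forces \<open>F\<close> to be small on a
 whole interval to the right. Density uses the interval starting at the point itself, which is small by the choice of
 \<open>V\<close>; domination uses the interval right of the end of a component of \<open>V j \<union> L j\<close>.\<close>

lemma levels_step:
 fixes F :: "real => real" and R' ka :: real and L :: "int => real set"
 defines "E \<equiv> %j :: int. {y. R' < y & 2 powi j < abs (F y)}"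
 defines "V \<equiv> %j. rset (%t. 1 / ka * ind (E j) t)"
 assumes F [measurable]: "F : Borel" and Rf: "!!y. Rf < y ==> F y = 0"
  and L: "good_levels N h0 L" and N: "1 <= N" and ka: "0 < ka" "ka <= 1 / 8" and de: "0 < de" "8 * de <= ka" and h0: "0 <= h0"
  and osc: "!!xi j h. xi ~: L (j + int N) ==>
   EX c0. leb {y : {xi<..<xi + 2 powi h}. R' < y & 2 powi j / 4 < abs (F y - c0)} <= enn (de * 2 powi h)"
 shows "good_levels N (h0 + 8 * de / ka) (%j. V j Un L j)" "dominated_levels N (4 * de / ka) L (%j. V j Un L j)"
proof -
 have Em [measurable]: "E j : sets borel" for j unfolding E_def by measurable
 have Esub: "E j <= {R'..Rf}" for j
 proof
  fix y assume y: "y : E j"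
  then have "2 powi j < abs (F y)" by (simp add: E_def)
  then have "F y ~= 0" using powi_pos[of j] by linarith
  then show "y : {R'..Rf}" using y Rf[of y] by (auto simp: E_def not_less[symmetric])
 qed
 have Emono: "E j <= E i" if "i <= j" for i j using powi_mono2[OF that] by (auto simp: E_def)
 define g where "g j t = 1 / ka * ind (E j) t" for j and t :: real
 have ibs: "ibs (g j)" for j unfolding g_def[abs_def] by (rule ibs_scaled_indicator[OF Em Esub])
 have gm: "g j : Borel" and nn: "0 <= g j t" for j t unfolding g_def[abs_def] using ka by auto
 have gi: "integrable lborel (g j)" for j using ibs by (simp add: ibs_def)
 have V: "V j = rset (g j)" for j by (simp add: V_def g_def[abs_def])
 have Vo: "open (V j)" for j unfolding V by (intro open_rset gi nn)
 have Vmono: "V j <= V i" if "i <= j" for i j unfolding V using Emono[OF that] ka by (intro rset_mono gi) (auto simp: g_def indicator_def)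
 have Lo: "open (L j)" and Lmono: "i <= j ==> L j <= L i"
  and Lthin: "a ~: L j ==> 0 < D ==> leb (L (j + int N) Int {a<..<a + D}) <= enn (h0 * D)" for i j a D using L unfolding good_levels_def by blast+
 have mE: "rleb (E j Int {a<..<c}) <= ka * (c - a)" if "a ~: V j" "a <= c" for a c j
 proof -
  have "mass (g j) a c <= c - a" using that by (intro not_rset) (simp_all add: V)
  moreover have "mass (g j) a c = 1 / ka * rleb (E j Int {a..c})" unfolding g_def by (rule mass_indicator) measurable
  ultimately show ?thesis using ka by (simp add: measure_Icc_Ioo field_simps)
 qed
 have key: "rleb (E (j + 1) Int {xi<..<xi + H}) <= de * H"
  if xi: "xi ~: L (j + int N)" and a: "a ~: V j" "xi <= a" "R' <= a" "a + D <= xi + H" "H <= 8 * D" and H: "H = 2 powi h"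
   and sm: "rleb (E j Int {a<..<a + D}) <= D / 2" for xi j a D H h
 proof -
  have D: "0 < D" using a(5) powi_pos[of h] H by linarith
  obtain c0 where c0: "leb {y : {xi<..<xi + H}. R' < y & 2 powi j / 4 < abs (F y - c0)} <= enn (de * H)" using osc[OF xi, of h] H by blast
  have "E (j + 1) = {y. R' < y & 2 * 2 powi j < abs (F y)}" unfolding E_def powi_Suc ..
  moreover have "rleb ({y. R' < y & 2 * 2 powi j < abs (F y)} Int {xi<..<xi + H}) <= de * H"
  proof (rule small_from_oscillation[OF F _ c0, of "{a<..<a + D}"])
   show "rleb ({a<..<a + D} Int {y. R' < y & 2 powi j < abs (F y)}) <= rleb {a<..<a + D} / 2" using sm D unfolding E_def by (simp add: Int_commute)
  qed (use a D de ka H in auto)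
  ultimately show ?thesis by simp
 qed
 show "dominated_levels N (4 * de / ka) L (%j. V j Un L j)" unfolding dominated_levels_def
 proof (intro conjI allI impI)
  show "L j : sets borel" for j using Lo by simp
  fix j x c assume x: "x < c" and c: "c ~: V j Un L j"
  define d where "d = c - x"
  have d: "0 < d" using x by (simp add: d_def)
  have cL: "c ~: L (j + int N)" and cV: "c ~: V (j + int N)" using c Lmono[of j "j + int N"] Vmono[of j "j + int N"] by auto
  define S where "S = {x..c} Int - L (j + int N)"
  have clS: "closed S" unfolding S_def using Lo by (auto simp: closed_Compl)
  have "c : S" using x cL by (simp add: S_def)
  then have Sne: "S ~= {}" by blast
  have Sb: "bdd_below S" unfolding S_def by (intro bdd_belowI[of _ x]) auto
  (* the first point of {x..c} outside the comparison set, where the oscillation bound starts to hold *)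
  define xi where "xi = Inf S"
  have xi: "xi : S" unfolding xi_def using closed_contains_Inf[OF Sne Sb clS] .
  let ?G = "%t. 1 / ka * ind (E (j + int N) Int {xi..c}) t"
  have ibsG: "ibs ?G" by (rule ibs_scaled_indicator) auto
  have G': "?G : Borel" "!!t. 0 <= ?G t" using ka by auto
  have "(V (j + int N) Un L (j + int N) - L (j + int N)) Int {x<..<(x + c) / 2} <= rset ?G"
  proof
   fix y assume y: "y : (V (j + int N) Un L (j + int N) - L (j + int N)) Int {x<..<(x + c) / 2}"
   then have yS: "y : S" "y < c" using x by (auto simp: S_def field_simps)
   then have "xi <= y" unfolding xi_def using Sb by (intro cInf_lower)
   obtain z where z: "y < z" "z - y < mass (g (j + int N)) y z" using y by (auto simp: V rset_def)
   have G: "mass ?G u u' = mass (g (j + int N)) u u'" if "xi <= u" "u' <= c" for u u' using that by (intro mass_cong) (auto simp: g_def indicator_def)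
   show "y : rset ?G"
   proof (cases "z <= c")
    case True then show ?thesis using z G[of y z] \<open>xi <= y\<close> by (auto simp: rset_def)
   next
    case False
    then have "mass (g (j + int N)) y z = mass (g (j + int N)) y c + mass (g (j + int N)) c z" using yS by (intro mass_split gi) auto
    moreover have "mass (g (j + int N)) c z <= z - c" using cV False by (intro not_rset) (auto simp: V)
    ultimately have "c - y < mass ?G y c" using z G[of y c] \<open>xi <= y\<close> by simp
    then show ?thesis using yS(2) by (auto simp: rset_def)
   qed
  qed
  then have "leb ((V (j + int N) Un L (j + int N) - L (j + int N)) Int {x<..<(x + c) / 2}) <= leb (rset ?G)" using open_rset[of ?G] ibsG G' by (intro emeasure_mono) (auto simp: ibs_def)
  also have "... <= enn (LINT t|lborel. ?G t)" by (rule rset_weak_type[OF ibsG G'(2,1)])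
  also have "(LINT t|lborel. ?G t) = 1 / ka * rleb (E (j + int N) Int {xi..c})" by simp
  also have "enn (1 / ka * rleb (E (j + int N) Int {xi..c})) <= enn (1 / ka * (4 * de * d))"
  proof (intro ennreal_leI mult_left_mono)
   show "rleb (E (j + int N) Int {xi..c}) <= 4 * de * d"
   proof (cases "R' < c")
    case False
    then have "E (j + int N) Int {xi..c} = {}" by (auto simp: E_def)
    then show ?thesis using de d by simp
   next
    case True
    obtain h where h: "2 * d <= 2 powi h" "2 powi h < 2 * (2 * d)" using dyadic_between[of "2 * d"] d by auto
    have "rleb (E j Int {c<..<c + d}) <= ka * d" using mE[of c j "c + d"] c d by simp
    also have "... <= d / 2" using mult_right_mono[OF ka(2), of d] d by simp
    finally have k: "rleb (E (j + 1) Int {xi<..<xi + 2 powi h}) <= de * 2 powi h" using xi c True h d by (intro key[where a=c and D=d and j=j]) (auto simp: S_def d_def)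
    have "rleb (E (j + int N) Int {xi..c}) = rleb (E (j + int N) Int {xi<..<c})" by (rule measure_Icc_Ioo[symmetric]) measurable
    also have "... <= rleb (E (j + 1) Int {xi<..<xi + 2 powi h})"
    proof (rule measure_mono_fmeasurable)
     have "c - xi <= 2 powi h" using xi h d by (auto simp: S_def d_def)
     then show "E (j + int N) Int {xi<..<c} <= E (j + 1) Int {xi<..<xi + 2 powi h}" using Emono[of "j + 1" "j + int N"] N by auto
     show "E (j + 1) Int {xi<..<xi + 2 powi h} : fmeasurable lborel" by (rule fmeasurable_bounded[of _ xi "xi + 2 powi h"]) auto
    qed simp
    also have "... <= de * 2 powi h" by (rule k)
    also have "... <= de * (4 * d)" using h de by (intro mult_left_mono) auto
    finally show ?thesis by simp
   qed
  qed (use ka in simp)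
  finally show "leb ((V (j + int N) Un L (j + int N) - L (j + int N)) Int {x<..<(x + c) / 2}) <= enn (4 * de / ka * (c - x))" by (simp add: d_def)
 qed
 show "good_levels N (h0 + 8 * de / ka) (%j. V j Un L j)" unfolding good_levels_def
 proof (intro conjI allI impI)
  show "open (V j Un L j)" for j using Vo Lo by auto
  show "V j Un L j <= V i Un L i" if "i <= j" for i j using Vmono[OF that] Lmono[OF that] by auto
  fix j a and D :: real assume a: "a ~: V j Un L j" and D: "0 < D"
  have aL: "a ~: L (j + int N)" using a Lmono[of j "j + int N"] by auto
  have sm: "rleb (E (j + 1) Int {a<..<a + D'}) <= 4 * de * D'" if D': "0 < D'" for D'
  proof (cases "R' < a + D'")
   case False
   then have "E (j + 1) Int {a<..<a + D'} = {}" by (auto simp: E_def)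
   then show ?thesis using de D' by simp
  next
   case True
   obtain h where h: "2 * D' <= 2 powi h" "2 powi h < 2 * (2 * D')" using dyadic_between[of "2 * D'"] D' by auto
   let ?H = "2 powi h :: real"
   obtain c0 where c0: "leb {y : {a<..<a + ?H}. R' < y & 2 powi j / 4 < abs (F y - c0)} <= enn (de * ?H)" using osc[OF aL] by blast
   let ?M = "{max a R'<..<a + ?H}"
   have M: "?H / 2 <= rleb ?M" using True h D' by (simp add: max_def)
   have "rleb ({y. R' < y & 2 * 2 powi j < abs (F y)} Int {a<..<a + ?H}) <= de * ?H"
   proof (rule small_from_oscillation[OF F _ c0, of ?M])
    have "rleb (?M Int E j) <= rleb (E j Int {a<..<a + ?H})" by (intro measure_mono_fmeasurable fmeasurable_bounded[of _ a "a + ?H"]) auto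
    also have "... <= ka * ?H" using mE[of a j "a + ?H"] a by simp
    also have "... <= ?H / 4" using mult_right_mono[OF ka(2), of ?H] powi_pos[of h] by simp
    finally show "rleb (?M Int {y. R' < y & 2 powi j < abs (F y)}) <= rleb ?M / 2" using M unfolding E_def by linarith
    show "?H / 8 <= rleb ?M" using M powi_pos[of h] by linarith
   qed (use de ka in auto)
   then have k: "rleb (E (j + 1) Int {a<..<a + ?H}) <= de * ?H" unfolding E_def powi_Suc .
   have "rleb (E (j + 1) Int {a<..<a + D'}) <= rleb (E (j + 1) Int {a<..<a + ?H})" using h D' by (intro measure_mono_fmeasurable fmeasurable_bounded[of _ a "a + ?H"]) auto
   also note k
   also have "de * ?H <= de * (4 * D')" using h de by (intro mult_left_mono) auto
   finally show ?thesis by simp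
  qed
  have "leb (V (j + int N) Int {a<..<a + D}) <= leb (V (j + 1) Int {a<..<a + D})" using Vmono[of "j + 1" "j + int N"] N Vo by (intro emeasure_mono) auto
  also have "... <= enn (2 * (4 * de / ka) * D)" unfolding V
  proof (rule rset_thin[OF gi nn gm])
   fix D' :: real assume "0 < D'"
   have "mass (g (j + 1)) a (a + D') = 1 / ka * rleb (E (j + 1) Int {a..a + D'})" unfolding g_def by (rule mass_indicator) measurable
   also have "... <= 1 / ka * (4 * de * D')" using sm[OF \<open>0 < D'\<close>] ka by (intro mult_left_mono) (auto simp: measure_Icc_Ioo)
   finally show "mass (g (j + 1)) a (a + D') <= 4 * de / ka * D'" by simp
  qed (use de ka D in \<open>auto simp: divide_le_eq\<close>)
  finally have v: "leb (V (j + int N) Int {a<..<a + D}) <= enn (8 * de / ka * D)" by simp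
  have "(V (j + int N) Un L (j + int N)) Int {a<..<a + D} = (L (j + int N) Int {a<..<a + D}) Un (V (j + int N) Int {a<..<a + D})" by auto
  then have "leb ((V (j + int N) Un L (j + int N)) Int {a<..<a + D})
    <= leb (L (j + int N) Int {a<..<a + D}) + leb (V (j + int N) Int {a<..<a + D})" using Vo Lo by (simp only:) (intro emeasure_subadditive, auto)
  also have "... <= enn (h0 * D) + enn (8 * de / ka * D)" using a D by (intro add_mono v Lthin) auto
  also have "... = enn ((h0 + 8 * de / ka) * D)" using h0 D de ka by (simp add: ennreal_plus[symmetric] distrib_right del: ennreal_plus)
  finally show "leb ((V (j + int N) Un L (j + int N)) Int {a<..<a + D}) <= enn ((h0 + 8 * de / ka) * D)" .
 next
  fix t :: real assume t: "0 < t"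
  obtain m where m: "0 < m" "!!j. j <= 0 ==> L j <= {- (m * 2 powr (- (1 + t) * of_int j))<..<m}" using L t unfolding good_levels_def by blast
  let ?g = "%t. 1 / ka * ind {R'..Rf} t"
  have ib: "ibs ?g" by (rule ibs_scaled_indicator[of _ R' Rf]) auto
  have "bounded (rset ?g)" using ka by (intro bounded_rset ib) auto
  then obtain B where B: "!!y. y : rset ?g ==> abs y <= B" by (auto simp: bounded_iff)
  have VB: "abs y <= B" if "y : V j" for j y
  proof -
   have "V j <= rset ?g" unfolding V using ib Esub[of j] ka by (intro rset_mono gi) (auto simp: ibs_def g_def indicator_def)
   then show ?thesis using that B by auto
  qed
  define m' where "m' = max m (abs B + 1)"
  show "EX m>0. ALL j<=0. V j Un L j <= {- (m * 2 powr (- (1 + t) * of_int j))<..<m}"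
  proof (intro exI[of _ m'] conjI allI impI)
   show "0 < m'" using m by (simp add: m'_def)
   fix j :: int assume j: "j <= 0"
   let ?q = "2 powr (- (1 + t) * of_int j)"
   have q: "1 <= ?q" using j t by (intro ge_one_powr_ge_zero) (auto simp: mult_nonpos_nonpos)
   have "m * ?q <= m' * ?q" by (intro mult_right_mono) (auto simp: m'_def)
   moreover have "m' * 1 <= m' * ?q" using q m by (intro mult_left_mono) (auto simp: m'_def)
   moreover have "m <= m'" "abs B + 1 <= m'" by (auto simp: m'_def)
   ultimately have "- (m' * ?q) < y & y < m'" if "y : V j | - (m * ?q) < y & y < m" for y using that VB[of y j] by linarith
   then show "V j Un L j <= {- (m' * ?q)<..<m'}" using m(2)[OF j] by fastforce
  qed
 qed
qed

end

lemma LlogL_power_growth: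
 assumes e: "0 < e" and t: "0 < t"
 obtains C where "0 < C" "!!u. 1 <= u ==> LL k e u <= C * u powr (1 + t)"
proof -
 define q where "q = real (1 + k) + (1 + e)"
 define s where "s = t / q"
 have q: "0 < q" and s: "0 < s" "s * q = t" using e t by (auto simp: q_def s_def)
 define C where "C = (1 + 1 / s) powr q"
 have "0 < 1 + 1 / s" using s by (intro add_pos_pos) auto
 then have C: "0 < C" by (simp add: C_def)
 show ?thesis
 proof (rule that[OF C])
  fix u :: real assume u: "1 <= u"
  define l where "l = log_plus u"
  have l: "0 <= l" "l = ln u" using u by (auto simp: l_def log_plus_def)
  have "log_plus l <= l" using ln_le_minus_one[of l] by (auto simp: log_plus_def l_def)
  then have "(1 + log_plus l) powr (1 + e) <= (1 + l) powr (1 + e)" using e by (intro powr_mono2) auto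
  then have "log_factor k e u <= (1 + l) ^ (1 + k) * (1 + l) powr (1 + e)" unfolding log_factor_def l_def[symmetric] using l by (intro mult_left_mono) auto
  also have "... = (1 + l) powr q"  unfolding q_def powr_add using l powr_realpow[of "1 + l" "1 + k"] by simp
  also have "... <= ((1 + 1 / s) * u powr s) powr q"
  proof (rule powr_mono2)
   have "1 <= u powr s" using u s by (intro ge_one_powr_ge_zero) auto
   then show "1 + l <= (1 + 1 / s) * u powr s" using ln_powr_bound[OF u s(1)] l(2) by (simp add: distrib_right)
  qed (use q l in auto)
  also have "... = C * u powr t" using s by (simp add: powr_mult powr_powr C_def)
  finally show "LL k e u <= C * u powr (1 + t)" unfolding LlogL_factor using u by (simp add: powr_add mult_ac)
 qed
qed

lemma Om_mono:
 assumes f: "bcs f" and e: "0 < e" and s: "0 < s" "s <= s'"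
 shows "Om k e f s' <= Om k e f s" unfolding Om_def
proof (rule rset_mono)
 show "LL k e (abs (f t) / s') <= LL k e (abs (f t) / s)" for t using s by (intro LlogL_mono e divide_left_mono) auto
qed (use ibs_LlogL(1)[OF f e, of _ k] s in \<open>auto simp: ibs_def\<close>)

lemma Fcom_zero_right:
 assumes "!!t. y <= t ==> f t = 0"
 shows "Fcom v b i f y = 0"
proof -
 have "Tlim v (%t. (- b t) ^ l * f t) y = 0" for l using Tlim_cong_right[of y "%t. (- b t) ^ l * f t" "%t. 0" v] assms Tlim_zero by simp
 then show ?thesis by (simp add: Fcom_def)
qed

context one_sided_weight
begin

lemma good_levels_weaken:
 assumes "good_levels N h U" "h <= h'"
 shows "good_levels N h' U"
proof -
 have "enn (h * D) <= enn (h' * D)" if "0 < D" for D using assms(2) that by (intro ennreal_leI mult_right_mono) auto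
 then show ?thesis using assms(1) unfolding good_levels_def by (meson order_trans)
qed

lemma good_levels_shift:
 assumes U: "good_levels N h U"
 shows "good_levels N h (%j. U (j - int L))" unfolding good_levels_def
proof (intro conjI allI impI)
 fix t :: real assume t: "0 < t"
 obtain m where m: "0 < m" "!!j. j <= 0 ==> U j <= {- (m * 2 powr (- (1 + t) * of_int j))<..<m}" using U t unfolding good_levels_def by blast
 let ?m = "m * 2 powr ((1 + t) * real L)"
 have "1 <= 2 powr ((1 + t) * real L)" using t by (intro ge_one_powr_ge_zero) auto
 then have m1: "m <= ?m" using m(1) by simp
 show "EX m>0. ALL j<=0. U (j - int L) <= {- (m * 2 powr (- (1 + t) * of_int j))<..<m}"
 proof (intro exI[of _ ?m] conjI allI impI)
  fix j :: int assume "j <= 0"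
  then have "U (j - int L) <= {- (m * 2 powr (- (1 + t) * of_int (j - int L)))<..<m}" by (intro m(2)) simp
  moreover have "m * 2 powr (- (1 + t) * of_int (j - int L)) = ?m * 2 powr (- (1 + t) * of_int j)" by (simp add: mult.assoc powr_add[symmetric] algebra_simps)
  ultimately show "U (j - int L) <= {- (?m * 2 powr (- (1 + t) * of_int j))<..<?m}" using m1 by (simp only:) fastforce
 qed (use m in simp)
next
 fix j a and D :: real assume "a ~: U (j - int L)" "0 < D"
 then have "leb (U (j - int L + int N) Int {a<..<a + D}) <= enn (h * D)" using U unfolding good_levels_def by blast
 then show "leb (U (j + int N - int L) Int {a<..<a + D}) <= enn (h * D)" by (simp add: algebra_simps)
qed (use U in \<open>auto simp: good_levels_def\<close>)

lemma level_sum_shift: "level_sum p (%j. U (j - int L)) = enn (2 powr (real L * p)) * level_sum p U"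
proof -
 have "level_sum p (%j. U (j - int L)) = isum (%j. enn (2 powr (of_int (j + int L) * p)) * emeasure M (U (j + int L - int L)))" unfolding level_sum_def by (rule isum_shift[symmetric])
 also have "... = isum (%j. enn (2 powr (real L * p)) * (enn (2 powr (of_int j * p)) * emeasure M (U j)))"
 proof -
  have "2 powr (of_int (j + int L) * p) = 2 powr (real L * p) * 2 powr (of_int j * p)" for j unfolding powr_add[symmetric] by (simp add: distrib_right add.commute)
  moreover have "j + int L - int L = j" for j by simp
  ultimately show ?thesis by (simp only: ennreal_mult powr_ge_zero mult.assoc)
 qed
 also have "... = enn (2 powr (real L * p)) * level_sum p U" unfolding level_sum_def by (rule nn_integral_cmult) simp
 finally show ?thesis .
qed

text \<open>Density: \<open>A (u / 2\<^sup>N) \<le> A u / 2\<^sup>N\<close>. Growth: \<open>A\<close> is below every power \<open>u\<^sup>1\<^sup>+\<^sup>t\<close>.\<close>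

lemma good_levels_Om:
 assumes f: "bcs f" and e: "0 < e" and N: "1 <= N"
 shows "good_levels N (2 / 2 ^ N) (%j. Om k e f (2 powi j))" unfolding good_levels_def
proof (intro conjI allI impI)
 note A = ibs_LlogL[OF f e powi_pos, of k]
 have Ai: "integrable lborel (%t. LL k e (abs (f t) / 2 powi j))" for j using A(1) by (simp add: ibs_def)
 show "open (Om k e f (2 powi j))" for j unfolding Om_def by (rule open_rset[OF Ai A(3)])
 show "Om k e f (2 powi j) <= Om k e f (2 powi i)" if "i <= j" for i j by (rule Om_mono[OF f e powi_pos powi_mono2[OF that]])
 fix j a and D :: real assume a: "a ~: Om k e f (2 powi j)" and D: "0 < D"
 have "leb (Om k e f (2 powi (j + int N)) Int {a<..<a + D}) <= enn (2 * (1 / 2 ^ N) * D)" unfolding Om_def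
 proof (rule rset_thin[OF Ai A(3) A(2)])
  fix D' :: real assume D': "0 < D'"
  have "mass (%t. LL k e (abs (f t) / 2 powi (j + int N))) a (a + D') <= mass (%t. LL k e (abs (f t) / 2 powi j) / 2 ^ N) a (a + D')"
  proof (rule mass_mono)
   fix t
   have eq: "abs (f t) / 2 powi (j + int N) = 1 / 2 ^ N * (abs (f t) / 2 powi j)" by (simp add: powi_add_nat)
   show "LL k e (abs (f t) / 2 powi (j + int N)) <= LL k e (abs (f t) / 2 powi j) / 2 ^ N"
    unfolding eq using LlogL_scale[OF e, of "abs (f t) / 2 powi j" "1 / 2 ^ N" k] by (simp add: less_imp_le)
  qed (use Ai in auto)
  also have "... = mass (%t. LL k e (abs (f t) / 2 powi j)) a (a + D') / 2 ^ N" by (rule mass_divide)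
  also have "... <= 1 / 2 ^ N * D'" using a not_rset[of a _ "a + D'"] D' by (simp add: Om_def divide_right_mono)
  finally show "mass (%t. LL k e (abs (f t) / 2 powi (j + int N))) a (a + D') <= 1 / 2 ^ N * D'" .
 next
  show "1 / 2 ^ N <= (1 / 2 :: real)" using power_increasing[OF N, of "2 :: real"] by (simp add: field_simps)
 qed (rule D)
 then show "leb (Om k e f (2 powi (j + int N)) Int {a<..<a + D}) <= enn (2 / 2 ^ N * D)" by simp
next
 fix t :: real assume t: "0 < t"
 obtain K0 R0 where f0: "!!t. abs (f t) <= K0" "!!t. R0 < abs t ==> f t = 0" using f by (auto simp: bcs_def)
 define K R where "K = max 1 K0" and "R = abs R0 + 1"
 have K: "1 <= K" "abs (f t) <= K" and R: "0 < R" "R < abs t ==> f t = 0" for t using f0(1)[of t] f0(2)[of t] by (auto simp: K_def R_def)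
 obtain C where C: "0 < C" "!!u. 1 <= u ==> LL k e u <= C * u powr (1 + t)" using LlogL_power_growth[OF e t] by blast
 define m where "m = 2 * R * (C * K powr (1 + t)) + R"
 have m: "0 < m" "R <= m" using R C K by (auto simp: m_def add_nonneg_pos)
 show "EX m>0. ALL j<=0. Om k e f (2 powi j) <= {- (m * 2 powr (- (1 + t) * real_of_int j))<..<m}"
 proof (intro exI[of _ m] conjI allI impI m subsetI)
  fix j :: int and y assume j: "j <= 0" and "y : Om k e f (2 powi j)"
  let ?A = "%t. LL k e (abs (f t) / 2 powi j)"
  obtain z where z: "y < z" "z - y < mass ?A y z" using \<open>y : Om k e f (2 powi j)\<close> by (auto simp: Om_def rset_def)
  have yR: "y <= R"
  proof (rule ccontr)
   assume "\<not> y <= R"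
   then have "mass ?A y z = 0" using R by (intro mass_eq_0) (auto simp: LlogL_loglogL_def)
   then show False using z by simp
  qed
  have zR: "- R <= z"
  proof (rule ccontr)
   assume "\<not> - R <= z"
   then have "mass ?A y z = 0" using R by (intro mass_eq_0) (auto simp: LlogL_loglogL_def)
   then show False using z by simp
  qed
  have p: "2 powr real_of_int j = 2 powi j" by (rule powr_real_of_int') auto
  let ?q = "2 powr (- (1 + t) * of_int j)"
  have q: "1 <= ?q" using j t by (intro ge_one_powr_ge_zero) (auto simp: mult_nonpos_nonpos)
  have "2 powi j <= (1 :: real)" using powi_mono2[OF j] by simp
  then have Kj: "1 <= K / 2 powi j" using K(1) powi_pos[of j] by (simp add: le_divide_eq)
  let ?c = "C * K powr (1 + t) * ?q"
  have A: "?A s <= ?c" for s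
  proof -
   have "?A s <= LL k e (K / 2 powi j)" using K by (intro LlogL_mono e divide_right_mono) (auto simp: less_imp_le)
   also have "... <= C * (K / 2 powi j) powr (1 + t)" by (rule C(2)[OF Kj])
   also have "(K / 2 powi j) powr (1 + t) = K powr (1 + t) * ?q"

   proof -
    have "(K / 2 powr x) powr a = K powr a * 2 powr (- a * x)" for x a :: real using K(1) by (subst powr_divide) (auto simp: powr_powr powr_minus_divide mult.commute)
    then show ?thesis unfolding p[symmetric] .
   qed
   finally show ?thesis by (simp add: mult.assoc)
  qed
  have "mass ?A y z <= mass (%t. ?c * ind {-R..R} t) y z"
  proof (rule mass_mono)
   show "integrable lborel ?A" using ibs_LlogL(1)[OF f e powi_pos] by (simp add: ibs_def)
   show "integrable lborel (%t. ?c * ind {-R..R} t)" using ibs_scaled_indicator[of "{-R..R}" "-R" R ?c] by (simp add: ibs_def)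
   fix s
   show "?A s <= ?c * ind {-R..R} s"
   proof (cases "R < abs s")
    case True then show ?thesis using R(2)[OF True] C(1) by (simp add: LlogL_loglogL_def indicator_def)
   next
    case False then have "s : {-R..R}" by auto
    then show ?thesis using A[of s] by simp
   qed
  qed
  also have "... = ?c * rleb ({-R..R} Int {y..z})" by (rule mass_indicator) simp
  also have "... <= ?c * rleb {-R..R}" using C(1) by (intro mult_left_mono measure_mono_fmeasurable fmeasurable_bounded[of _ "-R" R]) auto
  finally have "z - y < 2 * R * (C * K powr (1 + t)) * ?q" using z R(1) by (simp add: mult_ac)
  moreover have "R * 1 <= R * ?q" using q R(1) by (intro mult_left_mono) auto
  moreover have "m * ?q = 2 * R * (C * K powr (1 + t)) * ?q + R * ?q" by (simp add: m_def distrib_right)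
  ultimately have "- (m * ?q) < y" using zR by linarith
  moreover have "R < m" using R C K by (simp add: m_def)
  ultimately show "y : {- (m * ?q)<..<m}" using yR by simp
 qed
qed

text \<open>Induction on the order of the commutator. At each order the bad sets of the lower orders, shifted by
 a fixed number of dyadic levels, are the comparison family that controls the oscillation of the next
 one. The margins \<open>4 - 2 / 2\<^sup>n\<close> leave room for the density added at every step.\<close>

theorem commutator_levels:
 assumes p: "0 < p" "p < r" and e: "0 < e" and V: "0 < V"
  and T: "!!m. 0 < m ==> (nn_integral M (%x. enn (tail 0 m x powr p))) < \<infinity>"
 shows "EX C>0. ALL b f v R'. bmo_unit b --> bcs f --> (ALL j. abs (v j) <= V) -->
  (EX U. (ALL j. rset (%t. 8 * ind {y. R' < y & 2 powi j < abs (Fcom v b k f y)} t) <= U j) & (ALL j. open (U j)) &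
   level_sum p U <= enn C * level_sum p (%j. Om k e f (2 powi j)))"
proof -
 obtain N h0 C0 where N: "1 <= N" and h0: "0 < h0" and C0: "0 < C0" and dom: "!!U O'. good_levels N (4 / 2 ^ N) U ==>
   dominated_levels N h0 O' U ==> level_sum p U <= enn C0 * level_sum p O'" using level_set_domination[OF p] T by blast
 let ?E = "%v b l f R' j. {y. R' < y & 2 powi j < abs (Fcom v b l f y)}"
 let ?V = "%ka v b l f R' j. rset (%t. 1 / ka * ind (?E v b l f R' j) t)"
 let ?P = "%ka n C. ALL b f v R'. bmo_unit b --> bcs f --> (ALL j. abs (v j) <= V) -->
  (EX U. good_levels N ((4 - 2 / 2 ^ n) / 2 ^ N) U & (ALL j. Om k e f (2 powi j) <= U j) &
   (ALL l<n. ALL j. ?V ka v b l f R' j <= U j) & level_sum p U <= enn C * level_sum p (%j. Om k e f (2 powi j)))"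
 have ibsE: "ibs (%t. c * ind (?E v b l f R' j) t)" if b: "bmo_unit b" and f: "bcs f" for c v b l f R' j
 proof -
  interpret bmo_unit b by (rule b)
  have [measurable]: "Fcom v b l f : Borel" by (rule Fcom_measurable[OF f])
  obtain R where R: "!!t. R < abs t ==> f t = 0" using f by (auto simp: bcs_def)
  show ?thesis
  proof (rule ibs_scaled_indicator[of _ R' "abs R"])
   show "?E v b l f R' j <= {R'..abs R}"
   proof
    fix y assume y: "y : ?E v b l f R' j"
    then have "2 powi j < abs (Fcom v b l f y)" by simp
    then have "Fcom v b l f y ~= 0" using powi_pos[of j] by linarith
    then have "\<not> abs R < y" using Fcom_zero_right[of y f v b l] R by fastforce
    then show "y : {R'..abs R}" using y by simp
   qed
  qed measurable
 qed
 have "EX C>0. ?P ka n C" if "0 < ka" "ka <= 1 / 8" "n <= Suc k" for ka n using that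
 proof (induction n arbitrary: ka)
  case 0
  show ?case
  proof (intro exI[of _ 1] conjI allI impI)
   fix b f v R' assume f: "bcs f"
   show "EX U. good_levels N ((4 - 2 / 2 ^ 0) / 2 ^ N) U & (ALL j. Om k e f (2 powi j) <= U j) &
    (ALL l<0. ALL j. ?V ka v b l f R' j <= U j) & level_sum p U <= enn 1 * level_sum p (%j. Om k e f (2 powi j))"
    using good_levels_Om[OF f e N, of k] by (intro exI[of _ "%j. Om k e f (2 powi j)"]) simp
  qed simp
 next
  case (Suc n)
  note ka = Suc.prems(1,2)
  (* 8 de / ka is the density added in this step: it must fit into the margin and below h0 *)
  define de where "de = ka * min ((1 / 2 ^ n) / 2 ^ N) (min 1 h0) / 8"
  have "0 < min ((1 / 2 ^ n) / 2 ^ N) (min 1 h0)" using h0 by simp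
  then have de: "0 < de" using ka by (simp add: de_def)
  have d8: "8 * de / ka = min ((1 / 2 ^ n) / 2 ^ N) (min 1 h0)" using ka by (simp add: de_def)
  then have de1: "8 * de / ka <= (1 / 2 ^ n) / 2 ^ N" "8 * de / ka <= 1" "8 * de / ka <= h0" by auto
  then have de2: "8 * de <= ka" using ka by (simp add: divide_le_eq)
  obtain si et where si: "0 < si" "0 < et" and oscB: "ALL b f v xi h lam R' i. bmo_unit b --> bcs f --> (ALL j. abs (v j) <= V) --> i <= k --> 0 < lam -->
   xi ~: Om k e f (si * lam) -->
   (ALL l<i. leb {y : {xi<..<xi + 2 powi h}. R' < y & si * lam < abs (Fcom v b l f y)} <= enn (et * 2 powi h)) -->
   (EX c0. leb {y : {xi<..<xi + 2 powi h}. R' < y & lam / 4 < abs (Fcom v b i f y - c0)} <= enn (de * 2 powi h))" using oscillation_bound[OF e V de, of k] by blast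
  obtain L0 where L0: "(1 / 2) ^ L0 < si" using real_arch_pow_inv[OF si(1), of "1 / 2"] by auto
  have s2: "2 powi (j - int L0) <= si * 2 powi j" for j
  proof -
   have "(2 :: real) powi j = 2 powi (j - int L0) * 2 ^ L0" using powi_add_nat[of "j - int L0" L0] by simp
   then have "2 powi (j - int L0) = (1 / 2) ^ L0 * (2 :: real) powi j" by (simp add: power_divide)
   then show ?thesis using mult_right_mono[OF less_imp_le[OF L0], of "2 powi j"] by (simp add: less_imp_le)
  qed
  define L where "L = L0 + N"
  define ka' where "ka' = min et ka"
  have ka': "0 < ka'" "ka' <= 1 / 8" "ka' <= et" "ka' <= ka" using si ka by (auto simp: ka'_def)
  obtain C where C: "0 < C" "?P ka' n C" using Suc.IH[OF ka'(1,2)] Suc.prems(3) by auto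
  define C' where "C' = C0 * (2 powr (real L * p) * C)"
  show ?case
  proof (rule exI[of _ C'], rule conjI)
   show "0 < C'" using C0 C by (simp add: C'_def)
   show "?P ka (Suc n) C'"
   proof (intro allI impI)
    fix b f R' and v :: "int => real" assume b: "bmo_unit b" and f: "bcs f" and v: "ALL j. abs (v j :: real) <= V"
    interpret bmo_unit b by (rule b)
    obtain U where U: "good_levels N ((4 - 2 / 2 ^ n) / 2 ^ N) U" "!!j. Om k e f (2 powi j) <= U j"
     "!!l j. l < n ==> ?V ka' v b l f R' j <= U j" "level_sum p U <= enn C * level_sum p (%j. Om k e f (2 powi j))"
     using C(2)[THEN spec, THEN spec, THEN spec, THEN spec, THEN mp, THEN mp, THEN mp, OF b f v, of R'] by blast
    define F where "F = Fcom v b n f"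
    have Fm: "F : Borel" unfolding F_def by (rule Fcom_measurable[OF f])
    obtain R where R: "!!t. R < abs t ==> f t = 0" using f by (auto simp: bcs_def)
    have Rf: "F y = 0" if "abs R < y" for y unfolding F_def using that by (intro Fcom_zero_right R) auto
    have eta: "4 - 2 / 2 ^ Suc n = 4 - 2 / 2 ^ n + 1 / (2 :: real) ^ n" by (simp add: field_simps)
    have oscF: "EX c0. leb {y : {xi<..<xi + 2 powi h}. R' < y & 2 powi j / 4 < abs (F y - c0)} <= enn (de * 2 powi h)"
     if "xi ~: U (j + int N - int L)" for xi j h
    proof -
     have jL: "j + int N - int L = j - int L0" by (simp add: L_def)
     have xi: "xi ~: U (j - int L0)" using that unfolding jL .
     show ?thesis unfolding F_def
     proof (rule oscB[rule_format, OF b f])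
      show "abs (v j) <= V" for j using v by blast
      show "n <= k" using Suc.prems by simp
      show "xi ~: Om k e f (si * 2 powi j)" using xi U(2)[of "j - int L0"] Om_mono[OF f e powi_pos s2] by blast
      fix l assume l: "l < n"
      have [measurable]: "Fcom v b l f : Borel" by (rule Fcom_measurable[OF f])
      have "mass (%t. 1 / ka' * ind (?E v b l f R' (j - int L0)) t) xi (xi + 2 powi h) <= 2 powi h"
       using not_rset[of xi _ "xi + 2 powi h"] xi U(3)[OF l, of "j - int L0"] by (auto simp: less_imp_le)
      then have "1 / ka' * rleb (?E v b l f R' (j - int L0) Int {xi..xi + 2 powi h}) <= 2 powi h" by (subst (asm) mass_indicator) measurable
      then have le: "rleb (?E v b l f R' (j - int L0) Int {xi..xi + 2 powi h}) <= ka' * 2 powi h" using ka' by (simp add: field_simps)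
      have "leb {y : {xi<..<xi + 2 powi h}. R' < y & si * 2 powi j < abs (Fcom v b l f y)}
        <= leb (?E v b l f R' (j - int L0) Int {xi..xi + 2 powi h})" using s2[of j] by (intro emeasure_mono) auto
      also have "... = enn (rleb (?E v b l f R' (j - int L0) Int {xi..xi + 2 powi h}))" using finite_emeasure_Int_Icc by (intro emeasure_eq_ennreal_measure) (auto simp: less_top)
      also have "... <= enn (et * 2 powi h)" using le ka'(3) by (intro ennreal_leI order_trans[OF le] mult_right_mono) (auto simp: less_imp_le)
      finally show "leb {y : {xi<..<xi + 2 powi h}. R' < y & si * 2 powi j < abs (Fcom v b l f y)} <= enn (et * 2 powi h)" .
     qed simp
    qed
    let ?L = "%j. U (j - int L)"
    let ?U = "%j. ?V ka v b n f R' j Un ?L j"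
    have 2: "(2 :: real) / 2 ^ n <= 2" using one_le_power[of "2 :: real" n] by (simp add: divide_le_eq)
    note step = levels_step[OF Fm Rf good_levels_shift[OF U(1)] N ka de de2 _ oscF, unfolded F_def]
    have good: "good_levels N ((4 - 2 / 2 ^ n) / 2 ^ N + 8 * de / ka) ?U" and dominated: "dominated_levels N (4 * de / ka) ?L ?U" using step 2 by simp_all
    have good': "good_levels N ((4 - 2 / 2 ^ Suc n) / 2 ^ N) ?U"

     unfolding eta add_divide_distrib[of "4 - 2 / 2 ^ n"] by (rule good_levels_weaken[OF good add_left_mono[OF de1(1)]])
    have "dominated_levels N h0 ?L ?U"
    proof -
     have "4 * de / ka <= h0" using de1(3) de ka by (simp add: field_simps)
     then have "enn (4 * de / ka * (c - x)) <= enn (h0 * (c - x))" if "x < c" for c x using that by (intro ennreal_leI mult_right_mono) auto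
     then show ?thesis using dominated unfolding dominated_levels_def by (meson order_trans)
    qed
    moreover have "good_levels N (4 / 2 ^ N) ?U" by (rule good_levels_weaken[OF good']) (simp add: divide_right_mono)
    ultimately have "level_sum p ?U <= enn C0 * level_sum p ?L" using dom by blast
    also have "... <= enn C0 * (enn (2 powr (real L * p)) * (enn C * level_sum p (%j. Om k e f (2 powi j))))" unfolding level_sum_shift by (intro mult_left_mono U(4)) auto
    also have "... = enn C' * level_sum p (%j. Om k e f (2 powi j))" using C0 C(1) by (simp add: C'_def ennreal_mult mult.assoc)
    finally have sum: "level_sum p ?U <= enn C' * level_sum p (%j. Om k e f (2 powi j))" .
    have Umono: "U j <= ?L j" for j using U(1) unfolding good_levels_def by simp
    have "?V ka v b l f R' j <= ?U j" if "l < Suc n" for l j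
    proof (cases "l = n")
     case False
     then have l: "l < n" using that by simp
     have "?V ka v b l f R' j <= ?V ka' v b l f R' j"
     proof (rule rset_mono)
      have "1 / ka <= 1 / ka'" using ka' by (simp add: frac_le)
      then show "1 / ka * ind (?E v b l f R' j) t <= 1 / ka' * ind (?E v b l f R' j) t" for t :: real by (intro mult_right_mono) auto
     qed (use ibsE[OF b f] in \<open>auto simp only: ibs_def\<close>)
     then show ?thesis using U(3)[OF l, of j] Umono[of j] by blast
    qed simp
    moreover have "Om k e f (2 powi j) <= ?U j" for j using U(2)[of j] Umono[of j] by blast
    ultimately show "EX U. good_levels N ((4 - 2 / 2 ^ Suc n) / 2 ^ N) U & (ALL j. Om k e f (2 powi j) <= U j) &
     (ALL l<Suc n. ALL j. ?V ka v b l f R' j <= U j) & level_sum p U <= enn C' * level_sum p (%j. Om k e f (2 powi j))" using good' sum by (intro exI[of _ ?U]) blast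
   qed
  qed
 qed
 from this[of "1 / 8" "Suc k"] obtain C where C: "0 < C" "?P (1 / 8) (Suc k) C" by auto
 show ?thesis
 proof (rule exI[of _ C], intro conjI allI impI C(1))
  fix b f R' and v :: "int => real" assume h: "bmo_unit b" "bcs f" "ALL j. abs (v j :: real) <= V"
  obtain U where U: "good_levels N ((4 - 2 / 2 ^ Suc k) / 2 ^ N) U" "!!l j. l < Suc k ==> ?V (1 / 8) v b l f R' j <= U j"
   "level_sum p U <= enn C * level_sum p (%j. Om k e f (2 powi j))"  using C(2)[THEN spec, THEN spec, THEN spec, THEN spec, THEN mp, THEN mp, THEN mp, OF h, of R'] by blast
  then show "EX U. (ALL j. rset (%t. 8 * ind {y. R' < y & 2 powi j < abs (Fcom v b k f y)} t) <= U j) & (ALL j. open (U j)) &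
   level_sum p U <= enn C * level_sum p (%j. Om k e f (2 powi j))" using U(2)[of k] by (intro exI[of _ U]) (auto simp: good_levels_def)
 qed
qed

end

section \<open>Lebesgue measurable functions and weighted norms\<close>

lemma ennreal_powr_mono:
 assumes "x <= y" "0 < q" shows "ennreal_powr x q <= ennreal_powr y q"
proof (cases y)
 case (real r)
 then obtain s where s: "x = enn s" "0 <= s" using assms(1) by (cases x) (auto simp: top_unique)
 then have "s powr q <= r powr q" using assms real by (intro powr_mono2) auto
 then show ?thesis using s real by (simp add: ennreal_powr_def ennreal_leI)
qed (simp add: ennreal_powr_def)

lemma ennreal_powr_ennreal [simp]: "0 <= x ==> ennreal_powr (enn x) q = enn (x powr q)" by (simp add: ennreal_powr_def)

lemma ennreal_powr_cmult:
 assumes "0 < c" shows "ennreal_powr (enn c * X) q = enn (c powr q) * ennreal_powr X q"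
proof (cases X)
 case (real r)
 then show ?thesis using assms by (simp add: ennreal_mult[symmetric] powr_mult)
next
 case top
 then show ?thesis using assms by (simp add: ennreal_powr_def ennreal_mult_top)
qed

lemma AE_lebesgue: "AE x in lborel. P x ==> AE x in lebesgue. P x" by (rule AE_completion)

lemma lint_rep:
 fixes g g' :: "real => real"
 assumes "g : borel_measurable lebesgue" "g' : Borel" "AE t in lborel. g t = g' t"
 shows "(LINT t:{x..y}|lebesgue. g t) = mass g' x y"
proof -
 have m: "(%t. ind {x..y} t *\<^sub>R g' t) : borel_measurable lborel" using assms(2) by measurable
 have "(LINT t:{x..y}|lebesgue. g t) = (LINT t|lebesgue. ind {x..y} t *\<^sub>R g' t)" unfolding sli_def
 proof (rule integral_cong_AE)
  show "(%t. ind {x..y} t *\<^sub>R g t) : borel_measurable lebesgue" by (intro borel_measurable_scaleR borel_measurable_indicator assms(1)) simp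
  show "(%t. ind {x..y} t *\<^sub>R g' t) : borel_measurable lebesgue" using m by (rule measurable_completion)
  show "AE t in lebesgue. ind {x..y} t *\<^sub>R g t = ind {x..y} t *\<^sub>R g' t" using AE_lebesgue[OF assms(3)] by eventually_elim simp
 qed
 also have "... = mass g' x y" unfolding mass_def sli_def by (rule integral_completion[OF m])
 finally show ?thesis .
qed

lemma nn_rep:
 assumes "AE x in lborel. F x = F' x"
 shows "(nn_integral lebesgue (%x. F x)) = (lint (%x. F' x))" unfolding nn_integral_completion by (rule nn_integral_cong_AE[OF assms])

lemma locally_integrable_measurable:
 assumes "locally_integrable g" shows "g : borel_measurable lebesgue"
proof (rule borel_measurable_LIMSEQ_real)
 fix n :: nat
 have "g absolutely_integrable_on {- real n..real n}" using assms by (auto simp: locally_integrable_def)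
 then have "(%x. ind {- real n..real n} x *\<^sub>R g x) : borel_measurable lebesgue" unfolding set_integrable_def by (rule borel_measurable_integrable)
 then show "(%x. ind {- real n..real n} x *\<^sub>R g x) : borel_measurable lebesgue" .
next
 fix x
 obtain N where N: "abs x <= real N" using real_arch_simple by blast
 have "\<forall>\<^sub>F n in sequentially. ind {- real n..real n} x *\<^sub>R g x = g x" unfolding eventually_sequentially
 proof (intro exI[of _ N] allI impI)
  fix n assume "N <= n"
  then have "x : {- real n..real n}" using N by (auto simp: abs_le_iff)
  then show "ind {- real n..real n} x *\<^sub>R g x = g x" by simp
 qed
 then show "(%n. ind {- real n..real n} x *\<^sub>R g x) \<longlonglongrightarrow> g x" by (rule tendsto_eventually)
qed

lemma set_integrable_rep:
 assumes g: "locally_integrable g" and g': "g' : Borel" "AE t in lborel. g t = g' t"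
 shows "set_integrable lborel {x..y} g'"
proof -
 have m: "(%t. ind {x..y} t *\<^sub>R g' t) : borel_measurable lborel" using g'(1) by measurable
 have "g absolutely_integrable_on {x..y}" using g by (auto simp: locally_integrable_def)
 then have "integrable lebesgue (%t. ind {x..y} t *\<^sub>R g t)" unfolding set_integrable_def .
 then have "integrable lebesgue (%t. ind {x..y} t *\<^sub>R g' t)"
 proof (rule Bochner_Integration.integrable_cong_AE_imp)
  show "(%t. ind {x..y} t *\<^sub>R g' t) : borel_measurable lebesgue" using m by (rule measurable_completion)
  show "AE t in lebesgue. ind {x..y} t *\<^sub>R g t = ind {x..y} t *\<^sub>R g' t" using AE_lebesgue[OF g'(2)] by eventually_elim simp
 qed
 then show ?thesis unfolding set_integrable_def by (simp only: integrable_completion[OF m])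
qed

lemma maximal_plus_indicator:
 assumes "a < c" shows "maximal_plus (ind {a<..<c}) x <= enn (tail a c x)" unfolding maximal_plus_def
proof (rule SUP_least)
 fix h :: real assume "h : {0<..}"
 then have h: "0 < h" by simp
 have "(\<integral>\<^sup>+y\<in>{x..x + h}. enn (abs (ind {a<..<c} y)) \<partial>lebesgue) <= (lint (%y. ind {max a x..min c (x + h)} y))"
  unfolding nn_integral_completion by (intro nn_integral_mono) (auto simp: indicator_def)
 also have "... = enn (max 0 (min c (x + h) - max a x))" by (simp add: emeasure_lborel_Icc_eq max_def)
 also have "... <= enn (h * tail a c x)"
 proof (rule ennreal_leI)
  consider "c <= x" | "x < c" "a <= x" | "x < a" by linarith
  then show "max 0 (min c (x + h) - max a x) <= h * tail a c x"
  proof cases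
   case 2
   then have "1 <= (c - a) / (c - x)" by (simp add: le_divide_eq)
   then show ?thesis using 2 h by (simp add: tail_def)
  next
   case 3
   then have t: "tail a c x = (c - a) / (c - x)" using assms by (simp add: tail_def divide_le_eq)
   have "(min c (x + h) - a) * (c - x) <= h * (c - a)"
   proof (cases "x + h <= c")
    case True
    have "h * (c - a) - (x + h - a) * (c - x) = (a - x) * (c - x - h)" by (simp add: algebra_simps)
    moreover have "0 <= (a - x) * (c - x - h)" using 3 True by simp
    ultimately show ?thesis using True by simp
   next
    case False
    then have "(c - a) * (c - x) <= (c - a) * h" using assms by (intro mult_left_mono) auto
    then show ?thesis using False by (simp add: mult.commute)
   qed
   then have "min c (x + h) - a <= h * (c - a) / (c - x)" using 3 assms by (simp add: pos_le_divide_eq)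
   moreover have "0 <= h * (c - a) / (c - x)" using h 3 assms by simp
   ultimately show ?thesis unfolding t using 3 by simp
  qed (use h in \<open>auto simp: tail_def\<close>)
 qed
 also have "... = enn h * enn (tail a c x)" using h by (intro ennreal_mult') simp
 finally show "(\<integral>\<^sup>+y\<in>{x..x + h}. enn (abs (ind {a<..<c} y)) \<partial>lebesgue) / enn h <= enn (tail a c x)"
  using h by (intro divide_le_posI_ennreal) (auto simp: mult.commute)
qed

lemma one_sided_weight_density:
 assumes w: "w : C_plus r" and r: "1 < r" and w': "w' : Borel" "AE x in lborel. w x = w' x"
 shows "EX e0 C0. one_sided_weight (density lborel (%x. enn (w' x))) r e0 C0"
proof -
 obtain e0 C0 where e0: "0 < e0" "0 < C0" and C: "ALL a b c. a < b --> b < c --> c - b < b - a --> (ALL E:sets lebesgue. E <= {a<..<b} -->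
    (\<integral>\<^sup>+x\<in>E. enn (w x) \<partial>lebesgue) <= enn (C0 * (measure lebesgue E / (c - b)) powr e0) *
     (nn_integral lebesgue (%x. ennreal_powr (maximal_plus (ind {a<..<c}) x) r * enn (w x))))" using w unfolding C_plus_def mem_Collect_eq by (elim exE conjE) (rule that)
 let ?M = "density lborel (%x. enn (w' x))"
 have [measurable]: "w' : Borel" by (rule w')
 have "one_sided_weight ?M r e0 C0"
 proof
  fix a b c :: real and E assume abc: "a < b" "b < c" "c - b < b - a" and E: "E : sets borel" "E <= {a<..<b}"
  have "emeasure ?M E = (lint_on E (%x. enn (w' x)))" using E by (simp add: emeasure_density)
  also have "... = (\<integral>\<^sup>+x\<in>E. enn (w x) \<partial>lebesgue)" by (rule nn_rep[symmetric]) (use w'(2) in eventually_elim, simp)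
  also have "... <= enn (C0 * (measure lebesgue E / (c - b)) powr e0) *
     (nn_integral lebesgue (%x. ennreal_powr (maximal_plus (ind {a<..<c}) x) r * enn (w x)))" using E by (intro C[rule_format] abc) auto
  also have "measure lebesgue E = rleb E" using E by simp
  also have "(nn_integral lebesgue (%x. ennreal_powr (maximal_plus (ind {a<..<c}) x) r * enn (w x)))
    = (lint (%x. ennreal_powr (maximal_plus (ind {a<..<c}) x) r * enn (w' x)))" by (rule nn_rep) (use w'(2) in eventually_elim, simp)
  also have "... <= (lint (%x. enn (w' x) * enn (tail a c x powr r)))"
  proof (rule nn_integral_mono)
   fix x
   have "ennreal_powr (maximal_plus (ind {a<..<c}) x) r <= ennreal_powr (enn (tail a c x)) r" using abc r by (intro ennreal_powr_mono maximal_plus_indicator) auto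
   also have "... = enn (tail a c x powr r)" using abc by (intro ennreal_powr_ennreal tail_nonneg) auto
   finally show "ennreal_powr (maximal_plus (ind {a<..<c}) x) r * enn (w' x) <= enn (w' x) * enn (tail a c x powr r)" by (simp add: mult.commute mult_left_mono)
  qed
  also have "... = (nn_integral (?M) (%x. enn (tail a c x powr r)))" by (rule nn_integral_density[symmetric]) (auto simp: tail_def[abs_def])
  finally show "emeasure ?M E <= enn (C0 * (rleb E / (c - b)) powr e0) * (nn_integral (?M) (%x. enn (tail a c x powr r)))" by (simp add: mult_left_mono)
 qed (use r e0 in auto)
 then show ?thesis by blast
qed

text \<open>If the integral of \<open>A (\<bar>f\<bar> / s)\<close> over \<open>{x..x + h}\<close> exceeds \<open>h\<close>, no number below \<open>s\<close> is admissible in the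
 Luxemburg norm on this interval.\<close>

lemma Om_orlicz:
 assumes f: "bcs f'" "AE t in lborel. f t = f' t" and e: "0 < e" and s: "0 < s" and x: "x : Om k e f' s"
 shows "enn s <= orlicz_maximal_plus (LL k e) f x"
proof -
 let ?A = "%s t. LL k e (abs (f' t) / s)"
 obtain h where h: "0 < h" "h < mass (?A s) x (x + h)" using x unfolding Om_def rset_eq_witness by blast
 have "enn s <= luxemburg_norm (LL k e) {x..x + h} f" unfolding luxemburg_norm_def
 proof (rule INF_greatest)
  fix s' assume "s' : {s'. 0 < s' & (\<integral>\<^sup>+y\<in>{x..x + h}. enn (LL k e (abs (f y) / s')) \<partial>lebesgue) / emeasure lebesgue {x..x + h} <= 1}"
  then have s': "0 < s'" "(\<integral>\<^sup>+y\<in>{x..x + h}. enn (LL k e (abs (f y) / s')) \<partial>lebesgue) / emeasure lebesgue {x..x + h} <= 1" by auto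
  note A = ibs_LlogL[OF f(1) e, of _ k]
  have "(\<integral>\<^sup>+y\<in>{x..x + h}. enn (LL k e (abs (f y) / s')) \<partial>lebesgue) = (lint_on {x..x + h} (%y. enn (?A s' y)))"
   by (rule nn_rep) (use f(2) in eventually_elim, simp)
  also have "... = enn (mass (?A s') x (x + h))" using A[OF s'(1)] by (intro nn_mass) (auto simp: ibs_def)
  finally have "enn (mass (?A s') x (x + h)) / enn h <= 1" using s'(2) h by simp
  moreover have nn: "0 <= mass (?A s') x (x + h)" using A(3)[OF s'(1)] by (intro mass_nonneg)
  ultimately have "mass (?A s') x (x + h) / h <= 1" using h by (simp add: divide_ennreal del: divide_le_eq_1)
  then have le: "mass (?A s') x (x + h) <= h" using h by (simp add: divide_le_eq)
  show "enn s <= enn s'"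
  proof (rule ccontr)
   assume "\<not> enn s <= enn s'"
   then have "s' < s" by (simp add: ennreal_leI not_le[symmetric]) (meson ennreal_leI not_le)
   then have "?A s t <= ?A s' t" for t using s' e by (intro LlogL_mono divide_left_mono) auto
   then have "mass (?A s) x (x + h) <= mass (?A s') x (x + h)" using A(1)[OF s] A(1)[OF s'(1)] by (intro mass_mono) (auto simp: ibs_def)
   then show False using h le by simp
  qed
 qed
 also have "... <= orlicz_maximal_plus (LL k e) f x" unfolding orlicz_maximal_plus_def using h by (intro SUP_upper) auto
 finally show ?thesis .
qed

lemma dyadic_below_real:
 fixes y :: real assumes "0 < y"
 obtains j :: int where "2 powi j < y" "y <= 2 * 2 powi j"
proof -
 define j where "j = \<lceil>log 2 y\<rceil> - 1"
 have p: "2 powr real_of_int i = 2 powi i" for i by (rule powr_real_of_int') auto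
 have "2 powr of_int j < 2 powr log 2 y" "2 powr log 2 y <= 2 powr (1 + of_int j)" unfolding j_def by (intro powr_mono powr_less_mono; linarith)+
 then show ?thesis using that[of j] assms p by (simp add: powr_add)
qed

text \<open>A geometric series, stated for abstract level sets because the Orlicz maximal function
 may be infinite and its measurability is not established.\<close>

lemma layer_sum_le:
 assumes p: "0 < p"
 obtains K where "0 < K" "!!X S. (!!j. S j ==> ennreal (2 powi j) <= X) ==>
  isum (%j. enn (2 powr (of_int j * p)) * (if S j then 1 else 0)) <= enn K * ennreal_powr X p"
proof -
 define K0 where "K0 = isum (%j. 1 * enn (2 powr (p * of_int j)) * ind {..0} j)"
 have fin: "K0 < \<infinity>" unfolding K0_def by (rule isum_geometric_finite[OF p]) simp
 show ?thesis
 proof (rule that[of "enn2real K0 + 1"])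
  show "0 < enn2real K0 + 1" using enn2real_nonneg[of K0] by linarith
  fix X S assume S: "!!j. S j ==> ennreal (2 powi j) <= X"
  let ?F = "%j. enn (2 powr (of_int j * p)) * (if S j then 1 else 0)"
  show "isum ?F <= enn (enn2real K0 + 1) * ennreal_powr X p"
  proof (cases X)
   case top
   then show ?thesis using enn2real_nonneg[of K0] by (simp add: ennreal_powr_def ennreal_mult_top add_nonneg_pos)
  next
   case (real y)
   show ?thesis
   proof (cases "EX j. S j")
    case False then show ?thesis by simp
   next
    case True
    then obtain j0 where "2 powi j0 <= y" using S real by auto
    then have y: "0 < y" using powi_pos[of j0] by linarith
    define J where "J = \<lfloor>log 2 y\<rfloor>"
    have pw: "2 powr real_of_int i = 2 powi i" for i by (rule powr_real_of_int') auto
    have Jy: "2 powr of_int J <= y" using powr_mono[of "of_int J" "log 2 y" 2] y by (simp add: J_def)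
    have SJ: "j <= J" if "S j" for j
    proof -
     have "2 powr of_int j <= y" using S[OF that] real by (simp add: pw)
     then have "of_int j <= log 2 y" using y by (simp add: le_log_iff)
     then show ?thesis by (simp add: J_def le_floor_iff)
    qed
    have "isum ?F = isum (%j. ?F (j + J))" by (rule isum_shift[symmetric])
    also have "... <= isum (%j. enn (2 powr (of_int J * p)) * (1 * enn (2 powr (p * of_int j)) * ind {..0} j))"
    proof (rule nn_integral_mono)
     fix j
     have "2 powr (of_int (j + J) * p) = 2 powr (of_int J * p) * 2 powr (p * of_int j)" by (simp add: powr_add[symmetric] algebra_simps)
     then show "?F (j + J) <= enn (2 powr (of_int J * p)) * (1 * enn (2 powr (p * of_int j)) * ind {..0} j)" using SJ[of "j + J"] by (auto simp: ennreal_mult indicator_def)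
    qed
    also have "... = enn (2 powr (of_int J * p)) * K0" unfolding K0_def by (rule nn_integral_cmult) simp
    also have "... <= enn (y powr p) * enn (enn2real K0 + 1)"
    proof (intro mult_mono ennreal_leI)
     have "2 powr (of_int J * p) = (2 powr of_int J) powr p" by (simp add: powr_powr)
     also have "... <= y powr p" using Jy p by (intro powr_mono2) auto
     finally show "2 powr (of_int J * p) <= y powr p" .
     have "K0 = enn (enn2real K0)" using fin by simp
     also have "... <= enn (enn2real K0 + 1)" by (intro ennreal_leI) simp
     finally show "K0 <= enn (enn2real K0 + 1)" .
    qed auto
    finally show ?thesis using real by (simp add: mult.commute)
   qed
  qed
 qed
qed

lemma isum_measurable:
 assumes [measurable]: "!!j. F j : borel_measurable M"
 shows "(%x. isum (%j. F j x)) : borel_measurable M"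
proof -
 have "isum G = (\<Sum>n. G (int_decode n))" for G unfolding nn_integral_bij_count_space[OF bij_int_decode, symmetric] by (rule nn_integral_count_space_nat)
 then show ?thesis by simp
qed

context one_sided_weight
begin

lemma level_sum_layer:
 assumes U: "!!j. U j : sets borel"
 shows "level_sum p U = (nn_integral M (%x. isum (%j. enn (2 powr (of_int j * p)) * (if x : U j then 1 else 0))))"
proof -
 have [measurable]: "U j : sets M" for j using U by simp
 have "(nn_integral M (%x. isum (%j. enn (2 powr (of_int j * p)) * (if x : U j then 1 else 0))))
   = isum (%j. \<integral>\<^sup>+x. enn (2 powr (of_int j * p)) * ind (U j) x \<partial>M)"
  unfolding indicator_def[abs_def] of_bool_def by (rule nn_integral_count_space_nn_integral) (auto simp: U)
 also have "... = level_sum p U" unfolding level_sum_def using U by (simp add: nn_integral_cmult_indicator)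
 finally show ?thesis by simp
qed

text \<open>Summing the level set estimate over the dyadic levels, and letting the lower cut off tend to
 \<open>- \<infinity>\<close>.\<close>

lemma commutator_bound:
 assumes p: "0 < p" "p < r" and e: "0 < e" and V: "0 < V"
  and T: "!!m. 0 < m ==> (nn_integral M (%x. enn (tail 0 m x powr p))) < \<infinity>"
  and ac: "!!P. AE x in lborel. P x ==> AE x in M. P x"
 shows "EX C>0. ALL b f v. bmo_unit b --> bcs f --> (ALL j. abs (v j) <= V) -->
  (nn_integral M (%y. enn (abs (Fcom v b k f y) powr p))) <= enn C * level_sum p (%j. Om k e f (2 powi j))"
proof -
 obtain C where C: "0 < C" "ALL b f v R'. bmo_unit b --> bcs f --> (ALL j. abs (v j) <= V) -->
  (EX U. (ALL j. rset (%t. 8 * ind {y. R' < y & 2 powi j < abs (Fcom v b k f y)} t) <= U j) & (ALL j. open (U j)) &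
   level_sum p U <= enn C * level_sum p (%j. Om k e f (2 powi j)))" using commutator_levels[OF p e V T, of k] by blast
 show ?thesis
 proof (rule exI[of _ "2 powr p * C"], intro conjI allI impI)
  show "0 < 2 powr p * C" using C by simp
  fix b f and v :: "int => real" assume h: "bmo_unit b" "bcs f" "ALL j. abs (v j) <= V"
  interpret bmo_unit b by (rule h)
  let ?F = "Fcom v b k f" and ?S = "level_sum p (%j. Om k e f (2 powi j))"
  have Fm [measurable]: "?F : Borel" by (rule Fcom_measurable[OF h(2)])
  obtain R where R: "!!t. R < abs t ==> f t = 0" using h(2) by (auto simp: bcs_def)
  have cut: "(nn_integral M (%y. enn (abs (?F y) powr p) * ind {R'<..} y)) <= enn (2 powr p * C) * ?S" for R'
  proof -
   let ?E = "%j :: int. {y. R' < y & 2 powi j < abs (?F y)}"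
   have [measurable]: "?E j : sets borel" for j by measurable
   obtain U where U: "!!j. rset (%t. 8 * ind (?E j) t) <= U j" "!!j. open (U j)" "level_sum p U <= enn C * ?S"
    using C(2)[THEN spec, THEN spec, THEN spec, THEN spec, THEN mp, THEN mp, THEN mp, OF h, of R'] by blast
   have EU: "emeasure M (?E j) <= emeasure M (U j)" for j
   proof (rule emeasure_mono_AE[OF ac])
    have "?E j <= {R'..abs R}"
    proof
     fix y assume y: "y : ?E j"
     then have "2 powi j < abs (?F y)" by simp
     then have "?F y ~= 0" using powi_pos[of j] by linarith
     then have "\<not> abs R < y" using Fcom_zero_right[of y f v b k] R by fastforce
     then show "y : {R'..abs R}" using y by simp
    qed
    then have ib: "ibs (%t. 8 * ind (?E j) t)" by (intro ibs_scaled_indicator) auto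
    show "AE y in lborel. y : ?E j --> y : U j" using rset_AE[OF ib] U(1)[of j] by (auto simp: indicator_def elim!: eventually_mono)
    show "U j : sets M" using U(2) by simp
   qed
   have "(nn_integral M (%y. enn (abs (?F y) powr p) * ind {R'<..} y))
    <= (nn_integral M (%y. enn (2 powr p) * isum (%j. enn (2 powr (of_int j * p)) * (if y : ?E j then 1 else 0))))"
   proof (rule nn_integral_mono)
    fix y
    let ?G = "%j. enn (2 powr (of_int j * p)) * (if y : ?E j then 1 else 0)"
    show "enn (abs (?F y) powr p) * ind {R'<..} y <= enn (2 powr p) * isum ?G"
    proof (cases "R' < y & ?F y ~= 0")
     case True
     obtain j where j: "2 powi j < abs (?F y)" "abs (?F y) <= 2 * 2 powi j" using dyadic_below_real[of "abs (?F y)"] True by auto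
     have pw: "2 powr real_of_int j = 2 powi j" by (rule powr_real_of_int') auto
     have "abs (?F y) powr p <= (2 * 2 powr of_int j) powr p" unfolding pw using j p by (intro powr_mono2) auto
     also have "... = 2 powr p * 2 powr (of_int j * p)" by (simp add: powr_mult powr_powr)
     finally have "enn (abs (?F y) powr p) <= enn (2 powr p) * enn (2 powr (of_int j * p))" by (simp add: ennreal_mult[symmetric] ennreal_leI)
     also have "enn (2 powr (of_int j * p)) = isum (%i. ?G i * ind {j} i)" using True j by (subst nn_integral_count_space_indicator[symmetric]) (auto simp: nn_integral_count_space_finite)
     also have "... <= isum ?G" by (intro nn_integral_mono) (auto simp: indicator_def)
     finally show ?thesis using True by (simp add: mult_left_mono)
    qed (auto simp: indicator_def)
   qed
   also have "... = enn (2 powr p) * level_sum p ?E" unfolding level_sum_layer[of ?E p, OF \<open>!!j. ?E j : sets borel\<close>] by (rule nn_integral_cmult, rule isum_measurable) measurable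
   also have "... <= enn (2 powr p) * level_sum p U" unfolding level_sum_def by (intro mult_left_mono nn_integral_mono EU) auto
   also have "... <= enn (2 powr p) * (enn C * ?S)" by (intro mult_left_mono U) simp
   also have "... = enn (2 powr p * C) * ?S" using C(1) by (simp add: ennreal_mult mult.assoc)
   finally show ?thesis .
  qed
  have "(nn_integral M (%y. enn (abs (?F y) powr p))) = (nn_integral M (%y. (SUP n. enn (abs (?F y) powr p) * ind {- real n<..} y)))"
  proof (rule nn_integral_cong)
   fix y
   obtain n :: nat where n: "- y < real n" using reals_Archimedean2 by blast
   show "enn (abs (?F y) powr p) = (SUP n. enn (abs (?F y) powr p) * ind {- real n<..} y)"
   proof (rule antisym)
    have "enn (abs (?F y) powr p) = enn (abs (?F y) powr p) * ind {- real n<..} y" using n by simp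
    also have "... <= (SUP n. enn (abs (?F y) powr p) * ind {- real n<..} y)" by (rule SUP_upper) simp
    finally show "enn (abs (?F y) powr p) <= ..." .
    show "(SUP n. enn (abs (?F y) powr p) * ind {- real n<..} y) <= enn (abs (?F y) powr p)" by (intro SUP_least) (auto simp: indicator_def)
   qed
  qed
  also have "... = (SUP n. \<integral>\<^sup>+y. enn (abs (?F y) powr p) * ind {- real n<..} y \<partial>M)"
  proof (rule nn_integral_monotone_convergence_SUP)
   show "incseq (%n y. enn (abs (?F y) powr p) * ind {- real n<..} y)" by (auto simp: incseq_def le_fun_def indicator_def)
  qed measurable
  also have "... <= enn (2 powr p * C) * ?S" by (intro SUP_least cut)
  finally show "(nn_integral M (%y. enn (abs (?F y) powr p))) <= enn (2 powr p * C) * ?S" .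
 qed
qed

end

lemma sum_int_psum2:
 "(\<Sum>j = - int m..int n. v j * dif j g x) = psum2 v g x (m, n)" unfolding psum2_def psum_def prod.case
 by (rule sum.reindex_bij_witness[of _ "%a. - int m + int a" "%j. nat (j + int m)"]) auto

lemma differential_transform_rep:
 assumes g: "g : borel_measurable lebesgue" "g' : Borel" "AE t in lborel. g t = g' t" and T: "Tconv v g' x"
 shows "differential_transform v g x = Tlim v g' x"
proof -
 have "forward_mean j g x = avg j g' x" for j unfolding forward_mean_def avg_def lint_rep[OF g] by simp
 then have "(%(m, n). \<Sum>j = - int m..int n. v j * (forward_mean j g x - forward_mean (j - 1) g x)) = psum2 v g' x" by (auto simp: fun_eq_iff sum_int_psum2[symmetric] dif_def)
 then show ?thesis unfolding differential_transform_def using T unfolding Tconv_def by (simp add: tendsto_Lim prod_filter_eq_bot)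
qed

lemma (in bmo_unit) L2c_plus_power: "bcs f ==> L2c (%t. b t ^ q * f t)"
proof -
 assume "bcs f"
 from L2c_scale[OF L2c_power_minus[OF this, of q], of "(-1) ^ q"]
 show ?thesis by (simp add: mult.assoc[symmetric] power_mult_distrib[symmetric])
qed

text \<open>At a point \<open>x\<close> where everything converges, the iterated commutator is the transform of
 \<open>(b x - b)\<^sup>k f\<close>. The factor \<open>b\<^sup>q\<close> is carried along because a commutator applies the
 previous one also to \<open>b f\<close>.\<close>

lemma (in bmo_unit) iterated_commutator_rep:
 assumes f': "bcs f'" and f: "f : borel_measurable lebesgue" "AE t in lborel. f t = f' t"
  and b0: "b0 : borel_measurable lebesgue" "AE t in lborel. b0 t = be * b t"
  and x: "b0 x = be * b x" "!!q. Tconv v (%t. b t ^ q * f' t) x"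
 shows "L2c (%t. (b x - b t) ^ k * (b t ^ q * f' t)) & Tconv v (%t. (b x - b t) ^ k * (b t ^ q * f' t)) x &
  iterated_commutator k b0 (differential_transform v) (%t. b0 t ^ q * f t) x = be ^ (k + q) * Tlim v (%t. (b x - b t) ^ k * (b t ^ q * f' t)) x"
proof (induction k arbitrary: q)
 case 0
 have L: "L2c (%t. b t ^ q * f' t)" by (rule L2c_plus_power[OF f'])
 note add = Tlim_add[OF L L x(2) x(2), of "be ^ q" 0]
 have "differential_transform v (%t. b0 t ^ q * f t) x = Tlim v (%t. be ^ q * (b t ^ q * f' t) + 0 * (b t ^ q * f' t)) x"
 proof (rule differential_transform_rep[OF _ _ _ add(1)])
  show "(%t. b0 t ^ q * f t) : borel_measurable lebesgue" by (intro borel_measurable_times borel_measurable_power b0 f)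
  show "(%t. be ^ q * (b t ^ q * f' t) + 0 * (b t ^ q * f' t)) : Borel" using L2c_measurable[OF L] by simp
  show "AE t in lborel. b0 t ^ q * f t = be ^ q * (b t ^ q * f' t) + 0 * (b t ^ q * f' t)" using b0(2) f(2) by eventually_elim (simp add: power_mult_distrib)
 qed
 then show ?case using L x(2)[of q] add(2) by (simp add: iterated_commutator_def)
next
 case (Suc k)
 let ?g = "%k q t. (b x - b t) ^ k * (b t ^ q * f' t)"
 have eq: "?g (Suc k) q = (%t. b x * ?g k q t + (-1) * ?g k (Suc q) t)" by (auto simp: algebra_simps)
 note A = Suc[of q] and B = Suc[of "Suc q"]
 have L: "L2c (?g k q)" "L2c (?g k (Suc q))" and T: "Tconv v (?g k q) x" "Tconv v (?g k (Suc q)) x" using A B by blast+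
 note add = Tlim_add[OF L T, of "b x" "-1"]
 have "iterated_commutator (Suc k) b0 (differential_transform v) (%t. b0 t ^ q * f t) x
   = b0 x * iterated_commutator k b0 (differential_transform v) (%t. b0 t ^ q * f t) x
    - iterated_commutator k b0 (differential_transform v) (%t. b0 t ^ Suc q * f t) x" by (simp add: iterated_commutator_def commutator_def mult.assoc)
 also have "... = be ^ (Suc k + q) * (b x * Tlim v (?g k q) x - Tlim v (?g k (Suc q)) x)" using A B x(1) by (simp add: algebra_simps)
 finally show ?case unfolding eq using L2c_add[OF L, of "b x" "-1"] add by simp
qed

lemma psum2_AE_zero:
 assumes "AE t in lborel. g t = 0" shows "Tlim v g x = 0"
proof -
 have "mass g x y = 0" for x y unfolding mass_def sli_def using assms by (intro integral_eq_zero_AE) (auto elim!: eventually_mono)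
 then have "psum2 v g x = (%p. 0)" by (auto simp: psum2_def psum_def dif_def avg_def)
 then show ?thesis unfolding Tlim_def by (simp add: limI)
qed

lemma bmo_osc:
 assumes b: "locally_integrable b" and b': "b' : Borel" "AE t in lborel. b t = b' t"
  and n: "BMO_norm b <= enn be" "0 <= be" and xy: "x < y"
 shows "mass (%t. abs (b' t - mean b' x y)) x y <= be * (y - x)"
proof -
 have [measurable]: "b' : Borel" by (rule b')
 have im: "interval_mean b x y = mean b' x y" unfolding interval_mean_def mean_def lint_rep[OF locally_integrable_measurable[OF b] b'] ..
 let ?osc = "\<integral>\<^sup>+t. enn (ind {x..y} t * abs (b' t - mean b' x y)) \<partial>lborel"
 have "(\<integral>\<^sup>+t\<in>{x..y}. enn (abs (b t - interval_mean b x y)) \<partial>lebesgue) / enn (y - x) <= BMO_norm b"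
  unfolding BMO_norm_def using xy by (intro SUP_upper2[of "(x, y)"]) auto
 also have "(\<integral>\<^sup>+t\<in>{x..y}. enn (abs (b t - interval_mean b x y)) \<partial>lebesgue) = ?osc"
  unfolding im by (rule nn_rep) (use b'(2) in eventually_elim, simp add: indicator_def)
 finally have "?osc / enn (y - x) <= enn be" using n(1) by simp
 then have "?osc / enn (y - x) * enn (y - x) <= enn be * enn (y - x)" by (rule mult_right_mono) simp
 then have "?osc <= enn (be * (y - x))" using xy n(2) by (simp add: ennreal_divide_times ennreal_divide_self ennreal_mult)
 moreover have "mass (%t. abs (b' t - mean b' x y)) x y = enn2real ?osc" unfolding mass_def sli_def real_scaleR_def by (rule integral_eq_nn_integral) auto
 ultimately show ?thesis using n(2) xy by (simp add: enn2real_leI)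
qed

lemma bmo_unit_rep:
 assumes b: "locally_integrable b" and b': "b' : Borel" "AE t in lborel. b t = b' t"
  and n: "BMO_norm b <= enn be" "0 < be"
 shows "bmo_unit (%t. b' t / be)"
proof
 show "(%t. b' t / be) : Borel" using b' by simp
 show "set_integrable lborel {x..y} (%t. b' t / be)" for x y using set_integrable_rep[OF b b'] unfolding set_integrable_def real_scaleR_def times_divide_eq_right by (rule integrable_divide)
 fix x y :: real assume xy: "x < y"
 have "abs (b' t / be - mean (%t. b' t / be) x y) = abs (b' t - mean b' x y) / be" for t
 proof -
  have "mean (%t. b' t / be) x y = mean b' x y / be" by (simp add: mean_def mass_divide)
  then show ?thesis using n(2) by (simp add: diff_divide_distrib[symmetric])
 qed
 then show "mass (%t. abs (b' t / be - mean (%t. b' t / be) x y)) x y <= y - x" using bmo_osc[OF b b' n(1) less_imp_le[OF n(2)] xy] n(2) by (simp add: mass_divide divide_le_eq mult.commute)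
qed

text \<open>If the norm vanishes, \<open>b\<close> is constant and commutators of positive order vanish; dividing by the norm is
 impossible in this case.\<close>

lemma bmo_zero_const:
 assumes b: "locally_integrable b" and b': "b' : Borel" "AE t in lborel. b t = b' t" and n: "BMO_norm b = 0"
 obtains c where "AE t in lborel. b' t = c"
proof -
 interpret bmo_unit "%t. b' t / 1" by (rule bmo_unit_rep[OF b b']) (simp_all add: n)
 have z: "mass (%t. abs (b' t - mean b' x y)) x y = 0" if "x < y" for x y using bmo_osc[OF b b' _ order_refl that] n mass_nonneg[of "%t. abs (b' t - mean b' x y)" x y] by simp
 let ?m = "%n. mean b' (- real (Suc n)) (real (Suc n))"
 have "AE t in lborel. ALL n. t : {- real (Suc n)..real (Suc n)} --> b' t = ?m 0" unfolding AE_all_countable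
 proof
  fix n
  have "AE t in lborel. ind {- real (Suc n)..real (Suc n)} t * abs (b' t - ?m n) = 0"
   using integral_nonneg_eq_0_iff_AE[OF integrable_dev[of "- real (Suc n)" "real (Suc n)" "?m n"]] z[of "- real (Suc n)" "real (Suc n)"] by (simp add: mass_def sli_def)
  moreover have "2 * abs (?m 0 - ?m n) <= 0"
  proof (rule order_trans)
   show "2 * abs (?m 0 - ?m n) <= mass (%t. abs (b' t - ?m n)) (-1) 1" using mean_compare[of "-1" 1 "?m 0" "?m n"] z[of "-1" 1] by simp
   show "mass (%t. abs (b' t - ?m n)) (-1) 1 <= 0" using mass_dev_subset[of "- real (Suc n)" "-1" 1 "real (Suc n)" "?m n"] z[of "- real (Suc n)" "real (Suc n)"] by simp
  qed
  ultimately have "?m 0 = ?m n" and "AE t in lborel. ind {- real (Suc n)..real (Suc n)} t * abs (b' t - ?m n) = 0" by auto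
  then show "AE t in lborel. t : {- real (Suc n)..real (Suc n)} --> b' t = ?m 0" by (auto simp: indicator_def elim!: eventually_mono)
 qed
 then have "AE t in lborel. b' t = ?m 0"
 proof eventually_elim
  fix t assume *: "ALL n. t : {- real (Suc n)..real (Suc n)} --> b' t = ?m 0"
  obtain n where "abs t <= real n" using real_arch_simple by blast
  then have "t : {- real (Suc n)..real (Suc n)}" by auto
  then show "b' t = ?m 0" using * by blast
 qed
 then show ?thesis by (rule that)
qed

lemma bcs_rep:
 assumes f: "f : Linfty_c"
 obtains f' where "bcs f'" "AE t in lborel. f t = f' t" "f : borel_measurable lebesgue"
proof -
 obtain B K where fm: "f : borel_measurable lebesgue" and B: "!!x. abs (f x) <= B" and K: "compact K" "!!x. x ~: K ==> f x = 0" using f unfolding Linfty_c_def bounded_iff by auto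
 obtain R where R: "!!x. x : K ==> abs x <= R" using compact_imp_bounded[OF K(1)] by (auto simp: bounded_iff)
 obtain h where h: "h : borel_measurable lborel" "AE x in lborel. f x = h x" using completion_ex_borel_measurable_real[OF fm] by blast
 have [measurable]: "h : Borel" using h by simp
 let ?f = "%x. ind {-R..R} x * max (- B) (min B (h x))"
 have "bcs ?f" unfolding bcs_def
 proof (intro conjI exI allI impI)
  fix t :: real
  have "0 <= B" using B[of 0] by linarith
  then show "abs (?f t) <= B" by (auto simp: indicator_def)
  show "R < abs t ==> ?f t = 0" by (auto simp: indicator_def)
 qed measurable
 moreover have "AE x in lborel. f x = ?f x" using h(2)
 proof eventually_elim
  fix x assume x: "f x = h x"
  show "f x = ?f x"
  proof (cases "x : {-R..R}")
   case True then show ?thesis using x B[of x] by (simp add: abs_le_iff min_absorb2 max_absorb2)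
  next
   case False
   then have "x ~: K" using R[of x] by (auto simp: abs_le_iff)
   then show ?thesis using K False by simp
  qed
 qed
 ultimately show ?thesis using that fm by blast
qed

text \<open>Far to the left of the support, averages over intervals that reach across it show that the maximal function
 dominates a multiple of \<open>tail 0 m\<close>, and on bounded sets the weight is integrable.\<close>

lemma orlicz_infinite:
 assumes f: "bcs f'" "AE t in lborel. f t = f' t" and nz: "\<not> (AE t in lborel. f' t = 0)" and e: "0 < e" and p: "0 < p"
  and w: "w' : Borel" "!!x y. set_integrable lborel {x..y} w'" "!!x. 0 <= w' x" and m: "0 < m"
  and inf: "(nn_integral (density lborel (%x. enn (w' x))) (%x. enn (tail 0 m x powr p))) = \<infinity>"
 shows "(lint (%x. ennreal_powr (orlicz_maximal_plus (LL k e) f x) p * enn (w' x))) = \<infinity>"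
proof -
 let ?G = "orlicz_maximal_plus (LL k e) f"
 have [measurable]: "w' : Borel" "f' : Borel" using w f by (auto simp: bcs_def)
 obtain R0 B where R0: "!!t. R0 < abs t ==> f' t = 0" and B: "!!t. abs (f' t) <= B" using f(1) by (auto simp: bcs_def)
 define R where "R = abs R0 + 1"
 have R: "0 < R" "!!t. R < abs t ==> f' t = 0" using R0 by (auto simp: R_def)
 have fi: "integrable lborel (%t. abs (f' t))" using ibs_bounded[of f', OF _ B R0] by (auto simp: ibs_def)
 define I where "I = (LINT t|lborel. abs (f' t))"
 have "I ~= 0" using nz integral_nonneg_eq_0_iff_AE[OF fi] by (simp add: I_def)
 then have I: "0 < I" by (simp add: I_def less_le)
 have G: "enn (I / (2 * (R - x))) <= ?G x" if x: "x < - R" for x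
 proof (rule Om_orlicz[OF f e])
  let ?s = "I / (2 * (R - x))"
  show s: "0 < ?s" using I x R by simp
  have "mass (%t. abs (f' t)) x (x + (R - x)) = I" unfolding mass_def sli_def I_def
  proof (intro Bochner_Integration.integral_cong refl)
   fix t show "ind {x..x + (R - x)} t *\<^sub>R (abs (f' t)) = abs (f' t)"
   proof (cases "R < abs t")
    case False then have "t : {x..x + (R - x)}" using x by auto
    then show ?thesis by simp
   qed (simp add: R)
  qed
  then have "mass (%t. abs (f' t) / ?s) x (x + (R - x)) = 2 * (R - x)" unfolding mass_divide using I x R by simp
  moreover have "mass (%t. abs (f' t) / ?s) x (x + (R - x)) <= mass (%t. LL k e (abs (f' t) / ?s)) x (x + (R - x))"
   using ibs_LlogL(1)[OF f(1) e s] s by (intro mass_mono integrable_divide fi LlogL_ge e) (auto simp: ibs_def simp del: divide_divide_eq_right)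
  ultimately show "x : Om k e f' ?s" unfolding Om_def rset_eq_witness using x R by (intro exI[of _ "R - x"]) auto
 qed
 let ?H = "%x. enn ((I / (2 * (R - x))) powr p) * ind {..<- R} x * enn (w' x)"
 have pt: "enn (w' x) * enn (tail 0 m x powr p) <= enn (w' x) * ind {-R..m} x + enn ((4 * m / I) powr p) * ?H x" for x
 proof -
  consider "m < x" | "- R <= x" "x <= m" | "x < - R" by linarith
  then show ?thesis
  proof cases
   case 1 then show ?thesis using p by (simp add: tail_def)
  next
   case 2
   have "tail 0 m x powr p <= 1 powr p" using p m tail_nonneg[of 0 m x] tail_le_1[of 0 m x] by (intro powr_mono2) auto
   then have "enn (w' x) * enn (tail 0 m x powr p) <= enn (w' x) * 1" by (intro mult_left_mono) auto
   then show ?thesis using 2 by (simp add: add_increasing2)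
  next
   case 3
   have "tail 0 m x <= m / (m - x)" using 3 m R by (simp add: tail_def)
   also have "m / (m - x) <= m / ((R - x) / 2)" using 3 m R by (intro divide_left_mono) auto
   also have "... = (4 * m / I) * (I / (2 * (R - x)))"
   proof -
    have "m / (d / 2) = (4 * m / I) * (I / (2 * d))" for d using I by (simp add: field_simps)
    then show ?thesis .
   qed
   finally have "tail 0 m x powr p <= ((4 * m / I) * (I / (2 * (R - x)))) powr p" using p m tail_nonneg[of 0 m x] by (intro powr_mono2) auto
   then have "enn (tail 0 m x powr p) <= enn ((4 * m / I) powr p) * enn ((I / (2 * (R - x))) powr p)"
    by (simp only: powr_mult ennreal_mult[OF powr_ge_zero powr_ge_zero, symmetric] ennreal_leI)
   then have "enn (w' x) * enn (tail 0 m x powr p) <= enn (w' x) * (enn ((4 * m / I) powr p) * enn ((I / (2 * (R - x))) powr p))" by (intro mult_left_mono) auto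
   also have "... = enn (w' x) * ind {-R..m} x + enn ((4 * m / I) powr p) * ?H x" using 3 by (simp add: mult_ac)
   finally show ?thesis .
  qed
 qed
 let ?near = "\<integral>\<^sup>+x. enn (w' x) * ind {-R..m} x \<partial>lborel"
 have fin: "?near < \<infinity>"
 proof -
  have "?near = (lint (%x. enn (norm (ind {-R..m} x *\<^sub>R w' x))))" by (intro nn_integral_cong) (auto simp: indicator_def w(3))
  then show ?thesis using w(2)[of "-R" m] unfolding set_integrable_def integrable_iff_bounded by simp
 qed
 have "\<infinity> = (lint (%x. enn (w' x) * enn (tail 0 m x powr p)))" unfolding inf[symmetric] by (rule nn_integral_density) (auto simp: tail_def[abs_def])
 also have "... <= (lint (%x. enn (w' x) * ind {-R..m} x + enn ((4 * m / I) powr p) * ?H x))" by (intro nn_integral_mono pt)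
 also have "... = ?near + enn ((4 * m / I) powr p) * (lint (%x. ?H x))" by (simp add: nn_integral_add nn_integral_cmult)
 finally have "(lint (%x. ?H x)) = \<infinity>" using fin by (auto simp: top_unique ennreal_mult_eq_top_iff)
 moreover have "(lint (%x. ?H x)) <= (lint (%x. ennreal_powr (?G x) p * enn (w' x)))"
 proof (intro nn_integral_mono mult_right_mono)
  fix x show "enn ((I / (2 * (R - x))) powr p) * ind {..<- R} x <= ennreal_powr (?G x) p"
  proof (cases "x < - R")
   case True
   have "enn ((I / (2 * (R - x))) powr p) = ennreal_powr (enn (I / (2 * (R - x)))) p" using I R True by simp
   also have "... <= ennreal_powr (?G x) p" by (intro ennreal_powr_mono G True p)
   finally show ?thesis using True by simp
  qed simp
 qed simp
 ultimately show ?thesis by (simp add: top_unique)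
qed

section \<open>The weighted inequality\<close>

context bmo_unit
begin

lemma Tconv_AE_all:
 assumes L: "!!l. L2c (h l)" and v: "!!j. abs (v j) <= V"
 shows "AE x in lborel. ALL l :: nat. Tconv v (h l) x" unfolding AE_all_countable
proof
 fix l show "AE x in lborel. Tconv v (h l) x" by (rule Tconv_AE[of "h l" v V, OF L v])
qed

lemma weighted_norm_commutator:
 assumes f': "bcs f'" and f: "f : borel_measurable lebesgue" "AE t in lborel. f t = f' t"
  and b0: "b0 : borel_measurable lebesgue" "AE t in lborel. b0 t = be * b t" and be: "0 < be"
  and v: "!!j. abs (v j) <= V" and w: "w' : Borel" "AE x in lborel. w x = w' x" and p: "0 < p"
 shows "weighted_Lp_norm p w (%x. enn (abs (iterated_commutator k b0 (differential_transform v) f x))) =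
  ennreal_powr (enn ((be ^ k) powr p) * (nn_integral (density lborel (%x. enn (w' x))) (%x. enn (abs (Fcom v b k f' x) powr p)))) (1 / p)"
proof -
 have [measurable]: "w' : Borel" "Fcom v b k f' : Borel" by (intro w Fcom_measurable f')+
 have "AE x in lborel. ennreal_powr (enn (abs (iterated_commutator k b0 (differential_transform v) f x))) p * enn (w x)
   = enn ((be ^ k) powr p) * (enn (w' x) * enn (abs (Fcom v b k f' x) powr p))" using Tconv_AE_all[of "%q t. b t ^ q * f' t" v V, OF L2c_plus_power[OF f'] v]
   Tconv_AE_all[of "%q t. (- b t) ^ q * f' t" v V, OF L2c_power_minus[OF f'] v] b0(2) w(2)
 proof eventually_elim
  fix x assume c: "ALL q. Tconv v (%t. b t ^ q * f' t) x" "ALL q. Tconv v (%t. (- b t) ^ q * f' t) x"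
   and x: "b0 x = be * b x" "w x = w' x"
  have "iterated_commutator k b0 (differential_transform v) f x = be ^ k * Tlim v (%t. (b x - b t) ^ k * f' t) x"
   using iterated_commutator_rep[OF f' f b0 x(1) c(1)[rule_format], where k=k and q=0] by simp
  also have "... = be ^ k * Fcom v b k f' x" using Fcom_eq[OF f', of k v x] c(2) by simp
  finally have "abs (iterated_commutator k b0 (differential_transform v) f x) powr p = (be ^ k) powr p * abs (Fcom v b k f' x) powr p" using be by (simp add: abs_mult powr_mult)
  then show "ennreal_powr (enn (abs (iterated_commutator k b0 (differential_transform v) f x))) p * enn (w x)
   = enn ((be ^ k) powr p) * (enn (w' x) * enn (abs (Fcom v b k f' x) powr p))" using x(2) by (simp add: ennreal_mult mult_ac)
 qed
 from nn_rep[OF this] have "(nn_integral lebesgue (%x. ennreal_powr (enn (abs (iterated_commutator k b0 (differential_transform v) f x))) p * enn (w x)))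
   = enn ((be ^ k) powr p) * (lint (%x. enn (w' x) * enn (abs (Fcom v b k f' x) powr p)))" by (simp add: nn_integral_cmult)
 also have "(lint (%x. enn (w' x) * enn (abs (Fcom v b k f' x) powr p)))
   = (nn_integral (density lborel (%x. enn (w' x))) (%x. enn (abs (Fcom v b k f' x) powr p)))" by (rule nn_integral_density[symmetric]) measurable
 finally show ?thesis unfolding weighted_Lp_norm_def by simp
qed

lemma Fcom_AE_zero:
 assumes f': "bcs f'" and v: "!!j. abs (v j) <= V"
  and z: "(AE t in lborel. f' t = 0) | (1 <= k & (AE t in lborel. b t = c))"
 shows "AE x in lborel. Fcom v b k f' x = 0"
proof -
 have "AE x in lborel. AE t in lborel. (b x - b t) ^ k * f' t = 0"
 proof (cases "AE t in lborel. f' t = 0")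
  case True
  then have "AE t in lborel. (b x - b t) ^ k * f' t = 0" for x by eventually_elim simp
  then show ?thesis by simp
 next
  case False
  then have k: "1 <= k" and c: "AE t in lborel. b t = c" using z by auto
  from c show ?thesis
  proof eventually_elim
   fix x assume x: "b x = c"
   from c show "AE t in lborel. (b x - b t) ^ k * f' t = 0" by eventually_elim (use x k in auto)
  qed
 qed
 with Tconv_AE_all[of "%q t. (- b t) ^ q * f' t" v V, OF L2c_power_minus[OF f'] v]
 show ?thesis
 proof eventually_elim
  fix x assume "ALL q. Tconv v (%t. (- b t) ^ q * f' t) x" "AE t in lborel. (b x - b t) ^ k * f' t = 0"
  then show "Fcom v b k f' x = 0" using Fcom_eq[OF f', of k v x] psum2_AE_zero[of "%t. (b x - b t) ^ k * f' t" v x] by simp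
 qed
qed

end

theorem theorem8:
 fixes v :: "int \<Rightarrow> real" and k :: nat and p \<epsilon> :: real and w :: "real \<Rightarrow> real"
 assumes "bounded (range v)"
  and "0 < p" and "0 < \<epsilon>"
  and "weight w" and "w \<in> C_plus (max p 1 + \<epsilon>)"
 shows "\<exists>C>0. \<forall>b\<in>BMO. \<forall>f\<in>Linfty_c.
  weighted_Lp_norm p w
   (\<lambda>x. ennreal \<bar>iterated_commutator k b (differential_transform v) f x\<bar>)
  \<le> ennreal C * BMO_norm b ^ k *
   weighted_Lp_norm p w (orlicz_maximal_plus (LlogL_loglogL k \<epsilon>) f)"
proof -
 note p = \<open>0 < p\<close> and e = \<open>0 < \<epsilon>\<close>
 obtain V0 where V0: "!!j. abs (v j) <= V0" using assms(1) by (auto simp: bounded_iff)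
 define V where "V = abs V0 + 1"
 have V: "0 < V" "abs (v j) <= V" for j using V0[of j] by (auto simp: V_def)
 have w0: "!!x. 0 <= w x" and wl: "locally_integrable w" using assms(4) by (auto simp: weight_def)
 obtain u where u: "u : borel_measurable lborel" "AE x in lborel. w x = u x" using completion_ex_borel_measurable_real[OF locally_integrable_measurable[OF wl]] by blast
 define w' where "w' x = max 0 (u x)" for x
 have w'm [measurable]: "w' : Borel" using u(1) unfolding w'_def[abs_def] by simp
 have w': "AE x in lborel. w x = w' x" using u(2) by eventually_elim (metis w0 w'_def max.absorb2)
 have w'0: "0 <= w' x" for x by (simp add: w'_def)
 define M where "M = density lborel (%x. enn (w' x))"
 define r where "r = max p 1 + \<epsilon>"
 have r1: "1 < r" "p < r" using e by (auto simp: r_def)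
 obtain e0 C0 where "one_sided_weight M r e0 C0" using one_sided_weight_density[of w r w', OF _ r1(1) w'm w'] assms(5) unfolding M_def r_def by blast
 then interpret one_sided_weight M r e0 C0 .
 have ac: "AE x in M. P x" if "AE x in lborel. P x" for P unfolding M_def using that by (subst AE_density) auto
 let ?G = "orlicz_maximal_plus (LL k \<epsilon>)"
 let ?J = "%f. \<integral>\<^sup>+x. ennreal_powr (?G f x) p * enn (w' x) \<partial>lborel"
 let ?L = "%b f. weighted_Lp_norm p w (%x. enn (abs (iterated_commutator k b (differential_transform v) f x)))"
 have NG: "weighted_Lp_norm p w (?G f) = ennreal_powr (?J f) (1 / p)" for f
  unfolding weighted_Lp_norm_def by (subst nn_rep[of _ "%x. ennreal_powr (?G f x) p * enn (w' x)"]) (use w' in eventually_elim, auto)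
 obtain K where K: "0 < K" "!!X S. (!!j. S j ==> ennreal (2 powi j) <= X) ==>
  isum (%j. enn (2 powr (of_int j * p)) * (if S j then 1 else 0)) <= enn K * ennreal_powr X p" using layer_sum_le[OF p] by blast
 have lower: "level_sum p (%j. Om k \<epsilon> f' (2 powi j)) <= enn K * ?J f" if f': "bcs f'" "AE t in lborel. f t = f' t" for f f'
 proof -
  have Omm: "Om k \<epsilon> f' (2 powi j) : sets borel" for j using good_levels_Om[OF f'(1) e, of 1 k] by (simp add: good_levels_def)
  let ?H = "%x. isum (%j. enn (2 powr (real_of_int j * p)) * (if x : Om k \<epsilon> f' (2 powi j) then 1 else 0))"
  have Hm [measurable]: "?H : Borel"
  proof (rule isum_measurable)
   fix j
   have [measurable]: "Om k \<epsilon> f' (2 powi j) : sets borel" by (rule Omm)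
   show "(%x. enn (2 powr (real_of_int j * p)) * (if x : Om k \<epsilon> f' (2 powi j) then 1 else 0)) : Borel" by measurable
  qed
  have K1: "enn K * (enn (1 / K) * X) = X" "enn (1 / K) * (enn K * X) = X" for X using K(1) by (simp_all add: mult.assoc[symmetric] ennreal_mult[symmetric])
  have "level_sum p (%j. Om k \<epsilon> f' (2 powi j)) = (nn_integral M (%x. ?H x))" by (rule level_sum_layer[OF Omm])
  also have "... = (lint (%x. enn (w' x) * ?H x))" unfolding M_def by (rule nn_integral_density) measurable
  also have "... = enn K * (lint (%x. enn (1 / K) * (enn (w' x) * ?H x)))" by (subst nn_integral_cmult) (auto simp: K1)
  also have "... <= enn K * ?J f"
  proof (intro mult_left_mono nn_integral_mono)
   fix x
   have "?H x <= enn K * ennreal_powr (?G f x) p" by (intro K(2) Om_orlicz[OF f' e]) auto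
   then have "enn (1 / K) * (enn (w' x) * ?H x) <= enn (1 / K) * (enn (w' x) * (enn K * ennreal_powr (?G f x) p))" by (intro mult_left_mono) auto
   also have "... = enn (1 / K) * (enn K * (ennreal_powr (?G f x) p * enn (w' x)))" by (simp only: mult_ac)
   finally show "enn (1 / K) * (enn (w' x) * ?H x) <= ennreal_powr (?G f x) p * enn (w' x)" unfolding K1 .
  qed simp
  finally show ?thesis .
 qed
 (* A constant b cannot be normalised, and f = 0 gives no lower bound for the maximal function, so both are split off. *)
 have reduce: "EX C>0. ALL b:BMO. ALL f:Linfty_c. ?L b f <= enn C * BMO_norm b ^ k * weighted_Lp_norm p w (?G f)"
  if C: "0 < C" and main: "!!b f f'. bmo_unit b ==> bcs f' ==> AE t in lborel. f t = f' t ==> \<not> (AE t in lborel. f' t = 0) ==>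
   (nn_integral M (%x. enn (abs (Fcom v b k f' x) powr p))) <= enn C * ?J f" for C
 proof (rule exI[of _ "C powr (1 / p)"], intro conjI ballI)
  show "0 < C powr (1 / p)" using C by simp
  fix b f assume b: "b : BMO" and f: "f : Linfty_c"
  have bl: "locally_integrable b" and bn: "BMO_norm b < \<infinity>" using b by (auto simp: BMO_def)
  note bm = locally_integrable_measurable[OF bl]
  obtain b' where b': "b' : borel_measurable lborel" "AE t in lborel. b t = b' t" using completion_ex_borel_measurable_real[OF bm] by blast
  have b'm: "b' : Borel" using b' by simp
  obtain f' where f': "bcs f'" "AE t in lborel. f t = f' t" and fm: "f : borel_measurable lebesgue" using bcs_rep[OF f] by blast
  define be where "be = (if BMO_norm b = 0 then 1 else enn2real (BMO_norm b))"
  have ben: "BMO_norm b = enn be" if "BMO_norm b ~= 0" using that bn by (simp add: be_def)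
  have be: "0 < be" "BMO_norm b <= enn be" using bn by (auto simp: be_def enn2real_positive_iff zero_less_iff_neq_zero)
  define b'' where "b'' t = b' t / be" for t
  have "bmo_unit b''" unfolding b''_def[abs_def] by (rule bmo_unit_rep[OF bl b'm b'(2) be(2,1)])
  then interpret B: bmo_unit b'' .
  have bb: "AE t in lborel. b t = be * b'' t" using b'(2) by eventually_elim (use be in \<open>simp add: b''_def\<close>)
  let ?int_F = "\<integral>\<^sup>+x. enn (abs (Fcom v b'' k f' x) powr p) \<partial>M"
  have L: "?L b f = ennreal_powr (enn ((be ^ k) powr p) * ?int_F) (1 / p)" unfolding M_def by (rule B.weighted_norm_commutator[OF f'(1) fm f'(2) bm bb be(1) V(2) w'm w' p])
  show "?L b f <= enn (C powr (1 / p)) * BMO_norm b ^ k * weighted_Lp_norm p w (?G f)"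
  proof (cases "(AE t in lborel. f' t = 0) | (1 <= k & BMO_norm b = 0)")
   case True
   obtain c where c: "BMO_norm b = 0 --> (AE t in lborel. b'' t = c)"
   proof (cases "BMO_norm b = 0")
    case True
    then obtain c where "AE t in lborel. b' t = c" using bmo_zero_const[OF bl b'm b'(2)] by blast
    then have "AE t in lborel. b'' t = c / be" by eventually_elim (simp add: b''_def)
    then show ?thesis using that by blast
   qed (use that in blast)
   have "(AE t in lborel. f' t = 0) | (1 <= k & (AE t in lborel. b'' t = c))" using True c by blast
   then have "AE x in lborel. Fcom v b'' k f' x = 0" by (rule B.Fcom_AE_zero[OF f'(1) V(2)])
   then have "?int_F = (nn_integral M (%x. 0))" by (intro nn_integral_cong_AE ac) (auto elim!: eventually_mono)
   then show ?thesis unfolding L using p by (simp add: ennreal_powr_def)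
  next
   case False
   then have nb: "enn (be ^ k) = BMO_norm b ^ k" using ben be(1) by (cases "k = 0") (auto simp: ennreal_power)
   have "enn ((be ^ k) powr p) * ?int_F <= enn ((be ^ k) powr p) * (enn C * ?J f)" using False by (intro mult_left_mono main B.bmo_unit_axioms f') auto
   also have "... = enn ((be ^ k) powr p * C) * ?J f" using C by (simp add: ennreal_mult mult.assoc)
   finally have "?L b f <= ennreal_powr (enn ((be ^ k) powr p * C) * ?J f) (1 / p)" unfolding L using p by (intro ennreal_powr_mono) auto
   also have "... = enn (((be ^ k) powr p * C) powr (1 / p)) * weighted_Lp_norm p w (?G f)" unfolding NG using C be by (intro ennreal_powr_cmult) auto
   also have "((be ^ k) powr p * C) powr (1 / p) = be ^ k * C powr (1 / p)" using be C p by (simp add: powr_mult powr_powr)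
   finally show ?thesis using be(1) by (simp add: nb[symmetric] ennreal_mult mult.commute)
  qed
 qed
 show ?thesis
 proof (cases "ALL m>0. (nn_integral M (%x. enn (tail 0 m x powr p))) < \<infinity>")
  case True
  then obtain C where C: "0 < C" "ALL b f v. bmo_unit b --> bcs f --> (ALL j. abs (v j) <= V) -->
    (nn_integral M (%y. enn (abs (Fcom v b k f y) powr p))) <= enn C * level_sum p (%j. Om k \<epsilon> f (2 powi j))" using commutator_bound[OF p r1(2) e V(1) _ ac, of k] by blast
  show ?thesis
  proof (rule reduce[of "C * K"])
   fix b f f' assume h: "bmo_unit b" "bcs f'" "AE t in lborel. f t = f' t"
   have "(nn_integral M (%x. enn (abs (Fcom v b k f' x) powr p))) <= enn C * level_sum p (%j. Om k \<epsilon> f' (2 powi j))" using C(2) h V(2) by blast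
   also have "... <= enn C * (enn K * ?J f)" by (intro mult_left_mono lower h) auto
   also have "... = enn (C * K) * ?J f" using C(1) K(1) by (simp add: ennreal_mult mult.assoc)
   finally show "(nn_integral M (%x. enn (abs (Fcom v b k f' x) powr p))) <= enn (C * K) * ?J f" .
  qed (use C K in simp)
 next
  case False
  then obtain m where m: "0 < m" "(nn_integral M (%x. enn (tail 0 m x powr p))) = \<infinity>" by (auto simp: not_less top_unique)
  show ?thesis
  proof (rule reduce[of 1])
   fix b f f' assume h: "bmo_unit b" "bcs f'" "AE t in lborel. f t = f' t" "\<not> (AE t in lborel. f' t = 0)"
   have "?J f = \<infinity>" by (rule orlicz_infinite[OF h(2,3,4) e p w'm set_integrable_rep[OF wl w'm w'] w'0 m(1) m(2)[unfolded M_def]])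
   then show "(nn_integral M (%x. enn (abs (Fcom v b k f' x) powr p))) <= enn 1 * ?J f" by simp
  qed simp
 qed
qed

end
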